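(* Let $G$ be a semisimple connected Lie group of non-compact type with finite center, with maximal compact subgroup $K$, minimal parabolic subgroup $P$ and maximal split torus $A<P$, and let $w_0$ be a representative of the longest element of the Weyl group. For every $q\geq 3$, there exists a $G$-equivariant continuous symmetric map $$\mathrm{bar}_q:(G/P)^{(q)}\longrightarrow G/K,$$ where $(G/P)^{(q)}$ is the set of generic $q$-tuples of points of $G/P$. If further $w_0$ acts as $-1$ on the Lie algebra of $A$, then (for every $q\geq 3$) there exists a $G$-equivariant continuous symmetric map $$\mathrm{bar}_q:(G/P)^{q}_{\mathrm{p-opp}}\longrightarrow G/K,$$ where $(G/P)^{q}_{\mathrm{p-opp}}$ is the set of $q$-tuples of pairwise opposite points in $G/P$.
   Context: The choices are compatible in the standard way: there is a Cartan decomposition $\mathfrak{g}=\mathfrak{k}\oplus\mathfrak{p}$ with $\mathfrak{k}=\mathrm{Lie}(K)$, a maximal abelian subspace $\mathfrak{a}\subset\mathfrak{p}$ with $A=\exp(\mathfrak{a})$, and a choice of positive restricted roots such that $P=MAN$, where $M=Z_K(A)$ is the centralizer of $A$ in $K$ and $N$ is the unipotent radical of $P$. Let $T=N_K(A)$ be the normalizer of $A$ in $K$ and $W=T/M$ the Weyl group; $w_0\in T$ represents the longest element of $W$ (longest with respect to this choice of positive roots). That $w_0$ acts as $-1$ on the Lie algebra of $A$ means $\mathrm{Ad}(w_0)X=-X$ for all $X\in\mathfrak{a}$, equivalently $w_0aw_0^{-1}=a^{-1}$ for all $a\in A$. The canonical maximal flat is $F_A:=\{aK\mid a\in A\}\subset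 G/K$; every maximal flat of $G/K$ is of the form $gF_A$ with $g\in G$. The boundary of $F_A$ is $\partial F_A=\{wP\mid w\in W\}\subset G/P$, and $\partial(gF_A)=g(\partial F_A)$. A pair of points of $G/P$ is called opposite if it lies in the $G$-orbit (diagonal action) of $(P,w_0P)$; this relation is symmetric. Two opposite points $x,y$ lie in the boundary of a unique maximal flat $F_{x,y}$: if $(x,y)=g(P,w_0P)$ then $F_{x,y}=gF_A$. Let $(G/P)^{(3)}$ (in this sentence, the set of ordered triples used to define genericity) be the set of $(x,y,z)\in(G/P)^3$ such that $x$ and $y$ are opposite and $z$ is opposite to every point in $\partial F_{x,y}$. A $q$-tuple $(x_1,\dots,x_q)\in(G/P)^q$ is generic if $(x_i,x_j,x_k)$ belongs to this set of triples for any distinct $1\leq i,j,k\leq q$ (in any order); $(G/P)^{(q)}$ is the set of generic $q$-tuples. In particular, for $q=3$ the domain of $\mathrm{bar}_3$ consists of triples such that every permutation $(x,y,z)$ of the triple satisfies the condition that $x$ and $y$ are opposite and $z$ is opposite to every point in $\partial F_{x,y}$. $G$ acts diagonally on tuples and by left multiplication on $G/K$; the sets of tuples carry the subspace topology from $(G/P)^q$. A map on $q$-tuples is symmetric if it is invariant under all permutations of the $q$ entries. *)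

theory Defs
  imports "HOL-Analysis.Analysis" "HOL-Algebra.Left_Coset"
begin

section \<open>Smooth maps on open sets\<close>

text \<open>Intended for open S. On finite-dimensional domains, continuity of all iterated
  directional derivatives is the usual notion of being k times continuously differentiable.\<close>

primrec Ck_on :: "nat \<Rightarrow> 'a::real_normed_vector set \<Rightarrow> ('a \<Rightarrow> 'b::real_normed_vector) \<Rightarrow> bool" where
  "Ck_on 0 S f \<longleftrightarrow> continuous_on S f"
| "Ck_on (Suc k) S f \<longleftrightarrow> (\<forall>x\<in>S. f differentiable (at x)) \<and>
     (\<forall>v. Ck_on k S (\<lambda>x. frechet_derivative f (at x) v))"

definition smooth_on :: "'a::real_normed_vector set \<Rightarrow> ('a \<Rightarrow> 'b::real_normed_vector) \<Rightarrow> bool" where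
  "smooth_on S f \<longleftrightarrow> (\<forall>k. Ck_on k S f)"


section \<open>Lie groups\<close>

text \<open>A chart is a pair of its domain and a coordinate map into the model space \<open>'e\<close>, so that
  the dimension of the group is \<open>DIM('e)\<close>, which is positive.\<close>

record ('g, 'e) lie_data = "'g monoid" +
  topo :: "'g topology"
  atlas :: "('g set \<times> ('g \<Rightarrow> 'e)) set"

definition chart_inv :: "'g set \<times> ('g \<Rightarrow> 'e) \<Rightarrow> 'e \<Rightarrow> 'g" where
  "chart_inv c = inv_into (fst c) (snd c)"

definition smooth_atlas :: "('g, 'e::euclidean_space) lie_data \<Rightarrow> bool" where
  "smooth_atlas G \<longleftrightarrow>
     (\<Union>c\<in>atlas G. fst c) = topspace (topo G) \<and>
     (\<forall>(U, \<phi>) \<in> atlas G. openin (topo G) U \<and> open (\<phi> ` U) \<and>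
        homeomorphic_map (subtopology (topo G) U) (top_of_set (\<phi> ` U)) \<phi>) \<and>
     (\<forall>(U, \<phi>) \<in> atlas G. \<forall>(V, \<psi>) \<in> atlas G.
        smooth_on (\<phi> ` (U \<inter> V)) (\<psi> \<circ> chart_inv (U, \<phi>)))"

definition smooth_mult :: "('g, 'e::euclidean_space) lie_data \<Rightarrow> bool" where
  "smooth_mult G \<longleftrightarrow>
     continuous_map (prod_topology (topo G) (topo G)) (topo G) (\<lambda>(x, y). x \<otimes>\<^bsub>G\<^esub> y) \<and>
     (\<forall>c\<in>atlas G. \<forall>d\<in>atlas G. \<forall>e\<in>atlas G.
        smooth_on {(u, v) \<in> snd c ` fst c \<times> snd d ` fst d. chart_inv c u \<otimes>\<^bsub>G\<^esub> chart_inv d v \<in> fst e}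
          (\<lambda>(u, v). snd e (chart_inv c u \<otimes>\<^bsub>G\<^esub> chart_inv d v)))"

definition smooth_inv :: "('g, 'e::euclidean_space) lie_data \<Rightarrow> bool" where
  "smooth_inv G \<longleftrightarrow>
     continuous_map (topo G) (topo G) (\<lambda>x. inv\<^bsub>G\<^esub> x) \<and>
     (\<forall>c\<in>atlas G. \<forall>e\<in>atlas G.
        smooth_on {u \<in> snd c ` fst c. inv\<^bsub>G\<^esub> (chart_inv c u) \<in> fst e}
          (\<lambda>u. snd e (inv\<^bsub>G\<^esub> (chart_inv c u))))"

definition is_lie_group :: "('g, 'e::euclidean_space) lie_data \<Rightarrow> bool" where
  "is_lie_group G \<longleftrightarrow>
     group G \<and> topspace (topo G) = carrier G \<and> Hausdorff_space (topo G) \<and>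
     second_countable (topo G) \<and> smooth_atlas G \<and> smooth_mult G \<and> smooth_inv G"


section \<open>The Lie algebra\<close>

text \<open>The Lie algebra is the tangent space at the identity. A fixed chart around the identity
  identifies it with the whole model space \<open>'e\<close>; another choice of chart gives an isomorphic Lie
  algebra. The inner product of \<open>'e\<close> has no meaning here and is only used to compute traces.\<close>

definition base_chart :: "('g, 'e::euclidean_space) lie_data \<Rightarrow> 'g set \<times> ('g \<Rightarrow> 'e)" where
  "base_chart G = (SOME c. c \<in> atlas G \<and> \<one>\<^bsub>G\<^esub> \<in> fst c)"

abbreviation base_coord :: "('g, 'e::euclidean_space) lie_data \<Rightarrow> 'g \<Rightarrow> 'e" where
  "base_coord G \<equiv> snd (base_chart G)"

text \<open>The differential at the identity of conjugation by g.\<close>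

definition Ad :: "('g, 'e::euclidean_space) lie_data \<Rightarrow> 'g \<Rightarrow> 'e \<Rightarrow> 'e" where
  "Ad G g X = frechet_derivative
     (\<lambda>u. base_coord G (g \<otimes>\<^bsub>G\<^esub> chart_inv (base_chart G) u \<otimes>\<^bsub>G\<^esub> inv\<^bsub>G\<^esub> g))
     (at (base_coord G \<one>\<^bsub>G\<^esub>)) X"

text \<open>\<open>ad\<close> is the differential of \<open>Ad\<close> at the identity, and \<open>[X,Y] = ad(X) Y\<close>.\<close>

definition bracket :: "('g, 'e::euclidean_space) lie_data \<Rightarrow> 'e \<Rightarrow> 'e \<Rightarrow> 'e" where
  "bracket G X Y = frechet_derivative
     (\<lambda>u. Ad G (chart_inv (base_chart G) u) Y) (at (base_coord G \<one>\<^bsub>G\<^esub>)) X"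

definition one_param_subgroup :: "('g, 'e::euclidean_space) lie_data \<Rightarrow> (real \<Rightarrow> 'g) \<Rightarrow> bool" where
  "one_param_subgroup G \<gamma> \<longleftrightarrow>
     continuous_map euclideanreal (topo G) \<gamma> \<and>
     (\<forall>s t. \<gamma> (s + t) = \<gamma> s \<otimes>\<^bsub>G\<^esub> \<gamma> t) \<and>
     (\<forall>(U, \<phi>) \<in> atlas G. smooth_on {t. \<gamma> t \<in> U} (\<phi> \<circ> \<gamma>))"

definition lie_exp :: "('g, 'e::euclidean_space) lie_data \<Rightarrow> 'e \<Rightarrow> 'g" where
  "lie_exp G X = (THE \<gamma>. one_param_subgroup G \<gamma> \<and>
     ((base_coord G \<circ> \<gamma>) has_vector_derivative X) (at 0)) 1"

definition lie_of :: "('g, 'e::euclidean_space) lie_data \<Rightarrow> 'g set \<Rightarrow> 'e set" where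
  "lie_of G H = {X. \<forall>t. lie_exp G (t *\<^sub>R X) \<in> H}"

definition killing :: "('g, 'e::euclidean_space) lie_data \<Rightarrow> 'e \<Rightarrow> 'e \<Rightarrow> real" where
  "killing G X Y = (\<Sum>b\<in>Basis. bracket G X (bracket G Y b) \<bullet> b)"

definition lie_ideal :: "('g, 'e::euclidean_space) lie_data \<Rightarrow> 'e set \<Rightarrow> bool" where
  "lie_ideal G I \<longleftrightarrow> subspace I \<and> (\<forall>X. \<forall>Y\<in>I. bracket G X Y \<in> I)"

primrec derived_series :: "('g, 'e::euclidean_space) lie_data \<Rightarrow> 'e set \<Rightarrow> nat \<Rightarrow> 'e set" where
  "derived_series G I 0 = I"
| "derived_series G I (Suc n) =
     span {bracket G X Y | X Y. X \<in> derived_series G I n \<and> Y \<in> derived_series G I n}"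

definition semisimple :: "('g, 'e::euclidean_space) lie_data \<Rightarrow> bool" where
  "semisimple G \<longleftrightarrow>
     (\<forall>I. lie_ideal G I \<and> (\<exists>n. derived_series G I n = {0}) \<longrightarrow> I = {0})"

text \<open>For semisimple groups: no compact factors. The Killing form of an ideal is the restriction
  of the ambient one, and a semisimple ideal is compact iff its Killing form is negative
  definite.\<close>

definition noncompact_type :: "('g, 'e::euclidean_space) lie_data \<Rightarrow> bool" where
  "noncompact_type G \<longleftrightarrow>
     (\<forall>I. lie_ideal G I \<and> (\<forall>X\<in>I. X \<noteq> 0 \<longrightarrow> killing G X X < 0) \<longrightarrow> I = {0})"

definition group_center :: "('g, 'm) monoid_scheme \<Rightarrow> 'g set" where
  "group_center G = {z \<in> carrier G. \<forall>g\<in>carrier G. z \<otimes>\<^bsub>G\<^esub> g = g \<otimes>\<^bsub>G\<^esub> z}"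

definition maximal_compact :: "('g, 'e::euclidean_space) lie_data \<Rightarrow> 'g set \<Rightarrow> bool" where
  "maximal_compact G K \<longleftrightarrow> subgroup K G \<and> compactin (topo G) K \<and>
     (\<forall>L. subgroup L G \<and> compactin (topo G) L \<and> K \<subseteq> L \<longrightarrow> L = K)"


section \<open>Cartan decomposition, restricted roots and minimal parabolic subgroups\<close>

definition cartan_decomposition ::
  "('g, 'e::euclidean_space) lie_data \<Rightarrow> 'e set \<Rightarrow> 'e set \<Rightarrow> bool" where
  "cartan_decomposition G k p \<longleftrightarrow>
     subspace k \<and> subspace p \<and> k \<inter> p = {0} \<and> {X + Y | X Y. X \<in> k \<and> Y \<in> p} = UNIV \<and>
     (\<forall>X\<in>k. \<forall>Y\<in>k. bracket G X Y \<in> k) \<and>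
     (\<forall>X\<in>k. \<forall>Y\<in>p. bracket G X Y \<in> p) \<and>
     (\<forall>X\<in>p. \<forall>Y\<in>p. bracket G X Y \<in> k) \<and>
     (\<forall>X\<in>k. X \<noteq> 0 \<longrightarrow> killing G X X < 0) \<and>
     (\<forall>X\<in>p. X \<noteq> 0 \<longrightarrow> killing G X X > 0)"

definition abelian_subspace_of ::
  "('g, 'e::euclidean_space) lie_data \<Rightarrow> 'e set \<Rightarrow> 'e set \<Rightarrow> bool" where
  "abelian_subspace_of G p a \<longleftrightarrow> subspace a \<and> a \<subseteq> p \<and> (\<forall>X\<in>a. \<forall>Y\<in>a. bracket G X Y = 0)"

definition maximal_abelian_subspace_of ::
  "('g, 'e::euclidean_space) lie_data \<Rightarrow> 'e set \<Rightarrow> 'e set \<Rightarrow> bool" where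
  "maximal_abelian_subspace_of G p a \<longleftrightarrow> abelian_subspace_of G p a \<and>
     (\<forall>b. abelian_subspace_of G p b \<and> a \<subseteq> b \<longrightarrow> b = a)"

text \<open>Functionals on \<open>a\<close> are extensional functions, so that equality of functionals is equality
  of functions. Linearity of a root follows from the existence of a nonzero root vector.\<close>

definition root_space :: "('g, 'e::euclidean_space) lie_data \<Rightarrow> 'e set \<Rightarrow> ('e \<Rightarrow> real) \<Rightarrow> 'e set" where
  "root_space G a \<alpha> = {X. \<forall>H\<in>a. bracket G H X = \<alpha> H *\<^sub>R X}"

definition restricted_roots ::
  "('g, 'e::euclidean_space) lie_data \<Rightarrow> 'e set \<Rightarrow> ('e \<Rightarrow> real) set" where
  "restricted_roots G a = {\<alpha> \<in> extensional a. (\<exists>H\<in>a. \<alpha> H \<noteq> 0) \<and> (\<exists>X\<in>root_space G a \<alpha>. X \<noteq> 0)}"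

definition positive_system ::
  "('g, 'e::euclidean_space) lie_data \<Rightarrow> 'e set \<Rightarrow> ('e \<Rightarrow> real) set \<Rightarrow> bool" where
  "positive_system G a \<Phi> \<longleftrightarrow>
     (\<exists>H\<in>a. (\<forall>\<alpha>\<in>restricted_roots G a. \<alpha> H \<noteq> 0) \<and> \<Phi> = {\<alpha> \<in> restricted_roots G a. \<alpha> H > 0})"

definition simple_roots :: "'e::euclidean_space set \<Rightarrow> ('e \<Rightarrow> real) set \<Rightarrow> ('e \<Rightarrow> real) set" where
  "simple_roots a \<Phi> = {\<alpha> \<in> \<Phi>. \<not> (\<exists>\<beta>\<in>\<Phi>. \<exists>\<gamma>\<in>\<Phi>. \<alpha> = (\<lambda>H\<in>a. \<beta> H + \<gamma> H))}"

definition grp_N ::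
  "('g, 'e::euclidean_space) lie_data \<Rightarrow> 'e set \<Rightarrow> ('e \<Rightarrow> real) set \<Rightarrow> 'g set" where
  "grp_N G a \<Phi> = lie_exp G ` span (\<Union>\<alpha>\<in>\<Phi>. root_space G a \<alpha>)"

definition grp_M :: "('g, 'e::euclidean_space) lie_data \<Rightarrow> 'g set \<Rightarrow> 'g set \<Rightarrow> 'g set" where
  "grp_M G K A = {k \<in> K. \<forall>x\<in>A. k \<otimes>\<^bsub>G\<^esub> x = x \<otimes>\<^bsub>G\<^esub> k}"

definition grp_T :: "('g, 'e::euclidean_space) lie_data \<Rightarrow> 'g set \<Rightarrow> 'g set \<Rightarrow> 'g set" where
  "grp_T G K A = {k \<in> K. (\<lambda>x. k \<otimes>\<^bsub>G\<^esub> x \<otimes>\<^bsub>G\<^esub> inv\<^bsub>G\<^esub> k) ` A = A}"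

definition compatible_choices ::
  "('g, 'e::euclidean_space) lie_data \<Rightarrow> 'g set \<Rightarrow> 'g set \<Rightarrow> 'g set
    \<Rightarrow> 'e set \<Rightarrow> 'e set \<Rightarrow> ('e \<Rightarrow> real) set \<Rightarrow> bool" where
  "compatible_choices G K P A p a \<Phi> \<longleftrightarrow>
     cartan_decomposition G (lie_of G K) p \<and>
     maximal_abelian_subspace_of G p a \<and>
     A = lie_exp G ` a \<and>
     positive_system G a \<Phi> \<and>
     P = grp_M G K A <#>\<^bsub>G\<^esub> A <#>\<^bsub>G\<^esub> grp_N G a \<Phi>"


section \<open>The longest Weyl group element\<close>

text \<open>The Weyl group is \<open>W = T/M\<close>; all notions are expressed through representatives in \<open>T\<close>.
  A representative of the reflection in a simple root acts on \<open>a\<close> as the identity on the kernel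
  of the root and as \<open>-1\<close> on the Killing-orthogonal complement of this kernel in \<open>a\<close>.\<close>

definition simple_reflection_reps ::
  "('g, 'e::euclidean_space) lie_data \<Rightarrow> 'g set \<Rightarrow> 'g set \<Rightarrow> 'e set \<Rightarrow> ('e \<Rightarrow> real) set \<Rightarrow> 'g set" where
  "simple_reflection_reps G K A a \<Phi> =
     {s \<in> grp_T G K A. \<exists>\<alpha>\<in>simple_roots a \<Phi>.
        (\<forall>H\<in>a. \<alpha> H = 0 \<longrightarrow> Ad G s H = H) \<and>
        (\<forall>H\<in>a. (\<forall>H'\<in>a. \<alpha> H' = 0 \<longrightarrow> killing G H H' = 0) \<longrightarrow> Ad G s H = - H)}"

text \<open>Representatives of the Weyl group elements that are products of n simple reflections.\<close>

primrec weyl_words ::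
  "('g, 'e::euclidean_space) lie_data \<Rightarrow> 'g set \<Rightarrow> 'g set \<Rightarrow> 'e set \<Rightarrow> ('e \<Rightarrow> real) set \<Rightarrow> nat \<Rightarrow> 'g set" where
  "weyl_words G K A a \<Phi> 0 = grp_M G K A"
| "weyl_words G K A a \<Phi> (Suc n) =
     simple_reflection_reps G K A a \<Phi> <#>\<^bsub>G\<^esub> weyl_words G K A a \<Phi> n"

definition weyl_length ::
  "('g, 'e::euclidean_space) lie_data \<Rightarrow> 'g set \<Rightarrow> 'g set \<Rightarrow> 'e set \<Rightarrow> ('e \<Rightarrow> real) set \<Rightarrow> 'g \<Rightarrow> nat" where
  "weyl_length G K A a \<Phi> t = (LEAST n. t \<in> weyl_words G K A a \<Phi> n)"

definition longest_rep ::
  "('g, 'e::euclidean_space) lie_data \<Rightarrow> 'g set \<Rightarrow> 'g set \<Rightarrow> 'e set \<Rightarrow> ('e \<Rightarrow> real) set \<Rightarrow> 'g \<Rightarrow> bool" where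
  "longest_rep G K A a \<Phi> w0 \<longleftrightarrow> w0 \<in> grp_T G K A \<and>
     (\<forall>t\<in>grp_T G K A. weyl_length G K A a \<Phi> t \<le> weyl_length G K A a \<Phi> w0)"


section \<open>Homogeneous spaces\<close>

text \<open>\<open>G/H\<close> is \<open>lcosets\<^bsub>G\<^esub> H\<close>, on which \<open>g\<close> acts by \<open>\<lambda>x. g <#\<^bsub>G\<^esub> x\<close>; it
  carries the quotient topology.\<close>

definition coset_topology :: "('g, 'e) lie_data \<Rightarrow> 'g set \<Rightarrow> 'g set topology" where
  "coset_topology G H = topology (\<lambda>\<U>. \<U> \<subseteq> lcosets\<^bsub>G\<^esub> H \<and>
     openin (topo G) {g \<in> topspace (topo G). g <#\<^bsub>G\<^esub> H \<in> \<U>})"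

lemma openin_coset_topology:
  "openin (coset_topology G H) \<U> \<longleftrightarrow> \<U> \<subseteq> lcosets\<^bsub>G\<^esub> H \<and>
     openin (topo G) {g \<in> topspace (topo G). g <#\<^bsub>G\<^esub> H \<in> \<U>}"
proof -
  let ?R = "\<lambda>\<U>. {g \<in> topspace (topo G). g <#\<^bsub>G\<^esub> H \<in> \<U>}"
  have int: "?R (\<U> \<inter> \<V>) = ?R \<U> \<inter> ?R \<V>" for \<U> \<V> by auto
  have un: "?R (\<Union>\<K>) = \<Union>(?R ` \<K>)" for \<K> by auto
  have "istopology (\<lambda>\<U>. \<U> \<subseteq> lcosets\<^bsub>G\<^esub> H \<and> openin (topo G) (?R \<U>))"
    unfolding istopology_def by (auto simp only: int un intro!: openin_Int openin_Union)
  then show ?thesis by (simp add: coset_topology_def)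
qed

lemma quotient_map_coset_topology:
  assumes "topspace (topo G) = carrier G"
  shows "quotient_map (topo G) (coset_topology G H) (\<lambda>g. g <#\<^bsub>G\<^esub> H)"
proof -
  have "{g \<in> topspace (topo G). g <#\<^bsub>G\<^esub> H \<in> lcosets\<^bsub>G\<^esub> H} = topspace (topo G)"
    using assms by (auto simp: LCOSETS_def)
  then have "openin (coset_topology G H) (lcosets\<^bsub>G\<^esub> H)"
    by (simp add: openin_coset_topology)
  then have "topspace (coset_topology G H) = lcosets\<^bsub>G\<^esub> H"
    by (meson openin_coset_topology openin_subset openin_topspace subset_antisym)
  then show ?thesis
    using assms by (auto simp: quotient_map_def openin_coset_topology LCOSETS_def)
qed


section \<open>Flats, opposition and generic tuples\<close>

definition act_set :: "('g, 'e) lie_data \<Rightarrow> 'g \<Rightarrow> 'g set set \<Rightarrow> 'g set set" where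
  "act_set G g S = (\<lambda>x. g <#\<^bsub>G\<^esub> x) ` S"

definition base_flat :: "('g, 'e) lie_data \<Rightarrow> 'g set \<Rightarrow> 'g set \<Rightarrow> 'g set set" where
  "base_flat G K A = {x <#\<^bsub>G\<^esub> K | x. x \<in> A}"

definition base_flat_boundary ::
  "('g, 'e::euclidean_space) lie_data \<Rightarrow> 'g set \<Rightarrow> 'g set \<Rightarrow> 'g set \<Rightarrow> 'g set set" where
  "base_flat_boundary G K P A = {w <#\<^bsub>G\<^esub> P | w. w \<in> grp_T G K A}"

text \<open>The maximal flats are the translates \<open>g F\<^sub>A\<close>, with boundary \<open>g (\<partial>F\<^sub>A)\<close>.\<close>

definition flat_boundary ::
  "('g, 'e::euclidean_space) lie_data \<Rightarrow> 'g set \<Rightarrow> 'g set \<Rightarrow> 'g set \<Rightarrow> 'g set set \<Rightarrow> 'g set set" where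
  "flat_boundary G K P A F = (THE B. \<exists>g\<in>carrier G.
     F = act_set G g (base_flat G K A) \<and> B = act_set G g (base_flat_boundary G K P A))"

definition opposite ::
  "('g, 'e) lie_data \<Rightarrow> 'g set \<Rightarrow> 'g \<Rightarrow> 'g set \<Rightarrow> 'g set \<Rightarrow> bool" where
  "opposite G P w0 x y \<longleftrightarrow>
     (\<exists>g\<in>carrier G. x = g <#\<^bsub>G\<^esub> P \<and> y = g <#\<^bsub>G\<^esub> (w0 <#\<^bsub>G\<^esub> P))"

definition flat_through ::
  "('g, 'e) lie_data \<Rightarrow> 'g set \<Rightarrow> 'g set \<Rightarrow> 'g set \<Rightarrow> 'g \<Rightarrow> 'g set \<Rightarrow> 'g set \<Rightarrow> 'g set set" where
  "flat_through G K P A w0 x y = (THE F. \<exists>g\<in>carrier G.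
     x = g <#\<^bsub>G\<^esub> P \<and> y = g <#\<^bsub>G\<^esub> (w0 <#\<^bsub>G\<^esub> P) \<and> F = act_set G g (base_flat G K A))"

definition generic_triples ::
  "('g, 'e::euclidean_space) lie_data \<Rightarrow> 'g set \<Rightarrow> 'g set \<Rightarrow> 'g set \<Rightarrow> 'g
    \<Rightarrow> ('g set \<times> 'g set \<times> 'g set) set" where
  "generic_triples G K P A w0 =
     {(x, y, z). x \<in> lcosets\<^bsub>G\<^esub> P \<and> y \<in> lcosets\<^bsub>G\<^esub> P \<and> z \<in> lcosets\<^bsub>G\<^esub> P \<and>
        opposite G P w0 x y \<and>
        (\<forall>u \<in> flat_boundary G K P A (flat_through G K P A w0 x y). opposite G P w0 z u)}"

text \<open>A q-tuple of points is an extensional function on \<open>{..<q}\<close>.\<close>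

definition generic_tuples ::
  "('g, 'e::euclidean_space) lie_data \<Rightarrow> 'g set \<Rightarrow> 'g set \<Rightarrow> 'g set \<Rightarrow> 'g \<Rightarrow> nat \<Rightarrow> (nat \<Rightarrow> 'g set) set" where
  "generic_tuples G K P A w0 q =
     {x \<in> {..<q} \<rightarrow>\<^sub>E lcosets\<^bsub>G\<^esub> P.
        \<forall>i<q. \<forall>j<q. \<forall>k<q. i \<noteq> j \<and> j \<noteq> k \<and> i \<noteq> k \<longrightarrow>
          (x i, x j, x k) \<in> generic_triples G K P A w0}"

definition pairwise_opposite_tuples ::
  "('g, 'e) lie_data \<Rightarrow> 'g set \<Rightarrow> 'g \<Rightarrow> nat \<Rightarrow> (nat \<Rightarrow> 'g set) set" where
  "pairwise_opposite_tuples G P w0 q =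
     {x \<in> {..<q} \<rightarrow>\<^sub>E lcosets\<^bsub>G\<^esub> P. \<forall>i<q. \<forall>j<q. i \<noteq> j \<longrightarrow> opposite G P w0 (x i) (x j)}"

definition tuple_topology ::
  "('g, 'e) lie_data \<Rightarrow> 'g set \<Rightarrow> nat \<Rightarrow> (nat \<Rightarrow> 'g set) set \<Rightarrow> (nat \<Rightarrow> 'g set) topology" where
  "tuple_topology G P q D = subtopology (product_topology (\<lambda>_. coset_topology G P) {..<q}) D"

definition equivariant_on ::
  "('g, 'e) lie_data \<Rightarrow> nat \<Rightarrow> (nat \<Rightarrow> 'g set) set \<Rightarrow> ((nat \<Rightarrow> 'g set) \<Rightarrow> 'g set) \<Rightarrow> bool" where
  "equivariant_on G q D f \<longleftrightarrow>
     (\<forall>g\<in>carrier G. \<forall>x\<in>D. f (\<lambda>i\<in>{..<q}. g <#\<^bsub>G\<^esub> x i) = g <#\<^bsub>G\<^esub> f x)"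

definition symmetric_on :: "nat \<Rightarrow> (nat \<Rightarrow> 'b) set \<Rightarrow> ((nat \<Rightarrow> 'b) \<Rightarrow> 'c) \<Rightarrow> bool" where
  "symmetric_on q D f \<longleftrightarrow> (\<forall>\<sigma>. \<sigma> permutes {..<q} \<longrightarrow> (\<forall>x\<in>D. f (x \<circ> \<sigma>) = f x))"

end

theory Submission
  imports Defs "HOL-Complex_Analysis.Complex_Analysis"
begin

text \<open>
  The map is defined by a Kempf--Ness argument. An opposite pair \<open>(x, y) = g (P, w\<^sub>0 P)\<close> determines
  the vector \<open>v\<^sub>x\<^sub>y = Ad g H\<^sub>0\<close>, where \<open>H\<^sub>0\<close> is a fixed element of the open Weyl chamber: the
  stabilizer \<open>M A\<close> of the pair fixes \<open>H\<^sub>0\<close>. The barycenter of a tuple is the coset \<open>h K\<close> that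
  minimizes \<open>\<Sum> |Ad (h\<^sup>-\<^sup>1) v\<^sub>x\<^sub>y|\<^sup>2\<close>, summed over the ordered pairs of entries. This energy is convex
  along geodesics, and it is proper and strictly convex unless some nonzero \<open>X\<close> in \<open>p\<close> has every
  \<open>v\<^sub>x\<^sub>y\<close> in the sum of the eigenspaces of \<open>ad X\<close> with nonnegative eigenvalue. In that case the
  geodesic of \<open>X\<close> is asymptotic to a ray in each flat joining two entries; seen from an entry \<open>x\<close>,
  its direction is an element \<open>H\<^sub>x\<close> of \<open>a\<close> that depends only on \<open>X\<close> and \<open>x\<close>, and \<open>H\<^sub>y = w\<^sub>0\<^sup>-\<^sup>1 H\<^sub>x\<close>
  for opposite entries. If \<open>w\<^sub>0 = -1\<close>, three pairwise opposite entries give \<open>H\<^sub>x = - H\<^sub>x\<close>. If an entry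
  is opposite to the whole boundary of the flat of two others, then \<open>w\<^sub>0\<^sup>-\<^sup>1 H\<^sub>x\<close> is dominant; for
  \<open>x\<close> and \<open>y\<close> together this forces \<open>H\<^sub>x = 0\<close>. Either way \<open>X = 0\<close>. Uniqueness of the minimizer gives
  equivariance and symmetry; continuity holds because exceeding the value at the center on
  a whole sphere around the minimizer is, for the energy, an open condition on the vectors \<open>v\<^sub>x\<^sub>y\<close>.
\<close>

text \<open>The group is abstract, so every argument passes through the adjoint representation. A
  nondegenerate Killing form makes all derivations inner; hence the automorphisms of the bracket
  near 1 are exactly the \<open>Ad g\<close> with g near the identity, and \<open>AdE\<close> is
  injective there. One-parameter subgroups are therefore lifted from \<open>exp (t ad X)\<close>
  instead of being integrated on the group, and \<open>K\<close> is recognized as the group of all g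
  whose \<open>Ad g\<close> preserves \<open>Q\<close>: that group is compact because the kernel of
  \<open>AdE\<close> is central and the center is finite. The critical point is the longest element.
  It is defined by words, so its effect on the roots can only be known once \<open>T\<close> is
  shown to contain no element that preserves the positive roots and yet moves \<open>a\<close>. For
  such an element a certain determinant would vanish near the identity, where every
  \<open>Ad g\<close> factors through the negative root spaces and the complementary parabolic, and
  hence everywhere; but at the element itself it equals 1. That the directions
  \<open>H\<^sub>x\<close> are well defined rests on comparing the growth rates of one exponential
  in two ways.\<close>

section \<open>Calculus of k times continuously differentiable maps on open sets\<close>

lemma Ck_on_subset: "Ck_on k S f ==> T \<subseteq> S ==> Ck_on k T f"
 by (induction k arbitrary: f) (auto intro: continuous_on_subset)

lemma Ck_on_Suc_D: "Ck_on (Suc k) S f ==> Ck_on k S f"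
proof (induction k arbitrary: f)
 case 0
 thus ?case
  by (auto intro!: continuous_at_imp_continuous_on differentiable_imp_continuous_within)
next
 case (Suc k)
 thus ?case
  by (metis Ck_on.simps(2))
qed

lemma Ck_on_cong:
 assumes "open S" "!!x. x \<in> S ==> f x = g x"
 shows "Ck_on k S f \<longleftrightarrow> Ck_on k S g"
 using assms(2)
proof (induction k arbitrary: f g)
 case 0
 thus ?case by (simp cong: continuous_on_cong)
next
 case (Suc k)
 have hd: "(f has_derivative D) (at x) \<longleftrightarrow> (g has_derivative D) (at x)" if "x \<in> S" for x D
  using has_derivative_transform_within_open[OF _ assms(1) that] Suc.prems by (metis (full_types))
 hence fd: "frechet_derivative f (at x) = frechet_derivative g (at x)" if "x \<in> S" for x
  unfolding frechet_derivative_def using that by simp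
 have "f differentiable (at x) \<longleftrightarrow> g differentiable (at x)" if "x \<in> S" for x
  unfolding differentiable_def using hd[OF that] by simp
 moreover have "Ck_on k S (%x. frechet_derivative f (at x) v) \<longleftrightarrow> Ck_on k S (%x. frechet_derivative g (at x) v)" for v
  by (rule Suc.IH) (simp add: fd)
 ultimately show ?case by simp
qed

lemma Ck_on_SucI:
 assumes "open S" "!!x. x \<in> S ==> (f has_derivative f' x) (at x)"
  and "!!v. Ck_on k S (%x. f' x v)"
 shows "Ck_on (Suc k) S f"
proof -
 have "Ck_on k S (%x. frechet_derivative f (at x) v)" for v
  using Ck_on_cong[OF assms(1), where k=k and f="%x. frechet_derivative f (at x) v" and g="%x. f' x v"] assms(2,3)
  by (metis frechet_derivative_at)
 thus ?thesis using assms(2) by (auto simp: differentiable_def)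
qed

lemma Ck_on_has_derivative:
 "Ck_on (Suc k) S f ==> x \<in> S ==> (f has_derivative frechet_derivative f (at x)) (at x)"
 by (simp add: frechet_derivative_works)

lemma Ck_on_open_Union:
 assumes "!!x. x \<in> S ==> \<exists>T. open T \<and> x \<in> T \<and> Ck_on k T f"
 shows "Ck_on k S f"
 using assms
proof (induction k arbitrary: f)
 case 0
 thus ?case
  by (metis Ck_on.simps(1) continuous_at_imp_continuous_on continuous_on_eq_continuous_at)
next
 case (Suc k)
 thus ?case unfolding Ck_on.simps by metis
qed

lemma Ck_on_const: "open S ==> Ck_on k S (%x. c)"
proof (induction k arbitrary: c)
 case (Suc k)
 show ?case by (rule Ck_on_SucI[where f'="%x v. 0"]) (use Suc in auto)
qed simp

lemma Ck_on_bounded_linear: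
 assumes "bounded_linear L" "open S" "Ck_on k S f"
 shows "Ck_on k S (%x. L (f x))"
 using assms(3)
proof (induction k arbitrary: f)
 case 0
 thus ?case using bounded_linear.continuous_on[OF assms(1)] by simp
next
 case (Suc k)
 show ?case
  by (rule Ck_on_SucI[where f'="%x v. L (frechet_derivative f (at x) v)"])
    (use Suc assms in \<open>auto intro!: bounded_linear.has_derivative[OF assms(1)] simp: frechet_derivative_works\<close>)
qed

lemma Ck_on_linear: "bounded_linear L ==> open S ==> Ck_on k S L"
proof (cases k)
 case 0
 thus "bounded_linear L ==> open S ==> Ck_on k S L" by (simp add: linear_continuous_on)
next
 case (Suc m)
 thus "bounded_linear L ==> open S ==> Ck_on k S L"
  by (auto intro!: Ck_on_SucI[where f'="%x v. L v"] Ck_on_const bounded_linear_imp_has_derivative simp del: Ck_on.simps)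
qed

lemma Ck_on_add:
 assumes "open S" "Ck_on k S f" "Ck_on k S g"
 shows "Ck_on k S (%x. f x + g x)"
 using assms(2,3)
proof (induction k arbitrary: f g)
 case 0
 thus ?case by (simp add: continuous_on_add)
next
 case (Suc k)
 show ?case
  by (rule Ck_on_SucI[where f'="%x v. frechet_derivative f (at x) v + frechet_derivative g (at x) v"])
    (use Suc assms in \<open>auto intro!: has_derivative_add simp: frechet_derivative_works\<close>)
qed

lemma Ck_on_sum:
 assumes "open S" "!!i. i \<in> I ==> Ck_on k S (f i)"
 shows "Ck_on k S (%x. \<Sum>i\<in>I. f i x)"
 using assms(2)
 by (induction I rule: infinite_finite_induct) (auto intro: Ck_on_add Ck_on_const assms(1))

lemma Ck_on_bilinear:
 assumes "bounded_bilinear h" "open S" "Ck_on k S f" "Ck_on k S g"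
 shows "Ck_on k S (%x. h (f x) (g x))"
 using assms(3,4)
proof (induction k arbitrary: f g)
 case 0
 thus ?case using bounded_bilinear.continuous_on[OF assms(1)] by simp
next
 case (Suc k)
 have "Ck_on k S f" "Ck_on k S g" using Suc.prems by (simp_all only: Ck_on_Suc_D)
 thus ?case
  using Suc assms
  by (intro Ck_on_SucI[where f'="%x v. h (f x) (frechet_derivative g (at x) v) + h (frechet_derivative f (at x) v) (g x)"])
    (auto intro!: bounded_bilinear.FDERIV[OF assms(1)] Ck_on_add simp: frechet_derivative_works)
qed

lemma Ck_on_Pair:
 assumes "open S" "Ck_on k S f" "Ck_on k S g"
 shows "Ck_on k S (%x. (f x, g x))"
 using assms(2,3)
proof (induction k arbitrary: f g)
 case 0
 thus ?case by (simp add: continuous_on_Pair)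
next
 case (Suc k)
 show ?case
  by (rule Ck_on_SucI[where f'="%x v. (frechet_derivative f (at x) v, frechet_derivative g (at x) v)"])
    (use Suc assms in \<open>auto intro!: has_derivative_Pair simp: frechet_derivative_works\<close>)
qed

text \<open>In the derivative \<open>?g' (f x) (?f' x v)\<close> of the composite both the operator
  and its argument vary with x. Expanding the argument in the basis separates them into a finite sum
  of scalar coefficients times \<open>?g' (f x) b\<close>, and the induction hypothesis applies to
  the latter because b is fixed. This is why the middle space is Euclidean.\<close>

lemma Ck_on_compose:
 fixes f :: "'a::real_normed_vector => 'b::euclidean_space" and g :: "'b => 'c::real_normed_vector"
 assumes "open S" "open T" "f ` S \<subseteq> T" "Ck_on k S f" "Ck_on k T g"
 shows "Ck_on k S (%x. g (f x))"
 using assms(4,5)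
proof (induction k arbitrary: g)
 case 0
 thus ?case
  using assms(3) by (auto intro: continuous_on_compose2)
next
 case (Suc k)
 let ?f' = "%x. frechet_derivative f (at x)" and ?g' = "%y. frechet_derivative g (at y)"
 have fk: "Ck_on k S f" using Suc.prems(1) by (rule Ck_on_Suc_D)
 have gd: "(g has_derivative ?g' (f x)) (at (f x))" if "x \<in> S" for x
  using Suc.prems(2) assms(3) that by (auto simp: frechet_derivative_works)
 have fd: "(f has_derivative ?f' x) (at x)" if "x \<in> S" for x
  using Suc.prems(1) that by (auto simp: frechet_derivative_works)
 have exp: "?g' (f x) (?f' x v) = (\<Sum>b\<in>Basis. (?f' x v \<bullet> b) *\<^sub>R ?g' (f x) b)" if "x \<in> S" for x v
 proof -
  have lin: "linear (?g' (f x))" using gd[OF that] has_derivative_linear by blast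
  have "?g' (f x) (?f' x v) = ?g' (f x) (\<Sum>b\<in>Basis. (?f' x v \<bullet> b) *\<^sub>R b)"
   by (simp add: euclidean_representation)
  thus ?thesis
   by (simp only: linear_sum[OF lin] linear_cmul[OF lin] o_def)
 qed
 show ?case
 proof (rule Ck_on_SucI[OF assms(1), where f'="%x v. ?g' (f x) (?f' x v)"])
  show "((%x. g (f x)) has_derivative (%v. ?g' (f x) (?f' x v))) (at x)" if "x \<in> S" for x
   using diff_chain_at[OF fd[OF that] gd[OF that]] by (simp add: o_def)
  have "Ck_on k S (%x. \<Sum>b\<in>Basis. (?f' x v \<bullet> b) *\<^sub>R ?g' (f x) b)" for v
  proof (intro Ck_on_sum[OF assms(1)] Ck_on_bilinear[OF bounded_bilinear_scaleR assms(1)])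
   fix b
   show "Ck_on k S (%x. ?f' x v \<bullet> b)"
    using Suc.prems(1) by (intro Ck_on_bounded_linear[OF bounded_linear_inner_left assms(1)]) simp
   show "Ck_on k S (%x. ?g' (f x) b)"
    using Suc.prems(2) by (intro Suc.IH fk) simp
  qed
  thus "Ck_on k S (%x. ?g' (f x) (?f' x v))" for v
   using Ck_on_cong[OF assms(1), where k=k and f="%x. ?g' (f x) (?f' x v)"
     and g="%x. \<Sum>b\<in>Basis. (?f' x v \<bullet> b) *\<^sub>R ?g' (f x) b"] exp by blast
 qed
qed

section \<open>Smooth maps from vector spaces into the group\<close>

locale lie_grp =
 fixes G :: "('g, 'e::euclidean_space) lie_data" (structure)
 assumes is_lie_group: "is_lie_group G"
begin

sublocale group G
 using is_lie_group by (simp add: is_lie_group_def)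

lemma topspace_eq [simp]: "topspace (topo G) = carrier G"
 using is_lie_group by (simp add: is_lie_group_def)

lemma chart_facts:
 assumes "c \<in> atlas G"
 shows "openin (topo G) (fst c)" "open (snd c ` fst c)"
  "homeomorphic_map (subtopology (topo G) (fst c)) (top_of_set (snd c ` fst c)) (snd c)"
 using is_lie_group assms by (auto simp: is_lie_group_def smooth_atlas_def)

lemma chart_sub_carrier: "c \<in> atlas G ==> fst c \<subseteq> carrier G"
 using openin_subset[OF chart_facts(1)] by simp

lemma chart_inj: "c \<in> atlas G ==> inj_on (snd c) (fst c)"
 using homeomorphic_imp_injective_map[OF chart_facts(3)] chart_sub_carrier
 by (metis Int_absorb1 topspace_eq topspace_subtopology)

lemma chart_inv_in: "c \<in> atlas G ==> u \<in> snd c ` fst c ==> chart_inv c u \<in> fst c"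
 by (simp add: chart_inv_def inv_into_into)

lemma chart_chart_inv [simp]: "u \<in> snd c ` fst c ==> snd c (chart_inv c u) = u"
 by (simp add: chart_inv_def f_inv_into_f)

lemma chart_inv_chart [simp]: "c \<in> atlas G ==> x \<in> fst c ==> chart_inv c (snd c x) = x"
 by (simp add: chart_inv_def chart_inj)

lemma chart_exists: "x \<in> carrier G ==> \<exists>c\<in>atlas G. x \<in> fst c"
 using is_lie_group by (auto simp: is_lie_group_def smooth_atlas_def)

lemma chart_continuous: "c \<in> atlas G ==> continuous_map (subtopology (topo G) (fst c)) euclidean (snd c)"
 using homeomorphic_imp_continuous_map[OF chart_facts(3)] continuous_map_in_subtopology by blast

lemma chart_inv_continuous:
 assumes "c \<in> atlas G"
 shows "continuous_map (top_of_set (snd c ` fst c)) (topo G) (chart_inv c)"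
proof -
 obtain h where h: "homeomorphic_maps (subtopology (topo G) (fst c)) (top_of_set (snd c ` fst c)) (snd c) h"
  using chart_facts(3)[OF assms] homeomorphic_map_maps by blast
 hence "continuous_map (top_of_set (snd c ` fst c)) (subtopology (topo G) (fst c)) h"
  by (simp add: homeomorphic_maps_def)
 hence "continuous_map (top_of_set (snd c ` fst c)) (topo G) h"
  using continuous_map_in_subtopology by blast
 moreover have "h u = chart_inv c u" if "u \<in> snd c ` fst c" for u
  using h that chart_inj[OF assms] chart_sub_carrier[OF assms]
  by (auto simp: homeomorphic_maps_def chart_inv_def)
 ultimately show ?thesis
  by (metis (no_types, lifting) continuous_map_eq topspace_euclidean_subtopology)
qed

lemma base_chart: "base_chart G \<in> atlas G" "\<one> \<in> fst (base_chart G)"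
proof -
 have "\<exists>c. c \<in> atlas G \<and> \<one> \<in> fst c" using chart_exists[OF one_closed] by blast
 from someI_ex[OF this] show "base_chart G \<in> atlas G" "\<one> \<in> fst (base_chart G)"
  by (auto simp: base_chart_def)
qed

lemma mult_continuous: "continuous_map (prod_topology (topo G) (topo G)) (topo G) (%(x, y). x \<otimes> y)"
 using is_lie_group by (simp add: is_lie_group_def smooth_mult_def)

lemma inv_continuous: "continuous_map (topo G) (topo G) (%x. inv x)"
 using is_lie_group by (simp add: is_lie_group_def smooth_inv_def)

lemma continuous_map_mult:
 assumes "continuous_map X (topo G) f" "continuous_map X (topo G) h"
 shows "continuous_map X (topo G) (%x. f x \<otimes> h x)"
proof -
 have "continuous_map X (prod_topology (topo G) (topo G)) (%x. (f x, h x))"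
  using assms by (simp add: continuous_map_pairedI)
 from continuous_map_compose[OF this mult_continuous] show ?thesis by (simp add: o_def)
qed

lemma continuous_map_inv:
 assumes "continuous_map X (topo G) f"
 shows "continuous_map X (topo G) (%x. inv (f x))"
 using continuous_map_compose[OF assms inv_continuous] by (simp add: o_def)

text \<open>Regularity is tested in all charts at once, so that none has to be chosen along f. The
  continuity clause makes the preimages of chart domains open, which \<open>Ck_on\<close>
  presupposes.\<close>

definition Ck_map :: "nat => 'a::real_normed_vector set => ('a => 'g) => bool" where
 "Ck_map k S f \<longleftrightarrow> continuous_map (top_of_set S) (topo G) f \<and>
   (\<forall>c\<in>atlas G. Ck_on k {x\<in>S. f x \<in> fst c} (%x. snd c (f x)))"

lemma open_preimage:
 assumes "open S" "continuous_map (top_of_set S) (topo G) f" "openin (topo G) U"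
 shows "open {x\<in>S. f x \<in> U}"
proof -
 have "openin (top_of_set S) {x\<in>S. f x \<in> U}"
  using openin_continuous_map_preimage[OF assms(2,3)] by simp
 thus ?thesis using assms(1) openin_open_eq by blast
qed

lemma Ck_map_const: "open S ==> x \<in> carrier G ==> Ck_map k S (%_. x)"
 using open_preimage[of S "%_. x"] chart_facts(1) by (auto simp: Ck_map_def simp del: open_Collect_const intro!: Ck_on_const)

lemma Ck_map_carrier: "Ck_map k S f ==> x \<in> S ==> f x \<in> carrier G"
 by (auto simp: Ck_map_def continuous_map_def Pi_iff)

text \<open>Around a given point each of f, h and the product stays in one chart, on an open set by
  continuity. There the claim is the chain rule for multiplication in coordinates, and
  differentiability is local.\<close>

lemma Ck_map_mult:
 fixes f h :: "'a::euclidean_space => 'g"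
 assumes S: "open S" and f: "Ck_map k S f" and h: "Ck_map k S h"
 shows "Ck_map k S (%x. f x \<otimes> h x)"
proof -
 have cf: "continuous_map (top_of_set S) (topo G) f" and ch: "continuous_map (top_of_set S) (topo G) h"
  using f h by (auto simp: Ck_map_def)
 note cm = continuous_map_mult[OF cf ch]
 have "Ck_on k {x\<in>S. f x \<otimes> h x \<in> fst e} (%x. snd e (f x \<otimes> h x))" if e: "e \<in> atlas G" for e
 proof (rule Ck_on_open_Union)
  fix x assume x: "x \<in> {x\<in>S. f x \<otimes> h x \<in> fst e}"
  hence "f x \<in> carrier G" "h x \<in> carrier G" using f h Ck_map_carrier by auto
  then obtain c d where c: "c \<in> atlas G" "f x \<in> fst c" and d: "d \<in> atlas G" "h x \<in> fst d"
   using chart_exists by metis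
  let ?W = "{(u, v) \<in> snd c ` fst c \<times> snd d ` fst d. chart_inv c u \<otimes> chart_inv d v \<in> fst e}"
  let ?m = "%(u, v). snd e (chart_inv c u \<otimes> chart_inv d v)"
  let ?T = "{x\<in>S. f x \<in> fst c} \<inter> {x\<in>S. h x \<in> fst d} \<inter> {x\<in>S. f x \<otimes> h x \<in> fst e}"
  have T: "open ?T"
   by (intro open_Int open_preimage[OF S cf] open_preimage[OF S ch] open_preimage[OF S cm] chart_facts(1) c d e)
  have m: "Ck_on k ?W ?m"
   using is_lie_group c d e by (auto simp: is_lie_group_def smooth_mult_def smooth_on_def)
  have "continuous_map (top_of_set (snd c ` fst c \<times> snd d ` fst d)) (topo G) (%x. chart_inv c (fst x))"
   by (rule continuous_map_compose[OF _ chart_inv_continuous[OF c(1)], unfolded o_def])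
     (auto simp: continuous_map_in_subtopology continuous_on_fst)
  moreover have "continuous_map (top_of_set (snd c ` fst c \<times> snd d ` fst d)) (topo G) (%x. chart_inv d (snd x))"
   by (rule continuous_map_compose[OF _ chart_inv_continuous[OF d(1)], unfolded o_def])
     (auto simp: continuous_map_in_subtopology continuous_on_snd)
  ultimately have "continuous_map (top_of_set (snd c ` fst c \<times> snd d ` fst d)) (topo G)
    (%x. chart_inv c (fst x) \<otimes> chart_inv d (snd x))"
   by (rule continuous_map_mult)
  from open_preimage[OF _ this chart_facts(1)[OF e]]
  have "open {x \<in> snd c ` fst c \<times> snd d ` fst d. chart_inv c (fst x) \<otimes> chart_inv d (snd x) \<in> fst e}"
   using open_Times[OF chart_facts(2)[OF c(1)] chart_facts(2)[OF d(1)]] by blast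
  moreover have "{x \<in> snd c ` fst c \<times> snd d ` fst d. chart_inv c (fst x) \<otimes> chart_inv d (snd x) \<in> fst e} = ?W"
   by auto
  ultimately have W: "open ?W" by simp
  have "Ck_on k ?T (%x. ?m (snd c (f x), snd d (h x)))"
  proof (rule Ck_on_compose[OF T W _ _ m])
   show "(%x. (snd c (f x), snd d (h x))) ` ?T \<subseteq> ?W" using c d by auto
   have "Ck_on k ?T (%x. snd c (f x))" "Ck_on k ?T (%x. snd d (h x))"
    using f h c d unfolding Ck_map_def by (blast intro: Ck_on_subset)+
   thus "Ck_on k ?T (%x. (snd c (f x), snd d (h x)))" by (rule Ck_on_Pair[OF T])
  qed
  hence "Ck_on k ?T (%x. snd e (f x \<otimes> h x))"
   by (rule Ck_on_cong[OF T, THEN iffD1, rotated]) (use c d in auto)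
  thus "\<exists>T. open T \<and> x \<in> T \<and> Ck_on k T (%x. snd e (f x \<otimes> h x))"
   using T x c d by blast
 qed
 thus ?thesis using cm by (auto simp: Ck_map_def)
qed

lemma Ck_map_inv:
 fixes f :: "'a::euclidean_space => 'g"
 assumes S: "open S" and f: "Ck_map k S f"
 shows "Ck_map k S (%x. inv (f x))"
proof -
 have cf: "continuous_map (top_of_set S) (topo G) f"
  using f by (auto simp: Ck_map_def)
 note cm = continuous_map_inv[OF cf]
 have "Ck_on k {x\<in>S. inv (f x) \<in> fst e} (%x. snd e (inv (f x)))" if e: "e \<in> atlas G" for e
 proof (rule Ck_on_open_Union)
  fix x assume x: "x \<in> {x\<in>S. inv (f x) \<in> fst e}"
  hence "f x \<in> carrier G" using f Ck_map_carrier by auto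
  then obtain c where c: "c \<in> atlas G" "f x \<in> fst c"
   using chart_exists by metis
  let ?W = "{u \<in> snd c ` fst c. inv (chart_inv c u) \<in> fst e}"
  let ?m = "%u. snd e (inv (chart_inv c u))"
  let ?T = "{x\<in>S. f x \<in> fst c} \<inter> {x\<in>S. inv (f x) \<in> fst e}"
  have T: "open ?T"
   by (intro open_Int open_preimage[OF S cf] open_preimage[OF S cm] chart_facts(1) c e)
  have m: "Ck_on k ?W ?m"
   using is_lie_group c e by (auto simp: is_lie_group_def smooth_inv_def smooth_on_def)
  from open_preimage[OF _ continuous_map_inv[OF chart_inv_continuous] chart_facts(1)[OF e]]
  have W: "open ?W" using chart_facts(2) c by auto
  have "Ck_on k ?T (%x. ?m (snd c (f x)))"
  proof (rule Ck_on_compose[OF T W _ _ m])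
   show "(%x. snd c (f x)) ` ?T \<subseteq> ?W" using c by auto
   show "Ck_on k ?T (%x. snd c (f x))"
    using f c unfolding Ck_map_def by (blast intro: Ck_on_subset)
  qed
  hence "Ck_on k ?T (%x. snd e (inv (f x)))"
   by (rule Ck_on_cong[OF T, THEN iffD1, rotated]) (use c in auto)
  thus "\<exists>T. open T \<and> x \<in> T \<and> Ck_on k T (%x. snd e (inv (f x)))"
   using T x c by blast
 qed
 thus ?thesis using cm by (auto simp: Ck_map_def)
qed

lemma Ck_map_chart_inv:
 assumes c: "c \<in> atlas G"
 shows "Ck_map k (snd c ` fst c) (chart_inv c)"
proof -
 have "Ck_on k {x \<in> snd c ` fst c. chart_inv c x \<in> fst d} (%x. snd d (chart_inv c x))" if d: "d \<in> atlas G" for d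
 proof -
  have "smooth_on (snd c ` (fst c \<inter> fst d)) (snd d \<circ> chart_inv c)"
   using is_lie_group c d unfolding is_lie_group_def smooth_atlas_def
   by (metis (no_types, lifting) case_prod_beta prod.collapse)
  moreover have "{x \<in> snd c ` fst c. chart_inv c x \<in> fst d} = snd c ` (fst c \<inter> fst d)"
   using c by auto
  ultimately show ?thesis by (simp add: smooth_on_def o_def)
 qed
 thus ?thesis using chart_inv_continuous[OF c] by (simp add: Ck_map_def)
qed

lemma Ck_map_compose:
 fixes f :: "'a::euclidean_space => 'g" and h :: "'b::euclidean_space => 'a"
 assumes S: "open S" and T: "open T" and h: "Ck_on k T h" "h ` T \<subseteq> S" and f: "Ck_map k S f"
 shows "Ck_map k T (%x. f (h x))"
proof -
 have ch: "continuous_on T h" using h(1) Ck_on_Suc_D by (induction k) auto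
 have cf: "continuous_map (top_of_set S) (topo G) f"
  using f by (auto simp: Ck_map_def)
 have cm: "continuous_map (top_of_set T) (topo G) (%x. f (h x))"
  using continuous_map_compose[OF _ cf, of "top_of_set T" h] ch h(2)
  by (auto simp: o_def continuous_map_in_subtopology)
 have "Ck_on k {x\<in>T. f (h x) \<in> fst c} (%x. snd c (f (h x)))" if c: "c \<in> atlas G" for c
 proof (rule Ck_on_compose[where T="{x\<in>S. f x \<in> fst c}" and g="%x. snd c (f x)"])
  show "open {x\<in>T. f (h x) \<in> fst c}" by (rule open_preimage[OF T cm chart_facts(1)[OF c]])
  show "open {x\<in>S. f x \<in> fst c}" by (rule open_preimage[OF S cf chart_facts(1)[OF c]])
  show "h ` {x\<in>T. f (h x) \<in> fst c} \<subseteq> {x\<in>S. f x \<in> fst c}" using h(2) by auto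
  show "Ck_on k {x\<in>T. f (h x) \<in> fst c} h" using h(1) by (rule Ck_on_subset) auto
  show "Ck_on k {x\<in>S. f x \<in> fst c} (%x. snd c (f x))" using f c by (auto simp: Ck_map_def)
 qed
 thus ?thesis using cm by (auto simp: Ck_map_def)
qed

end

section \<open>The Banach algebra of endomorphisms\<close>

text \<open>A type of its own lets composition be the multiplication. Powers, the exponential series
  and its derivative then come from the classes \<open>real_normed_algebra_1\<close> and
  \<open>banach\<close>.\<close>

typedef (overloaded) 'a endo = "UNIV :: ('a::euclidean_space \<Rightarrow>\<^sub>L 'a) set"
 morphisms blinfun_of_endo endo_of_blinfun by simp

setup_lifting type_definition_endo

instantiation endo :: (euclidean_space) real_normed_algebra_1
begin

lift_definition zero_endo :: "'a endo" is 0 .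
lift_definition one_endo :: "'a endo" is id_blinfun .
lift_definition plus_endo :: "'a endo => 'a endo => 'a endo" is plus .
lift_definition minus_endo :: "'a endo => 'a endo => 'a endo" is minus .
lift_definition uminus_endo :: "'a endo => 'a endo" is uminus .
lift_definition times_endo :: "'a endo => 'a endo => 'a endo" is blinfun_compose .
lift_definition scaleR_endo :: "real => 'a endo => 'a endo" is scaleR .
lift_definition norm_endo :: "'a endo => real" is norm .
lift_definition dist_endo :: "'a endo => 'a endo => real" is dist .
lift_definition sgn_endo :: "'a endo => 'a endo" is sgn .
definition uniformity_endo :: "('a endo \<times> 'a endo) filter" where
 "uniformity_endo = (INF e\<in>{0<..}. principal {(x, y). dist x y < e})"
definition open_endo :: "'a endo set => bool" where
 "open_endo S = (\<forall>x\<in>S. \<forall>\<^sub>F (x', y) in uniformity. x' = x --> y \<in> S)"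

instance
proof
 fix a b c :: "'a endo" and r s :: real
 show "a + b + c = a + (b + c)" by transfer (rule add.assoc)
 show "a + b = b + a" by transfer (rule add.commute)
 show "0 + a = a" by transfer simp
 show "- a + a = 0" by transfer simp
 show "a - b = a + - b" by transfer simp
 show "r *\<^sub>R (a + b) = r *\<^sub>R a + r *\<^sub>R b" by transfer (rule scaleR_add_right)
 show "(r + s) *\<^sub>R a = r *\<^sub>R a + s *\<^sub>R a" by transfer (rule scaleR_add_left)
 show "r *\<^sub>R s *\<^sub>R a = (r * s) *\<^sub>R a" by transfer simp
 show "1 *\<^sub>R a = a" by transfer simp
 show "a * b * c = a * (b * c)" by (transfer, rule blinfun_eqI, simp)
 show "1 * a = a" "a * 1 = a" by (transfer, rule blinfun_eqI, simp)+
 show "(a + b) * c = a * c + b * c" "a * (b + c) = a * b + a * c"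
  by (transfer, rule blinfun_eqI, simp add: blinfun.bilinear_simps)+
 show "r *\<^sub>R a * b = r *\<^sub>R (a * b)" "a * r *\<^sub>R b = r *\<^sub>R (a * b)"
  by (transfer, rule blinfun_eqI, simp add: blinfun.bilinear_simps)+
 show "dist a b = norm (a - b)" by transfer (rule dist_norm)
 show "(norm a = 0) = (a = 0)" by transfer simp
 show "norm (a + b) <= norm a + norm b" by transfer (rule norm_triangle_ineq)
 show "norm (r *\<^sub>R a) = \<bar>r\<bar> * norm a" by transfer simp
 show "norm (a * b) <= norm a * norm b" by transfer (rule norm_blinfun_compose)
 show "norm (1::'a endo) = 1" by transfer simp
 show "(0::'a endo) ~= 1"
 proof
  assume "(0::'a endo) = 1"
  hence "norm (0::'a endo) = norm (1::'a endo)" by simp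
  thus False by (transfer) simp
 qed
 show "sgn a = inverse (norm a) *\<^sub>R a" by transfer (rule sgn_div_norm)
qed (simp_all add: uniformity_endo_def open_endo_def)

end

lift_definition app :: "'a::euclidean_space endo => 'a => 'a" (infixr \<open>\<cdot>\<close> 75) is blinfun_apply .

lemma endo_eqI: "(!!x. S \<cdot> x = T \<cdot> x) ==> S = T"
 by transfer (rule blinfun_eqI)

lemma bounded_bilinear_app: "bounded_bilinear (\<cdot>)"
proof
 fix S T :: "'a endo" and x y :: 'a and r :: real
 show "(S + T) \<cdot> x = S \<cdot> x + T \<cdot> x" "S \<cdot> (x + y) = S \<cdot> x + S \<cdot> y"
  "(r *\<^sub>R S) \<cdot> x = r *\<^sub>R S \<cdot> x" "S \<cdot> r *\<^sub>R x = r *\<^sub>R S \<cdot> x"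
  by (transfer, simp add: blinfun.bilinear_simps)+
 have "norm (S \<cdot> x) <= norm S * norm x * 1" for S :: "'a endo" and x
  by transfer (simp add: norm_blinfun)
 thus "\<exists>K. \<forall>(a::'a endo) b. norm (a \<cdot> b) <= norm a * norm b * K" by blast
qed

interpretation app: bounded_bilinear "(\<cdot>)"
 by (rule bounded_bilinear_app)

lemma app_mult [simp]: "(S * T) \<cdot> x = S \<cdot> T \<cdot> x"
 by transfer simp

lemma app_one [simp]: "1 \<cdot> x = x"
 by transfer simp

lemma norm_app: "norm (T \<cdot> x) <= norm T * norm x"
 by transfer (rule norm_blinfun)

lemma norm_endo_le: "0 <= c ==> (!!x. norm (T \<cdot> x) <= c * norm x) ==> norm T <= c"
 by transfer (rule norm_blinfun_bound)

lemma linear_app: "linear ((\<cdot>) T)"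
 by (simp add: app.bounded_linear_right bounded_linear.linear)

lemmas app_simps = app.add_left app.add_right app.diff_left app.diff_right app.minus_left app.minus_right
 app.zero_left app.zero_right app.scaleR_left app.scaleR_right

lift_definition endo :: "('a => 'a) => 'a::euclidean_space endo" is Blinfun .

lemma app_endo [simp]: "linear f ==> endo f \<cdot> x = f x"
 by transfer (simp add: bounded_linear_Blinfun_apply linear_linear)

lemma isometry_endo: "dist (blinfun_of_endo x) (blinfun_of_endo y) = dist x y"
 by transfer simp

instance endo :: (euclidean_space) banach
proof
 fix X :: "nat => 'a endo"
 assume "Cauchy X"
 hence "Cauchy (%n. blinfun_of_endo (X n))"
  by (simp add: Cauchy_def isometry_endo)
 then obtain L where "(%n. blinfun_of_endo (X n)) \<longlonglongrightarrow> L"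
  by (auto simp: Cauchy_convergent_iff convergent_def)
 hence "X \<longlonglongrightarrow> endo_of_blinfun L"
  by (auto simp: LIMSEQ_def simp flip: isometry_endo simp: endo_of_blinfun_inverse)
 thus "convergent X" by (auto simp: convergent_def)
qed

instance endo :: (euclidean_space) heine_borel
proof
 fix X :: "nat => 'a endo"
 assume "bounded (range X)"
 hence "bounded (range (%n. blinfun_of_endo (X n)))"
  unfolding bounded_def by (auto) (metis isometry_endo endo_of_blinfun_inverse UNIV_I)
 from bounded_imp_convergent_subsequence[OF this]
 obtain l r where "strict_mono (r::nat=>nat)" "((%n. blinfun_of_endo (X n)) \<circ> r) \<longlonglongrightarrow> l" by blast
 hence "(X \<circ> r) \<longlonglongrightarrow> endo_of_blinfun l"
  by (auto simp: LIMSEQ_def simp flip: isometry_endo simp: endo_of_blinfun_inverse)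
 thus "\<exists>l r. strict_mono (r::nat=>nat) \<and> (X \<circ> r) \<longlonglongrightarrow> l"
  using \<open>strict_mono r\<close> by blast
qed

text \<open>T is a combination of the matrix units \<open>?E b c\<close> with coefficients bounded
  by the norm of T, so the values of L on the matrix units bound L.\<close>

lemma bounded_linear_endo_dom:
 fixes L :: "'a::euclidean_space endo => 'b::real_normed_vector"
 assumes "linear L"
 shows "bounded_linear L"
proof -
 let ?E = "%b c. endo (%x::'a. (x \<bullet> b) *\<^sub>R c)"
 have l: "linear (%x::'a. (x \<bullet> b) *\<^sub>R c)" for b c
  by (intro linearI) (simp_all add: inner_add_left scaleR_add_left)
 have T: "T = (\<Sum>b\<in>Basis. \<Sum>c\<in>Basis. (T \<cdot> b \<bullet> c) *\<^sub>R ?E b c)" for T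
 proof (rule endo_eqI)
  fix x
  have "T \<cdot> x = (\<Sum>b\<in>Basis. (x \<bullet> b) *\<^sub>R T \<cdot> b)"
   by (metis (no_types, lifting) app.scaleR_right app.sum_right euclidean_representation sum.cong)
  also have "\<dots> = (\<Sum>b\<in>Basis. (x \<bullet> b) *\<^sub>R (\<Sum>c\<in>Basis. (T \<cdot> b \<bullet> c) *\<^sub>R c))"
   by (simp add: euclidean_representation)
  also have "\<dots> = (\<Sum>b\<in>Basis. \<Sum>c\<in>Basis. (T \<cdot> b \<bullet> c) *\<^sub>R ?E b c) \<cdot> x"
   by (simp add: app.sum_left app_simps l scaleR_sum_right mult.commute)
  finally show "T \<cdot> x = (\<Sum>b\<in>Basis. \<Sum>c\<in>Basis. (T \<cdot> b \<bullet> c) *\<^sub>R ?E b c) \<cdot> x" .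
 qed
 have "norm (L T) <= norm T * (\<Sum>b\<in>Basis. \<Sum>c\<in>Basis. norm (L (?E b c)))" for T
 proof -
  have "L T = (\<Sum>b\<in>Basis. \<Sum>c\<in>Basis. (T \<cdot> b \<bullet> c) *\<^sub>R L (?E b c))"
   by (subst T) (simp add: linear_sum[OF assms] linear_cmul[OF assms])
  also have "norm \<dots> <= (\<Sum>b\<in>Basis. \<Sum>c\<in>Basis. norm T * norm (L (?E b c)))"
  proof (intro sum_norm_le)
   fix b c :: 'a assume bc: "b \<in> Basis" "c \<in> Basis"
   have "\<bar>T \<cdot> b \<bullet> c\<bar> <= norm (T \<cdot> b)" using bc Basis_le_norm by blast
   also have "\<dots> <= norm T" using norm_app[of T b] bc by simp
   finally show "norm ((T \<cdot> b \<bullet> c) *\<^sub>R L (?E b c)) <= norm T * norm (L (?E b c))"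
    by (simp add: mult_right_mono)
  qed
  finally show ?thesis by (simp add: sum_distrib_left)
 qed
 thus ?thesis using assms
  by (intro bounded_linear_intro[where K="\<Sum>b\<in>Basis. \<Sum>c\<in>Basis. norm (L (?E b c))"])
    (auto simp: linear_add linear_cmul)
qed

section \<open>The exponential\<close>

lemma norm_power_diff:
 fixes S T :: "'a::real_normed_algebra_1"
 assumes "norm S <= r" "norm T <= r"
 shows "norm (S ^ Suc n - T ^ Suc n) <= real (Suc n) * r ^ n * norm (S - T)"
proof (induction n)
 case (Suc n)
 have r: "0 <= r" using assms norm_ge_zero order_trans by blast
 have "S ^ Suc (Suc n) - T ^ Suc (Suc n) = S * (S ^ Suc n - T ^ Suc n) + (S - T) * T ^ Suc n"
  by (simp add: algebra_simps)
 also have "norm \<dots> <= norm S * norm (S ^ Suc n - T ^ Suc n) + norm (S - T) * norm (T ^ Suc n)"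
  by (meson add_mono norm_mult_ineq norm_triangle_le)
 also have "\<dots> <= r * (real (Suc n) * r ^ n * norm (S - T)) + norm (S - T) * r ^ Suc n"
  using assms Suc r
  by (intro add_mono mult_mono order_trans[OF norm_power_ineq] power_mono) auto
 also have "\<dots> = real (Suc (Suc n)) * r ^ Suc n * norm (S - T)"
  by (simp add: algebra_simps)
 finally show ?case .
qed simp

text \<open>Termwise estimate: the powers of order n + 2 differ by at most
  \<open>(n + 2) * r ^ (n + 1) * norm (S - T)\<close>. Division by the factorial leaves the series
  of \<open>exp r\<close> without its constant term.\<close>

lemma exp_strict_derivative_bound:
 fixes S T :: "'a::{real_normed_algebra_1,banach}"
 assumes "norm S <= r" "norm T <= r"
 shows "norm (exp S - exp T - (S - T)) <= (exp r - 1) * norm (S - T)"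
proof -
 let ?f = "%n. (S ^ n /\<^sub>R fact n - T ^ n /\<^sub>R fact n)"
 have sm: "?f sums (exp S - exp T)"
  by (intro sums_diff exp_converges)
 hence "(%n. ?f (n + 2)) sums (exp S - exp T - (\<Sum>n<2. ?f n))"
  by (rule sums_split_initial_segment)
 hence s1: "(%n. ?f (n + 2)) sums (exp S - exp T - (S - T))"
  by (simp add: numeral_2_eq_2)
 have "(%n. r ^ n /\<^sub>R fact n) sums exp r" by (rule exp_converges)
 hence "(%n. r ^ (n+1) /\<^sub>R fact (n+1)) sums (exp r - (\<Sum>n<1. r ^ n /\<^sub>R fact n))"
  by (rule sums_split_initial_segment)
 hence s2: "(%n. r ^ (n+1) / fact (n+1) * norm (S - T)) sums ((exp r - 1) * norm (S - T))"
  by (intro sums_mult2) (simp add: divide_inverse mult.commute)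
 have bd: "norm (?f (n + 2)) <= r ^ (n+1) / fact (n+1) * norm (S - T)" for n
 proof -
  have "?f (n + 2) = (S ^ Suc (Suc n) - T ^ Suc (Suc n)) /\<^sub>R fact (n + 2)"
   by (simp add: scaleR_diff_right)
  also have "norm \<dots> = norm (S ^ Suc (Suc n) - T ^ Suc (Suc n)) / fact (n + 2)"
   by (simp add: divide_inverse mult.commute)
  also have "\<dots> <= (real (Suc (Suc n)) * r ^ Suc n * norm (S - T)) / fact (n + 2)"
   by (intro divide_right_mono norm_power_diff assms) simp
  also have "\<dots> = r ^ (n+1) / fact (n+1) * norm (S - T)"
   by (simp add: divide_simps)
  finally show ?thesis .
 qed
 have "norm (\<Sum>n. ?f (n + 2)) <= (\<Sum>n. r ^ (n+1) / fact (n+1) * norm (S - T))"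
  by (rule norm_suminf_le[OF bd sums_summable[OF s2]])
 thus ?thesis using sums_unique[OF s1] sums_unique[OF s2] by simp
qed

lemma exp_strict_derivative:
 fixes e :: real
 assumes "e > 0"
 obtains d where "d > 0" "!!S T :: 'a::{real_normed_algebra_1,banach}. norm S <= d ==> norm T <= d ==>
  norm (exp S - exp T - (S - T)) <= e * norm (S - T)"
proof
 show "ln (1 + e) > 0" using assms by simp
 show "norm (exp S - exp T - (S - T)) <= e * norm (S - T)"
  if "norm S <= ln (1 + e)" "norm T <= ln (1 + e)" for S T :: 'a
  using exp_strict_derivative_bound[OF that] assms by simp
qed

text \<open>Differentiability at 0 spreads to all t by the homomorphism property, and
  \<open>\<phi> t * exp (- t A)\<close> has derivative zero.\<close>

lemma exp_one_param_unique:
 fixes A :: "'a::{real_normed_algebra_1,banach}" and \<phi> :: "real => 'a"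
 assumes hom: "!!s t. \<phi> (s + t) = \<phi> s * \<phi> t" and one: "\<phi> 0 = 1"
  and der: "(\<phi> has_vector_derivative A) (at 0)"
 shows "\<phi> t = exp (t *\<^sub>R A)"
proof -
 have d: "(\<phi> has_vector_derivative \<phi> t * A) (at t)" for t
 proof -
  have "((%s. \<phi> (t + s)) has_vector_derivative \<phi> t * A) (at 0)"
   unfolding hom by (rule has_vector_derivative_mult_right[OF der])
  hence "((%s. \<phi> (t + s)) has_vector_derivative \<phi> t * A) (at (t - t))" by simp
  hence "(((%s. \<phi> (t + s)) \<circ> (%s. s - t)) has_vector_derivative 1 *\<^sub>R (\<phi> t * A)) (at t)"
   by (intro vector_diff_chain_at) (auto intro!: derivative_eq_intros)
  thus ?thesis by (simp add: o_def)
 qed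
 have e: "((%t. exp (t *\<^sub>R (-A))) has_vector_derivative (- A) * exp (t *\<^sub>R (-A))) (at t)" for t
  by (rule exp_scaleR_has_vector_derivative_left)
 have "((%t. \<phi> t * exp (t *\<^sub>R (-A))) has_vector_derivative
   (\<phi> t * ((- A) * exp (t *\<^sub>R (-A))) + (\<phi> t * A) * exp (t *\<^sub>R (-A)))) (at t)" for t
  by (rule has_vector_derivative_mult[OF d e])
 hence "((%t. \<phi> t * exp (t *\<^sub>R (-A))) has_vector_derivative 0) (at t)" for t
  by (simp add: algebra_simps)
 then obtain c where "!!t. \<phi> t * exp (t *\<^sub>R (-A)) = c"
  using has_vector_derivative_zero_constant[of UNIV "%t. \<phi> t * exp (t *\<^sub>R (-A))"]
  by (metis UNIV_I convex_UNIV has_vector_derivative_at_within)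
 hence "\<phi> t * exp (t *\<^sub>R (-A)) = \<phi> 0 * exp (0 *\<^sub>R (-A))" by metis
 hence "\<phi> t * exp (t *\<^sub>R (-A)) * exp (t *\<^sub>R A) = exp (t *\<^sub>R A)" by (simp add: one)
 moreover have "exp (t *\<^sub>R (-A)) * exp (t *\<^sub>R A) = 1"
  using exp_minus_inverse[of "t *\<^sub>R (-A)"] by simp
 ultimately show ?thesis by (simp add: mult.assoc)
qed

text \<open>An inverse function theorem at a point where the derivative is the identity. The map
  \<open>x - (f x - y)\<close> contracts by 1/2, so its fixed point lies within twice the initial
  error \<open>norm (y - f 0)\<close>.\<close>

lemma local_inverse_contraction:
 fixes f :: "'a::banach => 'a"
 assumes "d > 0"
  and lip: "!!S T. norm S <= d ==> norm T <= d ==> norm (f S - f T - (S - T)) <= norm (S - T) / 2"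
  and y: "norm (y - f 0) <= d / 2"
 shows "\<exists>x. norm x <= 2 * norm (y - f 0) \<and> f x = y"
proof -
 define \<rho> where "\<rho> = 2 * norm (y - f 0)"
 have rho: "0 <= \<rho>" "\<rho> <= d" using y by (auto simp: \<rho>_def)
 let ?g = "%x. x - (f x - y)"
 have "\<exists>!x. x \<in> cball 0 \<rho> \<and> ?g x = x"
 proof (rule Banach_fix)
  show "complete (cball (0::'a) \<rho>)" by (simp add: complete_eq_closed)
  show "cball (0::'a) \<rho> ~= {}" using rho by simp
  show "?g ` cball 0 \<rho> \<subseteq> cball 0 \<rho>"
  proof clarsimp
   fix x :: 'a assume x: "norm x <= \<rho>"
   have "norm (x - (f x - y)) = norm ((y - f 0) - (f x - f 0 - (x - 0)))" by (simp add: algebra_simps)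
   also have "\<dots> <= norm (y - f 0) + norm (f x - f 0 - (x - 0))" by (rule norm_triangle_ineq4)
   also have "\<dots> <= \<rho> / 2 + \<rho> / 2" using lip[of x 0] x rho assms(1) by (auto simp: \<rho>_def)
   finally show "norm (x - (f x - y)) <= \<rho>" by simp
  qed
  show "!!x y. x \<in> cball 0 \<rho> ==> y \<in> cball 0 \<rho> ==> dist (?g x) (?g y) <= 1/2 * dist x y"
  proof -
   fix a b :: 'a assume "a \<in> cball 0 \<rho>" "b \<in> cball 0 \<rho>"
   hence "norm (f a - f b - (a - b)) <= norm (a - b) / 2" using lip rho by simp
   thus "dist (?g a) (?g b) <= 1/2 * dist a b"
    by (simp add: dist_norm norm_minus_commute algebra_simps)
  qed
 qed auto
 thus ?thesis by (auto simp: \<rho>_def)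
qed

section \<open>Determinants of endomorphisms\<close>

text \<open>Matrices are indexed by finite types; turning the basis into such a type makes
  determinants available on an arbitrary Euclidean space.\<close>

typedef (overloaded) 'a::euclidean_space basis_index = "Basis :: 'a set"
 using nonempty_Basis by blast

instance basis_index :: (euclidean_space) finite
proof
 have "range (Rep_basis_index :: 'a basis_index => 'a) \<subseteq> Basis"
  using Rep_basis_index by blast
 thus "finite (UNIV :: 'a basis_index set)"
  by (meson Rep_basis_index_inject finite_Basis finite_imageD finite_subset injI)
qed

definition endo_matrix :: "'a::euclidean_space endo => real ^ 'a basis_index ^ 'a basis_index" where
 "endo_matrix T = (\<chi> i j. T \<cdot> Rep_basis_index j \<bullet> Rep_basis_index i)"

definition endo_det :: "'a::euclidean_space endo => real" where
 "endo_det T = det (endo_matrix T)"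

lemma sum_basis_index:
 "(\<Sum>i\<in>UNIV. f (Rep_basis_index (i :: 'a::euclidean_space basis_index))) = (\<Sum>b\<in>Basis. f b)"
proof -
 have "bij_betw (Rep_basis_index :: 'a basis_index => 'a) UNIV Basis"
  using type_definition.Rep_range[OF type_definition_basis_index]
  by (simp add: bij_betw_def Rep_basis_index_inject inj_on_def)
 thus ?thesis by (rule sum.reindex_bij_betw)
qed

lemma endo_det_one: "endo_det 1 = 1"
proof -
 have "endo_matrix (1 :: 'a endo) = mat 1"
  by (auto simp: endo_matrix_def mat_def vec_eq_iff inner_Basis Rep_basis_index Rep_basis_index_inject)
 thus ?thesis by (simp add: endo_det_def)
qed

lemma endo_det_eq_0:
 fixes T :: "'a::euclidean_space endo"
 assumes "T \<cdot> v = 0" "v ~= 0"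
 shows "endo_det T = 0"
proof (rule ccontr)
 let ?v = "(\<chi> i. v \<bullet> Rep_basis_index i) :: real ^ 'a basis_index"
 assume "endo_det T ~= 0"
 then obtain B where B: "B ** endo_matrix T = mat 1"
  by (auto simp: endo_det_def invertible_def simp flip: invertible_det_nz)
 have "endo_matrix T *v ?v = 0"
 proof (simp add: vec_eq_iff, intro allI)
  fix i :: "'a basis_index"
  have "(endo_matrix T *v ?v) $ i = (\<Sum>j\<in>UNIV. (T \<cdot> Rep_basis_index j \<bullet> Rep_basis_index i) * (v \<bullet> Rep_basis_index j))"
   by (simp add: matrix_vector_mult_def endo_matrix_def)
  also have "\<dots> = (\<Sum>b\<in>Basis. (T \<cdot> b \<bullet> Rep_basis_index i) * (v \<bullet> b))"
   by (rule sum_basis_index[of "%b. (T \<cdot> b \<bullet> Rep_basis_index i) * (v \<bullet> b)"])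
  also have "\<dots> = T \<cdot> (\<Sum>b\<in>Basis. (v \<bullet> b) *\<^sub>R b) \<bullet> Rep_basis_index i"
   by (simp add: app.sum_right app_simps inner_sum_left mult.commute)
  finally show "(endo_matrix T *v ?v) $ i = 0" using assms(1) by (simp add: euclidean_representation)
 qed
 hence "?v = 0" using B by (metis matrix_left_invertible_ker)
 hence "v \<bullet> b = 0" if "b \<in> Basis" for b
  using that by (metis Rep_basis_index_cases vec_lambda_beta zero_index)
 thus False using assms(2) euclidean_all_zero_iff by blast
qed

section \<open>Entire functions of a real variable\<close>

text \<open>A notion of analyticity closed under sums and products, hence under determinants, to
  which the identity theorem for holomorphic functions applies: vanishing on an interval around 0
  propagates to the whole line.\<close>

definition entire :: "(real => real) => bool" where
 "entire f \<longleftrightarrow> (\<exists>g. g holomorphic_on UNIV \<and> (\<forall>t. complex_of_real (f t) = g (complex_of_real t)))"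

lemma entire_const: "entire (%t. c)"
 unfolding entire_def by (rule exI[where x="%z. complex_of_real c"]) auto

lemma entire_mult:
 assumes "entire f" "entire g"
 shows "entire (%t. f t * g t)"
proof -
 obtain F H where "F holomorphic_on UNIV" "\<forall>t. complex_of_real (f t) = F (complex_of_real t)"
  "H holomorphic_on UNIV" "\<forall>t. complex_of_real (g t) = H (complex_of_real t)"
  using assms by (auto simp: entire_def)
 thus ?thesis unfolding entire_def
  by (intro exI[where x="%z. F z * H z"]) (auto intro!: holomorphic_intros)
qed

lemma entire_add:
 assumes "entire f" "entire g"
 shows "entire (%t. f t + g t)"
proof -
 obtain F H where "F holomorphic_on UNIV" "\<forall>t. complex_of_real (f t) = F (complex_of_real t)"
  "H holomorphic_on UNIV" "\<forall>t. complex_of_real (g t) = H (complex_of_real t)"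
  using assms by (auto simp: entire_def)
 thus ?thesis unfolding entire_def
  by (intro exI[where x="%z. F z + H z"]) (auto intro!: holomorphic_intros)
qed

lemma entire_sum: "(!!i. i \<in> I ==> entire (f i)) ==> entire (%t. \<Sum>i\<in>I. f i t)"
 by (induction I rule: infinite_finite_induct) (auto intro: entire_const entire_add)

lemma entire_prod: "(!!i. i \<in> I ==> entire (f i)) ==> entire (%t. \<Prod>i\<in>I. f i t)"
 by (induction I rule: infinite_finite_induct) (auto intro: entire_const entire_mult)

lemma entire_zero:
 assumes "entire f" "d > 0" "!!t. \<bar>t\<bar> < d ==> f t = 0"
 shows "f t = 0"
proof -
 obtain g where g: "g holomorphic_on UNIV" "!!t. complex_of_real (f t) = g (complex_of_real t)"
  using assms(1) by (auto simp: entire_def)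
 have "g (complex_of_real t) = 0"
 proof (rule analytic_continuation[OF g(1), where U="complex_of_real ` {-d<..<d}" and \<xi>=0])
  show "(0::complex) islimpt complex_of_real ` {-d<..<d}"
  proof (clarsimp simp: islimpt_approachable)
   fix e :: real assume "e > 0"
   thus "\<exists>x'\<in>{- d<..<d}. x' ~= 0 \<and> \<bar>x'\<bar> < e"
    using assms(2) by (intro bexI[where x="min e d / 2"]) auto
  qed
  show "g z = 0" if "z \<in> complex_of_real ` {-d<..<d}" for z
   using that g(2) assms(3) by (auto simp flip: g(2))
 qed auto
 thus ?thesis using g(2)[of t] by simp
qed

lemma entire_exp_entry: "entire (%t. exp (t *\<^sub>R A) \<cdot> x \<bullet> y)"
proof -
 let ?a = "%n. complex_of_real ((A ^ n /\<^sub>R fact n) \<cdot> x \<bullet> y)"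
 have bd: "norm (?a n * z ^ n) <= norm x * norm y * (norm A * norm z) ^ n /\<^sub>R fact n" for n z
 proof -
  have "\<bar>(A ^ n /\<^sub>R fact n) \<cdot> x \<bullet> y\<bar> <= norm ((A ^ n /\<^sub>R fact n) \<cdot> x) * norm y"
   by (rule Cauchy_Schwarz_ineq2)
  also have "\<dots> <= norm (A ^ n /\<^sub>R fact n) * norm x * norm y"
   by (intro mult_right_mono norm_app) auto
  also have "\<dots> <= (norm A ^ n / fact n) * norm x * norm y"
   by (intro mult_right_mono) (auto simp: divide_inverse norm_power_ineq mult.commute)
  finally have "\<bar>(A ^ n /\<^sub>R fact n) \<cdot> x \<bullet> y\<bar> * norm z ^ n <= (norm A ^ n / fact n) * norm x * norm y * norm z ^ n"
   by (rule mult_right_mono) simp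
  thus ?thesis by (simp add: norm_mult norm_power power_mult_distrib divide_inverse mult_ac)
 qed
 have sm: "summable (%n. ?a n * z ^ n)" for z
  by (rule summable_comparison_test'[OF _ bd])
    (use summable_mult[OF summable_exp_generic[of "norm A * norm z"], of "norm x * norm y"] in \<open>simp add: mult_ac\<close>)
 define g where "g z = (\<Sum>n. ?a n * z ^ n)" for z
 have ball: "g holomorphic_on ball 0 r" for r
  by (rule power_series_holomorphic[where a="?a"]) (use sm summable_sums in \<open>auto simp: g_def\<close>)
 have "g field_differentiable (at z)" for z
  using ball[of "norm z + 1"] by (intro holomorphic_on_imp_differentiable_at[where s="ball 0 (norm z + 1)"]) auto
 hence "g holomorphic_on UNIV"
  by (auto simp: holomorphic_on_def intro: field_differentiable_at_within)
 moreover have "complex_of_real (exp (t *\<^sub>R A) \<cdot> x \<bullet> y) = g (complex_of_real t)" for t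
 proof -
  have "(%n. (t *\<^sub>R A) ^ n /\<^sub>R fact n) sums exp (t *\<^sub>R A)" by (rule exp_converges)
  hence "(%n. ((t *\<^sub>R A) ^ n /\<^sub>R fact n) \<cdot> x \<bullet> y) sums (exp (t *\<^sub>R A) \<cdot> x \<bullet> y)"
   by (intro bounded_linear.sums[OF bounded_linear_inner_left] bounded_linear.sums[OF app.bounded_linear_left])
  hence "(%n. complex_of_real (((t *\<^sub>R A) ^ n /\<^sub>R fact n) \<cdot> x \<bullet> y)) sums complex_of_real (exp (t *\<^sub>R A) \<cdot> x \<bullet> y)"
   by (rule sums_of_real)
  moreover have "complex_of_real (((t *\<^sub>R A) ^ n /\<^sub>R fact n) \<cdot> x \<bullet> y) = ?a n * complex_of_real t ^ n" for n
   by (simp add: scaleR_power app_simps)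
  ultimately show ?thesis by (simp add: g_def sums_iff)
 qed
 ultimately show ?thesis unfolding entire_def by blast
qed

lemma entire_endo_det:
 fixes f :: "real => 'a::euclidean_space endo"
 assumes "!!x y. entire (%t. f t \<cdot> x \<bullet> y)"
 shows "entire (%t. endo_det (f t))"
 unfolding endo_det_def det_def endo_matrix_def
 by (simp, intro entire_sum entire_mult entire_const entire_prod assms)

lemma entire_sandwich: "entire (%t. (S * exp (t *\<^sub>R A) * R) \<cdot> x \<bullet> y)"
proof -
 have "(S * exp (t *\<^sub>R A) * R) \<cdot> x \<bullet> y = (\<Sum>b\<in>Basis. (exp (t *\<^sub>R A) \<cdot> (R \<cdot> x) \<bullet> b) * (S \<cdot> b \<bullet> y))" for t
 proof -
  let ?w = "exp (t *\<^sub>R A) \<cdot> (R \<cdot> x)"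
  have "(S * exp (t *\<^sub>R A) * R) \<cdot> x = S \<cdot> (\<Sum>b\<in>Basis. (?w \<bullet> b) *\<^sub>R b)"
   by (simp add: euclidean_representation)
  thus ?thesis by (simp add: app.sum_right app_simps inner_sum_left)
 qed
 thus ?thesis by (simp, intro entire_sum entire_mult entire_const entire_exp_entry)
qed

section \<open>Strict differentiability at the origin\<close>

text \<open>The strict derivative: both points vary near 0. In this form \<open>f\<close> minus its
  derivative is a contraction with small constant, as \<open>local_inverse_contraction\<close>
  requires.\<close>

definition strict_at_0 :: "('a::real_normed_vector => 'b::real_normed_vector) => ('a => 'b) => bool" where
 "strict_at_0 f D \<longleftrightarrow> (\<forall>\<epsilon>>0. \<exists>\<delta>>0. \<forall>X Y. norm X <= \<delta> --> norm Y <= \<delta> -->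
   norm (f X - f Y - D (X - Y)) <= \<epsilon> * norm (X - Y))"

lemma strict_at_0D: "strict_at_0 f D ==> e > 0 ==> \<exists>d>0. \<forall>X Y. norm X <= d --> norm Y <= d -->
  norm (f X - f Y - D (X - Y)) <= e * norm (X - Y)"
 by (simp add: strict_at_0_def)

lemma strict_at_0_compose:
 assumes f: "strict_at_0 f D" and L: "bounded_linear L"
 shows "strict_at_0 (%X. f (L X)) (%X. D (L X))"
 unfolding strict_at_0_def
proof (intro allI impI)
 fix e :: real assume e: "e > 0"
 obtain C where C: "C > 0" "!!X. norm (L X) <= norm X * C" using bounded_linear.pos_bounded[OF L] by blast
 obtain r where d: "r > 0" "!!S T. norm S <= r ==> norm T <= r ==> norm (f S - f T - D (S - T)) <= (e / C) * norm (S - T)"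
  using strict_at_0D[OF f divide_pos_pos[OF e C(1)]] by blast
 have "norm (f (L X) - f (L Y) - D (L (X - Y))) <= e * norm (X - Y)" if "norm X <= r / C" "norm Y <= r / C" for X Y
 proof -
  have "norm (L X) <= r" "norm (L Y) <= r" using that C(1) C(2)[of X] C(2)[of Y] by (simp_all add: pos_le_divide_eq)
  hence "norm (f (L X) - f (L Y) - D (L (X - Y))) <= (e / C) * norm (L (X - Y))"
   using d(2)[of "L X" "L Y"] by (simp add: linear_diff[OF bounded_linear.linear[OF L]])
  also have "\<dots> <= (e / C) * (norm (X - Y) * C)" using C e by (intro mult_left_mono) auto
  finally show ?thesis using C(1) by simp
 qed
 thus "\<exists>r>0. \<forall>X Y. norm X <= r --> norm Y <= r --> norm (f (L X) - f (L Y) - D (L (X - Y))) <= e * norm (X - Y)"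
  using d(1) C(1) by (intro exI[of _ "r / C"]) auto
qed

lemma strict_at_0_exp:
 fixes L :: "'a::real_normed_vector => 'b::{real_normed_algebra_1,banach}"
 assumes "bounded_linear L"
 shows "strict_at_0 (%X. exp (L X)) L"
proof -
 have "strict_at_0 (exp :: 'b => 'b) (%X. X)" unfolding strict_at_0_def by (metis exp_strict_derivative)
 from strict_at_0_compose[OF this assms] show ?thesis .
qed

lemma strict_at_0_lipschitz:
 assumes f: "strict_at_0 f D" and D: "bounded_linear D"
 obtains C e where "C > 0" "e > 0" "!!X Y. norm X <= e ==> norm Y <= e ==> norm (f X - f Y) <= C * norm (X - Y)"
proof -
 obtain C where C: "C > 0" "!!X. norm (D X) <= norm X * C" using bounded_linear.pos_bounded[OF D] by blast
 obtain e where d: "e > 0" "!!X Y. norm X <= e ==> norm Y <= e ==> norm (f X - f Y - D (X - Y)) <= 1 * norm (X - Y)"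
  using f zero_less_one unfolding strict_at_0_def by blast
 have "norm (f X - f Y) <= (1 + C) * norm (X - Y)" if XY: "norm X <= e" "norm Y <= e" for X Y
 proof -
  have "norm (f X - f Y) <= norm (f X - f Y - D (X - Y)) + norm (D (X - Y))"
   using norm_triangle_ineq[of "f X - f Y - D (X - Y)" "D (X - Y)"] by simp
  thus ?thesis using d(2)[OF XY] C(2)[of "X - Y"] by (simp add: algebra_simps)
 qed
 moreover have "1 + C > 0" using C(1) by simp
 ultimately show ?thesis using that d(1) by blast
qed

text \<open>Both factors equal 1 at 0, so up to the two derivative errors the difference of the
  products is a pair of mixed terms, each a Lipschitz difference times a factor that is small near
  0.\<close>

lemma strict_at_0_mult:
 fixes f g :: "'a::real_normed_vector => 'b::real_normed_algebra_1"
 assumes f: "strict_at_0 f D" "bounded_linear D" "f 0 = 1" and g: "strict_at_0 g D'" "bounded_linear D'" "g 0 = 1"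
 shows "strict_at_0 (%X. f X * g X) (%X. D X + D' X)"
 unfolding strict_at_0_def
proof (intro allI impI)
 fix e :: real assume e: "e > 0"
 obtain C d1 where 1: "C > 0" "d1 > 0" "!!X Y. norm X <= d1 ==> norm Y <= d1 ==> norm (f X - f Y) <= C * norm (X - Y)"
  using strict_at_0_lipschitz[OF f(1,2)] by blast
 obtain C' d2 where 2: "C' > 0" "d2 > 0" "!!X Y. norm X <= d2 ==> norm Y <= d2 ==> norm (g X - g Y) <= C' * norm (X - Y)"
  using strict_at_0_lipschitz[OF g(1,2)] by blast
 have e4: "e / 4 > 0" using e by simp
 obtain d3 where 3: "d3 > 0" "!!X Y. norm X <= d3 ==> norm Y <= d3 ==> norm (f X - f Y - D (X - Y)) <= (e / 4) * norm (X - Y)"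
  using f(1) e4 unfolding strict_at_0_def by blast
 obtain d4 where 4: "d4 > 0" "!!X Y. norm X <= d4 ==> norm Y <= d4 ==> norm (g X - g Y - D' (X - Y)) <= (e / 4) * norm (X - Y)"
  using g(1) e4 unfolding strict_at_0_def by blast
 \<comment> \<open>The last entry makes the two mixed terms, of size \<open>C * C' * r\<close>
   relative to \<open>norm (X - Y)\<close>, at most a quarter of \<open>e\<close> each.\<close>
 define r where "r = Min {d1, d2, d3, d4, e / (4 * (C * C'))}"
 have d: "r > 0" "r <= d1" "r <= d2" "r <= d3" "r <= d4" "r <= e / (4 * (C * C'))"
  using 1 2 3 4 e by (auto simp: r_def)
 have dC: "C * C' * r <= e / 4" using d(6) 1(1) 2(1) by (simp add: field_simps)
 have "norm (f X * g X - f Y * g Y - (D (X - Y) + D' (X - Y))) <= e * norm (X - Y)"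
  if X: "norm X <= r" and Y: "norm Y <= r" for X Y
 proof -
  let ?N = "norm (X - Y)"
  have eq: "f X * g X - f Y * g Y - (D (X - Y) + D' (X - Y)) =
   (f X - f Y - D (X - Y)) + (g X - g Y - D' (X - Y)) + (f X - f Y) * (g X - g 0) + (f Y - f 0) * (g X - g Y)"
   by (simp add: f(3) g(3) algebra_simps)
  have t1: "norm (f X - f Y - D (X - Y)) <= e / 4 * ?N" using 3(2) X Y d by simp
  have t2: "norm (g X - g Y - D' (X - Y)) <= e / 4 * ?N" using 4(2) X Y d by simp
  have t3: "norm ((f X - f Y) * (g X - g 0)) <= e / 4 * ?N"
  proof -
   have "norm (g X - g 0) <= C' * norm X" using 2(3)[of X 0] X d 2(2) by simp
   also have "\<dots> <= C' * r" using X 2(1) by simp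
   finally have "norm (f X - f Y) * norm (g X - g 0) <= (C * ?N) * (C' * r)"
    using 1(3)[of X Y] X Y d 1(1) by (intro mult_mono) auto
   also have "\<dots> = (C * C' * r) * ?N" by simp
   also have "\<dots> <= e / 4 * ?N" by (rule mult_right_mono[OF dC]) simp
   finally show ?thesis using norm_mult_ineq order_trans by blast
  qed
  have t4: "norm ((f Y - f 0) * (g X - g Y)) <= e / 4 * ?N"
  proof -
   have "norm (f Y - f 0) <= C * norm Y" using 1(3)[of Y 0] Y d 1(2) by simp
   also have "\<dots> <= C * r" using Y 1(1) by simp
   finally have "norm (f Y - f 0) * norm (g X - g Y) <= (C * r) * (C' * ?N)"
    using 2(3)[of X Y] X Y d 2(1) 1(1) by (intro mult_mono) auto
   also have "\<dots> = (C * C' * r) * ?N" by simp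
   also have "\<dots> <= e / 4 * ?N" by (rule mult_right_mono[OF dC]) simp
   finally show ?thesis using norm_mult_ineq order_trans by blast
  qed
  show ?thesis unfolding eq
   by (rule order_trans[OF norm_triangle_mono[OF norm_triangle_mono[OF norm_triangle_mono[OF t1 t2] t3] t4]]) simp
 qed
 thus "\<exists>r>0. \<forall>X Y. norm X <= r --> norm Y <= r --> norm (f X * g X - f Y * g Y - (D (X - Y) + D' (X - Y))) <= e * norm (X - Y)"
  using d(1) by blast
qed

section \<open>Linear algebra with respect to an inner product\<close>

lemma projection_along:
 fixes V W :: "'a::euclidean_space set"
 assumes V: "subspace V" and W: "subspace W" and int: "V \<inter> W = {0}"
  and sum: "!!x. \<exists>v\<in>V. \<exists>w\<in>W. x = v + w"
 obtains pr where "linear pr" "!!x. pr x \<in> V" "!!x. x - pr x \<in> W"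
  "!!x. x \<in> V ==> pr x = x" "!!x. x \<in> W ==> pr x = 0"
proof -
 have uniq: "v = v'" if "v \<in> V" "v' \<in> V" "x - v \<in> W" "x - v' \<in> W" for v v' x
 proof -
  have "v - v' \<in> V" using V that subspace_diff by blast
  moreover have "(x - v') - (x - v) \<in> W" by (rule subspace_diff[OF W that(4,3)])
  ultimately have "v - v' \<in> V \<inter> W" by simp
  thus ?thesis unfolding int by simp
 qed
 have "\<exists>v. v \<in> V \<and> x - v \<in> W" for x
 proof -
  obtain v w where "v \<in> V" "w \<in> W" "x = v + w" using sum[of x] by blast
  thus ?thesis by (intro exI[of _ v]) simp
 qed
 then obtain pr where pr: "!!x. pr x \<in> V" "!!x. x - pr x \<in> W" by metis
 have "linear pr"
 proof (rule linearI)
  fix x y :: 'a and r :: real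
  have "(x + y) - (pr x + pr y) = (x - pr x) + (y - pr y)" by simp
  thus "pr (x + y) = pr x + pr y"
   using uniq[of "pr (x + y)" "pr x + pr y" "x + y"] pr V W by (metis subspace_add)
  have "r *\<^sub>R x - r *\<^sub>R pr x = r *\<^sub>R (x - pr x)" by (simp add: scaleR_diff_right)
  thus "pr (r *\<^sub>R x) = r *\<^sub>R pr x"
   using uniq[of "pr (r *\<^sub>R x)" "r *\<^sub>R pr x" "r *\<^sub>R x"] pr V W by (metis subspace_scale)
 qed
 moreover have "pr x = x" if "x \<in> V" for x
  using uniq[of "pr x" x x] pr that W by (simp add: subspace_0)
 moreover have "pr x = 0" if "x \<in> W" for x
  using uniq[of "pr x" 0 x] pr that V by (simp add: subspace_0)
 ultimately show ?thesis using that pr by blast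
qed

text \<open>The Euclidean inner product of the coordinate space has no invariant meaning. Symmetry
  and orthogonality refer to a second form \<open>Q\<close>, so the spectral theorem is proved for
  an arbitrary one.\<close>

locale inner_form =
 fixes Q :: "'a::euclidean_space => 'a => real"
 assumes Q_linear: "linear (Q x)" and Q_sym: "Q x y = Q y x" and Q_pos: "x ~= 0 ==> Q x x > 0"
begin

lemma Q_simps:
 "Q (x + y) z = Q x z + Q y z" "Q z (x + y) = Q z x + Q z y"
 "Q (x - y) z = Q x z - Q y z" "Q z (x - y) = Q z x - Q z y"
 "Q (r *\<^sub>R x) z = r * Q x z" "Q z (r *\<^sub>R x) = r * Q z x"
 "Q (- x) z = - Q x z" "Q z (- x) = - Q z x" "Q 0 z = 0" "Q z 0 = 0"
proof -
 note r = linear_add[OF Q_linear] linear_diff[OF Q_linear] linear_cmul[OF Q_linear]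
  linear_neg[OF Q_linear] linear_0[OF Q_linear]
 show "Q z (x + y) = Q z x + Q z y" "Q z (x - y) = Q z x - Q z y" "Q z (r *\<^sub>R x) = r * Q z x"
  "Q z (- x) = - Q z x" "Q z 0 = 0" by (simp_all add: r)
 show "Q (x + y) z = Q x z + Q y z" "Q (x - y) z = Q x z - Q y z" "Q (r *\<^sub>R x) z = r * Q x z"
  "Q (- x) z = - Q x z" "Q 0 z = 0" by (simp_all add: r Q_sym[of _ z])
qed

lemma Q_sum: "Q (\<Sum>i\<in>I. f i) y = (\<Sum>i\<in>I. Q (f i) y)" "Q y (\<Sum>i\<in>I. f i) = (\<Sum>i\<in>I. Q y (f i))"
 by (induction I rule: infinite_finite_induct) (auto simp: Q_simps)

lemma bounded_bilinear_Q: "bounded_bilinear Q"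
proof -
 have "bilinear Q"
  unfolding bilinear_def by (auto intro!: linearI simp: Q_simps)
 thus ?thesis by (simp add: bilinear_conv_bounded_bilinear)
qed

lemma Q_nonneg: "Q x x \<ge> 0"
 using Q_pos[of x] by (cases "x = 0") (auto simp: Q_simps)

lemma Q_zero_iff [simp]: "Q x x = 0 \<longleftrightarrow> x = 0"
 using Q_pos[of x] by (cases "x = 0") (auto simp: Q_simps)

lemma Q_bounds:
 obtains c C where "c > 0" "C > 0" "!!x. c * (norm x)\<^sup>2 <= Q x x" "!!x. Q x x <= C * (norm x)\<^sup>2"
proof -
 interpret bq: bounded_bilinear Q by (rule bounded_bilinear_Q)
 obtain K where K: "K > 0" "!!a b. norm (Q a b) <= norm a * norm b * K"
  using bq.pos_bounded by blast
 have "continuous_on (sphere 0 1) (%x. Q x x)"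
  by (intro bq.continuous_on continuous_on_id)
 moreover obtain b :: 'a where "b \<in> Basis" using nonempty_Basis by blast
 hence "sphere (0::'a) 1 ~= {}" by (auto intro!: exI[of _ b])
 ultimately obtain u where u: "u \<in> sphere 0 1" "!!x. x \<in> sphere 0 1 ==> Q u u <= Q x x"
  using continuous_attains_inf[of "sphere (0::'a) 1" "%x. Q x x"] by auto
 have "Q u u * (norm x)\<^sup>2 <= Q x x" for x
 proof (cases "x = 0")
  case False
  hence "Q u u <= Q (x /\<^sub>R norm x) (x /\<^sub>R norm x)" by (intro u(2)) simp
  also have "\<dots> = Q x x / (norm x)\<^sup>2" by (simp add: Q_simps power2_eq_square divide_inverse)
  finally show ?thesis using False by (simp add: pos_le_divide_eq)
 qed (simp add: Q_simps)
 moreover have "Q u u > 0" using u(1) by (intro Q_pos) auto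
 moreover have "Q x x <= K * (norm x)\<^sup>2" for x
  using K(2)[of x x] by (auto simp: power2_eq_square mult.commute)
 ultimately show ?thesis using that K(1) by blast
qed

lemma orthogonal_decomposition:
 assumes V: "subspace V"
 obtains v r where "v \<in> V" "x = v + r" "!!y. y \<in> V ==> Q r y = 0"
proof -
 interpret bq: bounded_bilinear Q by (rule bounded_bilinear_Q)
 define J where "J y = (\<Sum>b\<in>Basis. Q b y *\<^sub>R b)" for y
 have J: "x \<bullet> J y = Q x y" for x y
 proof -
  have "x \<bullet> J y = (\<Sum>b\<in>Basis. (x \<bullet> b) * Q b y)"
   by (simp add: J_def inner_sum_right mult.commute)
  also have "\<dots> = Q (\<Sum>b\<in>Basis. (x \<bullet> b) *\<^sub>R b) y" by (simp add: Q_sum Q_simps)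
  finally show ?thesis by (simp add: euclidean_representation)
 qed
 have "linear J"
  by (rule linearI) (simp_all add: J_def Q_simps scaleR_add_left sum.distrib scaleR_sum_right)
 define W where "W = {r. \<forall>y\<in>J ` V. orthogonal y r}"
 have Weq: "W = {r. \<forall>y\<in>V. Q r y = 0}"
  by (auto simp: W_def orthogonal_def J inner_commute[of "J _"])
 have sW: "subspace W" unfolding Weq by (auto simp: subspace_def Q_simps)
 have "V \<inter> W = {0}"
 proof
  show "V \<inter> W \<subseteq> {0}" using Q_zero_iff by (auto simp: Weq)
 qed (use V sW in \<open>auto simp: subspace_0\<close>)
 moreover have "dim V + dim W = DIM('a)"
 proof -
  have "inj_on J V"
  proof (rule inj_onI)
   fix a b assume "J a = J b"
   hence "Q (a - b) a = Q (a - b) b" by (simp flip: J)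
   hence "Q (a - b) (a - b) = 0" by (simp add: Q_simps)
   thus "a = b" by simp
  qed
  hence "dim (J ` V) = dim V"
   using dim_image_eq[OF \<open>linear J\<close>, of V] V by (metis span_eq_iff)
  moreover have "subspace (J ` V)" using V \<open>linear J\<close> by (rule linear_subspace_image[rotated])
  ultimately show ?thesis
   using dim_subspace_orthogonal_to_vectors[of "J ` V" UNIV] by (auto simp: W_def add.commute)
 qed
 ultimately have "dim {x + y |x y. x \<in> V \<and> y \<in> W} = DIM('a)"
  using dim_sums_Int[OF V sW] by simp
 moreover have "subspace {x + y |x y. x \<in> V \<and> y \<in> W}" using V sW by (rule subspace_sums)
 ultimately have "{x + y |x y. x \<in> V \<and> y \<in> W} = UNIV"
  by (simp only: dim_eq_full span_eq_iff[THEN iffD2])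
 then obtain v r where "x = v + r" "v \<in> V" "r \<in> W" by blast
 thus ?thesis using that by (auto simp: Weq)
qed

text \<open>A maximizer u of the Rayleigh quotient on the unit sphere of V is an eigenvector. The
  form of \<open>l - S\<close> is positive semidefinite on V and zero at u, so its first variation
  at u vanishes, in particular along the defect \<open>w = l u - S u\<close>.\<close>

lemma symmetric_eigenvector:
 assumes S: "linear S" and sym: "!!x y. Q (S x) y = Q x (S y)"
  and V: "subspace V" "!!v. v \<in> V ==> S v \<in> V" "V ~= {0}"
 obtains l v where "v \<in> V" "v ~= 0" "S v = l *\<^sub>R v"
proof -
 interpret bq: bounded_bilinear Q by (rule bounded_bilinear_Q)
 let ?K = "{v \<in> V. Q v v = 1}"
 obtain c C where c: "c > 0" "!!x. c * (norm x)\<^sup>2 <= Q x x" by (rule Q_bounds) blast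
 have "closed ?K"
 proof -
  have "closed {v. Q v v = 1}"
   by (intro closed_Collect_eq bq.continuous_on continuous_on_id continuous_on_const)
  thus ?thesis using closed_subspace[OF V(1)] by (simp add: closed_Int Collect_conj_eq)
 qed
 moreover have "bounded ?K"
  unfolding bounded_iff
 proof (intro exI ballI)
  fix x assume "x \<in> ?K"
  hence "(norm x)\<^sup>2 <= 1 / c" using c(2)[of x] c(1) by (simp add: field_simps)
  thus "norm x <= sqrt (1 / c)" by (rule real_le_rsqrt)
 qed
 ultimately have "compact ?K" by (simp add: compact_eq_bounded_closed)
 moreover have "?K ~= {}"
 proof -
  obtain w where w: "w \<in> V" "w ~= 0" using V subspace_0 by blast
  hence "Q (w /\<^sub>R sqrt (Q w w)) (w /\<^sub>R sqrt (Q w w)) = 1"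
   using Q_pos[OF w(2)] by (simp add: Q_simps field_simps)
  thus ?thesis using V(1) w subspace_scale by blast
 qed
 moreover have "continuous_on ?K (%v. Q (S v) v)"
  by (intro bq.continuous_on linear_continuous_on continuous_on_id) (simp add: S linear_linear)
 ultimately obtain u where u: "u \<in> ?K" "!!v. v \<in> ?K ==> Q (S v) v <= Q (S u) u"
  using continuous_attains_sup[of ?K "%v. Q (S v) v"] by blast
 define l where "l = Q (S u) u"
 have semi: "Q (l *\<^sub>R v - S v) v \<ge> 0" if "v \<in> V" for v
 proof (cases "v = 0")
  case False
  let ?v = "v /\<^sub>R sqrt (Q v v)"
  have p: "Q v v > 0" by (rule Q_pos[OF False])
  have "?v \<in> ?K" using p that V(1) subspace_scale by (auto simp: Q_simps field_simps)
  hence "Q (S ?v) ?v <= l" unfolding l_def by (rule u(2))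
  hence "Q (S v) v / Q v v <= l" using p by (simp add: linear_cmul[OF S] Q_simps field_simps)
  thus ?thesis using p by (simp add: Q_simps field_simps)
 qed (simp add: Q_simps)
 define w where "w = l *\<^sub>R u - S u"
 have wV: "w \<in> V" and uV: "u \<in> V" using u(1) V by (auto simp: w_def subspace_diff subspace_scale)
 have wu: "Q w u = 0" using u(1) by (simp add: w_def Q_simps l_def)
 have key: "0 <= 2 * t * Q w w + t\<^sup>2 * Q (l *\<^sub>R w - S w) w" for t
 proof -
  have "0 <= Q (l *\<^sub>R (u + t *\<^sub>R w) - S (u + t *\<^sub>R w)) (u + t *\<^sub>R w)"
   using uV wV V(1) by (intro semi subspace_add subspace_scale)
  also have "l *\<^sub>R (u + t *\<^sub>R w) - S (u + t *\<^sub>R w) = w + t *\<^sub>R (l *\<^sub>R w - S w)"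
   by (simp add: w_def linear_add[OF S] linear_cmul[OF S] linear_diff[OF S] algebra_simps)
  also have "Q (w + t *\<^sub>R (l *\<^sub>R w - S w)) (u + t *\<^sub>R w) =
    Q w u + t * Q w w + t * Q (l *\<^sub>R w - S w) u + t * t * Q (l *\<^sub>R w - S w) w"
   by (simp add: Q_simps algebra_simps)
  also have "Q (l *\<^sub>R w - S w) u = Q w w"
  proof -
   have "Q (l *\<^sub>R w - S w) u = Q w (l *\<^sub>R u - S u)" by (simp add: Q_simps sym)
   thus ?thesis by (simp add: w_def)
  qed
  finally show ?thesis using wu by (simp add: power2_eq_square)
 qed
 have "Q w w = 0"
 proof (rule ccontr)
  assume "Q w w ~= 0"
  hence p: "Q w w > 0" using Q_nonneg[of w] by linarith
  define d where "d = Q (l *\<^sub>R w - S w) w"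
  have d: "d \<ge> 0" unfolding d_def by (rule semi[OF wV])
  \<comment> \<open>A negative t so small that the linear term of \<open>key\<close> outweighs the
    quadratic one; the added 1 covers \<open>d = 0\<close>.\<close>
  define t where "t = - Q w w / (d + 1)"
  have t: "t < 0" "t * d \<ge> - Q w w" using d p by (simp_all add: t_def field_simps)
  hence "t * (2 * Q w w + t * d) < 0" using p by (intro mult_neg_pos) auto
  hence "2 * t * Q w w + t\<^sup>2 * d < 0" by (simp add: power2_eq_square algebra_simps)
  thus False using key[of t] unfolding d_def by simp
 qed
 hence "S u = l *\<^sub>R u" by (simp add: w_def)
 moreover have "u ~= 0" using u(1) by (auto simp: Q_simps)
 ultimately show ?thesis using that uV by blast
qed

text \<open>Every nonzero invariant subspace contains a common eigenvector: if some operator is not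
  scalar on it, an eigenspace of that operator is smaller and still invariant. The complement of the
  span of all common eigenvectors is invariant, so it must be zero.\<close>

lemma commuting_symmetric_spectral:
 assumes S: "!!S. S \<in> F ==> linear S" "!!S x y. S \<in> F ==> Q (S x) y = Q x (S y)"
  and comm: "!!S T x. S \<in> F ==> T \<in> F ==> S (T x) = T (S x)"
 shows "span {v. \<forall>S\<in>F. \<exists>l. S v = l *\<^sub>R v} = UNIV"
proof -
 let ?E = "{v. \<forall>S\<in>F. \<exists>l. S v = l *\<^sub>R v}"
 have ex: "\<exists>v\<in>V. v ~= 0 \<and> v \<in> ?E" if "subspace V" "!!v S. S \<in> F ==> v \<in> V ==> S v \<in> V" "V ~= {0}" for V
  using that
 proof (induction "dim V" arbitrary: V rule: less_induct)
  case less
  show ?case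
  proof (cases "\<forall>S\<in>F. \<exists>l. \<forall>v\<in>V. S v = l *\<^sub>R v")
   case True
   thus ?thesis using less.prems subspace_0 by blast
  next
   case False
   then obtain S where SF: "S \<in> F" and nS: "!!l. \<exists>v\<in>V. S v ~= l *\<^sub>R v" by blast
   obtain l v where v: "v \<in> V" "v ~= 0" "S v = l *\<^sub>R v"
    using symmetric_eigenvector[OF S(1)[OF SF] S(2)[OF SF] less.prems(1)] less.prems SF by metis
   let ?W = "{w \<in> V. S w = l *\<^sub>R w}"
   have W: "subspace ?W"
    using less.prems(1)
    by (auto simp: subspace_def linear_add[OF S(1)[OF SF]] linear_cmul[OF S(1)[OF SF]] linear_0[OF S(1)[OF SF]] scaleR_add_right)
   have "?W \<subset> V" using nS[of l] by blast
   hence "dim ?W < dim V"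
    by (intro dim_psubset) (simp only: span_eq_iff[THEN iffD2, OF W] span_eq_iff[THEN iffD2, OF less.prems(1)])
   moreover have "T w \<in> ?W" if "T \<in> F" "w \<in> ?W" for w T
   proof -
    have "S (T w) = T (l *\<^sub>R w)" using that comm[OF SF that(1)] by simp
    thus ?thesis using that less.prems(2) by (simp add: linear_cmul[OF S(1)[OF that(1)]])
   qed
   moreover have "?W ~= {0}" using v by auto
   ultimately obtain w where "w \<in> ?W" "w ~= 0" "w \<in> ?E" using less.hyps[OF _ W] by blast
   thus ?thesis by blast
  qed
 qed
 define W where "W = {r. \<forall>y\<in>span ?E. Q r y = 0}"
 have sW: "subspace W" by (auto simp: subspace_def W_def Q_simps)
 have invE: "S v \<in> span ?E" if "S \<in> F" "v \<in> span ?E" for S v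
  using that(2)
 proof (induction rule: span_induct_alt)
  case base
  thus ?case by (simp add: linear_0[OF S(1)[OF that(1)]] span_zero)
 next
  case (step c x y)
  from step.hyps(1) that(1) obtain l where l: "S x = l *\<^sub>R x" by auto
  have "S (c *\<^sub>R x + y) = (c * l) *\<^sub>R x + S y"
   by (simp add: linear_add[OF S(1)[OF that(1)]] linear_cmul[OF S(1)[OF that(1)]] l)
  moreover have "(c * l) *\<^sub>R x + S y \<in> span ?E"
   by (rule span_add[OF span_scale[OF span_base[OF step.hyps(1)]] step.IH])
  ultimately show ?case by simp
 qed
 have "S r \<in> W" if "S \<in> F" "r \<in> W" for S r
  using that S(2)[OF that(1)] invE[OF that(1)] by (auto simp: W_def)
 hence "W = {0}"
 proof (rule_tac ccontr)
  assume "W ~= {0}" "!!S r. S \<in> F ==> r \<in> W ==> S r \<in> W"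
  then obtain v where v: "v \<in> W" "v ~= 0" "v \<in> ?E" using ex[OF sW] by blast
  hence "Q v v = 0" using span_base[of v ?E] unfolding W_def by blast
  thus False using v by simp
 qed
 have "x \<in> span ?E" for x
 proof -
  obtain v r where vr: "v \<in> span ?E" "x = v + r" "!!y. y \<in> span ?E ==> Q r y = 0"
   using orthogonal_decomposition[OF subspace_span[of ?E], of x] by blast
  hence "r \<in> W" unfolding W_def by blast
  thus ?thesis using \<open>W = {0}\<close> vr by simp
 qed
 thus ?thesis by blast
qed

lemma symmetric_spectral:
 assumes "linear S" "!!x y. Q (S x) y = Q x (S y)"
 shows "span (\<Union>l. {v. S v = l *\<^sub>R v}) = UNIV"
proof -
 have "{v. \<forall>T\<in>{S}. \<exists>l. T v = l *\<^sub>R v} = (\<Union>l. {v. S v = l *\<^sub>R v})" by auto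
 thus ?thesis using commuting_symmetric_spectral[of "{S}"] assms by auto
qed

end

section \<open>Exponentials and invariant subspaces\<close>

lemma exp_app_sums: "(%n. (S ^ n \<cdot> x) /\<^sub>R fact n) sums (exp S \<cdot> x)"
 using bounded_linear.sums[OF app.bounded_linear_left exp_converges[of S], of x] by (simp add: app_simps)

lemma exp_invariant:
 assumes V: "subspace V" and inv: "!!v. v \<in> V ==> S \<cdot> v \<in> V" and v: "v \<in> V"
 shows "exp S \<cdot> v \<in> V"
proof -
 have p: "S ^ n \<cdot> v \<in> V" for n
  by (induction n) (auto simp: v inv)
 have "(%n. \<Sum>i<n. (S ^ i \<cdot> v) /\<^sub>R fact i) \<longlonglongrightarrow> exp S \<cdot> v"
  using exp_app_sums[of S v] by (simp add: sums_def)
 moreover have "(\<Sum>i<n. (S ^ i \<cdot> v) /\<^sub>R fact i) \<in> V" for n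
  using p V by (intro subspace_sum subspace_scale)
 ultimately show ?thesis by (rule closed_sequentially[OF closed_subspace[OF V], rotated])
qed

text \<open>The relation is asked only on an invariant subspace V. This allows L to be a projection
  that intertwines S with a simpler S' on V but not globally, and so to read off one component of an
  exponential.\<close>

lemma exp_intertwine:
 assumes L: "linear L" and V: "subspace V" and inv: "!!v. v \<in> V ==> S \<cdot> v \<in> V"
  and tw: "!!v. v \<in> V ==> L (S \<cdot> v) = S' \<cdot> L v" and v: "v \<in> V"
 shows "L (exp S \<cdot> v) = exp S' \<cdot> L v"
proof -
 have p: "S ^ n \<cdot> v \<in> V \<and> L (S ^ n \<cdot> v) = S' ^ n \<cdot> L v" for n
  by (induction n) (auto simp: v inv tw)
 have "(%n. L ((S ^ n \<cdot> v) /\<^sub>R fact n)) sums L (exp S \<cdot> v)"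
  by (rule bounded_linear.sums[OF _ exp_app_sums]) (simp add: L linear_linear)
 hence "(%n. (S' ^ n \<cdot> L v) /\<^sub>R fact n) sums L (exp S \<cdot> v)"
  by (simp add: linear_cmul[OF L] p)
 thus ?thesis using exp_app_sums sums_unique2 by blast
qed

lemma exp_eigenvector:
 assumes "S \<cdot> v = l *\<^sub>R v"
 shows "exp S \<cdot> v = exp l *\<^sub>R v"
proof -
 have p: "S ^ n \<cdot> v = l ^ n *\<^sub>R v" for n
  by (induction n) (auto simp: assms app_simps)
 have "(%n. (l ^ n /\<^sub>R fact n) *\<^sub>R v) sums (exp l *\<^sub>R v)"
  by (rule bounded_linear.sums[OF bounded_linear_scaleR_left exp_converges])
 hence "(%n. (S ^ n \<cdot> v) /\<^sub>R fact n) sums (exp l *\<^sub>R v)"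
  by (simp add: p)
 thus ?thesis using exp_app_sums sums_unique2 by blast
qed

lemma (in inner_form) exp_adjoint:
 assumes "!!x y. Q (S \<cdot> x) y = Q x (S' \<cdot> y)"
 shows "Q (exp S \<cdot> x) y = Q x (exp S' \<cdot> y)"
proof -
 interpret bq: bounded_bilinear Q by (rule bounded_bilinear_Q)
 have p: "Q (S ^ n \<cdot> x) y = Q x (S' ^ n \<cdot> y)" for n
 proof (induction n arbitrary: x y)
  case (Suc n)
  have "S' ^ n \<cdot> S' \<cdot> y = S' \<cdot> S' ^ n \<cdot> y" by (metis app_mult power_commutes)
  thus ?case by (simp add: assms Suc)
 qed simp
 have "(%n. Q ((S ^ n \<cdot> x) /\<^sub>R fact n) y) sums Q (exp S \<cdot> x) y"
  by (rule bounded_linear.sums[OF bq.bounded_linear_left exp_app_sums])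
 moreover have "(%n. Q x ((S' ^ n \<cdot> y) /\<^sub>R fact n)) sums Q x (exp S' \<cdot> y)"
  by (rule bounded_linear.sums[OF bq.bounded_linear_right exp_app_sums])
 ultimately show ?thesis by (simp add: Q_simps p sums_iff)
qed

lemma exp_minus_app [simp]: "exp (- S) \<cdot> exp S \<cdot> x = x" "exp S \<cdot> exp (- S) \<cdot> x = x"
 using exp_minus_inverse[of S] exp_minus_inverse[of "-S"] by (metis app_mult app_one minus_minus)+

lemma exp_scaleR_add: "exp ((s + t) *\<^sub>R S) = exp (s *\<^sub>R S) * exp (t *\<^sub>R (S::'a::euclidean_space endo))"
 by (metis exp_add_commuting mult_scaleR_left mult_scaleR_right scaleR_add_left scaleR_scaleR mult.commute)

section \<open>Lie algebras with a Cartan decomposition\<close>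

definition endo_trace :: "'a::euclidean_space endo => real" where
 "endo_trace T = (\<Sum>b\<in>Basis. T \<cdot> b \<bullet> b)"

lemma linear_endo_trace: "linear endo_trace"
 by (rule linearI) (simp_all add: endo_trace_def app_simps inner_add_left sum.distrib sum_distrib_left)

lemmas endo_trace_simps = linear_add[OF linear_endo_trace] linear_diff[OF linear_endo_trace]
 linear_cmul[OF linear_endo_trace] linear_neg[OF linear_endo_trace]

lemma endo_trace_mult_commute: "endo_trace (S * T) = endo_trace (T * S)"
proof -
 have e: "endo_trace (S * T) = (\<Sum>b\<in>Basis. \<Sum>c\<in>Basis. (T \<cdot> b \<bullet> c) * (S \<cdot> c \<bullet> b))" for S T :: "'a endo"
  unfolding endo_trace_def
 proof (intro sum.cong refl)
  fix b :: 'a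
  have "(S * T) \<cdot> b = S \<cdot> (\<Sum>c\<in>Basis. (T \<cdot> b \<bullet> c) *\<^sub>R c)" by (simp add: euclidean_representation)
  thus "(S * T) \<cdot> b \<bullet> b = (\<Sum>c\<in>Basis. (T \<cdot> b \<bullet> c) * (S \<cdot> c \<bullet> b))"
   by (simp add: app.sum_right app_simps inner_sum_left)
 qed
 show ?thesis
  by (subst (1 2) e, subst sum.swap) (simp add: mult.commute)
qed

locale cartan_algebra =
 fixes br :: "'e::euclidean_space => 'e => 'e" and k p :: "'e set"
 assumes br_bilinear: "bilinear br"
  and leibniz: "br X (br Y Z) = br (br X Y) Z + br Y (br X Z)"
  and subspace_k: "subspace k" and subspace_p: "subspace p"
  and kp_int: "k \<inter> p = {0}" and kp_sum: "{X + Y | X Y. X \<in> k \<and> Y \<in> p} = UNIV"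
  and br_kk: "X \<in> k ==> Y \<in> k ==> br X Y \<in> k"
  and br_kp: "X \<in> k ==> Y \<in> p ==> br X Y \<in> p"
  and br_pp: "X \<in> p ==> Y \<in> p ==> br X Y \<in> k"
  and kil_neg: "X \<in> k ==> X ~= 0 ==> (\<Sum>b\<in>Basis. br X (br X b) \<bullet> b) < 0"
  and kil_pos: "X \<in> p ==> X ~= 0 ==> (\<Sum>b\<in>Basis. br X (br X b) \<bullet> b) > 0"
begin

definition ad :: "'e => 'e endo" where "ad X = endo (br X)"

lemma ad_app [simp]: "ad X \<cdot> Y = br X Y"
 using br_bilinear by (simp add: ad_def bilinear_def)

lemmas br_simps = bilinear_ladd[OF br_bilinear] bilinear_radd[OF br_bilinear] bilinear_lsub[OF br_bilinear]
 bilinear_rsub[OF br_bilinear] bilinear_lmul[OF br_bilinear] bilinear_rmul[OF br_bilinear]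
 bilinear_lneg[OF br_bilinear] bilinear_rneg[OF br_bilinear] bilinear_lzero[OF br_bilinear] bilinear_rzero[OF br_bilinear]

lemma linear_ad: "linear ad"
 by (rule linearI) (auto intro!: endo_eqI simp: br_simps app_simps)

lemmas ad_simps = linear_add[OF linear_ad] linear_diff[OF linear_ad] linear_cmul[OF linear_ad]
 linear_neg[OF linear_ad] linear_0[OF linear_ad]

lemma bounded_linear_ad: "bounded_linear ad"
 using linear_ad by (simp add: linear_linear)

lemma ad_br: "ad (br X Y) = ad X * ad Y - ad Y * ad X"
 by (rule endo_eqI) (simp add: app_simps leibniz[of X Y])

definition kil :: "'e => 'e => real" where "kil X Y = endo_trace (ad X * ad Y)"

lemma kil_eq: "kil X Y = (\<Sum>b\<in>Basis. br X (br Y b) \<bullet> b)"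
 by (simp add: kil_def endo_trace_def)

lemma kil_sym: "kil X Y = kil Y X"
 by (simp add: kil_def endo_trace_mult_commute)

lemma kil_simps:
 "kil (X + Y) Z = kil X Z + kil Y Z" "kil Z (X + Y) = kil Z X + kil Z Y"
 "kil (X - Y) Z = kil X Z - kil Y Z" "kil Z (X - Y) = kil Z X - kil Z Y"
 "kil (r *\<^sub>R X) Z = r * kil X Z" "kil Z (r *\<^sub>R X) = r * kil Z X"
 "kil (- X) Z = - kil X Z" "kil Z (- X) = - kil Z X" "kil 0 Z = 0" "kil Z 0 = 0"
 by (simp_all add: kil_def ad_simps endo_trace_simps algebra_simps linear_0[OF linear_endo_trace])

lemma kil_invariant: "kil (br X Y) Z = kil X (br Y Z)"
proof -
 have "endo_trace (ad Y * ad X * ad Z) = endo_trace (ad X * ad Z * ad Y)"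
  using endo_trace_mult_commute[of "ad Y" "ad X * ad Z"] by (simp add: mult.assoc)
 thus ?thesis
  by (simp add: kil_def ad_br algebra_simps endo_trace_simps)
qed

lemma kp_decomp: obtains X Y where "X \<in> k" "Y \<in> p" "Z = X + Y"
proof -
 have "Z \<in> {X + Y | X Y. X \<in> k \<and> Y \<in> p}" by (simp add: kp_sum)
 thus ?thesis using that by blast
qed

text \<open>Pairing Z = X + Y with X and with Y gives \<open>kil X X = kil Y Y\<close> by symmetry
  alone, before k and p are known to be orthogonal. The two sides have opposite signs.\<close>

lemma kil_nondegenerate:
 assumes "!!Y. kil Z Y = 0"
 shows "Z = 0"
proof -
 obtain X Y where XY: "X \<in> k" "Y \<in> p" "Z = X + Y" by (rule kp_decomp)
 have "kil X X + kil Y X = 0" "kil X Y + kil Y Y = 0"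
  using assms[of X] assms[of Y] XY by (simp_all add: kil_simps)
 hence eq: "kil X X = kil Y Y" using kil_sym[of X Y] by simp
 have "X = 0" using eq kil_neg[OF XY(1)] kil_pos[OF XY(2)] by (cases "Y = 0") (force simp: kil_eq br_simps)+
 moreover have "Y = 0" using eq kil_pos[OF XY(2)] \<open>X = 0\<close> by (auto simp: kil_eq br_simps)
 ultimately show ?thesis using XY by simp
qed

text \<open>Antisymmetry is not assumed: the Leibniz rule makes \<open>ad (br X X)\<close> the
  commutator of \<open>ad X\<close> with itself, and the Killing form is nondegenerate.\<close>

lemma br_self [simp]: "br X X = 0"
proof (rule kil_nondegenerate)
 fix Y
 have "kil (br X X) Y = endo_trace ((ad X * ad X - ad X * ad X) * ad Y)" by (simp add: kil_def ad_br)
 thus "kil (br X X) Y = 0" by (simp add: linear_0[OF linear_endo_trace])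
qed

lemma br_antisym: "br X Y = - br Y X"
proof -
 have "br (X + Y) (X + Y) = br X Y + br Y X" unfolding br_simps by simp
 hence "br X Y + br Y X = 0" by simp
 thus ?thesis by (simp add: eq_neg_iff_add_eq_0)
qed

lemma kil_invariant': "kil (br X Y) Z = - kil Y (br X Z)"
 using kil_invariant[of Y X Z] br_antisym[of X Y] by (simp add: kil_simps)

lemma ad_inj: "ad X = 0 ==> X = 0"
 by (rule kil_nondegenerate) (simp add: kil_def linear_0[OF linear_endo_trace])

definition kil_map :: "'e => 'e" where "kil_map X = (\<Sum>b\<in>Basis. kil X b *\<^sub>R b)"

lemma kil_map_inner: "kil_map X \<bullet> Y = kil X Y"
proof -
 have l: "linear (kil X)" by (rule linearI) (simp_all add: kil_simps)
 have "kil X Y = kil X (\<Sum>b\<in>Basis. (Y \<bullet> b) *\<^sub>R b)" by (simp add: euclidean_representation)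
 thus ?thesis
  by (simp add: kil_map_def inner_sum_left linear_sum[OF l] linear_cmul[OF l] inner_commute[of Y] mult.commute)
qed

lemma linear_kil_map: "linear kil_map"
 by (rule linearI) (simp_all add: kil_map_def kil_simps scaleR_add_left sum.distrib scaleR_sum_right)

lemma inj_kil_map: "inj kil_map"
proof (rule linear_injective_0[OF linear_kil_map, THEN iffD2], intro allI impI)
 fix X assume "kil_map X = 0"
 thus "X = 0" using kil_map_inner[of X] by (intro kil_nondegenerate) simp
qed

lemma endo_representation_exists:
 "\<exists>f. linear f \<and> (\<forall>T Y. kil (f T) Y = endo_trace (T * ad Y))"
proof -
 obtain g where g: "linear g" "g \<circ> kil_map = id" "kil_map \<circ> g = id"
  using linear_injective_isomorphism[OF linear_kil_map inj_kil_map]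
  by (metis (no_types, opaque_lifting) comp_def eq_id_iff)
 define t where "t T = (\<Sum>b\<in>Basis. endo_trace (T * ad b) *\<^sub>R b)" for T
 have t: "linear t"
  by (rule linearI) (simp_all add: t_def algebra_simps endo_trace_simps sum.distrib scaleR_sum_right)
 have "kil (g (t T)) Y = endo_trace (T * ad Y)" for T Y
 proof -
  have l: "linear (%Y. endo_trace (T * ad Y))"
   by (rule linearI) (simp_all add: ad_simps endo_trace_simps algebra_simps)
  have "kil (g (t T)) Y = t T \<bullet> Y" using g(3) by (metis comp_apply id_apply kil_map_inner)
  also have "\<dots> = (\<Sum>b\<in>Basis. (Y \<bullet> b) * endo_trace (T * ad b))"
   by (simp add: t_def inner_sum_left inner_commute[of Y] mult.commute)
  also have "\<dots> = endo_trace (T * ad (\<Sum>b\<in>Basis. (Y \<bullet> b) *\<^sub>R b))"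
   using linear_sum[OF l, of "%b. (Y \<bullet> b) *\<^sub>R b" Basis] linear_cmul[OF l] by simp
  finally show ?thesis by (simp add: euclidean_representation)
 qed
 thus ?thesis using linear_compose[OF t g(1)] by (intro exI[of _ "g \<circ> t"]) simp
qed

text \<open>A left inverse of \<open>ad\<close> on all endomorphisms: the functional that pairs T
  with \<open>ad Y\<close> under the trace, represented by the Killing form. Its kernel is a
  complement of the inner derivations, on which the local analysis of automorphisms is
  based.\<close>

definition killing_part :: "'e endo => 'e" where
 "killing_part = (SOME f. linear f \<and> (\<forall>T Y. kil (f T) Y = endo_trace (T * ad Y)))"

lemma linear_killing_part: "linear killing_part"
 and kil_killing_part: "kil (killing_part T) Y = endo_trace (T * ad Y)"
 using someI_ex[OF endo_representation_exists] by (auto simp: killing_part_def)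

lemma killing_part_ad [simp]: "killing_part (ad X) = X"
proof -
 have "killing_part (ad X) - X = 0"
  by (rule kil_nondegenerate) (simp only: kil_simps kil_killing_part, simp add: kil_def)
 thus ?thesis by simp
qed

text \<open>After subtracting the inner part, the remaining derivation \<open>?E\<close> has trace
  zero against every \<open>ad Y\<close>. Since \<open>ad (?E \<cdot> X)\<close> is the commutator
  of \<open>?E\<close> with \<open>ad X\<close>, cyclicity of the trace makes
  \<open>?E \<cdot> X\<close> Killing-orthogonal to everything.\<close>

lemma derivation_inner:
 assumes D: "!!X Y. D \<cdot> br X Y = br (D \<cdot> X) Y + br X (D \<cdot> Y)"
 shows "D = ad (killing_part D)"
proof -
 let ?E = "D - ad (killing_part D)"
 have E: "?E * ad X - ad X * ?E = ad (?E \<cdot> X)" for X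
  by (rule endo_eqI) (simp add: app_simps br_simps D leibniz[of _ X] algebra_simps)
 have tr: "endo_trace (?E * ad Y) = 0" for Y
  using kil_killing_part[of D Y] by (simp add: algebra_simps endo_trace_simps kil_def)
 have "?E \<cdot> X = 0" for X
 proof (rule kil_nondegenerate)
  fix Y
  have "kil (?E \<cdot> X) Y = endo_trace (?E * ad X * ad Y) - endo_trace (ad X * (?E * ad Y))"
   by (simp only: kil_def E[symmetric] left_diff_distrib endo_trace_simps mult.assoc)
  also have "\<dots> = endo_trace (?E * ad (br X Y))"
   by (subst endo_trace_mult_commute[of "ad X"]) (simp only: ad_br right_diff_distrib endo_trace_simps mult.assoc)
  finally show "kil (?E \<cdot> X) Y = 0" by (simp add: tr)
 qed
 hence "?E = 0" by (intro endo_eqI) (simp only: app.zero_left)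
 thus ?thesis by simp
qed

definition aut :: "'e endo => bool" where
 "aut T \<longleftrightarrow> (\<forall>X Y. T \<cdot> br X Y = br (T \<cdot> X) (T \<cdot> Y)) \<and> (\<exists>S. S * T = 1 \<and> T * S = 1)"

lemma aut_br: "aut T ==> T \<cdot> br X Y = br (T \<cdot> X) (T \<cdot> Y)"
 by (simp add: aut_def)

lemma aut_ad: "aut T ==> T * ad X = ad (T \<cdot> X) * T"
 by (rule endo_eqI) (simp add: aut_br)

lemma aut_mult: "aut S ==> aut T ==> aut (S * T)"
proof -
 assume S: "aut S" and T: "aut T"
 obtain S' T' where "S' * S = 1" "S * S' = 1" "T' * T = 1" "T * T' = 1"
  using S T by (auto simp: aut_def)
 hence "(T' * S') * (S * T) = 1" "(S * T) * (T' * S') = 1"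
  by (metis mult.assoc mult.right_neutral)+
 thus "aut (S * T)" using S T by (auto simp: aut_def)
qed

lemma aut_inverse:
 assumes "aut T" "S * T = 1" "T * S = 1"
 shows "aut S"
proof -
 have i: "S \<cdot> T \<cdot> X = X" "T \<cdot> S \<cdot> X = X" for X
  using assms(2,3) by (metis app_mult app_one)+
 have "S \<cdot> br X Y = br (S \<cdot> X) (S \<cdot> Y)" for X Y
  using aut_br[OF assms(1), of "S \<cdot> X" "S \<cdot> Y"] i by metis
 thus ?thesis using assms by (auto simp: aut_def)
qed

lemma aut_kil:
 assumes "aut T"
 shows "kil (T \<cdot> X) (T \<cdot> Y) = kil X Y"
proof -
 obtain S where S: "S * T = 1" "T * S = 1" using assms by (auto simp: aut_def)
 have a: "ad (T \<cdot> X) = T * ad X * S" for X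
  using aut_ad[OF assms, of X] S by (metis mult.assoc mult.right_neutral)
 have "kil (T \<cdot> X) (T \<cdot> Y) = endo_trace (T * (ad X * (S * T) * ad Y * S))"
  by (simp add: kil_def a mult.assoc)
 also have "\<dots> = endo_trace (ad X * ad Y * (S * T))"
  by (subst endo_trace_mult_commute) (simp add: S mult.assoc)
 finally show ?thesis by (simp add: S kil_def)
qed

text \<open>For a derivation, \<open>ad (D \<cdot> W)\<close> is the commutator of D and
  \<open>ad W\<close>. Hence conjugating \<open>ad (exp (t D) \<cdot> Y)\<close> back by
  \<open>exp (t D)\<close> gives a path with zero derivative.\<close>

lemma aut_exp:
 assumes D: "!!X Y. D \<cdot> br X Y = br (D \<cdot> X) Y + br X (D \<cdot> Y)"
 shows "aut (exp D)"
proof -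
 have "exp D \<cdot> br Y Z = br (exp D \<cdot> Y) (exp D \<cdot> Z)" for Y Z
 proof -
  let ?M = "%t. ad (exp (t *\<^sub>R D) \<cdot> Y)"
  let ?f = "%t. exp (t *\<^sub>R (- D)) * (?M t * exp (t *\<^sub>R D))"
  have dM: "(?M has_vector_derivative ad (D \<cdot> exp (t *\<^sub>R D) \<cdot> Y)) (at t)" for t
   using bounded_linear.has_vector_derivative[OF bounded_linear_compose[OF bounded_linear_ad app.bounded_linear_left]
     exp_scaleR_has_vector_derivative_left[of D t], of Y] by simp
  have M: "ad (D \<cdot> W) = D * ad W - ad W * D" for W
   by (rule endo_eqI) (simp add: D app_simps)
  have "(?f has_vector_derivative exp (t *\<^sub>R (- D)) * (?M t * (D * exp (t *\<^sub>R D)) + ad (D \<cdot> exp (t *\<^sub>R D) \<cdot> Y) * exp (t *\<^sub>R D))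
    + (exp (t *\<^sub>R (- D)) * (- D)) * (?M t * exp (t *\<^sub>R D))) (at t)" for t
   by (intro has_vector_derivative_mult exp_scaleR_has_vector_derivative_left exp_scaleR_has_vector_derivative_right dM)
  hence "(?f has_vector_derivative 0) (at t)" for t
   by (simp add: M algebra_simps)
  then obtain c where "!!t. ?f t = c"
   using has_vector_derivative_zero_constant[of UNIV ?f]
   by (metis UNIV_I convex_UNIV has_vector_derivative_at_within)
  hence "?f 1 = ?f 0" by metis
  hence "exp (- D) * (ad (exp D \<cdot> Y) * exp D) = ad Y" by simp
  hence "exp (- D) \<cdot> br (exp D \<cdot> Y) (exp D \<cdot> Z) = br Y Z"
   by (metis ad_app app_mult)
  thus ?thesis by (metis exp_minus_app(2))
 qed
 thus ?thesis unfolding aut_def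
  using exp_minus_inverse[of D] exp_minus_inverse[of "- D"] by auto
qed

lemma aut_exp_ad: "aut (exp (ad X))"
 by (rule aut_exp) (simp add: leibniz[of X])

lemma ad_bound: obtains C where "C > 0" "!!X. norm (ad X) <= C * norm X"
 using bounded_linear.pos_bounded[OF bounded_linear_ad] by (metis mult.commute)

text \<open>The automorphism equation for \<open>1 + v\<close> says that
  \<open>ad (v \<cdot> X)\<close> is the commutator of v with \<open>ad X\<close> up to the
  quadratic term \<open>ad (v \<cdot> X) * v\<close>. Traced against any \<open>ad Y\<close> the
  commutator vanishes because \<open>killing_part v = 0\<close>, so \<open>v \<cdot> X\<close> is
  bounded by a small multiple of itself.\<close>

lemma small_aut:
 obtains c where "c > 0" "!!v. killing_part v = 0 ==> aut (1 + v) ==> norm v < c ==> v = 0"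
proof -
 obtain Ca where Ca: "Ca > 0" "!!X. norm (ad X) <= Ca * norm X" using ad_bound by blast
 obtain Ct where Ct: "Ct > 0" "!!T :: 'e endo. norm (endo_trace T) <= norm T * Ct"
  using bounded_linear.pos_bounded[OF bounded_linear_endo_dom[OF linear_endo_trace]] by blast
 obtain B where B: "B > 0" "!!X. B * norm X <= norm (kil_map X)"
  using linear_inj_bounded_below_pos[OF linear_kil_map inj_kil_map] by blast
 let ?C = "Ct * Ca * Ca"
 have "v = 0" if v: "killing_part v = 0" "aut (1 + v)" "norm v < B / ?C" for v
 proof (rule endo_eqI)
  fix X
  let ?Z = "v \<cdot> X"
  have eq: "ad ?Z = v * ad X - ad X * v - ad ?Z * v"
   using aut_ad[OF v(2), of X] by (simp add: algebra_simps app_simps ad_simps)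
  have k: "kil ?Z Y = - endo_trace (ad ?Z * v * ad Y)" for Y
  proof -
   have "kil ?Z Y = endo_trace ((v * ad X - ad X * v - ad ?Z * v) * ad Y)"
    unfolding kil_def using eq by simp
   also have "\<dots> = endo_trace (v * ad X * ad Y) - endo_trace (ad X * (v * ad Y)) - endo_trace (ad ?Z * v * ad Y)"
    by (simp only: left_diff_distrib endo_trace_simps mult.assoc)
   also have "endo_trace (v * ad X * ad Y) - endo_trace (ad X * (v * ad Y)) = endo_trace (v * ad (br X Y))"
    by (subst endo_trace_mult_commute[of "ad X"]) (simp only: ad_br right_diff_distrib endo_trace_simps mult.assoc)
   also have "\<dots> = 0" using kil_killing_part[of v "br X Y"] v(1) by (simp add: kil_simps)
   finally show ?thesis by simp
  qed
  have "(norm (kil_map ?Z))\<^sup>2 = kil ?Z (kil_map ?Z)"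
   by (simp add: dot_square_norm flip: kil_map_inner)
  also have "\<dots> <= norm (ad ?Z * v * ad (kil_map ?Z)) * Ct"
   using Ct(2)[of "ad ?Z * v * ad (kil_map ?Z)"] unfolding k by (simp add: abs_le_iff)
  also have "\<dots> <= (norm (ad ?Z) * norm v * norm (ad (kil_map ?Z))) * Ct"
   using Ct(1) norm_mult_ineq[of "ad ?Z * v" "ad (kil_map ?Z)"] norm_mult_ineq[of "ad ?Z" v]
   by (intro mult_right_mono) (auto intro: order_trans[OF _ mult_right_mono])
  also have "\<dots> <= ((Ca * norm ?Z) * norm v * (Ca * norm (kil_map ?Z))) * Ct"
   using Ca Ct(1) by (intro mult_right_mono mult_mono) auto
  finally have "norm (kil_map ?Z) * norm (kil_map ?Z) <= (?C * norm v * norm ?Z) * norm (kil_map ?Z)"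
   by (simp add: power2_eq_square mult_ac)
  hence "norm (kil_map ?Z) <= ?C * norm v * norm ?Z"
   using Ca(1) Ct(1) by (cases "kil_map ?Z = 0") auto
  hence "B * norm ?Z <= ?C * norm v * norm ?Z" using B(2)[of ?Z] by linarith
  moreover have "?C * norm v < B" using v(3) Ca Ct by (simp add: field_simps)
  ultimately have "norm ?Z = 0"
   by (metis mult_right_le_imp_le norm_ge_zero not_less order_le_less)
  thus "v \<cdot> X = 0 \<cdot> X" by (simp add: app_simps)
 qed
 moreover have "B / ?C > 0" using B Ca Ct by simp
 ultimately show ?thesis using that by blast
qed

text \<open>Completed by the factor \<open>1 + V T\<close> in the complementary direction, f becomes
  a map F with derivative the identity, so an automorphism near 1 is some \<open>F S\<close>.
  Cancelling the automorphism \<open>f (killing_part S)\<close> leaves the automorphism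
  \<open>1 + V S\<close>, which \<open>small_aut\<close> forces to be 1. The lemma serves for the
  base chart, for \<open>exp (ad X)\<close> and for products of two exponentials.\<close>

lemma ad_local_parametrization:
 assumes f0: "f 0 = 1" and strict: "strict_at_0 f ad"
  and autf: "\<exists>e>0. \<forall>X. norm X <= e --> aut (f X)" and r: "r > 0"
 obtains s where "s > 0" "!!T. aut T ==> norm (T - 1) < s ==> \<exists>X. norm X < r \<and> f X = T"
proof -
 note blk = bounded_linear_endo_dom[OF linear_killing_part]
 obtain Cp where Cp: "Cp > 0" "!!T. norm (killing_part T) <= norm T * Cp"
  using bounded_linear.pos_bounded[OF blk] by blast
 define V where "V T = T - ad (killing_part T)" for T
 note kp_simps = linear_add[OF linear_killing_part] linear_diff[OF linear_killing_part] linear_0[OF linear_killing_part]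
 have blV: "bounded_linear V" unfolding V_def by (intro bounded_linear_intros bounded_linear_compose[OF bounded_linear_ad blk])
 obtain Cv where Cv: "Cv > 0" "!!T. norm (V T) <= norm T * Cv"
  using bounded_linear.pos_bounded[OF blV] by blast
 obtain e2 where d2: "e2 > 0" "!!X. norm X <= e2 ==> aut (f X)" using autf by blast
 obtain c where c: "c > 0" "!!v. killing_part v = 0 ==> aut (1 + v) ==> norm v < c ==> v = 0" using small_aut by blast
 define F where "F T = f (killing_part T) * (1 + V T)" for T
 have V0: "V 0 = 0" by (simp add: V_def kp_simps ad_simps)
 hence F0: "F 0 = 1" by (simp add: F_def kp_simps f0)
 have sV: "strict_at_0 (%T. 1 + V T) V"
  unfolding strict_at_0_def by (auto simp: linear_diff[OF bounded_linear.linear[OF blV]] intro: exI[of _ 1])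
 have "strict_at_0 F (%T. ad (killing_part T) + V T)" unfolding F_def
  by (rule strict_at_0_mult[OF strict_at_0_compose[OF strict blk] bounded_linear_compose[OF bounded_linear_ad blk] _ sV blV])
   (simp_all add: kp_simps f0 V0)
 from strict_at_0D[OF this, of "1/2"]
 obtain e where d: "e > 0" and Flip: "!!S T. norm S <= e ==> norm T <= e ==> norm (F S - F T - (S - T)) <= norm (S - T) / 2"
  by (auto simp: V_def)
 \<comment> \<open>The contraction finds a preimage S of norm below \<open>2 * s\<close>;
   \<open>Cp\<close> and \<open>Cv\<close> then bound its two components.\<close>
 define s where "s = min (e / 2) (min (e2 / (2 * Cp)) (min (r / (2 * Cp)) (c / (2 * Cv))))"
 have s: "s > 0" "s <= e / 2" "2 * s * Cp <= e2" "2 * s * Cp <= r" "2 * s * Cv <= c"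
 proof -
  show "s > 0" "s <= e / 2" using d d2 r c Cp Cv by (simp_all add: s_def)
  have "s <= e2 / (2 * Cp)" "s <= r / (2 * Cp)" "s <= c / (2 * Cv)" by (simp_all add: s_def)
  thus "2 * s * Cp <= e2" "2 * s * Cp <= r" "2 * s * Cv <= c"
   using Cp(1) Cv(1) by (simp_all add: pos_le_divide_eq mult_ac)
 qed
 have "\<exists>X. norm X < r \<and> f X = T" if T: "aut T" "norm (T - 1) < s" for T
 proof -
  obtain S where S: "norm S <= 2 * norm (T - F 0)" "F S = T"
   using local_inverse_contraction[of e F T] d Flip T(2) s(2) F0 by auto
  have nS: "norm S < 2 * s" using S T by (simp add: F0)
  have nk: "norm (killing_part S) < 2 * s * Cp" using Cp nS by (smt (verit) mult_strict_right_mono)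
  have af: "aut (f (killing_part S))" using nk s(3) by (intro d2) simp
  obtain R where R: "R * f (killing_part S) = 1" "f (killing_part S) * R = 1" using af by (auto simp: aut_def)
  have "aut (R * T)" using aut_mult aut_inverse[OF af R] T(1) by blast
  moreover have "R * T = 1 + V S"
   using S(2) R(1) unfolding F_def by (metis mult.assoc mult_1)
  moreover have "killing_part (V S) = 0" by (simp add: V_def kp_simps)
  moreover have "norm (V S) < c" using Cv nS s(5) by (smt (verit) mult_strict_right_mono)
  ultimately have "V S = 0" using c(2) by metis
  thus ?thesis using S(2) nk s(4) by (intro exI[of _ "killing_part S"]) (simp add: F_def)
 qed
 thus ?thesis using that s(1) by blast
qed

section \<open>The Cartan involution\<close>

definition k_part :: "'e => 'e" where
 "k_part = (SOME f. linear f \<and> (\<forall>x. f x \<in> k \<and> x - f x \<in> p) \<and> (\<forall>x\<in>k. f x = x) \<and> (\<forall>x\<in>p. f x = 0))"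

lemma k_part: "linear k_part" "k_part X \<in> k" "X - k_part X \<in> p" "X \<in> k ==> k_part X = X" "X \<in> p ==> k_part X = 0"
proof -
 have "\<exists>f. linear f \<and> (\<forall>x. f x \<in> k \<and> x - f x \<in> p) \<and> (\<forall>x\<in>k. f x = x) \<and> (\<forall>x\<in>p. f x = 0)"
  by (rule projection_along[OF subspace_k subspace_p kp_int]) (metis kp_decomp, blast)
 from someI_ex[OF this] show "linear k_part" "k_part X \<in> k" "X - k_part X \<in> p" "X \<in> k ==> k_part X = X"
  "X \<in> p ==> k_part X = 0"
  unfolding k_part_def by auto
qed

definition \<theta> :: "'e => 'e" where "\<theta> X = 2 *\<^sub>R k_part X - X"

lemma linear_theta: "linear \<theta>"
 by (rule linearI) (simp_all add: \<theta>_def linear_add[OF k_part(1)] linear_cmul[OF k_part(1)] algebra_simps)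

lemmas theta_simps = linear_add[OF linear_theta] linear_diff[OF linear_theta] linear_cmul[OF linear_theta] linear_neg[OF linear_theta]
 linear_0[OF linear_theta]

lemma theta_k: "X \<in> k ==> \<theta> X = X" and theta_p: "X \<in> p ==> \<theta> X = - X"
 using k_part(4,5)[of X] by (simp_all add: \<theta>_def algebra_simps scaleR_2)

lemma theta_theta [simp]: "\<theta> (\<theta> X) = X"
 by (rule kp_decomp[of X]) (simp add: theta_simps theta_k theta_p)

lemma theta_fixed: "\<theta> X = X ==> X \<in> k" and theta_neg: "\<theta> X = - X ==> X \<in> p"
proof -
 show "X \<in> k" if "\<theta> X = X"
 proof -
  have "2 *\<^sub>R X = 2 *\<^sub>R k_part X" using that by (simp add: \<theta>_def algebra_simps scaleR_2)
  hence "X = k_part X" by simp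
  thus ?thesis using k_part(2)[of X] by simp
 qed
 show "X \<in> p" if "\<theta> X = - X"
 proof -
  have "k_part X = 0" using that by (simp add: \<theta>_def)
  thus ?thesis using k_part(3)[of X] by simp
 qed
qed

lemma br_pk: "X \<in> p ==> Y \<in> k ==> br X Y \<in> p"
 using br_kp[of Y X] br_antisym[of X Y] subspace_p subspace_neg by simp

lemma theta_br: "\<theta> (br X Y) = br (\<theta> X) (\<theta> Y)"
proof -
 obtain X1 X2 where X: "X1 \<in> k" "X2 \<in> p" "X = X1 + X2" by (rule kp_decomp)
 obtain Y1 Y2 where Y: "Y1 \<in> k" "Y2 \<in> p" "Y = Y1 + Y2" by (rule kp_decomp)
 have "\<theta> (br X1 Y1) = br X1 Y1" "\<theta> (br X2 Y2) = br X2 Y2" "\<theta> (br X1 Y2) = - br X1 Y2" "\<theta> (br X2 Y1) = - br X2 Y1"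
  using X Y by (auto intro: theta_k theta_p br_kk br_pp br_kp br_pk)
 thus ?thesis using X Y by (simp add: br_simps theta_simps theta_k theta_p)
qed

lemma aut_theta: "aut (endo \<theta>)"
 unfolding aut_def
proof (intro conjI exI[of _ "endo \<theta>"])
 show "endo \<theta> * endo \<theta> = 1" "endo \<theta> * endo \<theta> = 1" by (rule endo_eqI, simp add: linear_theta)+
qed (simp add: linear_theta theta_br)

lemma kil_theta: "kil (\<theta> X) (\<theta> Y) = kil X Y"
 using aut_kil[OF aut_theta] by (simp add: linear_theta)

lemma kil_kp: "X \<in> k ==> Y \<in> p ==> kil X Y = 0"
 using kil_theta[of X Y] by (simp add: theta_k theta_p kil_simps)

text \<open>The standard inner product of a Cartan involution. For it \<open>ad X\<close> is
  symmetric when X lies in p and skew when X lies in k; the energy is measured in it.\<close>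

definition Q :: "'e => 'e => real" where "Q X Y = - kil X (\<theta> Y)"

sublocale inner_form Q
proof (rule inner_form.intro)
 show "linear (Q X)" for X by (rule linearI) (simp_all add: Q_def theta_simps kil_simps)
 show "Q X Y = Q Y X" for X Y
  using kil_theta[of X "\<theta> Y"] by (simp add: Q_def kil_sym)
 show "Q X X > 0" if "X ~= 0" for X
 proof -
  obtain Y Z where Y: "Y \<in> k" "Z \<in> p" "X = Y + Z" by (rule kp_decomp)
  have "Q X X = - kil Y Y + kil Z Z"
   using kil_kp[OF Y(1,2)] kil_sym[of Z Y] Y by (simp add: Q_def theta_simps theta_k theta_p kil_simps)
  thus ?thesis using kil_neg[OF Y(1)] kil_pos[OF Y(2)] that Y(3)
   by (cases "Y = 0"; cases "Z = 0") (auto simp: kil_eq br_simps)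
 qed
qed

lemma Q_br: "Q (br X Y) Z = - Q Y (br (\<theta> X) Z)"
 using kil_invariant'[of X Y "\<theta> Z"] theta_br[of "\<theta> X" Z] by (simp add: Q_def)

lemma Q_br_p: "X \<in> p ==> Q (br X Y) Z = Q Y (br X Z)"
 by (simp add: Q_br theta_p br_simps Q_simps)

lemma Q_br_k: "X \<in> k ==> Q (br X Y) Z = - Q Y (br X Z)"
 by (simp add: Q_br theta_k)

lemma Q_p: "X \<in> p ==> Q X Y = kil X Y" "Y \<in> p ==> Q X Y = kil X Y"
proof -
 show "Y \<in> p ==> Q X Y = kil X Y" for X Y by (simp add: Q_def theta_p kil_simps)
 thus "X \<in> p ==> Q X Y = kil X Y" using Q_sym kil_sym by metis
qed

lemma Q_exp_k:
 assumes "X \<in> k"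
 shows "Q (exp (ad X) \<cdot> Y) (exp (ad X) \<cdot> Z) = Q Y Z"
 using exp_adjoint[of "ad X" "- ad X" Y "exp (ad X) \<cdot> Z"]
 by (simp add: Q_br_k[OF assms] app_simps Q_simps)

lemma Q_exp_p:
 assumes "X \<in> p"
 shows "Q (exp (ad X) \<cdot> Y) Z = Q Y (exp (ad X) \<cdot> Z)"
 by (rule exp_adjoint) (simp add: Q_br_p[OF assms])

end

section \<open>Uniform differentiability on balls and smoothness of integral curves\<close>

text \<open>On a small ball the finitely many partial derivatives stay within
  \<open>\<epsilon> / n\<close> of those at x, so \<open>f - D\<close> has derivative of norm at
  most \<epsilon>; the mean value inequality does the rest.\<close>

lemma Ck_on_strict_derivative:
 fixes f :: "'a::euclidean_space => 'b::real_normed_vector"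
 assumes S: "open S" and f: "Ck_on 1 S f" and x: "x \<in> S" and D: "(f has_derivative D) (at x)" and e: "\<epsilon> > 0"
 obtains r where "r > 0" "cball x r \<subseteq> S"
  "!!y z. y \<in> cball x r ==> z \<in> cball x r ==> norm (f y - f z - D (y - z)) <= \<epsilon> * norm (y - z)"
proof -
 define D' where "D' y = frechet_derivative f (at y)" for y
 have D': "(f has_derivative D' y) (at y)" if "y \<in> S" for y
  using f that by (simp add: D'_def frechet_derivative_works)
 have cont: "continuous_on S (%y. D' y b)" for b
  using f by (simp add: D'_def)
 have Dx: "D = D' x" using has_derivative_unique[OF D D'[OF x]] .
 define n where "n = real DIM('a)"
 have n: "n > 0" by (simp add: n_def)
 have "\<forall>b\<in>Basis. \<exists>d>0. \<forall>y. dist y x < d --> y \<in> S \<and> norm (D' y b - D b) < \<epsilon> / n"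
 proof
  fix b :: 'a
  have "isCont (%y. D' y b) x" using cont S x continuous_on_eq_continuous_at by blast
  then obtain d1 where d1: "d1 > 0" "!!y. dist y x < d1 ==> dist (D' y b) (D' x b) < \<epsilon> / n"
   using e n unfolding continuous_at_eps_delta by (metis zero_less_divide_iff)
  obtain d2 where d2: "d2 > 0" "!!y. dist y x < d2 ==> y \<in> S" using S x open_dist by blast
  show "\<exists>d>0. \<forall>y. dist y x < d --> y \<in> S \<and> norm (D' y b - D b) < \<epsilon> / n"
   using d1 d2 by (intro exI[of _ "min d1 d2"]) (auto simp: Dx dist_norm)
 qed
 then obtain d where d: "!!b. b \<in> Basis ==> d b > 0"
  "!!b y. b \<in> Basis ==> dist y x < d b ==> y \<in> S \<and> norm (D' y b - D b) < \<epsilon> / n" by metis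
 define r where "r = Min (d ` Basis) / 2"
 have dl: "r > 0" "!!b. b \<in> Basis ==> r < d b"
 proof -
  have "Min (d ` Basis) > 0" using d(1) by (subst Min_gr_iff) auto
  thus "r > 0" by (simp add: r_def)
  fix b :: 'a assume "b \<in> Basis"
  hence "Min (d ` Basis) <= d b" by simp
  thus "r < d b" using \<open>Min (d ` Basis) > 0\<close> unfolding r_def by linarith
 qed
 have close: "y \<in> S \<and> norm (D' y b - D b) <= \<epsilon> / n" if "y \<in> cball x r" "b \<in> Basis" for y b
  using d(2)[of b y] dl(2)[of b] that by (force simp: dist_commute)
 obtain b0 :: 'a where b0: "b0 \<in> Basis" using nonempty_Basis by blast
 have sub: "cball x r \<subseteq> S" using close b0 by blast
 have lin: "linear (D' y)" if "y \<in> S" for y using D'[OF that] has_derivative_linear by blast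
 have bl: "bounded_linear D" using D has_derivative_bounded_linear by blast
 have on: "onorm (%v. D' y v - D v) <= \<epsilon>" if y: "y \<in> cball x r" for y
 proof (rule onorm_le)
  fix v :: 'a
  have yS: "y \<in> S" using y sub by blast
  have l: "linear (%v. D' y v - D v)"
   using lin[OF yS] bl by (intro linear_compose_sub) (auto simp: bounded_linear.linear)
  have "D' y v - D v = (\<Sum>b\<in>Basis. (v \<bullet> b) *\<^sub>R (D' y b - D b))"
   using linear_sum[OF l, of "%b. (v \<bullet> b) *\<^sub>R b" Basis] linear_cmul[OF l] by (simp add: euclidean_representation)
  also have "norm \<dots> <= (\<Sum>b\<in>(Basis::'a set). norm v * (\<epsilon> / n))"
  proof (intro sum_norm_le)
   fix b :: 'a assume b: "b \<in> Basis"
   show "norm ((v \<bullet> b) *\<^sub>R (D' y b - D b)) <= norm v * (\<epsilon> / n)"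
    unfolding norm_scaleR using close[OF y b] b Basis_le_norm[OF b, of v] by (intro mult_mono) auto
  qed
  also have "\<dots> = \<epsilon> * norm v" using n by (simp add: n_def)
  finally show "norm (D' y v - D v) <= \<epsilon> * norm v" .
 qed
 have "norm (f y - f z - D (y - z)) <= \<epsilon> * norm (y - z)" if yz: "y \<in> cball x r" "z \<in> cball x r" for y z
 proof -
  have "norm ((f y - D y) - (f z - D z)) <= \<epsilon> * norm (y - z)"
  proof (rule differentiable_bound[of "cball x r" "%y. f y - D y" "%y v. D' y v - D v"])
   show "((%y. f y - D y) has_derivative (%v. D' w v - D v)) (at w within cball x r)" if "w \<in> cball x r" for w
    using that sub
    by (intro has_derivative_diff[OF has_derivative_at_withinI[OF D'] bounded_linear_imp_has_derivative[OF bl]]) auto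
   show "onorm (%v. D' w v - D v) <= \<epsilon>" if "w \<in> cball x r" for w by (rule on[OF that])
  qed (use yz in simp_all)
  thus ?thesis by (simp add: linear_diff[OF bounded_linear.linear[OF bl]] algebra_simps)
 qed
 thus ?thesis using that dl(1) sub by blast
qed

text \<open>Bootstrapping: once u is k times differentiable, so is its derivative
  \<open>V (u t)\<close>.\<close>

lemma Ck_on_ode:
 fixes u :: "real => 'a::euclidean_space"
 assumes J: "open J" and O: "open \<Omega>" and u: "!!t. t \<in> J ==> u t \<in> \<Omega> \<and> (u has_vector_derivative V (u t)) (at t)"
  and V: "!!k. Ck_on k \<Omega> V"
 shows "Ck_on k J u"
proof (induction k)
 case 0
 have "isCont u t" if "t \<in> J" for t
  using u[OF that] has_vector_derivative_continuous by blast
 thus ?case by (simp add: continuous_at_imp_continuous_on)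
next
 case (Suc k)
 show ?case
 proof (rule Ck_on_SucI[OF J, where f'="%t v. v *\<^sub>R V (u t)"])
  show "(u has_derivative (%v. v *\<^sub>R V (u t))) (at t)" if "t \<in> J" for t
   using u[OF that] by (simp add: has_vector_derivative_def)
  have "Ck_on k J (%t. V (u t))"
   by (rule Ck_on_compose[OF J O _ Suc V]) (use u in auto)
  thus "Ck_on k J (%t. v *\<^sub>R V (u t))" for v
   by (rule Ck_on_bounded_linear[OF bounded_linear_scaleR_right J])
 qed
qed

section \<open>The adjoint representation\<close>

context lie_grp
begin

abbreviation "\<phi> \<equiv> base_coord G"
abbreviation "\<iota> \<equiv> chart_inv (base_chart G)"
abbreviation "\<Omega> \<equiv> snd (base_chart G) ` fst (base_chart G)"
abbreviation "u0 \<equiv> base_coord G \<one>"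

lemma iota_u0 [simp]: "\<iota> u0 = \<one>"
 using base_chart by simp

lemma u0_in [simp]: "u0 \<in> \<Omega>"
 using base_chart by blast

lemma open_Omega [simp]: "open \<Omega>"
 using base_chart chart_facts(2) by blast

lemma iota_carrier: "u \<in> \<Omega> ==> \<iota> u \<in> carrier G"
 using base_chart(1) chart_inv_in chart_sub_carrier by blast

text \<open>Differentiation in the second variable at one point costs one order and stays smooth in
  the first. This yields the smoothness of \<open>Ad\<close> in a chart and of left-invariant vector
  fields.\<close>

lemma partial_derivative:
 fixes F :: "'a::euclidean_space \<times> 'b::euclidean_space => 'g"
 assumes S: "open S" and T: "open T" and F: "Ck_map (Suc k) (S \<times> T) F" and d: "d \<in> atlas G" and v: "v \<in> T"
  and Fd: "!!w. w \<in> S ==> F (w, v) \<in> fst d"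
 shows "Ck_on k S (%w. frechet_derivative (%v. snd d (F (w, v))) (at v) Y)"
  and "w \<in> S ==> ((%v. snd d (F (w, v))) has_derivative frechet_derivative (%v. snd d (F (w, v))) (at v)) (at v)"
proof -
 let ?f = "%x. snd d (F x)"
 let ?W = "{x \<in> S \<times> T. F x \<in> fst d}"
 have W: "open ?W"
  using F open_Times[OF S T] chart_facts(1)[OF d] by (intro open_preimage) (auto simp: Ck_map_def)
 have f: "Ck_on (Suc k) ?W ?f" using F d by (auto simp: Ck_map_def)
 have vW: "(w, v) \<in> ?W" if "w \<in> S" for w using that v Fd by auto
 have der: "((%v. snd d (F (w, v))) has_derivative (%h. frechet_derivative ?f (at (w, v)) (0, h))) (at v)" if "w \<in> S" for w
 proof -
  have "((%v. (w, v)) has_derivative (%h. (0, h))) (at v)" by (auto intro!: derivative_eq_intros)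
  moreover have "(?f has_derivative frechet_derivative ?f (at (w, v))) (at (w, v))"
   by (rule Ck_on_has_derivative[OF f vW[OF that]])
  ultimately show ?thesis using diff_chain_at[of "%v. (w, v)" "%h. (0, h)" v ?f] by (simp add: o_def)
 qed
 have eq: "frechet_derivative (%v. snd d (F (w, v))) (at v) = (%h. frechet_derivative ?f (at (w, v)) (0, h))" if "w \<in> S" for w
  using frechet_derivative_at[OF der[OF that]] by simp
 show "w \<in> S ==> ((%v. snd d (F (w, v))) has_derivative frechet_derivative (%v. snd d (F (w, v))) (at v)) (at v)"
  using der eq by simp
 have "Ck_on k S (%w. frechet_derivative ?f (at (w, v)) (0, Y))"
 proof (rule Ck_on_compose[OF S W, of "%w. (w, v)" k "%x. frechet_derivative ?f (at x) (0, Y)"])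
  show "(%w. (w, v)) ` S \<subseteq> ?W" using vW by blast
  show "Ck_on k S (%w. (w, v))"
   by (intro Ck_on_Pair S Ck_on_const Ck_on_linear[of "%w. w"] bounded_linear_ident)
  show "Ck_on k ?W (%x. frechet_derivative ?f (at x) (0, Y))" using f by simp
 qed
 thus "Ck_on k S (%w. frechet_derivative (%v. snd d (F (w, v))) (at v) Y)"
  by (rule Ck_on_cong[OF S, THEN iffD1, rotated]) (simp add: eq)
qed

lemma Ck_map_iota: "Ck_map k \<Omega> \<iota>"
 by (rule Ck_map_chart_inv[OF base_chart(1)])

lemma Ck_map_fst_iota:
 assumes "c \<in> atlas G" "open (S :: 'b::euclidean_space set)"
 shows "Ck_map k (snd c ` fst c \<times> S) (%x. chart_inv c (fst x))"
 by (rule Ck_map_compose[OF chart_facts(2)[OF assms(1)] _ _ _ Ck_map_chart_inv[OF assms(1)]])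
   (auto intro!: open_Times chart_facts(2) Ck_on_linear bounded_linear_fst assms)

lemma Ck_map_snd_iota:
 assumes "c \<in> atlas G" "open (S :: 'b::euclidean_space set)"
 shows "Ck_map k (S \<times> snd c ` fst c) (%x. chart_inv c (snd x))"
 by (rule Ck_map_compose[OF chart_facts(2)[OF assms(1)] _ _ _ Ck_map_chart_inv[OF assms(1)]])
   (auto intro!: open_Times chart_facts(2) Ck_on_linear bounded_linear_snd assms)

lemma conj_has_derivative:
 assumes g: "g \<in> carrier G"
 shows "((%u. \<phi> (g \<otimes> \<iota> u \<otimes> inv g)) has_derivative Ad G g) (at u0)"
proof -
 have "Ck_map 1 \<Omega> (%u. g \<otimes> \<iota> u \<otimes> inv g)"
  using g by (intro Ck_map_mult Ck_map_const Ck_map_iota) auto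
 hence "Ck_on (Suc 0) {u \<in> \<Omega>. g \<otimes> \<iota> u \<otimes> inv g \<in> fst (base_chart G)} (%u. \<phi> (g \<otimes> \<iota> u \<otimes> inv g))"
  using base_chart(1) by (simp add: Ck_map_def del: Ck_on.simps)
 moreover have "u0 \<in> {u \<in> \<Omega>. g \<otimes> \<iota> u \<otimes> inv g \<in> fst (base_chart G)}"
  using g base_chart(2) by simp
 ultimately have "((%u. \<phi> (g \<otimes> \<iota> u \<otimes> inv g)) has_derivative frechet_derivative (%u. \<phi> (g \<otimes> \<iota> u \<otimes> inv g)) (at u0)) (at u0)"
  by (rule Ck_on_has_derivative)
 thus ?thesis by (simp add: Ad_def[abs_def] eta_contract_eq)
qed

lemma linear_Ad: "g \<in> carrier G ==> linear (Ad G g)"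
 using conj_has_derivative has_derivative_linear by blast

definition AdE :: "'g => 'e endo" where "AdE g = endo (Ad G g)"

lemma AdE_app [simp]: "g \<in> carrier G ==> AdE g \<cdot> X = Ad G g X"
 by (simp add: AdE_def linear_Ad)

lemma Ad_one: "Ad G \<one> X = X"
proof -
 have "((%u. \<phi> (\<one> \<otimes> \<iota> u \<otimes> inv \<one>)) has_derivative (%X. X)) (at u0)"
  by (rule has_derivative_transform_within_open[OF has_derivative_ident open_Omega u0_in])
    (simp add: iota_carrier)
 thus ?thesis using has_derivative_unique[OF conj_has_derivative[OF one_closed]] by metis
qed

lemma open_near_identity:
 assumes "continuous_map (top_of_set \<Omega>) (topo G) f" "f u0 = \<one>"
 obtains S where "open S" "u0 \<in> S" "S \<subseteq> \<Omega>" "!!u. u \<in> S ==> f u \<in> fst (base_chart G)"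
proof
 show "open {u \<in> \<Omega>. f u \<in> fst (base_chart G)}"
  by (intro open_preimage open_Omega assms chart_facts base_chart)
qed (use assms base_chart in auto)

lemma conj_near_identity:
 assumes "h \<in> carrier G"
 obtains S where "open S" "u0 \<in> S" "S \<subseteq> \<Omega>" "!!u. u \<in> S ==> h \<otimes> \<iota> u \<otimes> inv h \<in> fst (base_chart G)"
proof (rule open_near_identity[of "%u. h \<otimes> \<iota> u \<otimes> inv h"])
 show "continuous_map (top_of_set \<Omega>) (topo G) (%u. h \<otimes> \<iota> u \<otimes> inv h)"
  using assms chart_inv_continuous[OF base_chart(1)] by (intro continuous_map_mult) auto
qed (use assms that in auto)

lemma Ad_mult:
 assumes g: "g \<in> carrier G" and h: "h \<in> carrier G"
 shows "Ad G (g \<otimes> h) X = Ad G g (Ad G h X)"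
proof -
 obtain S where S: "open S" "u0 \<in> S" "S \<subseteq> \<Omega>" "!!u. u \<in> S ==> h \<otimes> \<iota> u \<otimes> inv h \<in> fst (base_chart G)"
  using conj_near_identity[OF h] by blast
 let ?h = "%u. \<phi> (h \<otimes> \<iota> u \<otimes> inv h)" and ?g = "%u. \<phi> (g \<otimes> \<iota> u \<otimes> inv g)"
 have h0: "?h u0 = u0" using h by simp
 have "(?g \<circ> ?h has_derivative Ad G g \<circ> Ad G h) (at u0)"
  by (rule diff_chain_at[OF conj_has_derivative[OF h]]) (simp only: h0 conj_has_derivative[OF g])
 hence "((%u. \<phi> ((g \<otimes> h) \<otimes> \<iota> u \<otimes> inv (g \<otimes> h))) has_derivative Ad G g \<circ> Ad G h) (at u0)"
 proof (rule has_derivative_transform_within_open[OF _ S(1,2)])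
  fix u assume u: "u \<in> S"
  have "\<iota> (?h u) = h \<otimes> \<iota> u \<otimes> inv h" using S(4)[OF u] base_chart(1) by simp
  moreover have "\<iota> u \<in> carrier G" using u S(3) iota_carrier by blast
  ultimately show "(?g \<circ> ?h) u = \<phi> ((g \<otimes> h) \<otimes> \<iota> u \<otimes> inv (g \<otimes> h))"
   using g h by (simp add: inv_mult_group m_assoc)
 qed
 hence "Ad G (g \<otimes> h) = Ad G g \<circ> Ad G h"
  using has_derivative_unique conj_has_derivative[OF m_closed[OF g h]] by blast
 thus ?thesis by simp
qed

lemma AdE_one [simp]: "AdE \<one> = 1"
 by (rule endo_eqI) (simp add: Ad_one)

lemma AdE_mult: "g \<in> carrier G ==> h \<in> carrier G ==> AdE (g \<otimes> h) = AdE g * AdE h"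
 by (rule endo_eqI) (simp add: Ad_mult)

lemma AdE_inv [simp]: "g \<in> carrier G ==> AdE (inv g) * AdE g = 1" "g \<in> carrier G ==> AdE g * AdE (inv g) = 1"
 by (simp_all flip: AdE_mult)

lemma Ad_inv_cancel [simp]:
 "g \<in> carrier G ==> Ad G (inv g) (Ad G g X) = X" "g \<in> carrier G ==> Ad G g (Ad G (inv g) X) = X"
 using Ad_mult[of "inv g" g X] Ad_mult[of g "inv g" X] by (simp_all add: Ad_one)

lemma Ck_on_AdE_iota: "Ck_on k \<Omega> (%u. AdE (\<iota> u))"
proof -
 let ?F = "%x. \<iota> (fst x) \<otimes> \<iota> (snd x) \<otimes> inv \<iota> (fst x)"
 have "Ck_map (Suc k) (\<Omega> \<times> \<Omega>) ?F"
  by (intro Ck_map_mult Ck_map_inv Ck_map_fst_iota Ck_map_snd_iota open_Times open_Omega base_chart)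
 from partial_derivative(1)[OF open_Omega open_Omega this base_chart(1) u0_in]
 have *: "Ck_on k \<Omega> (%u. Ad G (\<iota> u) Y)" for Y
  using base_chart(2) by (simp add: Ad_def iota_carrier)
 let ?L = "%b Y. endo (%x::'e. (x \<bullet> b) *\<^sub>R (Y::'e))"
 have l: "linear (%x::'e. (x \<bullet> b) *\<^sub>R (Y::'e))" for b Y
  by (intro linearI) (simp_all add: inner_add_left scaleR_add_left)
 have L: "bounded_linear (?L b)" for b
  by (rule linear_linear[THEN iffD2], rule linearI; rule endo_eqI; simp only: app_endo[OF l] app_simps)
    (simp_all add: scaleR_add_right mult.commute)
 have "Ck_on k \<Omega> (%u. \<Sum>b\<in>Basis. ?L b (Ad G (\<iota> u) b))"
  by (intro Ck_on_sum open_Omega Ck_on_bounded_linear[OF L] *)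
 thus ?thesis
 proof (rule Ck_on_cong[OF open_Omega, THEN iffD1, rotated])
  fix u assume u: "u \<in> \<Omega>"
  note g = iota_carrier[OF u]
  show "(\<Sum>b\<in>Basis. ?L b (Ad G (\<iota> u) b)) = AdE (\<iota> u)"
  proof (rule endo_eqI)
   fix x
   have "Ad G (\<iota> u) x = Ad G (\<iota> u) (\<Sum>b\<in>Basis. (x \<bullet> b) *\<^sub>R b)" by (simp add: euclidean_representation)
   thus "(\<Sum>b\<in>Basis. ?L b (Ad G (\<iota> u) b)) \<cdot> x = AdE (\<iota> u) \<cdot> x"
    using g by (simp add: app.sum_left l linear_sum[OF linear_Ad[OF g]] linear_cmul[OF linear_Ad[OF g]])
  qed
 qed
qed

definition adG :: "'e => 'e endo" where "adG = frechet_derivative (%u. AdE (\<iota> u)) (at u0)"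

lemma AdE_iota_has_derivative: "((%u. AdE (\<iota> u)) has_derivative adG) (at u0)"
 unfolding adG_def by (rule Ck_on_has_derivative[OF Ck_on_AdE_iota u0_in])

lemma linear_adG: "linear adG"
 using AdE_iota_has_derivative has_derivative_linear by blast

lemma adG_app: "adG X \<cdot> Y = bracket G X Y"
proof -
 have "((%u. AdE (\<iota> u) \<cdot> Y) has_derivative (%X. adG X \<cdot> Y)) (at u0)"
  by (rule bounded_linear.has_derivative[OF app.bounded_linear_left AdE_iota_has_derivative])
 hence "((%u. Ad G (\<iota> u) Y) has_derivative (%X. adG X \<cdot> Y)) (at u0)"
  by (rule has_derivative_transform_within_open[OF _ open_Omega u0_in]) (simp add: iota_carrier)
 from frechet_derivative_at[OF this] show ?thesis by (metis bracket_def)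
qed

lemma bracket_bilinear: "bilinear (bracket G)"
 unfolding bilinear_def
proof (intro conjI allI)
 have "bracket G X = (%Y. adG X \<cdot> Y)" for X by (simp add: adG_app)
 thus "linear (bracket G X)" for X by (simp add: linear_app)
 show "linear (%X. bracket G X Y)" for Y
  by (rule linearI) (simp_all flip: adG_app add: linear_add[OF linear_adG] linear_cmul[OF linear_adG] app_simps)
qed

lemma adG_Ad:
 assumes g: "g \<in> carrier G"
 shows "adG (Ad G g X) = AdE g * adG X * AdE (inv g)"
proof -
 obtain S where S: "open S" "u0 \<in> S" "S \<subseteq> \<Omega>" "!!u. u \<in> S ==> g \<otimes> \<iota> u \<otimes> inv g \<in> fst (base_chart G)"
  using conj_near_identity[OF g] by blast
 let ?g = "%u. \<phi> (g \<otimes> \<iota> u \<otimes> inv g)"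
 have g0: "?g u0 = u0" using g by simp
 have "((%u. AdE (\<iota> u)) \<circ> ?g has_derivative adG \<circ> Ad G g) (at u0)"
  by (rule diff_chain_at[OF conj_has_derivative[OF g]]) (simp only: g0 AdE_iota_has_derivative)
 hence "((%u. AdE g * AdE (\<iota> u) * AdE (inv g)) has_derivative adG \<circ> Ad G g) (at u0)"
 proof (rule has_derivative_transform_within_open[OF _ S(1,2)])
  fix u assume u: "u \<in> S"
  have "\<iota> (?g u) = g \<otimes> \<iota> u \<otimes> inv g" using S(4)[OF u] base_chart(1) by simp
  moreover have "\<iota> u \<in> carrier G" using u S(3) iota_carrier by blast
  ultimately show "((%u. AdE (\<iota> u)) \<circ> ?g) u = AdE g * AdE (\<iota> u) * AdE (inv g)"
   using g by (simp add: AdE_mult)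
 qed
 moreover have "((%u. AdE g * AdE (\<iota> u) * AdE (inv g)) has_derivative (%X. AdE g * adG X * AdE (inv g))) (at u0)"
  by (intro has_derivative_mult_left has_derivative_mult_right AdE_iota_has_derivative)
 ultimately have "adG \<circ> Ad G g = (%X. AdE g * adG X * AdE (inv g))" by (rule has_derivative_unique)
 thus ?thesis by (metis comp_apply)
qed

lemma Ad_bracket:
 assumes g: "g \<in> carrier G"
 shows "Ad G g (bracket G X Y) = bracket G (Ad G g X) (Ad G g Y)"
 using g by (simp flip: adG_app add: adG_Ad)

text \<open>The Jacobi identity is the derivative at the identity of the fact that each
  \<open>Ad g\<close> preserves the bracket.\<close>

lemma bracket_leibniz: "bracket G X (bracket G Y Z) = bracket G (bracket G X Y) Z + bracket G Y (bracket G X Z)"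
proof -
 interpret b: bounded_bilinear "bracket G"
  using bracket_bilinear by (simp add: bilinear_conv_bounded_bilinear)
 have A: "((%u. AdE (\<iota> u) \<cdot> W) has_derivative (%X. bracket G X W)) (at u0)" for W
  using bounded_linear.has_derivative[OF app.bounded_linear_left AdE_iota_has_derivative] by (simp add: adG_app)
 have 1: "((%u. bracket G (AdE (\<iota> u) \<cdot> Y) (AdE (\<iota> u) \<cdot> Z)) has_derivative
   (%X. bracket G Y (bracket G X Z) + bracket G (bracket G X Y) Z)) (at u0)"
  using b.FDERIV[OF A A, of Y Z] by (simp add: Ad_one)
 have "((%u. AdE (\<iota> u) \<cdot> bracket G Y Z) has_derivative
   (%X. bracket G Y (bracket G X Z) + bracket G (bracket G X Y) Z)) (at u0)"
  by (rule has_derivative_transform_within_open[OF 1 open_Omega u0_in]) (simp add: iota_carrier Ad_bracket)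
 from has_derivative_unique[OF A this] show ?thesis by (metis add.commute)
qed

text \<open>Near the identity this is continuity in the base chart; multiplicativity carries it to
  any g by left translation.\<close>

lemma continuous_AdE: "continuous_map (topo G) euclidean AdE"
proof -
 have iota: "continuous_on \<Omega> (%u. AdE (\<iota> u))" using Ck_on_AdE_iota[of 0] by simp
 have "\<exists>T. openin (topo G) T \<and> g \<in> T \<and> T \<subseteq> {x \<in> carrier G. AdE x \<in> V}"
  if V: "open V" and g: "g \<in> carrier G" "AdE g \<in> V" for V g
 proof -
  let ?W = "{u \<in> \<Omega>. AdE g * AdE (\<iota> u) \<in> V}"
  let ?N = "{x \<in> topspace (topo G). inv g \<otimes> x \<in> {h \<in> fst (base_chart G). \<phi> h \<in> ?W}}"
  have "open ?W"
  proof -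
   have "continuous_on \<Omega> (%u. AdE g * AdE (\<iota> u))" by (intro continuous_intros iota)
   from continuous_open_preimage[OF this open_Omega V] show ?thesis
    by (simp add: vimage_def Int_def)
  qed
  hence "openin (topo G) {h \<in> fst (base_chart G). \<phi> h \<in> ?W}"
   using openin_continuous_map_preimage[OF chart_continuous[OF base_chart(1)], of ?W]
    chart_facts(1)[OF base_chart(1)] chart_sub_carrier[OF base_chart(1)]
   by (simp add: openin_open_subtopology Int_absorb1)
  hence "openin (topo G) ?N"
   using g by (intro openin_continuous_map_preimage[OF continuous_map_mult]) auto
  moreover have "g \<in> ?N"
   using g base_chart by auto
  moreover have "?N \<subseteq> {x \<in> carrier G. AdE x \<in> V}"
  proof (intro subsetI)
   fix x assume x: "x \<in> ?N"
   hence x': "x \<in> carrier G" "inv g \<otimes> x \<in> fst (base_chart G)" "AdE g * AdE (\<iota> (\<phi> (inv g \<otimes> x))) \<in> V"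
    by auto
   hence "AdE g * AdE (inv g \<otimes> x) \<in> V" using base_chart(1) by simp
   hence "AdE (g \<otimes> (inv g \<otimes> x)) \<in> V" using AdE_mult[of g "inv g \<otimes> x"] g x' by simp
   moreover have "g \<otimes> (inv g \<otimes> x) = x" using g x by (simp flip: m_assoc)
   ultimately show "x \<in> {x \<in> carrier G. AdE x \<in> V}" using x by simp
  qed
  ultimately show "\<exists>T. openin (topo G) T \<and> g \<in> T \<and> T \<subseteq> {x \<in> carrier G. AdE x \<in> V}" by blast
 qed
 hence "openin (topo G) {g \<in> carrier G. AdE g \<in> V}" if V: "open V" for V
  by (subst openin_subopen) (use V in blast)
 thus ?thesis by (simp add: continuous_map)
qed

end

section \<open>One-parameter subgroups\<close>

text \<open>The extension at t is the n-th power of \<open>g0 (t / n)\<close>. Any two admissible n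
  give the same value because both are powers of \<open>g0\<close> at the common
  subdivision.\<close>

lemma (in group) local_hom_extension:
 fixes g0 :: "real => 'a"
 assumes tau: "\<tau> > 0" and carr: "!!t. \<bar>t\<bar> <= \<tau> ==> g0 t \<in> carrier G"
  and hom: "!!s t. \<bar>s\<bar> <= \<tau> ==> \<bar>t\<bar> <= \<tau> ==> \<bar>s + t\<bar> <= \<tau> ==> g0 (s + t) = g0 s \<otimes> g0 t"
 obtains g :: "real => 'a" where "!!s t. g (s + t) = g s \<otimes> g t" "!!t. \<bar>t\<bar> <= \<tau> ==> g t = g0 t"
  "!!t. g t \<in> carrier G"
proof -
 have g00: "g0 0 = \<one>"
 proof -
  have "g0 0 \<otimes> g0 0 = g0 0" using hom[of 0 0] tau by simp
  thus ?thesis using carr[of 0] tau by (metis abs_0 l_cancel_one less_imp_le)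
 qed
 have pow: "g0 (real n * s) = g0 s [^] n" if "\<bar>real n * s\<bar> <= \<tau>" for n s
  using that
 proof (induction n)
  case (Suc n)
  have le: "\<bar>real n * s\<bar> <= \<tau>" "\<bar>s\<bar> <= \<tau>"
  proof -
   have "real n * \<bar>s\<bar> <= real (Suc n) * \<bar>s\<bar>" "1 * \<bar>s\<bar> <= real (Suc n) * \<bar>s\<bar>"
    by (intro mult_right_mono; simp)+
   thus "\<bar>real n * s\<bar> <= \<tau>" "\<bar>s\<bar> <= \<tau>" using Suc.prems by (simp_all add: abs_mult)
  qed
  have "g0 (real (Suc n) * s) = g0 (real n * s + s)" by (simp add: algebra_simps)
  also have "\<dots> = g0 (real n * s) \<otimes> g0 s" using le Suc.prems by (intro hom) (auto simp: algebra_simps)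
  finally show ?case using Suc.IH[OF le(1)] by simp
 qed (simp add: g00)
 have indep: "g0 (t / real N) [^] N = g0 (t / real M) [^] M"
  if "N > 0" "M > 0" "\<bar>t / real N\<bar> <= \<tau>" "\<bar>t / real M\<bar> <= \<tau>" for N M t
 proof -
  let ?s = "t / (real N * real M)"
  have e: "real M * ?s = t / real N" "real N * ?s = t / real M" using that by simp_all
  have "\<bar>?s\<bar> <= \<tau>"
  proof -
   have "\<bar>?s\<bar> = \<bar>t / real N\<bar> / real M" using that by (simp add: abs_mult)
   also have "\<dots> <= \<bar>t / real N\<bar>" using that by (simp add: divide_le_eq mult_le_cancel_left1)
   finally show ?thesis using that by simp
  qed
  hence c: "g0 ?s \<in> carrier G" by (rule carr)
  have "g0 (t / real N) = g0 ?s [^] M" "g0 (t / real M) = g0 ?s [^] N"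
   using pow[of M ?s] pow[of N ?s] e that by simp_all
  thus ?thesis using c by (simp add: nat_pow_pow mult.commute)
 qed
 define N where "N t = Suc (nat \<lceil>\<bar>t\<bar> / \<tau>\<rceil>)" for t
 have N: "N t > 0" "!!n. N t <= n ==> \<bar>t / real n\<bar> <= \<tau>" for t
 proof -
  show "N t > 0" by (simp add: N_def)
  fix n assume "N t <= n"
  hence "\<bar>t\<bar> / \<tau> <= real n" unfolding N_def by linarith
  hence "\<bar>t\<bar> <= real n * \<tau>" using tau by (simp add: divide_le_eq)
  moreover have "n > 0" using \<open>N t <= n\<close> by (simp add: N_def)
  ultimately show "\<bar>t / real n\<bar> <= \<tau>" by (simp add: divide_le_eq mult.commute)
 qed
 define g where "g t = g0 (t / real (N t)) [^] N t" for t
 have g: "g t = g0 (t / real n) [^] n" if "N t <= n" for t n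
  unfolding g_def using that N[of t] by (intro indep) auto
 have "g (s + t) = g s \<otimes> g t" for s t
 proof -
  define n where "n = max (N (s + t)) (max (N s) (N t))"
  have n: "N (s + t) <= n" "N s <= n" "N t <= n" by (auto simp: n_def)
  have b: "\<bar>s / real n\<bar> <= \<tau>" "\<bar>t / real n\<bar> <= \<tau>" "\<bar>s / real n + t / real n\<bar> <= \<tau>"
   using N(2)[OF n(1)] N(2)[OF n(2)] N(2)[OF n(3)] by (auto simp: add_divide_distrib)
  have c: "g0 (s / real n) \<in> carrier G" "g0 (t / real n) \<in> carrier G" using b carr by auto
  have h: "g0 (s / real n + t / real n) = g0 (s / real n) \<otimes> g0 (t / real n)" by (rule hom[OF b])
  have "g0 (t / real n + s / real n) = g0 (t / real n) \<otimes> g0 (s / real n)"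
   using b by (intro hom) (simp_all add: add.commute)
  hence comm: "g0 (s / real n) \<otimes> g0 (t / real n) = g0 (t / real n) \<otimes> g0 (s / real n)"
   using h by (simp add: add.commute)
  have "g (s + t) = (g0 (s / real n) \<otimes> g0 (t / real n)) [^] n"
   using g[OF n(1)] h by (simp add: add_divide_distrib)
  also have "\<dots> = g0 (s / real n) [^] n \<otimes> g0 (t / real n) [^] n"
   by (rule pow_mult_distrib[OF comm c])
  finally show ?thesis using g[OF n(2)] g[OF n(3)] by simp
 qed
 moreover have "g t = g0 t" if "\<bar>t\<bar> <= \<tau>" for t
  unfolding g_def using indep[of "N t" 1 t] N[of t] that carr[of t] by simp
 moreover have "g t \<in> carrier G" for t
  unfolding g_def using N[of t] carr by simp
 ultimately show ?thesis using that by blast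
qed

locale lie_cartan = lie_grp G for G :: "('g, 'e::euclidean_space) lie_data" (structure) +
 fixes k p :: "'e set"
 assumes connected: "connected_space (topo G)" and cartan: "cartan_decomposition G k p"
begin

sublocale cartan_algebra "bracket G" k p
proof (rule cartan_algebra.intro[OF bracket_bilinear bracket_leibniz])
 note c = cartan[unfolded cartan_decomposition_def killing_def]
 show "subspace k" "subspace p" "k \<inter> p = {0}" "{X + Y |X Y. X \<in> k \<and> Y \<in> p} = UNIV" using c by auto
 show "X \<in> k ==> Y \<in> k ==> bracket G X Y \<in> k" "X \<in> k ==> Y \<in> p ==> bracket G X Y \<in> p"
  "X \<in> p ==> Y \<in> p ==> bracket G X Y \<in> k" for X Y using c by blast+
 show "X \<in> k ==> X ~= 0 ==> (\<Sum>b\<in>Basis. bracket G X (bracket G X b) \<bullet> b) < 0"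
  "X \<in> p ==> X ~= 0 ==> (\<Sum>b\<in>Basis. bracket G X (bracket G X b) \<bullet> b) > 0" for X using c by blast+
qed

lemma killing_eq: "killing G = kil"
 by (intro ext) (simp add: killing_def kil_eq)

lemma adG_eq: "adG = ad"
 by (intro ext endo_eqI) (simp add: adG_app)

lemma aut_AdE: "g \<in> carrier G ==> aut (AdE g)"
 unfolding aut_def using AdE_inv by (metis AdE_app Ad_bracket)

text \<open>\<open>Ad\<close> in the base chart, recentred so that 0 goes to 1; its strict
  derivative at 0 is \<open>ad\<close>. It is unrelated to the positive system \<Phi>.\<close>

definition Phi :: "'e => 'e endo" where "Phi X = AdE (\<iota> (u0 + X))"

lemma Phi_0 [simp]: "Phi 0 = 1"
 by (simp add: Phi_def)

lemma Phi_strict: "strict_at_0 Phi ad"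
 unfolding strict_at_0_def
proof (intro allI impI)
 fix \<epsilon> :: real assume "\<epsilon> > 0"
 then obtain e where d: "e > 0" "cball u0 e \<subseteq> \<Omega>"
  "!!y z. y \<in> cball u0 e ==> z \<in> cball u0 e ==> norm (AdE (\<iota> y) - AdE (\<iota> z) - ad (y - z)) <= \<epsilon> * norm (y - z)"
  using Ck_on_strict_derivative[OF open_Omega Ck_on_AdE_iota u0_in AdE_iota_has_derivative] adG_eq by metis
 have "norm (Phi X - Phi Y - ad (X - Y)) <= \<epsilon> * norm (X - Y)" if "norm X <= e" "norm Y <= e" for X Y
  using d(3)[of "u0 + X" "u0 + Y"] that by (simp add: Phi_def dist_norm)
 thus "\<exists>e>0. \<forall>X Y. norm X <= e --> norm Y <= e --> norm (Phi X - Phi Y - ad (X - Y)) <= \<epsilon> * norm (X - Y)" using d(1) by blast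
qed

lemma chart_ball: obtains d where "d > 0" "!!X. norm X <= d ==> u0 + X \<in> \<Omega>"
proof -
 obtain d where "d > 0" "cball u0 d \<subseteq> \<Omega>"
  using open_Omega u0_in open_contains_cball by blast
 thus ?thesis using that[of d] by (auto simp: dist_norm subset_iff)
qed

definition nball :: "real => 'g set" where
 "nball r = {h \<in> fst (base_chart G). norm (\<phi> h - u0) < r}"

lemma openin_nball: "openin (topo G) (nball r)"
proof -
 have "nball r = {h \<in> fst (base_chart G). \<phi> h \<in> ball u0 r}"
  by (auto simp: nball_def dist_norm norm_minus_commute)
 thus ?thesis
  using openin_continuous_map_preimage[OF chart_continuous[OF base_chart(1)], of "ball u0 r"]
   chart_facts(1)[OF base_chart(1)] chart_sub_carrier[OF base_chart(1)]
  by (simp add: openin_open_subtopology Int_absorb1)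
qed

lemma nball_carrier: "h \<in> nball r ==> h \<in> carrier G"
 using chart_sub_carrier[OF base_chart(1)] by (auto simp: nball_def)

lemma one_nball: "r > 0 ==> \<one> \<in> nball r"
 using base_chart by (simp add: nball_def)

lemma nball_mono: "r <= s ==> nball r \<subseteq> nball s"
 by (auto simp: nball_def)

lemma nball_AdE: "h \<in> nball r ==> AdE h = Phi (\<phi> h - u0)"
 using base_chart(1) by (simp add: nball_def Phi_def)

lemma nball_iota: "u0 + X \<in> \<Omega> ==> norm X < r ==> \<iota> (u0 + X) \<in> nball r"
 using chart_inv_in[OF base_chart(1)] by (auto simp: nball_def)

lemma nball_subset:
 assumes "openin (topo G) U" "\<one> \<in> U"
 obtains r where "r > 0" "nball r \<subseteq> U"
proof -
 let ?W = "{u \<in> \<Omega>. \<iota> u \<in> U}"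
 have "open ?W" by (rule open_preimage[OF open_Omega chart_inv_continuous[OF base_chart(1)] assms(1)])
 moreover have "u0 \<in> ?W" using assms(2) by simp
 ultimately obtain r where r: "r > 0" "ball u0 r \<subseteq> ?W" using open_contains_ball by blast
 have "nball r \<subseteq> U"
 proof
  fix h assume h: "h \<in> nball r"
  hence "\<phi> h \<in> ball u0 r" by (simp add: nball_def dist_norm norm_minus_commute)
  hence "\<iota> (\<phi> h) \<in> U" using r by blast
  thus "h \<in> U" using h base_chart(1) by (simp add: nball_def)
 qed
 thus ?thesis using that r by blast
qed

lemma ad_lower_bound: obtains c where "c > 0" "!!X. norm X <= c * norm (ad X)"
proof -
 obtain K where K: "K > 0" "!!T. norm (killing_part T) <= norm T * K"
  using bounded_linear.pos_bounded[OF bounded_linear_endo_dom[OF linear_killing_part]] by blast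
 hence "norm X <= K * norm (ad X)" for X using K(2)[of "ad X"] by (simp add: mult.commute)
 thus ?thesis using that K by blast
qed

text \<open>\<open>ad\<close> is injective, hence bounded below, and \<open>Phi\<close> differs from
  it by a term with Lipschitz constant \<open>1 / (2 * c)\<close>, which absorbs only half of that
  bound.\<close>

lemma Phi_lower_bound:
 obtains e C where "e > 0" "C > 0" "!!X Y. norm X <= e ==> norm Y <= e ==> norm (X - Y) <= C * norm (Phi X - Phi Y)"
proof -
 obtain c where c: "c > 0" "!!X. norm X <= c * norm (ad X)" using ad_lower_bound by blast
 obtain e where d: "e > 0" "!!X Y. norm X <= e ==> norm Y <= e ==> norm (Phi X - Phi Y - ad (X - Y)) <= (1 / (2 * c)) * norm (X - Y)"
  using strict_at_0D[OF Phi_strict, of "1 / (2 * c)"] c by auto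
 have "norm (X - Y) <= (2 * c) * norm (Phi X - Phi Y)" if "norm X <= e" "norm Y <= e" for X Y
 proof -
  have "norm (ad (X - Y)) <= norm (Phi X - Phi Y) + norm (Phi X - Phi Y - ad (X - Y))"
   using norm_triangle_ineq4[of "Phi X - Phi Y" "Phi X - Phi Y - ad (X - Y)"] by simp
  also have "\<dots> <= norm (Phi X - Phi Y) + (1 / (2 * c)) * norm (X - Y)" using d(2)[OF that] by simp
  finally have "c * norm (ad (X - Y)) <= c * (norm (Phi X - Phi Y) + (1 / (2 * c)) * norm (X - Y))"
   using c(1) by simp
  hence "norm (X - Y) <= c * norm (Phi X - Phi Y) + norm (X - Y) / 2"
   using c(1) c(2)[of "X - Y"] by (simp add: algebra_simps)
  thus ?thesis by simp
 qed
 thus ?thesis using that d(1) c(1) by (metis mult_pos_pos zero_less_numeral)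
qed

lemma nball_inj:
 obtains e where "e > 0" "!!g h. g \<in> nball e ==> h \<in> nball e ==> AdE g = AdE h ==> g = h"
proof -
 obtain e C where d: "e > 0" "C > 0" "!!X Y. norm X <= e ==> norm Y <= e ==> norm (X - Y) <= C * norm (Phi X - Phi Y)"
  using Phi_lower_bound by blast
 have "g = h" if gh: "g \<in> nball e" "h \<in> nball e" "AdE g = AdE h" for g h
 proof -
  have "norm ((\<phi> g - u0) - (\<phi> h - u0)) <= C * norm (Phi (\<phi> g - u0) - Phi (\<phi> h - u0))"
   using gh by (intro d(3)) (auto simp: nball_def)
  also have "\<dots> = 0" using gh by (simp flip: nball_AdE)
  finally have "\<phi> g = \<phi> h" by simp
  thus ?thesis using gh chart_inj[OF base_chart(1)] by (auto simp: nball_def inj_on_def)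
 qed
 thus ?thesis using that d(1) by blast
qed

lemma nball_square:
 assumes "r > 0"
 obtains s where "s > 0" "s <= r" "!!g h. g \<in> nball s ==> h \<in> nball s ==> g \<otimes> h \<in> nball r"
proof -
 define W where "W = {x \<in> topspace (prod_topology (topo G) (topo G)). (case x of (g, h) => g \<otimes> h) \<in> nball r}"
 have W: "openin (prod_topology (topo G) (topo G)) W"
  unfolding W_def by (rule openin_continuous_map_preimage[OF mult_continuous openin_nball])
 have oneW: "(\<one>, \<one>) \<in> W"
  using one_nball[OF assms] by (simp add: W_def)
 obtain U V where UV: "openin (topo G) U" "openin (topo G) V" "\<one> \<in> U" "\<one> \<in> V" "U \<times> V \<subseteq> W"
  using openin_prod_topology_alt[THEN iffD1, OF W, rule_format, OF oneW] by (elim exE conjE)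
 obtain a where a: "a > 0" "nball a \<subseteq> U \<inter> V"
  using nball_subset[OF openin_Int[OF UV(1,2)]] UV(3,4) by blast
 have "nball (min a r) \<subseteq> nball a" by (rule nball_mono) simp
 hence "g \<otimes> h \<in> nball r" if "g \<in> nball (min a r)" "h \<in> nball (min a r)" for g h
 proof -
  have "(g, h) \<in> U \<times> V" using a that \<open>nball (min a r) \<subseteq> nball a\<close> by blast
  thus ?thesis using UV(5) by (auto simp: W_def)
 qed
 thus ?thesis using that[of "min a r"] a assms by simp
qed

lemma AdE_open:
 assumes "r > 0"
 obtains s where "s > 0" "!!T. aut T ==> norm (T - 1) < s ==> \<exists>h\<in>nball r. AdE h = T"
proof -
 obtain e where d: "e > 0" "!!X. norm X <= e ==> u0 + X \<in> \<Omega>" using chart_ball by blast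
 have "\<exists>e>0. \<forall>X. norm X <= e --> aut (Phi X)"
  using d aut_AdE iota_carrier unfolding Phi_def by blast
 then obtain s where s: "s > 0" "!!T. aut T ==> norm (T - 1) < s ==> \<exists>X. norm X < min r e \<and> Phi X = T"
  using ad_local_parametrization[of Phi "min r e"] Phi_strict assms d by auto
 have "\<exists>h\<in>nball r. AdE h = T" if T: "aut T" "norm (T - 1) < s" for T
 proof -
  obtain X where "norm X < min r e" "Phi X = T" using s(2)[OF T] by blast
  thus ?thesis using d by (intro bexI[of _ "\<iota> (u0 + X)"]) (auto simp: Phi_def intro: nball_iota)
 qed
 thus ?thesis using that s(1) by blast
qed

text \<open>A radius, fixed once, within which an element is determined by its \<open>AdE\<close>.
  Globally this fails by central elements, so each identification of two group elements must be
  localized to \<open>nball rad\<close>.\<close>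

definition rad :: real where
 "rad = (SOME \<delta>. \<delta> > 0 \<and> (\<forall>g h. g \<in> nball \<delta> --> h \<in> nball \<delta> --> AdE g = AdE h --> g = h))"

lemma delta0: "rad > 0" "g \<in> nball rad ==> h \<in> nball rad ==> AdE g = AdE h ==> g = h"
proof -
 have "\<exists>d. d > 0 \<and> (\<forall>g h. g \<in> nball d --> h \<in> nball d --> AdE g = AdE h --> g = h)"
  using nball_inj by metis
 from someI_ex[OF this]
 show "rad > 0" "g \<in> nball rad ==> h \<in> nball rad ==> AdE g = AdE h ==> g = h"
  unfolding rad_def by blast+
qed

lemma hom_power:
 fixes c :: "real => 'g"
 assumes hom: "!!s t. c (s + t) = c s \<otimes> c t" and carr: "!!t. c t \<in> carrier G"
 shows "c 0 = \<one>" "c (real n * t) = c t [^] n"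
proof -
 have "c 0 \<otimes> c 0 = c 0" using hom[of 0 0] by simp
 thus 0: "c 0 = \<one>" using carr[of 0] by (metis l_cancel_one)
 show "c (real n * t) = c t [^] n"
 proof (induction n)
  case (Suc n)
  have "c (real (Suc n) * t) = c (real n * t + t)" by (simp add: algebra_simps)
  thus ?case by (simp only: hom Suc nat_pow_Suc)
 qed (simp add: 0)
qed

text \<open>For n large, both paths at \<open>t / n\<close> lie where \<open>AdE\<close> is
  injective and so agree there; the n-th powers agree as well.\<close>

lemma one_param_unique:
 fixes c c' :: "real => 'g"
 assumes hom: "!!s t. c (s + t) = c s \<otimes> c t" "!!s t. c' (s + t) = c' s \<otimes> c' t"
  and carr: "!!t. c t \<in> carrier G" "!!t. c' t \<in> carrier G"
  and near: "\<tau> > 0" "!!t. \<bar>t\<bar> < \<tau> ==> c t \<in> nball rad" "!!t. \<bar>t\<bar> < \<tau> ==> c' t \<in> nball rad"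
  and eq: "!!t. AdE (c t) = AdE (c' t)"
 shows "c t = c' t"
proof -
 obtain n :: nat where n: "real n > \<bar>t\<bar> / \<tau>" using reals_Archimedean2 by blast
 hence n0: "n > 0" using near(1) by (metis abs_ge_zero divide_nonneg_pos of_nat_0 not_gr_zero not_le)
 have "\<bar>t / real n\<bar> < \<tau>" using n n0 near(1) by (simp add: field_simps)
 hence "c (t / real n) = c' (t / real n)" using near(2,3) eq delta0(2) by blast
 hence "c (real n * (t / real n)) = c' (real n * (t / real n))"
  by (simp only: hom_power(2)[OF hom(1) carr(1)] hom_power(2)[OF hom(2) carr(2)])
 thus ?thesis using n0 by simp
qed

text \<open>For small t the automorphism \<open>exp (t ad X)\<close> has a lift near the identity.
  The lifts multiply correctly because both sides of the equation lie in \<open>nball rad\<close>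
  and have the same \<open>AdE\<close>. The bound s is uniform in X, which later gives continuity of
  the exponential map at 0.\<close>

lemma one_param_local:
 assumes "r > 0"
 obtains s where "s > 0" "!!X \<tau>. \<tau> > 0 ==> (!!t. \<bar>t\<bar> <= \<tau> ==> norm (exp (t *\<^sub>R ad X) - 1) < s) ==>
  \<exists>c. (\<forall>s t. c (s + t) = c s \<otimes> c t) \<and> (\<forall>t. c t \<in> carrier G) \<and> (\<forall>t. AdE (c t) = exp (t *\<^sub>R ad X)) \<and>
   (\<forall>t. \<bar>t\<bar> <= \<tau> --> c t \<in> nball r)"
proof -
 obtain q where q: "q > 0" "q <= rad" "!!g h. g \<in> nball q ==> h \<in> nball q ==> g \<otimes> h \<in> nball rad"
  using nball_square[OF delta0(1)] by blast
 obtain s where s: "s > 0" "!!T. aut T ==> norm (T - 1) < s ==> \<exists>h\<in>nball (min q r). AdE h = T"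
  using AdE_open[of "min q r"] q assms by auto
 have key: "\<exists>c. (\<forall>s t. c (s + t) = c s \<otimes> c t) \<and> (\<forall>t. c t \<in> carrier G) \<and> (\<forall>t. AdE (c t) = exp (t *\<^sub>R ad X)) \<and>
   (\<forall>t. \<bar>t\<bar> <= \<tau> --> c t \<in> nball r)"
  if tau: "\<tau> > 0" and X: "!!t. \<bar>t\<bar> <= \<tau> ==> norm (exp (t *\<^sub>R ad X) - 1) < s" for X \<tau>
 proof -
  have "\<exists>h\<in>nball (min q r). AdE h = exp (t *\<^sub>R ad X)" if "\<bar>t\<bar> <= \<tau>" for t
   using s(2)[OF _ X[OF that]] aut_exp_ad[of "t *\<^sub>R X"] by (simp add: ad_simps)
  then obtain g0 where g0: "!!t. \<bar>t\<bar> <= \<tau> ==> g0 t \<in> nball (min q r)" "!!t. \<bar>t\<bar> <= \<tau> ==> AdE (g0 t) = exp (t *\<^sub>R ad X)"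
   by metis
  have nb: "nball (min q r) \<subseteq> nball q" "nball (min q r) \<subseteq> nball r" "nball q \<subseteq> nball rad"
   using q by (auto intro!: nball_mono)
  have carr: "g0 t \<in> carrier G" if "\<bar>t\<bar> <= \<tau>" for t using g0(1)[OF that] nball_carrier by blast
  have hom: "g0 (a + b) = g0 a \<otimes> g0 b" if "\<bar>a\<bar> <= \<tau>" "\<bar>b\<bar> <= \<tau>" "\<bar>a + b\<bar> <= \<tau>" for a b
  proof (rule delta0(2))
   show "g0 (a + b) \<in> nball rad" using g0(1)[OF that(3)] nb by blast
   show "g0 a \<otimes> g0 b \<in> nball rad" using g0(1)[OF that(1)] g0(1)[OF that(2)] nb q(3) by blast
   show "AdE (g0 (a + b)) = AdE (g0 a \<otimes> g0 b)"
    using that carr by (simp add: AdE_mult g0(2) exp_scaleR_add)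
  qed
  obtain c where c: "!!s t. c (s + t) = c s \<otimes> c t" "!!t. \<bar>t\<bar> <= \<tau> ==> c t = g0 t" "!!t. c t \<in> carrier G"
   by (rule local_hom_extension[OF tau, of g0]) (use carr hom in blast)+
  have "AdE (c t) = exp (t *\<^sub>R ad X)" for t
  proof (rule exp_one_param_unique)
   show "AdE (c (s + t)) = AdE (c s) * AdE (c t)" for s t by (simp add: c AdE_mult)
   show "AdE (c 0) = 1" using c(2)[of 0] g0(2)[of 0] tau by simp
   have "((%t. exp (t *\<^sub>R ad X)) has_vector_derivative ad X) (at 0)"
    using exp_scaleR_has_vector_derivative_right[of "ad X" 0 UNIV] by simp
   thus "((%t. AdE (c t)) has_vector_derivative ad X) (at 0)"
    by (rule has_vector_derivative_transform_within_open[where S="{-\<tau><..<\<tau>}"]) (use tau c(2) g0(2) in auto)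
  qed
  moreover have "c t \<in> nball r" if "\<bar>t\<bar> <= \<tau>" for t using c(2)[OF that] g0(1)[OF that] nb(2) by auto
  ultimately show ?thesis using c(1,3) by (intro exI[of _ c]) simp
 qed
 show ?thesis by (rule that[OF s(1)], rule key)
qed

end

section \<open>The exponential map\<close>

lemma exp_near_one:
 assumes "s > 0"
 obtains d where "d > 0" "!!A :: 'a::{real_normed_algebra_1,banach}. norm A <= d ==> norm (exp A - 1) < s"
proof -
 obtain e where d: "e > 0" "!!S T :: 'a. norm S <= e ==> norm T <= e ==> norm (exp S - exp T - (S - T)) <= 1 * norm (S - T)"
  using exp_strict_derivative[OF zero_less_one] by blast
 have "norm (exp A - 1) < s" if "norm A <= min e (s / 4)" for A :: 'a
 proof -
  have "norm (exp A - 1) <= norm (exp A - 1 - A) + norm A" using norm_triangle_ineq[of "exp A - 1 - A" A] by simp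
  thus ?thesis using d(2)[of A 0] d(1) that assms by simp
 qed
 thus ?thesis using that[of "min e (s / 4)"] d(1) assms by simp
qed

context lie_cartan
begin

lemma one_param_exists:
 "\<exists>c. (\<forall>s t. c (s + t) = c s \<otimes> c t) \<and> (\<forall>t. c t \<in> carrier G) \<and> (\<forall>t. AdE (c t) = exp (t *\<^sub>R ad X)) \<and>
  (\<forall>r>0. \<exists>\<tau>>0. \<forall>t. \<bar>t\<bar> <= \<tau> --> c t \<in> nball r)"
proof -
 have ex: "\<exists>c. (\<forall>s t. c (s + t) = c s \<otimes> c t) \<and> (\<forall>t. c t \<in> carrier G) \<and> (\<forall>t. AdE (c t) = exp (t *\<^sub>R ad X)) \<and>
  (\<exists>\<tau>>0. \<forall>t. \<bar>t\<bar> <= \<tau> --> c t \<in> nball r)" if r: "r > 0" for r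
 proof -
  obtain s where s: "s > 0" "!!\<tau>. \<tau> > 0 ==> (!!t. \<bar>t\<bar> <= \<tau> ==> norm (exp (t *\<^sub>R ad X) - 1) < s) ==>
   \<exists>c. (\<forall>s t. c (s + t) = c s \<otimes> c t) \<and> (\<forall>t. c t \<in> carrier G) \<and> (\<forall>t. AdE (c t) = exp (t *\<^sub>R ad X)) \<and>
   (\<forall>t. \<bar>t\<bar> <= \<tau> --> c t \<in> nball r)"
   by (rule one_param_local[OF r]) blast
  obtain d where d: "d > 0" "!!A :: 'e endo. norm A <= d ==> norm (exp A - 1) < s"
   using exp_near_one[OF s(1)] by blast
  define \<tau> where "\<tau> = d / (norm (ad X) + 1)"
  have tau: "\<tau> > 0" using d by (simp add: \<tau>_def add_nonneg_pos)
  have "norm (exp (t *\<^sub>R ad X) - 1) < s" if "\<bar>t\<bar> <= \<tau>" for t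
  proof (rule d(2))
   have "\<bar>t\<bar> * norm (ad X) <= \<tau> * (norm (ad X) + 1)" using that tau by (intro mult_mono) auto
   also have "\<dots> = d" by (simp add: \<tau>_def add_nonneg_eq_0_iff)
   finally show "norm (t *\<^sub>R ad X) <= d" by simp
  qed
  from s(2)[OF tau this] show ?thesis using tau by blast
 qed
 from ex[OF delta0(1)] obtain c \<tau> where c: "!!s t. c (s + t) = c s \<otimes> c t" "!!t. c t \<in> carrier G"
  "!!t. AdE (c t) = exp (t *\<^sub>R ad X)" "\<tau> > 0" "!!t. \<bar>t\<bar> <= \<tau> ==> c t \<in> nball rad" by blast
 \<comment> \<open>A path lifted with a smaller radius coincides with \<open>c\<close> by
   uniqueness, so \<open>c\<close> inherits the finer control near 0.\<close>
 have "\<exists>\<tau>>0. \<forall>t. \<bar>t\<bar> <= \<tau> --> c t \<in> nball r" if "r > 0" for r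
 proof -
  have "min r rad > 0" using that delta0 by simp
  from ex[OF this] obtain c' \<tau>' where c': "!!s t. c' (s + t) = c' s \<otimes> c' t" "!!t. c' t \<in> carrier G"
   "!!t. AdE (c' t) = exp (t *\<^sub>R ad X)" "\<tau>' > 0" "!!t. \<bar>t\<bar> <= \<tau>' ==> c' t \<in> nball (min r rad)" by blast
  have nb: "nball (min r rad) \<subseteq> nball rad" "nball (min r rad) \<subseteq> nball r" by (rule nball_mono, simp)+
  have "c t = c' t" for t
  proof (rule one_param_unique[where \<tau>="min \<tau> \<tau>'", OF c(1) c'(1) c(2) c'(2)])
   show "c' t \<in> nball rad" if "\<bar>t\<bar> < min \<tau> \<tau>'" for t using c'(5)[of t] nb(1) that by auto
  qed (use c c' in auto)
  thus ?thesis using c'(4,5) nb(2) by (metis subsetD)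
 qed
 thus ?thesis using c(1-3) by blast
qed

definition gam :: "'e => real => 'g" where
 "gam X = (SOME \<gamma>. (\<forall>s t. \<gamma> (s + t) = \<gamma> s \<otimes> \<gamma> t) \<and> (\<forall>t. \<gamma> t \<in> carrier G) \<and> (\<forall>t. AdE (\<gamma> t) = exp (t *\<^sub>R ad X)) \<and>
  (\<forall>r>0. \<exists>\<tau>>0. \<forall>t. \<bar>t\<bar> <= \<tau> --> \<gamma> t \<in> nball r))"

lemma gam: "gam X (s + t) = gam X s \<otimes> gam X t" "gam X t \<in> carrier G" "AdE (gam X t) = exp (t *\<^sub>R ad X)"
 "r > 0 ==> \<exists>\<tau>>0. \<forall>t. \<bar>t\<bar> <= \<tau> --> gam X t \<in> nball r"
 using someI_ex[OF one_param_exists[of X]] unfolding gam_def by blast+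

lemma gam_0 [simp]: "gam X 0 = \<one>"
 by (rule hom_power(1)[OF gam(1,2)])

lemma gam_unique:
 assumes hom: "!!s t. c (s + t) = c s \<otimes> c t" and carr: "!!t. c t \<in> carrier G"
  and near: "\<tau> > 0" "!!t. \<bar>t\<bar> < \<tau> ==> c t \<in> nball rad" and Ad: "!!t. AdE (c t) = exp (t *\<^sub>R ad X)"
 shows "c t = gam X t"
proof -
 obtain \<tau>' where "\<tau>' > 0" "\<forall>t. \<bar>t\<bar> <= \<tau>' --> gam X t \<in> nball rad" using gam(4)[OF delta0(1)] by blast
 thus ?thesis
  by (intro one_param_unique[where \<tau>="min \<tau> \<tau>'", OF hom gam(1) carr gam(2)]) (use near Ad gam(3) in auto)
qed

lemma gam_continuous: "continuous_map euclideanreal (topo G) (gam X)"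
proof -
 have "open {t. gam X t \<in> U}" if U: "openin (topo G) U" for U
  unfolding open_dist
 proof (intro ballI)
  fix t0 assume t0: "t0 \<in> {t. gam X t \<in> U}"
  have "openin (topo G) {h \<in> topspace (topo G). gam X t0 \<otimes> h \<in> U}"
   using gam(2) U by (intro openin_continuous_map_preimage[OF continuous_map_mult]) auto
  moreover have "\<one> \<in> {h \<in> topspace (topo G). gam X t0 \<otimes> h \<in> U}" using t0 gam(2) by simp
  ultimately obtain r where r: "r > 0" "nball r \<subseteq> {h \<in> topspace (topo G). gam X t0 \<otimes> h \<in> U}"
   using nball_subset by blast
  obtain \<tau> where \<tau>: "\<tau> > 0" "\<forall>t. \<bar>t\<bar> <= \<tau> --> gam X t \<in> nball r" using gam(4)[OF r(1)] by blast
  have "gam X t \<in> U" if "dist t t0 < \<tau>" for t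
  proof -
   have "gam X (t - t0) \<in> nball r" using \<tau>(2) that by (simp add: dist_real_def)
   hence "gam X t0 \<otimes> gam X (t - t0) \<in> U" using r(2) by blast
   thus ?thesis by (simp flip: gam(1))
  qed
  thus "\<exists>e>0. \<forall>t. dist t t0 < e --> t \<in> {t. gam X t \<in> U}" using \<tau>(1) by blast
 qed
 thus ?thesis using gam(2) by (auto simp: continuous_map)
qed

text \<open>In coordinates \<open>Y t\<close> of the path, \<open>Phi (Y t) = exp (t ad X)\<close>.
  The lower bound for \<open>Phi\<close> gives \<open>Y t = O(t)\<close>; strictness of
  \<open>Phi\<close> then makes \<open>ad (Y t - t X)\<close> of smaller order than t, and
  \<open>ad\<close> is bounded below.\<close>

lemma gam_derivative: "((\<phi> \<circ> gam X) has_vector_derivative X) (at 0)"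
proof -
 obtain r1 C where d1: "r1 > 0" "C > 0" "!!X Y. norm X <= r1 ==> norm Y <= r1 ==> norm (X - Y) <= C * norm (Phi X - Phi Y)"
  using Phi_lower_bound by blast
 obtain c where c: "c > 0" "!!X. norm X <= c * norm (ad X)" using ad_lower_bound by blast
 define Y where "Y t = \<phi> (gam X t) - u0" for t
 define M where "M = norm (ad X) + 1"
 have M: "M > 0" by (simp add: M_def add_nonneg_pos)
 have bound: "\<exists>d>0. \<forall>t. \<bar>t\<bar> < d --> norm (Y t - t *\<^sub>R X) <= e * \<bar>t\<bar>" if e: "e > 0" for e
 proof -
  \<comment> \<open>\<open>e1\<close> and \<open>e2\<close> are chosen so that the error of
    \<open>Phi\<close> and that of the exponential each contribute
    \<open>e / (2 * c)\<close>.\<close>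
  define e1 where "e1 = e / (2 * c * C * M)"
  define e2 where "e2 = min 1 (e / (2 * c))"
  have e1: "e1 > 0" and e2: "e2 > 0" "e2 <= 1" using e c d1 M by (auto simp: e1_def e2_def)
  obtain r2 where d2: "r2 > 0" "!!X Y. norm X <= r2 ==> norm Y <= r2 ==> norm (Phi X - Phi Y - ad (X - Y)) <= e1 * norm (X - Y)"
   using strict_at_0D[OF Phi_strict e1] by blast
  obtain \<tau>1 where t1: "\<tau>1 > 0" "!!t. \<bar>t\<bar> <= \<tau>1 ==> gam X t \<in> nball (min r1 r2)"
   using gam(4)[of "min r1 r2"] d1(1) d2(1) by auto
  have "((%t. exp (t *\<^sub>R ad X)) has_derivative (%t. t *\<^sub>R ad X)) (at 0)"
   using exp_scaleR_has_vector_derivative_right[of "ad X" 0 UNIV] by (simp add: has_vector_derivative_def)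
  then obtain \<tau>2 where t2: "\<tau>2 > 0" "!!t. \<bar>t\<bar> < \<tau>2 ==> norm (exp (t *\<^sub>R ad X) - 1 - t *\<^sub>R ad X) <= e2 * \<bar>t\<bar>"
   using e2(1) by (auto simp: has_derivative_at_alt)
  have "norm (Y t - t *\<^sub>R X) <= e * \<bar>t\<bar>" if t: "\<bar>t\<bar> < min \<tau>1 \<tau>2" for t
  proof -
   have nb: "gam X t \<in> nball (min r1 r2)" using t1(2) t by simp
   have Phi: "Phi (Y t) = exp (t *\<^sub>R ad X)" using nball_AdE[OF nb] gam(3) by (simp add: Y_def)
   have Ys: "norm (Y t) <= r1" "norm (Y t) <= r2" using nb by (auto simp: Y_def nball_def)
   have E: "norm (exp (t *\<^sub>R ad X) - 1 - t *\<^sub>R ad X) <= e2 * \<bar>t\<bar>" using t2(2) t by simp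
   have "norm (exp (t *\<^sub>R ad X) - 1) <= norm (exp (t *\<^sub>R ad X) - 1 - t *\<^sub>R ad X) + norm (t *\<^sub>R ad X)"
    using norm_triangle_ineq[of "exp (t *\<^sub>R ad X) - 1 - t *\<^sub>R ad X" "t *\<^sub>R ad X"] by simp
   also have "\<dots> <= 1 * \<bar>t\<bar> + \<bar>t\<bar> * norm (ad X)" using E mult_right_mono[OF e2(2), of "\<bar>t\<bar>"] by simp
   finally have E1: "norm (exp (t *\<^sub>R ad X) - 1) <= M * \<bar>t\<bar>" by (simp add: M_def algebra_simps)
   have "norm (Y t) <= C * norm (exp (t *\<^sub>R ad X) - 1)" using d1(3)[OF Ys(1), of 0] d1(1) Phi by simp
   also have "\<dots> <= C * (M * \<bar>t\<bar>)" using E1 d1(2) by simp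
   finally have nY: "norm (Y t) <= C * M * \<bar>t\<bar>" by simp
   have "ad (Y t - t *\<^sub>R X) = (exp (t *\<^sub>R ad X) - 1 - t *\<^sub>R ad X) - (Phi (Y t) - Phi 0 - ad (Y t - 0))"
    by (simp add: Phi ad_simps)
   also have "norm \<dots> <= norm (exp (t *\<^sub>R ad X) - 1 - t *\<^sub>R ad X) + norm (Phi (Y t) - Phi 0 - ad (Y t - 0))"
    by (rule norm_triangle_ineq4)
   also have "\<dots> <= e2 * \<bar>t\<bar> + e1 * norm (Y t)" using E d2(2)[OF Ys(2), of 0] d2(1) by simp
   also have "\<dots> <= e / (2 * c) * \<bar>t\<bar> + e1 * (C * M * \<bar>t\<bar>)"
    using nY e1 by (intro add_mono mult_right_mono mult_left_mono) (auto simp: e2_def)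
   also have "\<dots> = e / c * \<bar>t\<bar>" using c d1 M by (simp add: e1_def field_simps)
   finally have "c * norm (ad (Y t - t *\<^sub>R X)) <= c * (e / c * \<bar>t\<bar>)" using c(1) by (intro mult_left_mono) simp_all
   thus ?thesis using c(2)[of "Y t - t *\<^sub>R X"] c(1) by simp
  qed
  thus ?thesis using t1 t2 by (intro exI[of _ "min \<tau>1 \<tau>2"]) auto
 qed
 have Y0: "Y 0 = 0" by (simp add: Y_def)
 have "(Y has_derivative (%t. t *\<^sub>R X)) (at 0)"
  unfolding has_derivative_at_alt using bound by (auto simp: Y0 bounded_linear_scaleR_left)
 hence "((%t. u0 + Y t) has_derivative (%t. t *\<^sub>R X)) (at 0)"
  by (auto intro!: derivative_eq_intros)
 thus ?thesis by (simp add: has_vector_derivative_def Y_def o_def)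
qed

text \<open>In a chart the path solves an autonomous equation whose right-hand side V is the
  left-invariant vector field of X, written as a derivative of the multiplication in its second
  factor.\<close>

lemma gam_smooth:
 assumes d: "d \<in> atlas G"
 shows "smooth_on {t. gam X t \<in> fst d} (snd d \<circ> gam X)"
 unfolding smooth_on_def o_def
proof
 fix n
 let ?J = "{t. gam X t \<in> fst d}" and ?S = "snd d ` fst d"
 let ?F = "%x. chart_inv d (fst x) \<otimes> \<iota> (snd x)"
 define V where "V w = frechet_derivative (%v. snd d (?F (w, v))) (at u0) X" for w
 have J: "open ?J"
  using gam_continuous[of X] chart_facts(1)[OF d] by (force simp: continuous_map)
 have F: "Ck_map k (?S \<times> \<Omega>) ?F" for k
  by (intro Ck_map_mult Ck_map_fst_iota Ck_map_snd_iota open_Times open_Omega base_chart chart_facts d)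
 have Fd: "?F (w, u0) \<in> fst d" if "w \<in> ?S" for w
  using chart_inv_in[OF d that] chart_sub_carrier[OF d] by (simp add: subset_iff)
 note pd = partial_derivative[OF chart_facts(2)[OF d] open_Omega F d u0_in Fd]
 show "Ck_on n ?J (%t. snd d (gam X t))"
 proof (rule Ck_on_ode[OF J chart_facts(2)[OF d], where V=V])
  show "Ck_on k ?S V" for k unfolding V_def by (rule pd(1))
  fix t assume t: "t \<in> ?J"
  let ?w = "snd d (gam X t)"
  have w: "?w \<in> ?S" using t by blast
  have "((%v. snd d (?F (?w, v))) has_derivative frechet_derivative (%v. snd d (?F (?w, v))) (at u0)) (at u0)"
   by (rule pd(2)[OF _ w])
  moreover have "(\<phi> \<circ> gam X) 0 = u0" by simp
  ultimately have "((%v. snd d (?F (?w, v))) \<circ> (\<phi> \<circ> gam X) has_derivative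
    frechet_derivative (%v. snd d (?F (?w, v))) (at u0) \<circ> (%s. s *\<^sub>R X)) (at 0)"
   using gam_derivative[of X] unfolding has_vector_derivative_def by (intro diff_chain_at) simp_all
  moreover have "frechet_derivative (%v. snd d (?F (?w, v))) (at u0) \<circ> (%s. s *\<^sub>R X) = (%s. s *\<^sub>R V ?w)"
   using has_derivative_linear[OF pd(2)[OF _ w]] by (auto simp: V_def linear_cmul)
  ultimately have "((%v. snd d (?F (?w, v))) \<circ> (\<phi> \<circ> gam X) has_vector_derivative V ?w) (at 0)"
   by (simp add: has_vector_derivative_def)
  hence "((%s. snd d (gam X (t + s))) has_vector_derivative V ?w) (at 0)"
  proof (rule has_vector_derivative_transform_within_open[where S="{s. gam X s \<in> fst (base_chart G)}"])
   show "open {s. gam X s \<in> fst (base_chart G)}"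
    using gam_continuous[of X] chart_facts(1)[OF base_chart(1)] by (force simp: continuous_map)
  qed (use base_chart t d in \<open>auto simp: gam(1)\<close>)
  hence "((%s. snd d (gam X (t + s))) has_vector_derivative V ?w) (at (t - t))" by simp
  hence "(((%s. snd d (gam X (t + s))) \<circ> (%s. s - t)) has_vector_derivative 1 *\<^sub>R V ?w) (at t)"
   by (intro vector_diff_chain_at) (auto intro!: derivative_eq_intros)
  thus "?w \<in> ?S \<and> ((%t. snd d (gam X t)) has_vector_derivative V ?w) (at t)"
   using w by (simp add: o_def)
 qed
qed

lemma one_param_subgroup_gam: "one_param_subgroup G (gam X)"
 unfolding one_param_subgroup_def using gam_continuous gam(1) gam_smooth by auto

text \<open>A one-parameter subgroup with velocity X has \<open>AdE\<close> equal to
  \<open>exp (t ad X)\<close>, by uniqueness in the algebra of endomorphisms, and is then determined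
  by its behaviour near 0. This gives the definite description in \<open>lie_exp\<close> a
  meaning.\<close>

lemma lie_exp_eq: "lie_exp G X = gam X 1"
proof -
 have "(THE c. one_param_subgroup G c \<and> ((\<phi> \<circ> c) has_vector_derivative X) (at 0)) = gam X"
 proof (rule the_equality)
  show "one_param_subgroup G (gam X) \<and> ((\<phi> \<circ> gam X) has_vector_derivative X) (at 0)"
   using one_param_subgroup_gam gam_derivative by blast
  fix c assume g: "one_param_subgroup G c \<and> ((\<phi> \<circ> c) has_vector_derivative X) (at 0)"
  hence hom: "!!s t. c (s + t) = c s \<otimes> c t" and cont: "continuous_map euclideanreal (topo G) c"
   and der: "((\<phi> \<circ> c) has_vector_derivative X) (at 0)" by (auto simp: one_param_subgroup_def)
  have carr: "c t \<in> carrier G" for t using cont by (auto simp: continuous_map)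
  have 0: "c 0 = \<one>" by (rule hom_power(1)[OF hom carr])
  have opn: "open {t. c t \<in> U}" if "openin (topo G) U" for U
   using cont that by (auto simp: continuous_map)
  have "0 \<in> {t. c t \<in> nball rad}" using 0 one_nball delta0 by simp
  then obtain \<tau> where tau: "\<tau> > 0" "ball 0 \<tau> \<subseteq> {t. c t \<in> nball rad}"
   using opn[OF openin_nball] open_contains_ball by blast
  have Ad: "AdE (c t) = exp (t *\<^sub>R ad X)" for t
  proof (rule exp_one_param_unique)
   show "AdE (c (s + t)) = AdE (c s) * AdE (c t)" for s t by (simp add: hom carr AdE_mult)
   show "AdE (c 0) = 1" by (simp add: 0)
   have "((%u. AdE (\<iota> u)) has_derivative ad) (at ((\<phi> \<circ> c) 0))"
    using AdE_iota_has_derivative adG_eq 0 by simp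
   hence "((%u. AdE (\<iota> u)) \<circ> (\<phi> \<circ> c) has_derivative ad \<circ> (%t. t *\<^sub>R X)) (at 0)"
    using der unfolding has_vector_derivative_def by (intro diff_chain_at)
   hence "((%u. AdE (\<iota> u)) \<circ> (\<phi> \<circ> c) has_vector_derivative ad X) (at 0)"
    by (simp add: has_vector_derivative_def o_def ad_simps)
   thus "((%t. AdE (c t)) has_vector_derivative ad X) (at 0)"
    by (rule has_vector_derivative_transform_within_open[where S="{t. c t \<in> fst (base_chart G)}"])
      (use opn[OF chart_facts(1)[OF base_chart(1)]] base_chart 0 in auto)
  qed
  show "c = gam X"
  proof (intro ext gam_unique[OF hom carr tau(1) _ Ad])
   show "c t \<in> nball rad" if "\<bar>t\<bar> < \<tau>" for t using that tau(2) by auto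
  qed
 qed
 thus ?thesis by (simp add: lie_exp_def)
qed

lemma lie_exp_scale: "lie_exp G (t *\<^sub>R X) = gam X t"
proof -
 obtain \<tau> where tau: "\<tau> > 0" "!!t. \<bar>t\<bar> <= \<tau> ==> gam X t \<in> nball rad" using gam(4)[OF delta0(1)] by blast
 have "gam X (t * s) = gam (t *\<^sub>R X) s" for s
 proof (rule gam_unique[where \<tau>="\<tau> / (\<bar>t\<bar> + 1)"])
  show "gam X (t * (a + b)) = gam X (t * a) \<otimes> gam X (t * b)" for a b by (simp add: distrib_left gam(1))
  show "AdE (gam X (t * s)) = exp (s *\<^sub>R ad (t *\<^sub>R X))" for s by (simp add: gam(3) ad_simps mult.commute)
  show "\<tau> / (\<bar>t\<bar> + 1) > 0" using tau(1) by (simp add: add_nonneg_pos)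
  show "gam X (t * s) \<in> nball rad" if "\<bar>s\<bar> < \<tau> / (\<bar>t\<bar> + 1)" for s
  proof (rule tau(2))
   have "\<bar>s\<bar> * (\<bar>t\<bar> + 1) < \<tau>" using that by (simp add: pos_less_divide_eq add_nonneg_pos)
   moreover have "\<bar>t\<bar> * \<bar>s\<bar> <= \<bar>s\<bar> * (\<bar>t\<bar> + 1)" by (simp add: algebra_simps)
   ultimately show "\<bar>t * s\<bar> <= \<tau>" by (simp add: abs_mult)
  qed
 qed (rule gam(2))
 from this[of 1] show ?thesis by (simp add: lie_exp_eq)
qed

lemma lie_exp_carrier [simp]: "lie_exp G X \<in> carrier G"
 by (simp add: lie_exp_eq gam(2))

lemma AdE_lie_exp [simp]: "AdE (lie_exp G X) = exp (ad X)"
 by (simp add: lie_exp_eq gam(3))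

lemma Ad_lie_exp: "Ad G (lie_exp G X) Y = exp (ad X) \<cdot> Y"
 using AdE_app[OF lie_exp_carrier, of X Y] by simp

lemma lie_exp_add: "lie_exp G ((s + t) *\<^sub>R X) = lie_exp G (s *\<^sub>R X) \<otimes> lie_exp G (t *\<^sub>R X)"
 by (simp only: lie_exp_scale gam(1))

lemma lie_exp_0 [simp]: "lie_exp G 0 = \<one>"
 using lie_exp_scale[of 0 0] by simp

lemma lie_exp_minus: "lie_exp G X \<otimes> lie_exp G (- X) = \<one>"
 using lie_exp_add[of 1 "-1" X] by simp

lemma inv_lie_exp: "inv (lie_exp G X) = lie_exp G (- X)"
 using lie_exp_minus[of "- X"] by (intro inv_equality) simp_all

lemma exp_conj_endo:
 assumes "S * T = (1::'e endo)" "T * S = 1"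
 shows "T * exp A * S = exp (T * A * S)"
proof (rule endo_eqI)
 fix x
 have 1: "S \<cdot> T \<cdot> y = y" "T \<cdot> S \<cdot> y = y" for y using assms app_mult app_one by metis+
 have "T \<cdot> exp A \<cdot> S \<cdot> x = exp (T * A * S) \<cdot> T \<cdot> S \<cdot> x"
  by (rule exp_intertwine[OF linear_app subspace_UNIV]) (simp_all add: 1)
 thus "(T * exp A * S) \<cdot> x = exp (T * A * S) \<cdot> x" by (simp add: 1)
qed

lemma lie_exp_conj:
 assumes g: "g \<in> carrier G"
 shows "g \<otimes> lie_exp G X \<otimes> inv g = lie_exp G (Ad G g X)"
proof -
 have "openin (topo G) {h \<in> topspace (topo G). g \<otimes> h \<otimes> inv g \<in> nball rad}"
  using g openin_nball by (intro openin_continuous_map_preimage[OF continuous_map_mult] continuous_map_mult) auto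
 moreover have "\<one> \<in> {h \<in> topspace (topo G). g \<otimes> h \<otimes> inv g \<in> nball rad}" using g one_nball delta0 by simp
 ultimately obtain r where r: "r > 0" "nball r \<subseteq> {h \<in> topspace (topo G). g \<otimes> h \<otimes> inv g \<in> nball rad}"
  using nball_subset by blast
 obtain \<tau> where tau: "\<tau> > 0" "!!t. \<bar>t\<bar> <= \<tau> ==> gam X t \<in> nball r" using gam(4)[OF r(1)] by blast
 have "g \<otimes> gam X t \<otimes> inv g = gam (Ad G g X) t" for t
 proof (rule gam_unique[OF _ _ tau(1)])
  show "g \<otimes> gam X (s + t) \<otimes> inv g = (g \<otimes> gam X s \<otimes> inv g) \<otimes> (g \<otimes> gam X t \<otimes> inv g)" for s t
  proof -
   have "(g \<otimes> gam X s \<otimes> inv g) \<otimes> (g \<otimes> gam X t \<otimes> inv g) = g \<otimes> gam X s \<otimes> (inv g \<otimes> g) \<otimes> gam X t \<otimes> inv g"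
    using g gam(2) by (simp only: m_assoc m_closed inv_closed)
   thus ?thesis using g gam(2) by (simp add: gam(1) m_assoc)
  qed
  show "g \<otimes> gam X t \<otimes> inv g \<in> carrier G" for t using g gam(2) by simp
  show "g \<otimes> gam X t \<otimes> inv g \<in> nball rad" if "\<bar>t\<bar> < \<tau>" for t using tau(2)[of t] r(2) that by auto
  show "AdE (g \<otimes> gam X t \<otimes> inv g) = exp (t *\<^sub>R ad (Ad G g X))" for t
  proof -
   have "AdE (g \<otimes> gam X t \<otimes> inv g) = AdE g * exp (t *\<^sub>R ad X) * AdE (inv g)"
    using g gam(2) by (simp add: AdE_mult gam(3))
   also have "\<dots> = exp (AdE g * (t *\<^sub>R ad X) * AdE (inv g))" by (rule exp_conj_endo) (simp_all add: g)
   finally show ?thesis using adG_Ad[OF g, of X] adG_eq by simp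
  qed
 qed
 thus ?thesis by (simp add: lie_exp_eq)
qed

lemma lie_exp_near:
 assumes "openin (topo G) U" "\<one> \<in> U"
 obtains r where "r > 0" "!!X. norm X < r ==> lie_exp G X \<in> U"
proof -
 obtain q where q: "q > 0" "nball q \<subseteq> U" using nball_subset[OF assms] by blast
 define q' where "q' = min q rad"
 have q': "q' > 0" "nball q' \<subseteq> nball q" "nball q' \<subseteq> nball rad"
  using q delta0 by (auto simp: q'_def intro!: nball_mono)
 obtain s where s: "s > 0" "!!X \<tau>. \<tau> > 0 ==> (!!t. \<bar>t\<bar> <= \<tau> ==> norm (exp (t *\<^sub>R ad X) - 1) < s) ==>
   \<exists>c. (\<forall>s t. c (s + t) = c s \<otimes> c t) \<and> (\<forall>t. c t \<in> carrier G) \<and> (\<forall>t. AdE (c t) = exp (t *\<^sub>R ad X)) \<and>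
   (\<forall>t. \<bar>t\<bar> <= \<tau> --> c t \<in> nball q')"
  by (rule one_param_local[OF q'(1)]) blast
 obtain d where d: "d > 0" "!!A :: 'e endo. norm A <= d ==> norm (exp A - 1) < s"
  using exp_near_one[OF s(1)] by blast
 obtain Ca where Ca: "Ca > 0" "!!X. norm (ad X) <= Ca * norm X" using ad_bound by blast
 have "lie_exp G X \<in> U" if X: "norm X < d / Ca" for X
 proof -
  have small: "norm (exp (t *\<^sub>R ad X) - 1) < s" if "\<bar>t\<bar> <= 1" for t
  proof (rule d(2))
   have "norm (t *\<^sub>R ad X) <= 1 * norm (ad X)" using that by (simp add: mult_left_le_one_le)
   also have "\<dots> <= Ca * norm X" using Ca(2) by simp
   also have "\<dots> <= d" using X Ca(1) by (simp add: field_simps)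
   finally show "norm (t *\<^sub>R ad X) <= d" .
  qed
  obtain c where c: "!!s t. c (s + t) = c s \<otimes> c t" "!!t. c t \<in> carrier G" "!!t. AdE (c t) = exp (t *\<^sub>R ad X)"
   "!!t. \<bar>t\<bar> <= 1 ==> c t \<in> nball q'" using s(2)[OF zero_less_one small] by blast
  have "c 1 = gam X 1"
   by (rule gam_unique[OF c(1,2) zero_less_one _ c(3)]) (use c(4) q'(3) in auto)
  thus ?thesis using c(4)[of 1] q'(2) q(2) by (auto simp: lie_exp_eq)
 qed
 thus ?thesis using that[of "d / Ca"] d(1) Ca(1) by simp
qed

text \<open>If g is near the identity, \<open>AdE g\<close> is an automorphism near 1, hence
  \<open>exp (ad X)\<close> with X small. Both g and \<open>lie_exp G X\<close> then lie in
  \<open>nball rad\<close>, so they coincide.\<close>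

lemma lie_exp_nbhd: obtains U where "openin (topo G) U" "\<one> \<in> U" "U \<subseteq> range (lie_exp G)"
proof -
 obtain r where r: "r > 0" "!!X. norm X < r ==> lie_exp G X \<in> nball rad"
  using lie_exp_near[OF openin_nball one_nball] delta0 by blast
 obtain s where s: "s > 0" "!!T. aut T ==> norm (T - 1) < s ==> \<exists>X. norm X < r \<and> exp (ad X) = T"
  using ad_local_parametrization[of "%X. exp (ad X)" r] strict_at_0_exp[OF bounded_linear_ad] r(1) aut_exp_ad by (auto simp: ad_simps)
 define U where "U = nball rad \<inter> {g \<in> topspace (topo G). AdE g \<in> ball 1 s}"
 have "openin (topo G) U" unfolding U_def
  by (intro openin_Int openin_nball openin_continuous_map_preimage[OF continuous_AdE]) simp
 moreover have "\<one> \<in> U" using s(1) one_nball delta0 by (simp add: U_def)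
 moreover have "U \<subseteq> range (lie_exp G)"
 proof
  fix g assume g: "g \<in> U"
  hence "aut (AdE g)" "norm (AdE g - 1) < s" by (auto simp: U_def aut_AdE dist_norm norm_minus_commute)
  then obtain X where X: "norm X < r" "exp (ad X) = AdE g" using s(2) by blast
  hence "g = lie_exp G X" using g r(2) by (intro delta0(2)) (auto simp: U_def)
  thus "g \<in> range (lie_exp G)" by blast
 qed
 ultimately show ?thesis using that by blast
qed

text \<open>An induction principle for the group: a set absorbing exponentials on the right is open,
  and so is its complement, because exponentials have inverses of the same kind. Connectedness
  finishes.\<close>

lemma lie_exp_generates:
 assumes S: "S \<subseteq> carrier G" "\<one> \<in> S" and step: "!!g X. g \<in> S ==> g \<otimes> lie_exp G X \<in> S"
 shows "S = carrier G"
proof -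
 obtain U where U: "openin (topo G) U" "\<one> \<in> U" "U \<subseteq> range (lie_exp G)" using lie_exp_nbhd by blast
 have nb: "\<exists>T. openin (topo G) T \<and> g \<in> T \<and> T \<subseteq> R"
  if R: "g \<in> R" "R \<subseteq> carrier G" "!!X. g \<otimes> lie_exp G X \<in> R" for g R
 proof -
  have g: "g \<in> carrier G" using R by blast
  let ?T = "{h \<in> topspace (topo G). inv g \<otimes> h \<in> U}"
  have "openin (topo G) ?T" using g U(1)
   by (intro openin_continuous_map_preimage[OF continuous_map_mult]) auto
  moreover have "g \<in> ?T" using g U(2) by simp
  moreover have "?T \<subseteq> R"
  proof
   fix h assume h: "h \<in> ?T"
   then obtain X where "inv g \<otimes> h = lie_exp G X" using U(3) by blast
   hence "h = g \<otimes> lie_exp G X" using g h by (metis (no_types, lifting) inv_solve_left lie_exp_carrier mem_Collect_eq topspace_eq)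
   thus "h \<in> R" using R(3) by simp
  qed
  ultimately show ?thesis by blast
 qed
 have "openin (topo G) S" by (subst openin_subopen, intro ballI nb step) (use S in auto)
 moreover have "openin (topo G) (carrier G - S)"
 proof (subst openin_subopen, intro ballI nb)
  fix g X assume g: "g \<in> carrier G - S"
  have "g \<otimes> lie_exp G X \<notin> S"
  proof
   assume "g \<otimes> lie_exp G X \<in> S"
   hence "g \<otimes> lie_exp G X \<otimes> lie_exp G (- X) \<in> S" by (rule step)
   thus False using g by (simp add: m_assoc lie_exp_minus)
  qed
  thus "g \<otimes> lie_exp G X \<in> carrier G - S" using g by simp
 qed auto
 hence "closedin (topo G) S" using S by (simp add: closedin_def)
 ultimately have "S = {} \<or> S = topspace (topo G)"
  using connected by (simp add: connected_space_clopen_in)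
 thus ?thesis using S by auto
qed

lemma AdE_kernel:
 assumes g: "g \<in> carrier G" "AdE g = 1"
 shows "g \<in> group_center G"
proof -
 have comm: "g \<otimes> lie_exp G X = lie_exp G X \<otimes> g" for X
 proof -
  have "Ad G g X = X" using AdE_app[OF g(1), of X] g(2) by simp
  hence "g \<otimes> lie_exp G X \<otimes> inv g = lie_exp G X" using lie_exp_conj[OF g(1), of X] by simp
  thus ?thesis using g(1) by (metis inv_closed inv_inv lie_exp_carrier inv_solve_right m_closed)
 qed
 have "{h \<in> carrier G. g \<otimes> h = h \<otimes> g} = carrier G"
 proof (rule lie_exp_generates)
  fix h X assume h: "h \<in> {h \<in> carrier G. g \<otimes> h = h \<otimes> g}"
  hence "g \<otimes> (h \<otimes> lie_exp G X) = h \<otimes> (g \<otimes> lie_exp G X)" using g(1) by (simp flip: m_assoc)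
  thus "h \<otimes> lie_exp G X \<in> {h \<in> carrier G. g \<otimes> h = h \<otimes> g}"
   using h g(1) by (simp add: comm m_assoc)
 qed (use g in auto)
 thus ?thesis using g by (auto simp: group_center_def)
qed

lemma compact_nbhd: obtains C U where "compactin (topo G) C" "openin (topo G) U" "\<one> \<in> U" "U \<subseteq> C"
proof -
 obtain e where d: "e > 0" "!!X. norm X <= e ==> u0 + X \<in> \<Omega>" using chart_ball by blast
 have sub: "cball u0 e \<subseteq> \<Omega>"
 proof
  fix u assume "u \<in> cball u0 e"
  thus "u \<in> \<Omega>" using d(2)[of "u - u0"] by (simp add: dist_norm norm_minus_commute)
 qed
 have "compactin (top_of_set \<Omega>) (cball u0 e)" using sub by (simp add: compactin_subtopology)
 hence "compactin (topo G) (\<iota> ` cball u0 e)"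
  by (rule image_compactin[OF _ chart_inv_continuous[OF base_chart(1)]])
 moreover have "nball e \<subseteq> \<iota> ` cball u0 e"
 proof
  fix g assume g: "g \<in> nball e"
  hence "g = \<iota> (\<phi> g)" "\<phi> g \<in> cball u0 e"
   using base_chart(1) by (auto simp: nball_def dist_norm norm_minus_commute)
  thus "g \<in> \<iota> ` cball u0 e" by blast
 qed
 ultimately show ?thesis using that openin_nball one_nball[OF d(1)] by blast
qed

lemma exp_ad_inj:
 assumes "!!t. exp (t *\<^sub>R ad X) = exp (t *\<^sub>R ad Y)"
 shows "X = Y"
proof -
 have "((%t. exp (t *\<^sub>R ad X)) has_vector_derivative ad X) (at 0)" for X
  using exp_scaleR_has_vector_derivative_right[of "ad X" 0 UNIV] by simp
 from this[of X] this[of Y] have "ad X = ad Y"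
  unfolding assms by (rule vector_derivative_unique_at)
 thus ?thesis by (metis killing_part_ad)
qed

end

section \<open>Restricted roots\<close>

lemma (in inner_form) orthogonal_family_finite:
 assumes "0 \<notin> S" "!!x y. x \<in> S ==> y \<in> S ==> x ~= y ==> Q x y = 0"
 shows "finite S"
proof -
 have "independent S"
  unfolding dependent_def
 proof clarify
  fix v assume v: "v \<in> S" "v \<in> span (S - {v})"
  have "subspace {w. Q v w = 0}" by (auto simp: subspace_def Q_simps)
  hence "span (S - {v}) \<subseteq> {w. Q v w = 0}"
   by (rule span_minimal[rotated]) (use assms(2) v in auto)
  hence "Q v v = 0" using v by blast
  thus False using v assms(1) by simp
 qed
 thus ?thesis using independent_bound by blast
qed

locale lie_root = lie_cartan G k p for G :: "('g, 'e::euclidean_space) lie_data" (structure) and k p :: "'e set" +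
 fixes a :: "'e set" and \<Phi> :: "('e => real) set"
 assumes max_abelian: "maximal_abelian_subspace_of G p a" and pos_system: "positive_system G a \<Phi>"
begin

abbreviation "br \<equiv> bracket G"
abbreviation "rs \<equiv> root_space G a"
abbreviation "R \<equiv> restricted_roots G a"

lemma subspace_a: "subspace a" and a_p: "H \<in> a ==> H \<in> p" and br_aa: "H \<in> a ==> H' \<in> a ==> br H H' = 0"
 using max_abelian by (auto simp: maximal_abelian_subspace_of_def abelian_subspace_of_def)

lemma a_maximal:
 assumes Y: "Y \<in> p" "!!H. H \<in> a ==> br H Y = 0"
 shows "Y \<in> a"
proof -
 let ?b = "{H + c *\<^sub>R Y | H c. H \<in> a}"
 have "subspace ?b"
  unfolding subspace_def
 proof (intro conjI ballI allI)
  show "0 \<in> ?b" using subspace_0[OF subspace_a] by (auto intro!: exI[of _ 0] exI[of _ "0::real"])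
  fix x y assume "x \<in> ?b" "y \<in> ?b"
  then obtain H c H' c' where e: "x = H + c *\<^sub>R Y" "H \<in> a" "y = H' + c' *\<^sub>R Y" "H' \<in> a" by blast
  have "x + y = (H + H') + (c + c') *\<^sub>R Y" using e by (simp add: algebra_simps)
  thus "x + y \<in> ?b" using e subspace_add[OF subspace_a] by blast
 next
  fix r x assume "x \<in> ?b"
  then obtain H c where e: "x = H + c *\<^sub>R Y" "H \<in> a" by blast
  have "r *\<^sub>R x = r *\<^sub>R H + (r * c) *\<^sub>R Y" using e by (simp add: algebra_simps)
  thus "r *\<^sub>R x \<in> ?b" using e subspace_scale[OF subspace_a] by blast
 qed
 moreover have "?b \<subseteq> p" using a_p Y(1) subspace_p by (auto intro!: subspace_add subspace_scale)
 moreover have "br x y = 0" if xy: "x \<in> ?b" "y \<in> ?b" for x y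
 proof -
  obtain H c H' c' where e: "x = H + c *\<^sub>R Y" "H \<in> a" "y = H' + c' *\<^sub>R Y" "H' \<in> a" using xy by blast
  have "br Y H' = 0" using Y(2)[OF e(4)] br_antisym[of Y H'] by simp
  thus ?thesis using e Y(2) br_aa by (simp add: br_simps)
 qed
 moreover have "a \<subseteq> ?b" by (auto intro!: exI[of _ "0::real"])
 ultimately have "?b = a"
  using max_abelian unfolding maximal_abelian_subspace_of_def abelian_subspace_of_def by blast
 moreover have "Y \<in> ?b" using subspace_0[OF subspace_a] by (force intro!: exI[of _ 0] exI[of _ "1::real"])
 ultimately show ?thesis by simp
qed

lemma rsD: "X \<in> rs \<alpha> ==> H \<in> a ==> br H X = \<alpha> H *\<^sub>R X"
 by (simp add: root_space_def)

lemma subspace_rs: "subspace (rs \<alpha>)"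
 by (auto simp: subspace_def root_space_def br_simps scaleR_add_right)

lemma root_ext: "\<alpha> \<in> R ==> \<alpha> \<in> extensional a"
 by (simp add: restricted_roots_def)

lemma root_vector: assumes "\<alpha> \<in> R" obtains E where "E \<in> rs \<alpha>" "E ~= 0"
 using assms by (auto simp: restricted_roots_def)

lemma root_linear:
 assumes "\<alpha> \<in> R" "H \<in> a" "H' \<in> a"
 shows "\<alpha> (H + H') = \<alpha> H + \<alpha> H'" "\<alpha> (H - H') = \<alpha> H - \<alpha> H'" "\<alpha> (c *\<^sub>R H) = c * \<alpha> H" "\<alpha> (- H) = - \<alpha> H" "\<alpha> 0 = 0"
proof -
 obtain E where E: "E \<in> rs \<alpha>" "E ~= 0" using root_vector[OF assms(1)] by blast
 note sub = subspace_add[OF subspace_a assms(2,3)] subspace_diff[OF subspace_a assms(2,3)]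
  subspace_scale[OF subspace_a assms(2), of c] subspace_neg[OF subspace_a assms(2)] subspace_0[OF subspace_a]
 have e: "\<alpha> h *\<^sub>R E = br h E" if "h \<in> a" for h using rsD[OF E(1) that] by simp
 have "\<alpha> (H + H') *\<^sub>R E = (\<alpha> H + \<alpha> H') *\<^sub>R E" "\<alpha> (H - H') *\<^sub>R E = (\<alpha> H - \<alpha> H') *\<^sub>R E"
  "\<alpha> (c *\<^sub>R H) *\<^sub>R E = (c * \<alpha> H) *\<^sub>R E" "\<alpha> (- H) *\<^sub>R E = (- \<alpha> H) *\<^sub>R E" "\<alpha> 0 *\<^sub>R E = 0 *\<^sub>R E"
  by (simp_all only: scaleR_add_left scaleR_diff_left scaleR_minus_left scaleR_zero_left br_simps
    e[OF assms(2)] e[OF assms(3)] e[OF sub(1)] e[OF sub(2)] e[OF sub(3)] e[OF sub(4)] e[OF sub(5)] flip: scaleR_scaleR)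
 thus "\<alpha> (H + H') = \<alpha> H + \<alpha> H'" "\<alpha> (H - H') = \<alpha> H - \<alpha> H'" "\<alpha> (c *\<^sub>R H) = c * \<alpha> H"
  "\<alpha> (- H) = - \<alpha> H" "\<alpha> 0 = 0" using E(2) by (simp_all only: scaleR_cancel_right) simp_all
qed

text \<open>The zero weight is treated like a root wherever possible; its space is the centralizer of \<open>a\<close>.\<close>

definition zero_wt :: "'e => real" where "zero_wt = (\<lambda>H\<in>a. 0)"

definition wts :: "('e => real) set" where "wts = insert zero_wt R"

lemma rs_zero_wt: "X \<in> rs zero_wt \<longleftrightarrow> (\<forall>H\<in>a. br H X = 0)"
 by (simp add: root_space_def zero_wt_def)

lemma wts_ext: "\<alpha> \<in> wts ==> \<alpha> \<in> extensional a"
 by (auto simp: wts_def root_ext zero_wt_def)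

lemma wt_ext_eq: "\<alpha> \<in> extensional a ==> \<beta> \<in> extensional a ==> (!!H. H \<in> a ==> \<alpha> H = \<beta> H) ==> \<alpha> = \<beta>"
 by (auto intro: extensionalityI)

lemma wts_iff: "\<alpha> \<in> extensional a ==> X \<in> rs \<alpha> ==> X ~= 0 ==> \<alpha> \<in> wts"
 unfolding wts_def restricted_roots_def zero_wt_def
 by (auto intro!: extensionalityI[of _ a])

lemma rs_orthogonal:
 assumes "\<alpha> \<in> extensional a" "\<beta> \<in> extensional a" "\<alpha> ~= \<beta>" "X \<in> rs \<alpha>" "Y \<in> rs \<beta>"
 shows "Q X Y = 0"
proof -
 obtain H where H: "H \<in> a" "\<alpha> H ~= \<beta> H" using wt_ext_eq assms by metis
 have "\<alpha> H * Q X Y = \<beta> H * Q X Y"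
  using Q_br_p[OF a_p[OF H(1)], of X Y] rsD[OF assms(4) H(1)] rsD[OF assms(5) H(1)] by (simp add: Q_simps)
 thus ?thesis using H(2) by simp
qed

text \<open>The operators \<open>br H\<close> with H in \<open>a\<close> commute and are symmetric
  for \<open>Q\<close>, so they can be diagonalized simultaneously; a common eigenvector defines its
  weight.\<close>

lemma span_rs: "span (\<Union>\<alpha>\<in>wts. rs \<alpha>) = UNIV"
proof -
 let ?F = "bracket G ` a"
 have "span {v. \<forall>S\<in>?F. \<exists>l. S v = l *\<^sub>R v} = UNIV"
 proof (rule commuting_symmetric_spectral)
  show "linear S" if "S \<in> ?F" for S using that bracket_bilinear by (auto simp: bilinear_def)
  show "Q (S x) y = Q x (S y)" if "S \<in> ?F" for S x y using that Q_br_p a_p by auto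
  show "S (T x) = T (S x)" if ST: "S \<in> ?F" "T \<in> ?F" for S T x
  proof -
   obtain H H' where "H \<in> a" "H' \<in> a" "S = br H" "T = br H'" using ST by blast
   thus ?thesis using bracket_leibniz[of H H' x] br_aa[of H H'] by (simp add: br_simps)
  qed
 qed
 moreover have "{v. \<forall>S\<in>?F. \<exists>l. S v = l *\<^sub>R v} \<subseteq> (\<Union>\<alpha>\<in>wts. rs \<alpha>)"
 proof
  fix v assume "v \<in> {v. \<forall>S\<in>?F. \<exists>l. S v = l *\<^sub>R v}"
  hence "\<forall>H\<in>a. \<exists>l. br H v = l *\<^sub>R v" by auto
  then obtain l where l: "!!H. H \<in> a ==> br H v = l H *\<^sub>R v" by metis
  show "v \<in> (\<Union>\<alpha>\<in>wts. rs \<alpha>)"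
  proof (cases "v = 0")
   case True
   thus ?thesis using subspace_0[OF subspace_rs] by (auto simp: wts_def)
  next
   case False
   have "v \<in> rs (restrict l a)" using l by (simp add: root_space_def)
   thus ?thesis using wts_iff[OF restrict_extensional _ False] by blast
  qed
 qed
 ultimately show ?thesis using span_mono[of "{v. \<forall>S\<in>?F. \<exists>l. S v = l *\<^sub>R v}" "\<Union>\<alpha>\<in>wts. rs \<alpha>"] by simp blast
qed

lemma finite_R: "finite R"
proof -
 have "\<forall>\<alpha>\<in>R. \<exists>E. E \<in> rs \<alpha> \<and> E ~= 0" using root_vector by metis
 then obtain E where E: "!!\<alpha>. \<alpha> \<in> R ==> E \<alpha> \<in> rs \<alpha>" "!!\<alpha>. \<alpha> \<in> R ==> E \<alpha> ~= 0" by metis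
 have orth: "Q (E \<alpha>) (E \<beta>) = 0" if "\<alpha> \<in> R" "\<beta> \<in> R" "\<alpha> ~= \<beta>" for \<alpha> \<beta>
  using rs_orthogonal[OF root_ext root_ext] that E by blast
 have inj: "inj_on E R"
 proof (rule inj_onI, rule ccontr)
  fix \<alpha> \<beta> assume ab: "\<alpha> \<in> R" "\<beta> \<in> R" "E \<alpha> = E \<beta>" "\<alpha> ~= \<beta>"
  hence "Q (E \<alpha>) (E \<alpha>) = 0" using orth by metis
  thus False using E(2) ab(1) by simp
 qed
 have "finite (E ` R)"
 proof (rule orthogonal_family_finite)
  show "0 \<notin> E ` R" using E(2) by fastforce
  fix x y assume "x \<in> E ` R" "y \<in> E ` R" "x ~= y"
  thus "Q x y = 0" using orth by blast
 qed
 thus ?thesis using inj finite_imageD by blast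
qed

text \<open>Roots are compared as functions, so the operations on functionals must return
  extensional ones.\<close>

definition wneg :: "('e => real) => 'e => real" where "wneg \<alpha> = (\<lambda>H\<in>a. - \<alpha> H)"
definition wadd :: "('e => real) => ('e => real) => 'e => real" where "wadd \<alpha> \<beta> = (\<lambda>H\<in>a. \<alpha> H + \<beta> H)"
definition wscale :: "real => ('e => real) => 'e => real" where "wscale c \<alpha> = (\<lambda>H\<in>a. c * \<alpha> H)"

lemma w_ext [simp]: "wneg \<alpha> \<in> extensional a" "wadd \<alpha> \<beta> \<in> extensional a" "wscale c \<alpha> \<in> extensional a" "zero_wt \<in> extensional a"
 by (simp_all add: wneg_def wadd_def wscale_def zero_wt_def)

lemma w_app [simp]: "H \<in> a ==> wneg \<alpha> H = - \<alpha> H" "H \<in> a ==> wadd \<alpha> \<beta> H = \<alpha> H + \<beta> H"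
 "H \<in> a ==> wscale c \<alpha> H = c * \<alpha> H" "H \<in> a ==> zero_wt H = 0"
 by (simp_all add: wneg_def wadd_def wscale_def zero_wt_def)

lemma br_rs: "X \<in> rs \<alpha> ==> Y \<in> rs \<beta> ==> br X Y \<in> rs (wadd \<alpha> \<beta>)"
proof -
 assume X: "X \<in> rs \<alpha>" and Y: "Y \<in> rs \<beta>"
 have "br H (br X Y) = (\<alpha> H + \<beta> H) *\<^sub>R br X Y" if H: "H \<in> a" for H
  using bracket_leibniz[of H X Y] rsD[OF X H] rsD[OF Y H] by (simp add: br_simps scaleR_add_left)
 thus "br X Y \<in> rs (wadd \<alpha> \<beta>)" by (simp add: root_space_def)
qed

lemma theta_rs: "X \<in> rs \<alpha> ==> \<theta> X \<in> rs (wneg \<alpha>)"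
proof -
 assume X: "X \<in> rs \<alpha>"
 have "br H (\<theta> X) = - \<alpha> H *\<^sub>R \<theta> X" if H: "H \<in> a" for H
 proof -
  have "br H (\<theta> X) = \<theta> (br (\<theta> H) X)" by (simp add: theta_br)
  thus ?thesis using rsD[OF X H] theta_p[OF a_p[OF H]] by (simp add: br_simps theta_simps)
 qed
 thus "\<theta> X \<in> rs (wneg \<alpha>)" by (simp add: root_space_def)
qed

lemma root_rootI: "\<alpha> \<in> extensional a ==> X \<in> rs \<alpha> ==> X ~= 0 ==> \<alpha> ~= zero_wt ==> \<alpha> \<in> R"
 using wts_iff by (auto simp: wts_def)

lemma wneg_root: "\<alpha> \<in> R ==> wneg \<alpha> \<in> R"
proof -
 assume R: "\<alpha> \<in> R"
 obtain E where E: "E \<in> rs \<alpha>" "E ~= 0" using root_vector[OF R] by blast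
 obtain H where "H \<in> a" "\<alpha> H ~= 0" using R by (auto simp: restricted_roots_def)
 hence "wneg \<alpha> ~= zero_wt" by (metis neg_equal_0_iff_equal w_app(1,4))
 moreover have "\<theta> E ~= 0" using E(2) by (metis theta_theta theta_simps(5))
 ultimately show "wneg \<alpha> \<in> R" using root_rootI[OF _ theta_rs[OF E(1)]] by simp
qed

lemma wneg_wneg [simp]: "\<alpha> \<in> extensional a ==> wneg (wneg \<alpha>) = \<alpha>"
 by (rule wt_ext_eq) auto

definition hv :: "('e => real) => 'e" where "hv \<alpha> = (SOME h. h \<in> a \<and> (\<forall>H\<in>a. kil h H = \<alpha> H))"

lemma br_E_theta:
 assumes "\<alpha> \<in> extensional a" "E \<in> rs \<alpha>"
 shows "br E (\<theta> E) \<in> a" "H \<in> a ==> kil (br E (\<theta> E)) H = - \<alpha> H * Q E E"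
proof -
 show "br E (\<theta> E) \<in> a"
 proof (rule a_maximal)
  have "\<theta> (br E (\<theta> E)) = - br E (\<theta> E)" using br_antisym[of "\<theta> E" E] by (simp add: theta_br)
  thus "br E (\<theta> E) \<in> p" by (rule theta_neg)
  fix H assume "H \<in> a"
  thus "br H (br E (\<theta> E)) = 0" using rsD[OF br_rs[OF assms(2) theta_rs[OF assms(2)]]] by simp
 qed
 show "kil (br E (\<theta> E)) H = - \<alpha> H * Q E E" if H: "H \<in> a"
 proof -
  have "br (\<theta> E) H = \<alpha> H *\<^sub>R \<theta> E" using br_antisym[of "\<theta> E" H] rsD[OF theta_rs[OF assms(2)] H] H by simp
  thus ?thesis using kil_invariant[of E "\<theta> E" H] by (simp add: kil_simps Q_def)
 qed
qed

text \<open>For a root vector E the bracket of E and \<open>\<theta> E\<close> lies in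
  \<open>a\<close> by maximality, and up to the factor \<open>- Q E E\<close> it represents the
  root.\<close>

lemma hv:
 assumes "\<alpha> \<in> R"
 shows "hv \<alpha> \<in> a" "H \<in> a ==> kil (hv \<alpha>) H = \<alpha> H"
proof -
 obtain E where E: "E \<in> rs \<alpha>" "E ~= 0" using root_vector[OF assms] by blast
 note b = br_E_theta[OF root_ext[OF assms] E(1)]
 let ?h = "(- 1 / Q E E) *\<^sub>R br E (\<theta> E)"
 have "?h \<in> a \<and> (\<forall>H\<in>a. kil ?h H = \<alpha> H)"
  using b E(2) subspace_scale[OF subspace_a] subspace_neg[OF subspace_a] by (simp add: kil_simps)
 hence "\<exists>h. h \<in> a \<and> (\<forall>H\<in>a. kil h H = \<alpha> H)" by blast
 from someI_ex[OF this] show "hv \<alpha> \<in> a" "H \<in> a ==> kil (hv \<alpha>) H = \<alpha> H"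
  unfolding hv_def by auto
qed

lemma a_eqI:
 assumes "X \<in> a" "Y \<in> a" "!!H. H \<in> a ==> kil X H = kil Y H"
 shows "X = Y"
proof -
 have "X - Y \<in> a" using assms subspace_diff[OF subspace_a] by blast
 hence "Q (X - Y) (X - Y) = 0" using assms(3)[of "X - Y"] a_p by (simp add: Q_p kil_simps)
 thus ?thesis by simp
qed

lemma br_E_theta_hv:
 assumes "\<alpha> \<in> R" "E \<in> rs \<alpha>"
 shows "br E (\<theta> E) = - Q E E *\<^sub>R hv \<alpha>"
proof (rule a_eqI)
 show "br E (\<theta> E) \<in> a" by (rule br_E_theta[OF root_ext[OF assms(1)] assms(2)])
 show "- Q E E *\<^sub>R hv \<alpha> \<in> a" using hv(1)[OF assms(1)] subspace_scale[OF subspace_a] by blast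
 show "kil (br E (\<theta> E)) H = kil (- Q E E *\<^sub>R hv \<alpha>) H" if "H \<in> a" for H
  using br_E_theta(2)[OF root_ext[OF assms(1)] assms(2) that] hv(2)[OF assms(1) that] by (simp add: kil_simps)
qed

lemma root_hv_pos: "\<alpha> \<in> R ==> \<alpha> (hv \<alpha>) > 0"
proof -
 assume R: "\<alpha> \<in> R"
 obtain H where H: "H \<in> a" "\<alpha> H ~= 0" using R by (auto simp: restricted_roots_def)
 have "hv \<alpha> ~= 0" using hv(2)[OF R H(1)] H(2) by (auto simp: kil_simps)
 hence "Q (hv \<alpha>) (hv \<alpha>) > 0" by (rule Q_pos)
 thus ?thesis using hv[OF R] a_p by (simp add: Q_p)
qed

text \<open>For root vectors E and X the square length of \<open>br (\<theta> E) X\<close> equals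
  \<open>Q E E * \<beta> (hv \<alpha>) * Q X X\<close> plus the square length of
  \<open>br E X\<close>. It is positive, so this bracket is a root vector for the difference; no
  root strings enter.\<close>

lemma root_diff:
 assumes R: "\<alpha> \<in> R" "\<beta> \<in> R" "\<alpha> ~= \<beta>" "\<beta> (hv \<alpha>) > 0"
 shows "wadd \<beta> (wneg \<alpha>) \<in> R"
proof -
 obtain E where E: "E \<in> rs \<alpha>" "E ~= 0" using root_vector[OF R(1)] by blast
 obtain X where X: "X \<in> rs \<beta>" "X ~= 0" using root_vector[OF R(2)] by blast
 let ?Y = "br (\<theta> E) X" and ?Z = "br E X"
 have "Q ?Y ?Y = - Q X (br E ?Y)" by (simp add: Q_br)
 also have "br E ?Y = br (br E (\<theta> E)) X + br (\<theta> E) ?Z" by (rule bracket_leibniz)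
 also have "br (br E (\<theta> E)) X = - Q E E *\<^sub>R (\<beta> (hv \<alpha>) *\<^sub>R X)"
  using br_E_theta_hv[OF R(1) E(1)] rsD[OF X(1) hv(1)[OF R(1)]] by (simp add: br_simps)
 also have "Q X (- Q E E *\<^sub>R (\<beta> (hv \<alpha>) *\<^sub>R X) + br (\<theta> E) ?Z) = - Q E E * \<beta> (hv \<alpha>) * Q X X - Q ?Z ?Z"
  using Q_br[of "\<theta> E" ?Z X] Q_sym[of X "br (\<theta> E) ?Z"] by (simp add: Q_simps)
 finally have "Q ?Y ?Y = Q E E * \<beta> (hv \<alpha>) * Q X X + Q ?Z ?Z" by simp
 moreover have "Q E E * \<beta> (hv \<alpha>) * Q X X > 0" using Q_pos E X R(4) by simp
 ultimately have "Q ?Y ?Y > 0" using Q_nonneg[of ?Z] by linarith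
 hence Y: "?Y ~= 0" by (auto simp: Q_simps)
 have "?Y \<in> rs (wadd (wneg \<alpha>) \<beta>)" by (rule br_rs[OF theta_rs[OF E(1)] X(1)])
 moreover have eq: "wadd (wneg \<alpha>) \<beta> = wadd \<beta> (wneg \<alpha>)" by (rule wt_ext_eq) auto
 moreover have "wadd \<beta> (wneg \<alpha>) ~= zero_wt"
 proof
  assume *: "wadd \<beta> (wneg \<alpha>) = zero_wt"
  have "\<alpha> H = \<beta> H" if "H \<in> a" for H
   using fun_cong[OF *, of H] that by simp
  hence "\<alpha> = \<beta>" by (intro wt_ext_eq root_ext R)
  thus False using R(3) by simp
 qed
 ultimately show ?thesis using root_rootI[OF _ _ Y] by simp
qed

text \<open>One regular element is fixed among those that define the positive system. It orders the
  roots, and its conjugates are the vectors attached to opposite pairs.\<close>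

definition H0 :: 'e where
 "H0 = (SOME H. H \<in> a \<and> (\<forall>\<alpha>\<in>R. \<alpha> H ~= 0) \<and> \<Phi> = {\<alpha> \<in> R. \<alpha> H > 0})"

lemma H0: "H0 \<in> a" "\<alpha> \<in> R ==> \<alpha> H0 ~= 0" "\<Phi> = {\<alpha> \<in> R. \<alpha> H0 > 0}"
proof -
 have "\<exists>H. H \<in> a \<and> (\<forall>\<alpha>\<in>R. \<alpha> H ~= 0) \<and> \<Phi> = {\<alpha> \<in> R. \<alpha> H > 0}"
  using pos_system by (auto simp: positive_system_def)
 from someI_ex[OF this] show "H0 \<in> a" "\<alpha> \<in> R ==> \<alpha> H0 ~= 0" "\<Phi> = {\<alpha> \<in> R. \<alpha> H0 > 0}"
  unfolding H0_def by blast+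
qed

lemma Phi_iff: "\<alpha> \<in> \<Phi> \<longleftrightarrow> \<alpha> \<in> R \<and> \<alpha> H0 > 0"
 using H0(3) by blast

lemma Phi_R: "\<alpha> \<in> \<Phi> ==> \<alpha> \<in> R"
 by (simp add: Phi_iff)

lemma neg_Phi_iff: "\<alpha> \<in> R ==> wneg \<alpha> \<in> \<Phi> \<longleftrightarrow> \<alpha> \<notin> \<Phi>"
 using H0(1) H0(2)[of \<alpha>] wneg_root[of \<alpha>] by (auto simp: Phi_iff)

lemma simple_Phi: "\<alpha> \<in> simple_roots a \<Phi> ==> \<alpha> \<in> \<Phi>"
 by (simp add: simple_roots_def)

lemma simple_rootsD: "\<alpha> \<in> simple_roots a \<Phi> ==> \<beta> \<in> \<Phi> ==> c \<in> \<Phi> ==> \<alpha> ~= wadd \<beta> c"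
 by (auto simp: simple_roots_def wadd_def)

text \<open>A positive root that is not simple splits into two positive roots with smaller values at
  \<open>H0\<close>; the induction counts the positive roots below.\<close>

lemma positive_root_induct [consumes 1, case_names base step]:
 assumes \<beta>: "\<beta> \<in> \<Phi>" and base: "!!\<alpha>. \<alpha> \<in> simple_roots a \<Phi> ==> Pr \<alpha>"
  and step: "!!\<beta> c. \<beta> \<in> \<Phi> ==> c \<in> \<Phi> ==> Pr \<beta> ==> Pr c ==> Pr (wadd \<beta> c)"
 shows "Pr \<beta>"
 using \<beta>
proof (induction "card {c \<in> \<Phi>. c H0 < \<beta> H0}" arbitrary: \<beta> rule: less_induct)
 case less
 have fin: "finite \<Phi>" by (rule finite_subset[OF _ finite_R]) (auto simp: Phi_R)
 show ?case
 proof (cases "\<beta> \<in> simple_roots a \<Phi>")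
  case False
  then obtain c d where gd: "c \<in> \<Phi>" "d \<in> \<Phi>" "\<beta> = wadd c d"
   using less.prems by (auto simp: simple_roots_def wadd_def)
  have lt: "c H0 < \<beta> H0" "d H0 < \<beta> H0" using gd H0(1) by (auto simp: Phi_iff)
  have "card {e \<in> \<Phi>. e H0 < x H0} < card {e \<in> \<Phi>. e H0 < \<beta> H0}" if "x \<in> \<Phi>" "x H0 < \<beta> H0" for x
   by (rule psubset_card_mono) (use fin that in auto)
  hence "Pr c" "Pr d" using less.hyps gd lt by blast+
  thus ?thesis using step gd by blast
 qed (rule base)
qed

text \<open>Otherwise the difference is a root. Depending on its sign, one of the two simple roots
  is a sum of two positive ones.\<close>

lemma simple_obtuse:
 assumes "\<alpha> \<in> simple_roots a \<Phi>" "\<beta> \<in> simple_roots a \<Phi>" "\<alpha> ~= \<beta>"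
 shows "\<beta> (hv \<alpha>) <= 0"
proof (rule ccontr)
 assume "\<not> \<beta> (hv \<alpha>) <= 0"
 have R: "\<alpha> \<in> R" "\<beta> \<in> R" using assms simple_Phi Phi_R by auto
 let ?d = "wadd \<beta> (wneg \<alpha>)"
 have d: "?d \<in> R" using root_diff[OF R assms(3)] \<open>\<not> \<beta> (hv \<alpha>) <= 0\<close> by simp
 show False
 proof (cases "?d \<in> \<Phi>")
  case True
  have "\<beta> = wadd \<alpha> ?d" by (rule wt_ext_eq) (auto simp: root_ext R)
  thus False using simple_rootsD[OF assms(2) simple_Phi[OF assms(1)] True] by simp
 next
  case False
  hence "wneg ?d \<in> \<Phi>" using neg_Phi_iff[OF d] by simp
  moreover have "\<alpha> = wadd \<beta> (wneg ?d)" by (rule wt_ext_eq) (auto simp: root_ext R)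
  ultimately show False using simple_rootsD[OF assms(1) simple_Phi[OF assms(2)]] by metis
 qed
qed

definition refl :: "('e => real) => 'e => 'e" where
 "refl \<alpha> H = H - (2 * \<alpha> H / \<alpha> (hv \<alpha>)) *\<^sub>R hv \<alpha>"

lemma refl_a: "\<alpha> \<in> R ==> H \<in> a ==> refl \<alpha> H \<in> a"
 unfolding refl_def using hv(1) subspace_a by (intro subspace_diff subspace_scale) auto

text \<open>For a simple root \<open>\<alpha>\<close>, a positive root \<open>\<beta>\<close> is decomposed as \<open>c \<alpha> + d\<close> with \<open>d\<close> in the
 cone spanned by the other simple roots. Only the sign conditions on \<open>d\<close> below matter, which
 avoids proving that the simple roots are linearly independent.\<close>

lemma positive_root_decomposition:
 assumes \<alpha>: "\<alpha> \<in> simple_roots a \<Phi>" and \<beta>: "\<beta> \<in> \<Phi>"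
 shows "\<exists>c d. c \<ge> 0 \<and> d (hv \<alpha>) <= 0 \<and> ((\<forall>H\<in>a. d H = 0) \<or> d H0 > 0) \<and> (\<forall>H\<in>a. \<beta> H = c * \<alpha> H + d H)"
 using \<beta>
proof (induction rule: positive_root_induct)
 case (base \<beta>)
 have aR: "\<alpha> \<in> R" using \<alpha> simple_Phi Phi_R by auto
 show ?case
 proof (cases "\<beta> = \<alpha>")
  case True
  thus ?thesis by (intro exI[of _ 1] exI[of _ "%_. 0"]) simp
 next
  case False
  hence "\<beta> (hv \<alpha>) <= 0" using simple_obtuse[OF \<alpha> base] by blast
  moreover have "\<beta> H0 > 0" using simple_Phi[OF base] by (simp add: Phi_iff)
  ultimately show ?thesis by (intro exI[of _ 0] exI[of _ \<beta>]) simp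
 qed
next
 case (step \<beta> g)
 obtain c d where 3: "c \<ge> 0" "d (hv \<alpha>) <= 0" "(\<forall>H\<in>a. d H = 0) \<or> d H0 > 0" "\<forall>H\<in>a. \<beta> H = c * \<alpha> H + d H"
  using step(3) by blast
 obtain c' d' where 4: "c' \<ge> 0" "d' (hv \<alpha>) <= 0" "(\<forall>H\<in>a. d' H = 0) \<or> d' H0 > 0" "\<forall>H\<in>a. g H = c' * \<alpha> H + d' H"
  using step(4) by blast
 have "(\<forall>H\<in>a. d H + d' H = 0) \<or> d H0 + d' H0 > 0" using 3(3) 4(3) H0(1) by force
 moreover have "\<forall>H\<in>a. wadd \<beta> g H = (c + c') * \<alpha> H + (d H + d' H)"
  using 3(4) 4(4) by (simp add: algebra_simps)
 ultimately show ?case using 3 4 by (intro exI[of _ "c + c'"] exI[of _ "%H. d H + d' H"]) simp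
qed

text \<open>If z were negative, adding the decompositions of \<beta> and of \<open>- z\<close> would
  express a multiple of \<alpha> as the sum of the two remainders. At \<open>hv \<alpha>\<close>
  this gives the sign of the multiple, and at \<open>H0\<close> it then forces the remainder of
  \<beta> to vanish, so \<beta> would be proportional to \<alpha>.\<close>

lemma simple_reflection_positive:
 assumes \<alpha>: "\<alpha> \<in> simple_roots a \<Phi>" and \<beta>: "\<beta> \<in> \<Phi>" and np: "!!c. \<beta> ~= wscale c \<alpha>"
  and z: "z \<in> R" "!!H. H \<in> a ==> z H = \<beta> (refl \<alpha> H)"
 shows "z \<in> \<Phi>"
proof (rule ccontr)
 assume "z \<notin> \<Phi>"
 hence ng: "wneg z \<in> \<Phi>" using neg_Phi_iff[OF z(1)] by simp
 have aP: "\<alpha> \<in> \<Phi>" and aR: "\<alpha> \<in> R" using \<alpha> simple_Phi Phi_R by auto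
 have bR: "\<beta> \<in> R" using \<beta> Phi_R by auto
 obtain c e where 3: "c \<ge> 0" "e (hv \<alpha>) <= 0" "(\<forall>H\<in>a. e H = 0) \<or> e H0 > 0" "\<forall>H\<in>a. \<beta> H = c * \<alpha> H + e H"
  using positive_root_decomposition[OF \<alpha> \<beta>] by blast
 obtain c' e' where 4: "c' \<ge> 0" "e' (hv \<alpha>) <= 0" "(\<forall>H\<in>a. e' H = 0) \<or> e' H0 > 0" "\<forall>H\<in>a. wneg z H = c' * \<alpha> H + e' H"
  using positive_root_decomposition[OF \<alpha> ng] by blast
 define d where "d = 2 * \<beta> (hv \<alpha>) / \<alpha> (hv \<alpha>)"
 have g: "z H = \<beta> H - d * \<alpha> H" if H: "H \<in> a" for H
  using root_linear[OF bR H subspace_scale[OF subspace_a hv(1)[OF aR]]] root_linear(3)[OF bR hv(1)[OF aR] H] z(2)[OF H]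
  by (simp add: refl_def d_def)
 have eq: "(d - c - c') * \<alpha> H = e H + e' H" if H: "H \<in> a" for H
 proof -
  have "\<beta> H = c * \<alpha> H + e H" "- z H = c' * \<alpha> H + e' H" using 3(4) 4(4) H by auto
  thus ?thesis using g[OF H] by (simp add: left_diff_distrib)
 qed
 have "(d - c - c') * \<alpha> (hv \<alpha>) <= 0" using eq[OF hv(1)[OF aR]] 3(2) 4(2) by simp
 hence le: "d - c - c' <= 0" using root_hv_pos[OF aR] by (simp add: mult_le_0_iff)
 have "e H0 \<ge> 0" "e' H0 \<ge> 0" using 3(3) 4(3) H0(1) by force+
 moreover have "(d - c - c') * \<alpha> H0 <= 0" using le aP by (simp add: Phi_iff mult_le_0_iff)
 ultimately have "e H0 = 0" using eq[OF H0(1)] by linarith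
 hence "\<forall>H\<in>a. e H = 0" using 3(3) by auto
 hence "\<beta> = wscale c \<alpha>" using 3(4) by (intro wt_ext_eq[OF root_ext[OF bR] w_ext(3)]) auto
 thus False using np by blast
qed

text \<open>If a smaller positive multiple were a root, the difference from \<alpha> would be a
  positive root too, and \<alpha> would be the sum of both.\<close>

lemma simple_root_shortest:
 assumes \<alpha>: "\<alpha> \<in> simple_roots a \<Phi>" and c: "0 < c" "c < 1"
 shows "wscale c \<alpha> \<notin> \<Phi>"
proof
 assume s: "wscale c \<alpha> \<in> \<Phi>"
 have aP: "\<alpha> \<in> \<Phi>" and aR: "\<alpha> \<in> R" using \<alpha> simple_Phi Phi_R by auto
 let ?b = "wscale c \<alpha>"
 have bR: "?b \<in> R" using s Phi_R by blast
 have "hv ?b = c *\<^sub>R hv \<alpha>"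
  by (rule a_eqI) (use hv[OF bR] hv[OF aR] subspace_scale[OF subspace_a] in \<open>auto simp: kil_simps\<close>)
 hence "\<alpha> (hv ?b) > 0" using root_linear(3)[OF aR hv(1)[OF aR] H0(1)] root_hv_pos[OF aR] c by simp
 moreover have "?b ~= \<alpha>"
 proof
  assume "?b = \<alpha>"
  hence "c * \<alpha> H0 = \<alpha> H0" using w_app(3)[OF H0(1)] by metis
  thus False using c aP by (simp add: Phi_iff)
 qed
 ultimately have d: "wadd \<alpha> (wneg ?b) \<in> R" using root_diff[OF bR aR] by simp
 have "wadd \<alpha> (wneg ?b) H0 = (1 - c) * \<alpha> H0" using H0(1) by (simp add: algebra_simps)
 hence "wadd \<alpha> (wneg ?b) \<in> \<Phi>" using d aP c by (simp add: Phi_iff)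
 moreover have "\<alpha> = wadd ?b (wadd \<alpha> (wneg ?b))" by (rule wt_ext_eq) (auto simp: root_ext aR)
 ultimately show False using simple_rootsD[OF \<alpha> s] by metis
qed

text \<open>On the plane spanned by \<open>H\<^sub>\<alpha>\<close> and \<open>E - \<theta> E\<close>, \<open>ad (E + \<theta> E)\<close> is an infinitesimal rotation;
 half a turn gives the reflection.\<close>

lemma reflection_exists:
 assumes \<alpha>: "\<alpha> \<in> R"
 obtains Z where "Z \<in> k" "!!H. H \<in> a ==> exp (ad Z) \<cdot> H = refl \<alpha> H"
proof -
 obtain E where E: "E \<in> rs \<alpha>" "E ~= 0" using root_vector[OF \<alpha>] by blast
 let ?Z = "E + \<theta> E" and ?D = "E - \<theta> E" and ?h = "hv \<alpha>" and ?n = "\<alpha> (hv \<alpha>)" and ?q = "Q E E"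
 have q: "?q > 0" using E(2) by (rule Q_pos)
 have n: "?n > 0" by (rule root_hv_pos[OF \<alpha>])
 have Zk: "?Z \<in> k" by (rule theta_fixed) (simp add: theta_simps add.commute)
 have ZH: "br ?Z H = - \<alpha> H *\<^sub>R ?D" if H: "H \<in> a" for H
  using br_antisym[of E H] br_antisym[of "\<theta> E" H] rsD[OF E(1) H] rsD[OF theta_rs[OF E(1)] H] H
  by (simp add: br_simps algebra_simps)
 have ZD: "br ?Z ?D = (2 * ?q) *\<^sub>R ?h"
  using br_E_theta_hv[OF \<alpha> E(1)] br_antisym[of "\<theta> E" E] by (simp add: br_simps algebra_simps flip: scaleR_2)
 \<comment> \<open>The square of \<open>ad ?Z\<close> acts on the plane as the scalar
   \<open>- (2 * ?n * ?q)\<close>, so \<open>w\<close> is the angular frequency and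
   \<open>pi / w\<close> half a turn.\<close>
 define w where "w = sqrt (2 * ?n * ?q)"
 have w: "w > 0" "w * w = 2 * ?n * ?q" using q n by (auto simp: w_def)
 define f where "f s = cos (w * s) *\<^sub>R ?h - (?n / w * sin (w * s)) *\<^sub>R ?D" for s
 have f': "(f has_vector_derivative br ?Z (f s)) (at s)" for s
 proof -
  have "(f has_vector_derivative (- (sin (w * s) * w)) *\<^sub>R ?h - (?n / w * (cos (w * s) * w)) *\<^sub>R ?D) (at s)"
   unfolding f_def by (auto intro!: derivative_eq_intros simp: has_real_derivative_iff_has_vector_derivative[symmetric])
  moreover have "br ?Z (f s) = (- (sin (w * s) * w)) *\<^sub>R ?h - (?n / w * (cos (w * s) * w)) *\<^sub>R ?D"
  proof -
   have gen: "br Z (x *\<^sub>R h - y *\<^sub>R D) = x *\<^sub>R br Z h - y *\<^sub>R br Z D" for x y h D Z by (simp add: br_simps)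
   have "br ?Z (f s) = - (cos (w * s) * ?n) *\<^sub>R ?D - (?n / w * sin (w * s) * (2 * ?q)) *\<^sub>R ?h"
    by (simp only: f_def gen ZD ZH[OF hv(1)[OF \<alpha>]] scaleR_scaleR) simp
   moreover have "?n / w * sin (w * s) * (2 * ?q) = sin (w * s) * w" using w by (simp add: field_simps)
   moreover have "?n / w * (cos (w * s) * w) = cos (w * s) * ?n" using w by simp
   ultimately show ?thesis by simp
  qed
  ultimately show ?thesis by simp
 qed
 have fs: "exp (s *\<^sub>R ad ?Z) \<cdot> ?h = f s" for s
 proof -
  let ?g = "%s. exp (s *\<^sub>R (- ad ?Z)) \<cdot> f s"
  have "(?g has_vector_derivative exp (s *\<^sub>R (- ad ?Z)) \<cdot> br ?Z (f s) + (exp (s *\<^sub>R (- ad ?Z)) * (- ad ?Z)) \<cdot> f s) (at s)" for s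
   by (rule bounded_bilinear.has_vector_derivative[OF bounded_bilinear_app exp_scaleR_has_vector_derivative_right f'])
  hence "(?g has_vector_derivative 0) (at s)" for s by (simp add: app_simps)
  then obtain c where "!!s. ?g s = c"
   using has_vector_derivative_zero_constant[of UNIV ?g]
   by (metis UNIV_I convex_UNIV has_vector_derivative_at_within)
  hence "?g s = ?g 0" by metis
  also have "?g 0 = ?h" by (simp add: f_def)
  finally have "exp (- (s *\<^sub>R ad ?Z)) \<cdot> f s = ?h" by simp
  thus ?thesis using exp_minus_app(2)[of "s *\<^sub>R ad ?Z" "f s"] by simp
 qed
 define s where "s = pi / w"
 have half: "exp (ad (s *\<^sub>R ?Z)) \<cdot> ?h = - ?h"
  using fs[of s] w by (simp add: ad_simps f_def s_def)
 have ker: "exp (ad (s *\<^sub>R ?Z)) \<cdot> H = H" if "H \<in> a" "\<alpha> H = 0" for H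
  using exp_eigenvector[of "ad (s *\<^sub>R ?Z)" H 0] ZH[OF that(1)] that(2) by (simp add: br_simps)
 have "exp (ad (s *\<^sub>R ?Z)) \<cdot> H = refl \<alpha> H" if H: "H \<in> a" for H
 proof -
  let ?c = "\<alpha> H / ?n"
  have ch: "?c *\<^sub>R ?h \<in> a" using hv(1)[OF \<alpha>] subspace_scale[OF subspace_a] by blast
  have "\<alpha> (H - ?c *\<^sub>R ?h) = 0"
   using root_linear(2)[OF \<alpha> H ch] root_linear(3)[OF \<alpha> hv(1)[OF \<alpha>] H] n by simp
  hence "exp (ad (s *\<^sub>R ?Z)) \<cdot> (H - ?c *\<^sub>R ?h) = H - ?c *\<^sub>R ?h"
   using ker subspace_diff[OF subspace_a H ch] by blast
  hence "exp (ad (s *\<^sub>R ?Z)) \<cdot> H = H - ?c *\<^sub>R ?h + ?c *\<^sub>R (exp (ad (s *\<^sub>R ?Z)) \<cdot> ?h)"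
   by (simp only: app_simps) (simp add: algebra_simps)
  also have "\<dots> = H - (2 * ?c) *\<^sub>R ?h" unfolding half by (simp add: algebra_simps flip: scaleR_2)
  finally show ?thesis by (simp add: refl_def)
 qed
 moreover have "s *\<^sub>R ?Z \<in> k" using Zk subspace_scale[OF subspace_k] by blast
 ultimately show ?thesis using that by blast
qed

end

section \<open>The maximal compact subgroup and the polar decomposition\<close>

locale lie_symmetric = lie_root G "lie_of G K" p a \<Phi>
 for G :: "('g, 'e::euclidean_space) lie_data" (structure) and K :: "'g set" and p a :: "'e set" and \<Phi> +
 assumes maximal_compact: "maximal_compact G K" and finite_center: "finite (group_center G)"
begin

abbreviation "k \<equiv> lie_of G K"

lemma subgroup_K: "subgroup K G"
 using maximal_compact by (simp add: maximal_compact_def)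

lemma K_carrier: "g \<in> K ==> g \<in> carrier G"
 using subgroup_K subgroup.mem_carrier by metis

lemma lie_exp_K: "X \<in> k ==> lie_exp G X \<in> K"
 unfolding lie_of_def using scaleR_one by (metis (mono_tags, lifting) mem_Collect_eq)

lemma Ad_K_k:
 assumes g: "g \<in> K" and X: "X \<in> k"
 shows "Ad G g X \<in> k"
proof -
 note gc = K_carrier[OF g]
 have "lie_exp G (t *\<^sub>R Ad G g X) \<in> K" for t
 proof -
  have "lie_exp G (t *\<^sub>R X) \<in> K" using X by (simp add: lie_of_def)
  hence "g \<otimes> lie_exp G (t *\<^sub>R X) \<otimes> inv g \<in> K"
   using g subgroup_K by (simp add: subgroup.m_closed subgroup.m_inv_closed)
  thus ?thesis using lie_exp_conj[OF gc, of "t *\<^sub>R X"] linear_cmul[OF linear_Ad[OF gc]] by simp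
 qed
 thus ?thesis by (simp add: lie_of_def)
qed

lemma p_iff: "X \<in> p \<longleftrightarrow> (\<forall>Y\<in>k. kil X Y = 0)"
proof
 assume "\<forall>Y\<in>k. kil X Y = 0"
 moreover obtain Y Z where YZ: "Y \<in> k" "Z \<in> p" "X = Y + Z" by (rule kp_decomp)
 ultimately have "kil Y Y = 0" using kil_kp[OF YZ(1,2)] kil_sym[of Z Y] by (force simp: kil_simps)
 hence "Y = 0" using kil_neg[OF YZ(1)] by (auto simp: kil_eq)
 thus "X \<in> p" using YZ by simp
next
 show "X \<in> p ==> \<forall>Y\<in>k. kil X Y = 0" using kil_kp kil_sym by metis
qed

lemma kil_Ad: "g \<in> carrier G ==> kil (Ad G g X) (Ad G g Y) = kil X Y"
 using aut_kil[OF aut_AdE] by simp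

lemma Ad_K_p:
 assumes g: "g \<in> K" and X: "X \<in> p"
 shows "Ad G g X \<in> p"
 unfolding p_iff
proof
 fix Y assume Y: "Y \<in> k"
 have ig: "inv g \<in> K" using g subgroup_K by (simp add: subgroup.m_inv_closed)
 have "kil (Ad G g X) Y = kil X (Ad G (inv g) Y)"
  using kil_Ad[OF K_carrier[OF g], of X "Ad G (inv g) Y"] K_carrier[OF g] by simp
 also have "\<dots> = 0" using X Ad_K_k[OF ig Y] by (simp add: p_iff)
 finally show "kil (Ad G g X) Y = 0" .
qed

lemma Ad_K_theta:
 assumes g: "g \<in> K"
 shows "Ad G g (\<theta> X) = \<theta> (Ad G g X)"
proof -
 obtain Y Z where YZ: "Y \<in> k" "Z \<in> p" "X = Y + Z" by (rule kp_decomp)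
 note l = linear_Ad[OF K_carrier[OF g]]
 show ?thesis using YZ Ad_K_k[OF g YZ(1)] Ad_K_p[OF g YZ(2)]
  by (simp add: theta_simps theta_k theta_p linear_add[OF l] linear_diff[OF l])
qed

lemma Q_Ad_K: "g \<in> K ==> Q (Ad G g X) (Ad G g Y) = Q X Y"
 by (simp add: Q_def kil_Ad K_carrier flip: Ad_K_theta)

text \<open>Only closed conditions are imposed, which together with the norm bound from
  \<open>Q\<close> gives compactness; preservation of \<open>Q\<close> already forces
  invertibility.\<close>

definition isometries :: "'e endo set" where
 "isometries = {T. (\<forall>X Y. T \<cdot> br X Y = br (T \<cdot> X) (T \<cdot> Y)) \<and> (\<forall>X Y. Q (T \<cdot> X) (T \<cdot> Y) = Q X Y)}"

lemma compact_isometries: "compact isometries"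
proof -
 interpret bq: bounded_bilinear Q by (rule bounded_bilinear_Q)
 interpret bb: bounded_bilinear br using bracket_bilinear by (simp add: bilinear_conv_bounded_bilinear)
 have "isometries = (\<Inter>X. \<Inter>Y. {T. T \<cdot> br X Y = br (T \<cdot> X) (T \<cdot> Y)} \<inter> {T. Q (T \<cdot> X) (T \<cdot> Y) = Q X Y})"
  by (auto simp: isometries_def)
 moreover have "closed \<dots>"
  by (intro closed_INT ballI closed_Int closed_Collect_eq bq.continuous_on bb.continuous_on app.continuous_on
    continuous_on_id continuous_on_const)
 ultimately have "closed isometries" by simp
 moreover obtain c C where c: "c > 0" "C > 0" "!!x. c * (norm x)\<^sup>2 <= Q x x" "!!x. Q x x <= C * (norm x)\<^sup>2"
  by (rule Q_bounds) blast
 have "norm T <= sqrt (C / c)" if T: "T \<in> isometries" for T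
 proof (rule norm_endo_le)
  fix x
  have "c * (norm (T \<cdot> x))\<^sup>2 <= C * (norm x)\<^sup>2"
   using c(3)[of "T \<cdot> x"] c(4)[of x] T by (auto simp: isometries_def)
  hence "(norm (T \<cdot> x))\<^sup>2 <= C / c * (norm x)\<^sup>2"
   using c(1) by (simp add: pos_le_divide_eq mult.commute)
  hence "(norm (T \<cdot> x))\<^sup>2 <= (sqrt (C / c) * norm x)\<^sup>2"
   using c(1,2) by (simp add: power_mult_distrib)
  thus "norm (T \<cdot> x) <= sqrt (C / c) * norm x"
   by (rule power2_le_imp_le) (use c(1,2) in simp)
 qed (use c(1,2) in simp)
 hence "bounded isometries" by (rule boundedI)
 ultimately show ?thesis by (simp add: compact_eq_bounded_closed)
qed

text \<open>The right-hand side L is a closed subgroup containing K, so by maximality it suffices to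
  see that L is compact. \<open>AdE\<close> sends L into a compact set, covered by finitely many
  small balls. Within one ball two elements differ by a factor from a compact neighbourhood of the
  identity and a central element, and the center is finite.\<close>

lemma K_eq: "K = {g \<in> carrier G. \<forall>X Y. Q (Ad G g X) (Ad G g Y) = Q X Y}"
proof -
 define L where "L = {g \<in> carrier G. \<forall>X Y. Q (Ad G g X) (Ad G g Y) = Q X Y}"
 have L_iso: "L = {g \<in> carrier G. AdE g \<in> isometries}"
  by (auto simp: L_def isometries_def Ad_bracket)
 have subL: "subgroup L G"
 proof (rule subgroupI)
  show "L \<subseteq> carrier G" "L ~= {}" using Ad_one one_closed by (auto simp: L_def)
  show "inv g \<in> L" if "g \<in> L" for g
  proof -
   have g: "g \<in> carrier G" "!!X Y. Q (Ad G g X) (Ad G g Y) = Q X Y" using that by (auto simp: L_def)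
   have "Q (Ad G (inv g) X) (Ad G (inv g) Y) = Q X Y" for X Y
    using g(2)[of "Ad G (inv g) X" "Ad G (inv g) Y"] g(1) by simp
   thus ?thesis using g(1) by (simp add: L_def)
  qed
  show "g \<otimes> h \<in> L" if "g \<in> L" "h \<in> L" for g h using that by (auto simp: L_def Ad_mult)
 qed
 have KL: "K \<subseteq> L" using Q_Ad_K K_carrier by (auto simp: L_def)
 have closedL: "closedin (topo G) L"
 proof -
  have "closedin (topo G) {g \<in> topspace (topo G). AdE g \<in> isometries}"
   by (rule closedin_continuous_map_preimage[OF continuous_AdE])
     (simp add: compact_imp_closed[OF compact_isometries])
  thus ?thesis by (simp add: L_iso)
 qed
 obtain C U where C: "compactin (topo G) C" "openin (topo G) U" "\<one> \<in> U" "U \<subseteq> C" using compact_nbhd by blast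
 obtain r where r: "r > 0" "nball r \<subseteq> U" using nball_subset[OF C(2,3)] by blast
 obtain s where s: "s > 0" "!!T. aut T ==> norm (T - 1) < s ==> \<exists>h\<in>nball r. AdE h = T"
  using AdE_open[OF r(1)] by blast
 obtain M where M: "M > 0" "!!T. T \<in> isometries ==> norm T <= M"
  using compact_imp_bounded[OF compact_isometries] unfolding bounded_pos by blast
 \<comment> \<open>Two points of one ball are less than \<open>2 * e\<close> apart, and M bounds the
   norm of the inverse, so the quotient is within s of 1.\<close>
 define e where "e = s / (2 * M)"
 have e: "e > 0" using s M by (simp add: e_def)
 obtain F where F: "finite F" "F \<subseteq> isometries" "isometries \<subseteq> (\<Union>T\<in>F. ball T e)"
  using compactE_image[OF compact_isometries, of isometries "%T. ball T e"] e
  by (metis UN_I centre_in_ball open_ball subsetI)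
 define F' where "F' = {T \<in> F. \<exists>g\<in>L. AdE g \<in> ball T e}"
 obtain c where c: "!!T. T \<in> F' ==> c T \<in> L \<and> AdE (c T) \<in> ball T e"
  using bchoice[of F' "%T g. g \<in> L \<and> AdE g \<in> ball T e"] by (auto simp: F'_def)
 have LK: "L \<subseteq> carrier G" by (auto simp: L_def)
 define B where "B = (\<Union>(T, z)\<in>F' \<times> group_center G. (%x. c T \<otimes> x \<otimes> z) ` C)"
 have "compactin (topo G) B"
  unfolding B_def
 proof (intro compactin_Union ballI)
  show "finite ((%(T, z). (%x. c T \<otimes> x \<otimes> z) ` C) ` (F' \<times> group_center G))"
   using F(1) finite_center by (simp add: F'_def)
  fix S assume "S \<in> (%(T, z). (%x. c T \<otimes> x \<otimes> z) ` C) ` (F' \<times> group_center G)"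
  then obtain T z where T: "T \<in> F'" "z \<in> group_center G" "S = (%x. c T \<otimes> x \<otimes> z) ` C" by blast
  have "continuous_map (topo G) (topo G) (%x. c T \<otimes> x \<otimes> z)"
   using c[OF T(1)] LK T(2) by (intro continuous_map_mult) (auto simp: group_center_def)
  thus "compactin (topo G) S" unfolding T(3) by (rule image_compactin[OF C(1)])
 qed
 moreover have "L \<subseteq> B"
 proof
  fix g assume g: "g \<in> L"
  hence gc: "g \<in> carrier G" and gi: "AdE g \<in> isometries" using L_iso by auto
  obtain T where T: "T \<in> F" "AdE g \<in> ball T e" using F(3) gi by blast
  hence T': "T \<in> F'" using g by (auto simp: F'_def)
  let ?h = "c T"
  have h: "?h \<in> L" "AdE ?h \<in> ball T e" using c[OF T'] by auto
  have hc: "?h \<in> carrier G" and ihL: "inv ?h \<in> L" using h(1) LK subL by (auto simp: subgroup.m_inv_closed)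
  have "norm (AdE g - AdE ?h) <= dist (AdE g) T + dist T (AdE ?h)"
   by (simp add: dist_triangle flip: dist_norm)
  hence close: "norm (AdE g - AdE ?h) < 2 * e"
   using T(2) h(2) by (simp add: dist_commute)
  have "AdE (inv ?h \<otimes> g) - 1 = AdE (inv ?h) * (AdE g - AdE ?h)"
   using hc gc by (simp add: AdE_mult algebra_simps)
  hence "norm (AdE (inv ?h \<otimes> g) - 1) <= norm (AdE (inv ?h)) * norm (AdE g - AdE ?h)"
   by (simp add: norm_mult_ineq)
  also have "\<dots> <= M * norm (AdE g - AdE ?h)"
   using M(2)[of "AdE (inv ?h)"] ihL L_iso by (intro mult_right_mono) auto
  also have "\<dots> < M * (2 * e)" using close M(1) by simp
  also have "\<dots> = s" using M by (simp add: e_def)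
  finally obtain x where x: "x \<in> nball r" "AdE x = AdE (inv ?h \<otimes> g)"
   using s(2)[OF aut_AdE] hc gc by blast
  have xc: "x \<in> carrier G" and xC: "x \<in> C" using x nball_carrier r C by auto
  \<comment> \<open>\<open>?h \<otimes> x\<close> and g have the same \<open>AdE\<close>, so their
    quotient is central.\<close>
  define z where "z = inv (?h \<otimes> x) \<otimes> g"
  have zc: "z \<in> carrier G" using hc xc gc by (simp add: z_def)
  have "AdE (?h \<otimes> x) = AdE g" using hc xc gc x(2) by (simp add: AdE_mult flip: mult.assoc)
  hence "AdE z = AdE (inv g) * AdE g"
  proof -
   assume *: "AdE (?h \<otimes> x) = AdE g"
   have "AdE z = AdE (inv (?h \<otimes> x)) * AdE (?h \<otimes> x)" using hc xc gc by (simp add: z_def AdE_mult[of "inv (?h \<otimes> x)"] *)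
   thus ?thesis using hc xc gc by (simp only: AdE_inv m_closed)
  qed
  hence "z \<in> group_center G" using AdE_kernel[OF zc] gc by simp
  moreover have "g = ?h \<otimes> x \<otimes> z" using hc xc gc by (simp add: z_def m_assoc[symmetric] inv_solve_left)
  ultimately show "g \<in> B" using T' xC by (auto simp: B_def)
 qed
 ultimately have "compactin (topo G) L" using closedL by (metis closed_compactin)
 hence "L = K" using maximal_compact subL KL by (simp add: maximal_compact_def)
 thus ?thesis by (simp add: L_def)
qed

text \<open>The logarithm f of A is defined on a basis of eigenvectors. An automorphism multiplies
  eigenvalues under the bracket, so their logarithms add and f is a derivation, hence inner. Its
  symmetry for \<open>Q\<close> places the generator in p.\<close>

lemma positive_aut_log:
 assumes A: "aut A" and sym: "!!x y. Q (A \<cdot> x) y = Q x (A \<cdot> y)" and pos: "!!x. x ~= 0 ==> Q (A \<cdot> x) x > 0"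
 obtains Y where "Y \<in> p" "exp (ad Y) = A"
proof -
 define E where "E l = {v. A \<cdot> v = l *\<^sub>R v}" for l
 have "span (\<Union>l. E l) = UNIV"
  unfolding E_def by (rule symmetric_spectral[OF linear_app sym])
 moreover obtain B where B: "B \<subseteq> (\<Union>l. E l)" "independent B" "(\<Union>l. E l) \<subseteq> span B"
  using maximal_independent_subset by blast
 ultimately have spanB: "span B = UNIV"
  using span_mono[OF B(3)] by (simp add: span_span top.extremum_unique)
 obtain ev where ev: "!!b. b \<in> B ==> A \<cdot> b = ev b *\<^sub>R b"
  using B(1) unfolding E_def by (metis (mono_tags, lifting) UN_E mem_Collect_eq subsetD)
 have evpos: "l > 0" if "v ~= 0" "A \<cdot> v = l *\<^sub>R v" for v l
  using pos[OF that(1)] Q_pos[OF that(1)] that(2) by (simp add: Q_simps zero_less_mult_iff)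
 have orth: "Q v b = 0" if "A \<cdot> v = l *\<^sub>R v" "b \<in> B" "ev b ~= l" for v b l
  using sym[of v b] ev[OF that(2)] that by (simp add: Q_simps)
 obtain f where f: "linear f" "!!b. b \<in> B ==> f b = ln (ev b) *\<^sub>R b"
  using linear_independent_extend[OF B(2), of "%b. ln (ev b) *\<^sub>R b"] by blast
 have spanI: "P x" if "subspace {x. P x}" "!!b. b \<in> B ==> P b" for P x
  using span_minimal[OF _ that(1), of B] that(2) spanB by blast
 note subs = subspace_def Q_simps br_simps linear_add[OF f(1)] linear_cmul[OF f(1)] linear_0[OF f(1)] algebra_simps
 have Bzero: "w = 0" if w: "!!b. b \<in> B ==> Q w b = 0" for w
 proof -
  have "Q w x = 0" for x by (rule spanI) (use w in \<open>auto simp: subs\<close>)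
  thus ?thesis by (metis Q_zero_iff)
 qed
 have fsymB: "Q (f b) b' = Q b (f b')" if b: "b \<in> B" "b' \<in> B" for b b'
 proof (cases "ev b' = ev b")
  case False
  thus ?thesis using orth[OF ev[OF b(1)] b(2)] f(2) b by (simp add: Q_simps)
 qed (use f(2) b in \<open>simp add: Q_simps\<close>)
 have fsym: "Q (f x) y = Q x (f y)" for x y
 proof -
  have 1: "Q (f b) y = Q b (f y)" if b: "b \<in> B" for b y by (rule spanI) (use fsymB b in \<open>auto simp: subs\<close>)
  show ?thesis by (rule spanI) (use 1 in \<open>auto simp: subs\<close>)
 qed
 \<comment> \<open>The bracket of two basis vectors is an eigenvector that need not belong to B, so
   f must be known on all eigenvectors. B separates points under \<open>Q\<close>, which reduces the
   claim to basis vectors.\<close>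
 have fE: "f v = ln l *\<^sub>R v" if v: "A \<cdot> v = l *\<^sub>R v" for v l
 proof -
  have "f v - ln l *\<^sub>R v = 0"
  proof (rule Bzero)
   fix b assume b: "b \<in> B"
   have "Q (f v - ln l *\<^sub>R v) b = (ln (ev b) - ln l) * Q v b"
    using fsym[of v b] f(2)[OF b] by (simp add: Q_simps algebra_simps)
   thus "Q (f v - ln l *\<^sub>R v) b = 0" using orth[OF v b] by auto
  qed
  thus ?thesis by simp
 qed
 have der: "f (br x y) = br (f x) y + br x (f y)" for x y
 proof -
  have 0: "f (br b b') = br (f b) b' + br b (f b')" if b: "b \<in> B" "b' \<in> B" for b b'
  proof -
   have nz: "b ~= 0" "b' ~= 0" using b B(2) dependent_zero by auto
   have "A \<cdot> br b b' = (ev b * ev b') *\<^sub>R br b b'" using aut_br[OF A] ev b by (simp add: br_simps)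
   hence "f (br b b') = ln (ev b * ev b') *\<^sub>R br b b'" by (rule fE)
   moreover have "ln (ev b * ev b') = ln (ev b) + ln (ev b')"
    using evpos[OF nz(1) ev[OF b(1)]] evpos[OF nz(2) ev[OF b(2)]] by (simp add: ln_mult)
   ultimately show ?thesis using f(2) b by (simp add: br_simps scaleR_add_left)
  qed
  have 1: "f (br b y) = br (f b) y + br b (f y)" if b: "b \<in> B" for b y by (rule spanI) (use 0 b in \<open>auto simp: subs\<close>)
  show ?thesis by (rule spanI) (use 1 in \<open>auto simp: subs\<close>)
 qed
 define Y where "Y = killing_part (endo f)"
 have adY: "endo f = ad Y" unfolding Y_def by (rule derivation_inner) (simp add: f(1) der)
 have fY: "f x = br Y x" for x using arg_cong[OF adY, of "%T. T \<cdot> x"] f(1) by simp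
 have "Y \<in> p"
 proof (rule theta_neg)
  have "ad (Y + \<theta> Y) = 0"
  proof (rule endo_eqI)
   fix x
   have "Q (br (\<theta> Y) x + br Y x) y = 0" for y
    using fsym[of x y] Q_br[of "\<theta> Y" x y] by (simp add: fY Q_simps)
   hence "br (\<theta> Y) x + br Y x = 0" by (metis Q_zero_iff)
   thus "ad (Y + \<theta> Y) \<cdot> x = 0 \<cdot> x" by (simp add: br_simps app_simps add.commute)
  qed
  hence "Y + \<theta> Y = 0" by (rule ad_inj)
  thus "\<theta> Y = - Y" by (simp add: add_eq_0_iff)
 qed
 moreover have "exp (ad Y) = A"
 proof (rule endo_eqI)
  fix x
  have "exp (ad Y) \<cdot> b = A \<cdot> b" if b: "b \<in> B" for b
  proof -
   have nz: "b ~= 0" using b B(2) dependent_zero by auto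
   have "ad Y \<cdot> b = ln (ev b) *\<^sub>R b" using f(2)[OF b] fY by simp
   from exp_eigenvector[OF this] show ?thesis using ev[OF b] evpos[OF nz ev[OF b]] by simp
  qed
  thus "exp (ad Y) \<cdot> x = A \<cdot> x"
   using linear_eq_on_span[OF linear_app linear_app, of B] spanB by blast
 qed
 ultimately show ?thesis using that by blast
qed

text \<open>The adjoint of \<open>Ad g\<close> for \<open>Q\<close> is \<open>\<theta>\<close>
  conjugating \<open>Ad (inv g)\<close>, so A is \<open>Ad g\<close> times its adjoint. With X half
  the logarithm of A, the element \<open>lie_exp G (- X) \<otimes> g\<close> preserves
  \<open>Q\<close> and therefore lies in K.\<close>

lemma polar_decomposition:
 assumes g: "g \<in> carrier G"
 obtains X c where "X \<in> p" "c \<in> K" "g = lie_exp G X \<otimes> c"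
proof -
 have adj: "Q (Ad G g x) y = Q x (\<theta> (Ad G (inv g) (\<theta> y)))" if g: "g \<in> carrier G" for g x y
  using kil_Ad[OF g, of x "Ad G (inv g) (\<theta> y)"] g by (simp add: Q_def)
 define A where "A = AdE g * endo \<theta> * AdE (inv g) * endo \<theta>"
 have ig: "inv g \<in> carrier G" using g by simp
 have Aapp: "A \<cdot> x = Ad G g (\<theta> (Ad G (inv g) (\<theta> x)))" for x using g by (simp add: A_def linear_theta)
 obtain Y where Y: "Y \<in> p" "exp (ad Y) = A"
 proof (rule positive_aut_log)
  show "aut A" unfolding A_def by (intro aut_mult aut_AdE aut_theta g ig)
  have QA: "Q (A \<cdot> x) y = Q (\<theta> (Ad G (inv g) (\<theta> x))) (\<theta> (Ad G (inv g) (\<theta> y)))" for x y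
   unfolding Aapp by (rule adj[OF g])
  show "Q (A \<cdot> x) y = Q x (A \<cdot> y)" for x y using QA Q_sym by metis
  show "Q (A \<cdot> x) x > 0" if "x ~= 0" for x
  proof -
   have "\<theta> (Ad G (inv g) (\<theta> x)) ~= 0"
   proof
    assume "\<theta> (Ad G (inv g) (\<theta> x)) = 0"
    hence "Ad G g (Ad G (inv g) (\<theta> x)) = Ad G g 0" by (metis theta_theta theta_simps(5))
    hence "\<theta> x = 0" using g linear_0[OF linear_Ad[OF g]] by simp
    thus False using that by (metis theta_theta theta_simps(5))
   qed
   thus ?thesis unfolding QA by (rule Q_pos)
  qed
 qed
 define X where "X = (1/2) *\<^sub>R Y"
 have X: "X \<in> p" unfolding X_def using Y(1) subspace_scale[OF subspace_p] by blast
 have eX: "exp (ad X) * exp (ad X) = A"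
  using Y(2) exp_scaleR_add[of "1/2" "1/2" "ad Y"] by (simp add: X_def ad_simps)
 define c where "c = lie_exp G (- X) \<otimes> g"
 have kc: "c \<in> carrier G" using g by (simp add: c_def)
 have kap: "Ad G c x = exp (- ad X) \<cdot> Ad G g x" for x
  using g by (simp add: c_def Ad_mult Ad_lie_exp ad_simps)
 have "Q (Ad G c x) (Ad G c y) = Q x y" for x y
 proof -
  have eqy: "\<theta> (Ad G (inv g) (\<theta> (exp (- ad X) \<cdot> exp (- ad X) \<cdot> Ad G g y))) = y"
  proof -
   let ?w = "\<theta> (Ad G (inv g) (\<theta> (exp (- ad X) \<cdot> exp (- ad X) \<cdot> Ad G g y)))"
   have "Ad G g ?w = A \<cdot> exp (- ad X) \<cdot> exp (- ad X) \<cdot> Ad G g y" by (simp add: Aapp)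
   also have "\<dots> = Ad G g y" by (simp flip: eX)
   finally have "Ad G (inv g) (Ad G g ?w) = Ad G (inv g) (Ad G g y)" by simp
   thus ?thesis using g by simp
  qed
  have "- X \<in> p" using X subspace_neg[OF subspace_p] by blast
  from Q_exp_p[OF this] have "Q (Ad G c x) (Ad G c y) = Q (Ad G g x) (exp (- ad X) \<cdot> exp (- ad X) \<cdot> Ad G g y)"
   by (simp add: kap ad_simps)
  also have "\<dots> = Q x y" by (simp add: adj[OF g] eqy)
  finally show ?thesis .
 qed
 hence "c \<in> K" using kc by (subst K_eq) simp
 moreover have "g = lie_exp G X \<otimes> c"
  using g lie_exp_minus[of X] by (simp add: c_def flip: m_assoc)
 ultimately show ?thesis using that X by blast
qed

end

section \<open>The Weyl group\<close>

context lie_root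
begin

text \<open>Not the Weyl group: a sum of weight spaces selected by a predicate. Nilradicals,
  parabolic subalgebras and the filtrations by an element of \<open>a\<close> are all of this form,
  and inclusions between them become statements about weights.\<close>

definition W :: "(('e => real) => bool) => 'e set" where "W P = span (\<Union>\<alpha>\<in>{\<alpha>\<in>wts. P \<alpha>}. rs \<alpha>)"

lemma subspace_W [simp]: "subspace (W P)"
 by (simp add: W_def)

lemmas W_closed = subspace_0[OF subspace_W] subspace_add[OF subspace_W] subspace_scale[OF subspace_W]

lemma rs_W: "\<alpha> \<in> wts ==> P \<alpha> ==> X \<in> rs \<alpha> ==> X \<in> W P"
 unfolding W_def by (intro span_base) blast

lemma W_induct:
 assumes "X \<in> W P" "subspace V" "!!\<alpha> X. \<alpha> \<in> wts ==> P \<alpha> ==> X \<in> rs \<alpha> ==> X \<in> V"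
 shows "X \<in> V"
proof -
 have "W P \<subseteq> V" unfolding W_def by (rule span_minimal[OF _ assms(2)]) (use assms(3) in auto)
 thus ?thesis using assms(1) by blast
qed

lemma W_mono: "X \<in> W P ==> (!!\<alpha>. \<alpha> \<in> wts ==> P \<alpha> ==> P' \<alpha>) ==> X \<in> W P'"
 by (rule W_induct[of X P]) (auto intro: rs_W)

lemma W_orth:
 assumes "X \<in> W P" "Y \<in> W P'" "!!\<alpha>. \<alpha> \<in> wts ==> P \<alpha> ==> \<not> P' \<alpha>"
 shows "Q X Y = 0"
proof -
 have 1: "Q X Y = 0" if X: "\<alpha> \<in> wts" "P \<alpha>" "X \<in> rs \<alpha>" for \<alpha> X
 proof -
  have "Y \<in> {Y. Q X Y = 0}"
  proof (rule W_induct[OF assms(2)])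
   show "subspace {Y. Q X Y = 0}" by (auto simp: subspace_def Q_simps)
   show "Z \<in> {Y. Q X Y = 0}" if "\<beta> \<in> wts" "P' \<beta>" "Z \<in> rs \<beta>" for \<beta> Z
    using rs_orthogonal[OF wts_ext[OF X(1)] wts_ext[OF that(1)] _ X(3) that(3)] assms(3)[OF X(1,2)] that(2) by blast
  qed
  thus ?thesis by simp
 qed
 have "X \<in> {X. Q X Y = 0}"
 proof (rule W_induct[OF assms(1)])
  show "subspace {X. Q X Y = 0}" by (auto simp: subspace_def Q_simps)
 qed (use 1 in auto)
 thus ?thesis by simp
qed

lemma W_decomp: "\<exists>v\<in>W P. \<exists>w\<in>W (%\<alpha>. \<not> P \<alpha>). x = v + w"
proof -
 let ?S = "{v + w | v w. v \<in> W P \<and> w \<in> W (%\<alpha>. \<not> P \<alpha>)}"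
 have "span (\<Union>\<alpha>\<in>wts. rs \<alpha>) \<subseteq> ?S"
 proof (rule span_minimal)
  show "subspace ?S" by (rule subspace_sums) simp_all
  show "(\<Union>\<alpha>\<in>wts. rs \<alpha>) \<subseteq> ?S"
  proof
   fix x assume "x \<in> (\<Union>\<alpha>\<in>wts. rs \<alpha>)"
   then obtain \<alpha> where \<alpha>: "\<alpha> \<in> wts" "x \<in> rs \<alpha>" by blast
   have 0: "0 \<in> W P'" for P' by (simp add: subspace_0)
   show "x \<in> ?S"
   proof (cases "P \<alpha>")
    case True
    hence "x \<in> W P" using rs_W \<alpha> by blast
    thus ?thesis using 0[of "%\<alpha>. \<not> P \<alpha>"] by (intro CollectI exI[of _ x] exI[of _ 0]) simp
   next
    case False
    hence "x \<in> W (%\<alpha>. \<not> P \<alpha>)" using rs_W[of \<alpha> "%\<alpha>. \<not> P \<alpha>"] \<alpha> by blast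
    thus ?thesis using 0[of P] by (intro CollectI exI[of _ 0] exI[of _ x]) simp
   qed
  qed
 qed
 hence "x \<in> ?S" using span_rs by blast
 thus ?thesis by blast
qed

lemma rs_W_iff:
 assumes "\<alpha> \<in> wts" "E \<in> rs \<alpha>" "E ~= 0"
 shows "E \<in> W P \<longleftrightarrow> P \<alpha>"
proof
 show "P \<alpha>" if E: "E \<in> W P"
 proof (rule ccontr)
  assume "\<not> P \<alpha>"
  moreover have "E \<in> W (%\<beta>. \<beta> = \<alpha>)" by (rule rs_W[OF assms(1) _ assms(2)]) simp
  ultimately have "Q E E = 0" using W_orth[OF E] by blast
  thus False using assms(3) by simp
 qed
qed (rule rs_W[OF assms(1) _ assms(2)])

lemma W_projection:
 obtains pr where "linear pr" "!!x. pr x \<in> W P" "!!x. x - pr x \<in> W (%\<alpha>. \<not> P \<alpha>)"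
  "!!x. x \<in> W P ==> pr x = x" "!!x. x \<in> W (%\<alpha>. \<not> P \<alpha>) ==> pr x = 0"
proof (rule projection_along[OF subspace_W[of P] subspace_W[of "%\<alpha>. \<not> P \<alpha>"] _ W_decomp])
 show "W P \<inter> W (%\<alpha>. \<not> P \<alpha>) = {0}"
 proof
  show "W P \<inter> W (%\<alpha>. \<not> P \<alpha>) \<subseteq> {0}"
  proof
   fix x assume "x \<in> W P \<inter> W (%\<alpha>. \<not> P \<alpha>)"
   hence "Q x x = 0" using W_orth[of x P x "%\<alpha>. \<not> P \<alpha>"] by blast
   thus "x \<in> {0}" by simp
  qed
 qed (simp add: subspace_0)
qed (rule that)

lemma W_br:
 assumes "X \<in> W P" "Y \<in> W P'" and add: "!!\<alpha> \<beta>. \<alpha> \<in> wts ==> \<beta> \<in> wts ==> P \<alpha> ==> P' \<beta> ==> wadd \<alpha> \<beta> \<in> wts ==> P'' (wadd \<alpha> \<beta>)"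
 shows "br X Y \<in> W P''"
proof -
 have 1: "br X Y \<in> W P''" if X: "\<alpha> \<in> wts" "P \<alpha>" "X \<in> rs \<alpha>" for \<alpha> X
 proof -
  have "Y \<in> {Y. br X Y \<in> W P''}"
  proof (rule W_induct[OF assms(2)])
   show "subspace {Y. br X Y \<in> W P''}"
    by (auto simp: subspace_def br_simps intro: W_closed)
   show "Z \<in> {Y. br X Y \<in> W P''}" if Z: "\<beta> \<in> wts" "P' \<beta>" "Z \<in> rs \<beta>" for \<beta> Z
   proof (cases "br X Z = 0")
    case False
    have b: "br X Z \<in> rs (wadd \<alpha> \<beta>)" by (rule br_rs[OF X(3) Z(3)])
    hence w: "wadd \<alpha> \<beta> \<in> wts" using wts_iff[OF w_ext(2)] False by blast
    thus ?thesis using rs_W[where P=P'', OF w add[OF X(1) Z(1) X(2) Z(2) w] b] by simp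
   qed (simp add: subspace_0)
  qed
  thus ?thesis by simp
 qed
 have "X \<in> {X. br X Y \<in> W P''}"
 proof (rule W_induct[OF assms(1)])
  show "subspace {X. br X Y \<in> W P''}"
   by (auto simp: subspace_def br_simps intro: W_closed)
 qed (use 1 in auto)
 thus ?thesis by simp
qed

end

lemma (in group) conj_fixed_commute:
 assumes "x \<in> carrier G" "y \<in> carrier G" "x \<otimes> y \<otimes> inv x = y"
 shows "x \<otimes> y = y \<otimes> x"
proof -
 have "x \<otimes> y = (x \<otimes> y \<otimes> inv x) \<otimes> x" using assms(1,2) by (simp add: m_assoc)
 thus ?thesis by (simp only: assms(3))
qed

context lie_symmetric
begin

definition A :: "'g set" where "A = lie_exp G ` a"

abbreviation "T \<equiv> grp_T G K A"
abbreviation "M \<equiv> grp_M G K A"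

lemma A_commute: "x \<in> A ==> y \<in> A ==> x \<otimes> y = y \<otimes> x"
proof -
 assume x: "x \<in> A" and y: "y \<in> A"
 obtain H where Hx: "H \<in> a" "x = lie_exp G H" using x unfolding A_def by (rule imageE)
 obtain H' where Hy: "H' \<in> a" "y = lie_exp G H'" using y unfolding A_def by (rule imageE)
 note H = Hx(1) Hy(1) Hx(2) Hy(2)
 have "ad H \<cdot> H' = 0 *\<^sub>R H'" using br_aa[OF H(1,2)] by simp
 from exp_eigenvector[OF this] have "Ad G (lie_exp G H) H' = H'" by (simp add: Ad_lie_exp)
 hence "lie_exp G H \<otimes> lie_exp G H' \<otimes> inv (lie_exp G H) = lie_exp G H'" by (simp add: lie_exp_conj)
 thus ?thesis using H by (intro conj_fixed_commute) simp_all
qed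

text \<open>Commutation in the group is differentiated twice: in t it says that
  \<open>exp (s ad H)\<close> fixes Y, and in s that the bracket vanishes. Thus normalizing A
  implies preserving \<open>a\<close>.\<close>

lemma centralizes_a:
 assumes "Y \<in> p" and c: "!!H t. H \<in> a ==> exp (ad H) * exp (t *\<^sub>R ad Y) = exp (t *\<^sub>R ad Y) * exp (ad H)"
 shows "Y \<in> a"
proof (rule a_maximal[OF assms(1)])
 fix H assume H: "H \<in> a"
 have fix1: "exp (s *\<^sub>R ad H) \<cdot> Y = Y" for s
 proof (rule exp_ad_inj)
  fix t
  have sH: "s *\<^sub>R H \<in> a" using H subspace_scale[OF subspace_a] by blast
  let ?E = "exp (s *\<^sub>R ad H)"
  have inv: "exp (- (s *\<^sub>R ad H)) * ?E = 1" "?E * exp (- (s *\<^sub>R ad H)) = 1"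
   using exp_minus_inverse[of "- (s *\<^sub>R ad H)"] exp_minus_inverse[of "s *\<^sub>R ad H"] by simp_all
  have "ad (?E \<cdot> Y) * ?E = ?E * ad Y" using aut_ad[OF aut_exp_ad[of "s *\<^sub>R H"], of Y] by (simp add: ad_simps)
  from arg_cong[OF this, of "%T. T * exp (- (s *\<^sub>R ad H))"]
  have "ad (?E \<cdot> Y) = ?E * ad Y * exp (- (s *\<^sub>R ad H))" by (simp only: mult.assoc inv(2) mult_1_right)
  hence "exp (t *\<^sub>R ad (?E \<cdot> Y)) = ?E * exp (t *\<^sub>R ad Y) * exp (- (s *\<^sub>R ad H))"
   using exp_conj_endo[OF inv, of "t *\<^sub>R ad Y"] by simp
  also have "\<dots> = exp (t *\<^sub>R ad Y)" using c[OF sH, of t] inv by (simp add: ad_simps mult.assoc)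
  finally show "exp (t *\<^sub>R ad (?E \<cdot> Y)) = exp (t *\<^sub>R ad Y)" .
 qed
 have "((%s. exp (s *\<^sub>R ad H) \<cdot> Y) has_vector_derivative ad H \<cdot> Y) (at 0)"
  using bounded_linear.has_vector_derivative[OF app.bounded_linear_left exp_scaleR_has_vector_derivative_right[of "ad H" 0 UNIV]]
  by simp
 hence "((%s::real. Y) has_vector_derivative br H Y) (at 0)" by (simp add: fix1)
 moreover have "((%s::real. Y) has_vector_derivative 0) (at 0)" by (rule has_vector_derivative_const)
 ultimately show "br H Y = 0" by (rule vector_derivative_unique_at)
qed

lemma T_K: "t \<in> T ==> t \<in> K"
 by (simp add: grp_T_def)

lemma T_carrier: "t \<in> T ==> t \<in> carrier G"
 by (simp add: T_K K_carrier)

lemma T_a: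
 assumes t: "t \<in> T" and H: "H \<in> a"
 shows "Ad G t H \<in> a"
proof (rule centralizes_a)
 show "Ad G t H \<in> p" by (rule Ad_K_p[OF T_K[OF t] a_p[OF H]])
 fix H' s assume H': "H' \<in> a"
 have "lie_exp G (s *\<^sub>R H) \<in> A" using H subspace_scale[OF subspace_a] by (auto simp: A_def)
 hence "t \<otimes> lie_exp G (s *\<^sub>R H) \<otimes> inv t \<in> A" using t by (auto simp: grp_T_def)
 hence "lie_exp G (s *\<^sub>R Ad G t H) \<in> A"
  by (simp add: lie_exp_conj T_carrier[OF t] linear_cmul[OF linear_Ad[OF T_carrier[OF t]]])
 hence "lie_exp G H' \<otimes> lie_exp G (s *\<^sub>R Ad G t H) = lie_exp G (s *\<^sub>R Ad G t H) \<otimes> lie_exp G H'"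
  using H' by (intro A_commute) (auto simp: A_def)
 hence "AdE (lie_exp G H' \<otimes> lie_exp G (s *\<^sub>R Ad G t H)) = AdE (lie_exp G (s *\<^sub>R Ad G t H) \<otimes> lie_exp G H')" by simp
 thus "exp (ad H') * exp (s *\<^sub>R ad (Ad G t H)) = exp (s *\<^sub>R ad (Ad G t H)) * exp (ad H')"
  by (simp add: AdE_mult ad_simps)
qed

lemma T_iff: "t \<in> T \<longleftrightarrow> t \<in> K \<and> Ad G t ` a = a"
proof
 assume t: "t \<in> T"
 note l = linear_Ad[OF T_carrier[OF t]]
 have inj: "inj_on (Ad G t) a" by (rule inj_on_inverseI[of _ "Ad G (inv t)"]) (simp add: T_carrier[OF t])
 have "Ad G t ` a = a"
 proof (rule subspace_dim_equal)
  show "subspace (Ad G t ` a)" by (rule linear_subspace_image[OF l subspace_a])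
  show "dim a <= dim (Ad G t ` a)"
   using dim_image_eq[OF l, of a] inj span_eq_iff[THEN iffD2, OF subspace_a] by simp
 qed (use T_a[OF t] subspace_a in auto)
 thus "t \<in> K \<and> Ad G t ` a = a" using T_K[OF t] by simp
next
 assume t: "t \<in> K \<and> Ad G t ` a = a"
 hence "(%x. t \<otimes> x \<otimes> inv t) ` A = (%H. lie_exp G (Ad G t H)) ` a"
  by (simp add: A_def image_image lie_exp_conj K_carrier)
 also have "\<dots> = lie_exp G ` (Ad G t ` a)" by (simp only: image_image)
 finally have "(%x. t \<otimes> x \<otimes> inv t) ` A = lie_exp G ` (Ad G t ` a)" .
 thus "t \<in> T" using t by (simp add: grp_T_def A_def)
qed

lemma T_inv: "t \<in> T ==> inv t \<in> T"
proof -
 assume t: "t \<in> T"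
 have "Ad G (inv t) ` a = Ad G (inv t) ` (Ad G t ` a)" using t T_iff by simp
 also have "\<dots> = a" by (simp add: image_image T_carrier[OF t])
 finally show "inv t \<in> T" using t subgroup_K T_K[OF t] by (simp add: T_iff subgroup.m_inv_closed)
qed

lemma T_mult: "s \<in> T ==> t \<in> T ==> s \<otimes> t \<in> T"
proof -
 assume s: "s \<in> T" and t: "t \<in> T"
 have "Ad G (s \<otimes> t) ` a = Ad G s ` (Ad G t ` a)"
  by (simp add: image_image Ad_mult T_carrier[OF s] T_carrier[OF t])
 thus "s \<otimes> t \<in> T" using s t subgroup_K by (simp add: T_iff subgroup.m_closed)
qed

lemma M_iff: "m \<in> M \<longleftrightarrow> m \<in> K \<and> (\<forall>H\<in>a. Ad G m H = H)"
proof
 assume m: "m \<in> M"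
 hence mK: "m \<in> K" by (simp add: grp_M_def)
 note mc = K_carrier[OF mK]
 have "Ad G m H = H" if H: "H \<in> a" for H
 proof (rule exp_ad_inj)
  fix s
  have "lie_exp G (s *\<^sub>R H) \<in> A" using H subspace_scale[OF subspace_a] by (auto simp: A_def)
  hence "m \<otimes> lie_exp G (s *\<^sub>R H) = lie_exp G (s *\<^sub>R H) \<otimes> m" using m by (simp add: grp_M_def)
  hence "m \<otimes> lie_exp G (s *\<^sub>R H) \<otimes> inv m = lie_exp G (s *\<^sub>R H)" using mc by (simp add: m_assoc)
  hence "lie_exp G (s *\<^sub>R Ad G m H) = lie_exp G (s *\<^sub>R H)"
   by (simp add: lie_exp_conj mc linear_cmul[OF linear_Ad[OF mc]])
  hence "AdE (lie_exp G (s *\<^sub>R Ad G m H)) = AdE (lie_exp G (s *\<^sub>R H))" by simp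
  thus "exp (s *\<^sub>R ad (Ad G m H)) = exp (s *\<^sub>R ad H)" by (simp add: ad_simps)
 qed
 thus "m \<in> K \<and> (\<forall>H\<in>a. Ad G m H = H)" using mK by blast
next
 assume m: "m \<in> K \<and> (\<forall>H\<in>a. Ad G m H = H)"
 hence mc: "m \<in> carrier G" by (simp add: K_carrier)
 have "m \<otimes> x = x \<otimes> m" if x: "x \<in> A" for x
 proof -
  obtain H where H: "H \<in> a" "x = lie_exp G H" using x by (auto simp: A_def)
  have "m \<otimes> x \<otimes> inv m = x" using lie_exp_conj[OF mc, of H] m H by simp
  thus ?thesis using mc H by (intro conj_fixed_commute) simp_all
 qed
 thus "m \<in> M" using m by (simp add: grp_M_def)
qed

lemma M_T: "m \<in> M ==> m \<in> T"
 by (auto simp: M_iff T_iff image_iff)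

definition tw :: "'g => ('e => real) => 'e => real" where "tw t \<alpha> = (\<lambda>H\<in>a. \<alpha> (Ad G (inv t) H))"

lemma tw_ext [simp]: "tw t \<alpha> \<in> extensional a"
 by (simp add: tw_def)

lemma tw_app: "H \<in> a ==> tw t \<alpha> H = \<alpha> (Ad G (inv t) H)"
 by (simp add: tw_def)

lemma tw_Ad: "t \<in> T ==> H \<in> a ==> tw t \<alpha> (Ad G t H) = \<alpha> H"
 using T_a by (simp add: tw_app T_carrier)

lemma tw_inv_app: "t \<in> T ==> H \<in> a ==> tw (inv t) \<alpha> H = \<alpha> (Ad G t H)"
 by (simp add: tw_app T_carrier)

lemma tw_mult: "s \<in> T ==> t \<in> T ==> tw (s \<otimes> t) \<alpha> = tw s (tw t \<alpha>)"
 using T_a[OF T_inv] by (auto simp: tw_def inv_mult_group T_carrier Ad_mult)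

lemma tw_inv [simp]: "t \<in> T ==> \<alpha> \<in> extensional a ==> tw (inv t) (tw t \<alpha>) = \<alpha>"
 "t \<in> T ==> \<alpha> \<in> extensional a ==> tw t (tw (inv t) \<alpha>) = \<alpha>"
 using T_a T_a[OF T_inv] by (auto intro!: wt_ext_eq simp: tw_app T_carrier)

lemma tw_wneg: "t \<in> T ==> tw t (wneg \<alpha>) = wneg (tw t \<alpha>)"
 using T_a[OF T_inv] by (intro wt_ext_eq) (auto simp: tw_app)

lemma tw_wscale: "t \<in> T ==> tw t (wscale c \<alpha>) = wscale c (tw t \<alpha>)"
 using T_a[OF T_inv] by (intro wt_ext_eq) (auto simp: tw_app)

lemma tw_wadd: "t \<in> T ==> tw t (wadd \<alpha> \<beta>) = wadd (tw t \<alpha>) (tw t \<beta>)"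
 using T_a[OF T_inv] by (intro wt_ext_eq) (auto simp: tw_app)

lemma Ad_rs:
 assumes t: "t \<in> T" and X: "X \<in> rs \<alpha>"
 shows "Ad G t X \<in> rs (tw t \<alpha>)"
proof -
 note tc = T_carrier[OF t]
 have "br H (Ad G t X) = tw t \<alpha> H *\<^sub>R Ad G t X" if H: "H \<in> a" for H
 proof -
  have "br H (Ad G t X) = Ad G t (br (Ad G (inv t) H) X)" using tc by (simp add: Ad_bracket)
  also have "\<dots> = tw t \<alpha> H *\<^sub>R Ad G t X"
   using rsD[OF X T_a[OF T_inv[OF t] H]] H by (simp add: linear_cmul[OF linear_Ad[OF tc]] tw_app)
  finally show ?thesis .
 qed
 thus ?thesis by (simp add: root_space_def)
qed

lemma tw_R:
 assumes t: "t \<in> T" and \<alpha>: "\<alpha> \<in> R"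
 shows "tw t \<alpha> \<in> R"
proof -
 obtain E where E: "E \<in> rs \<alpha>" "E ~= 0" using root_vector[OF \<alpha>] by blast
 have "Ad G t E ~= 0" using E(2) T_carrier[OF t] by (metis Ad_inv_cancel(1) inv_closed linear_0 linear_Ad)
 moreover have "tw t \<alpha> ~= zero_wt"
 proof
  assume "tw t \<alpha> = zero_wt"
  hence "\<alpha> H = 0" if "H \<in> a" for H using tw_Ad[OF t that, of \<alpha>] T_a[OF t that] by simp
  thus False using \<alpha> by (auto simp: restricted_roots_def)
 qed
 ultimately show ?thesis using root_rootI[OF tw_ext Ad_rs[OF t E(1)]] by blast
qed

lemma tw_wts: "t \<in> T ==> \<alpha> \<in> wts ==> tw t \<alpha> \<in> wts"
proof -
 assume t: "t \<in> T" and "\<alpha> \<in> wts"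
 moreover have "tw t zero_wt = zero_wt" using T_a[OF T_inv[OF t]] by (intro wt_ext_eq) (auto simp: tw_app)
 ultimately show "tw t \<alpha> \<in> wts" using tw_R[OF t] by (auto simp: wts_def)
qed

lemma Ad_W:
 assumes t: "t \<in> T" and X: "X \<in> W P" and P: "!!\<alpha>. \<alpha> \<in> wts ==> P \<alpha> ==> P' (tw t \<alpha>)"
 shows "Ad G t X \<in> W P'"
proof -
 note l = linear_Ad[OF T_carrier[OF t]]
 have "X \<in> {X. Ad G t X \<in> W P'}"
 proof (rule W_induct[OF X])
  show "subspace {X. Ad G t X \<in> W P'}"
   by (auto simp: subspace_def linear_add[OF l] linear_cmul[OF l] linear_0[OF l] intro: W_closed)
  show "Y \<in> {X. Ad G t X \<in> W P'}" if "\<alpha> \<in> wts" "P \<alpha>" "Y \<in> rs \<alpha>" for \<alpha> Y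
   using rs_W[where P=P', OF tw_wts[OF t that(1)] P[OF that(1,2)] Ad_rs[OF t that(3)]] by simp
 qed
 thus ?thesis by simp
qed

lemma roots_separate:
 assumes "H \<in> a" "!!\<alpha>. \<alpha> \<in> R ==> \<alpha> H = 0"
 shows "H = 0"
proof (rule ad_inj, rule endo_eqI)
 fix x
 have "x \<in> {x. br H x = 0}"
 proof (rule W_induct[of x "%_. True"])
  show "x \<in> W (%_. True)" using span_rs by (simp add: W_def)
  show "subspace {x. br H x = 0}" by (auto simp: subspace_def br_simps)
  show "Y \<in> {x. br H x = 0}" if "\<alpha> \<in> wts" "Y \<in> rs \<alpha>" for \<alpha> Y
   using rsD[OF that(2) assms(1)] that(1) assms by (auto simp: wts_def)
 qed
 thus "ad H \<cdot> x = 0 \<cdot> x" by (simp add: app_simps)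
qed

end

section \<open>Elements of T that preserve the positive roots\<close>

context lie_symmetric
begin

definition dominant :: "'e => bool" where "dominant H \<longleftrightarrow> H \<in> a \<and> (\<forall>\<alpha>\<in>\<Phi>. \<alpha> H \<ge> 0)"

text \<open>The product of the two exponentials has derivative
  \<open>ad (pr X) + ad (X - pr X) = ad X\<close> at 0, so it parametrizes the automorphisms near 1.
  With pr the projection onto the negative root spaces this is the open cell of the Bruhat
  decomposition.\<close>

lemma big_cell:
 assumes pr: "linear pr"
 obtains s where "s > 0" "!!U. aut U ==> norm (U - 1) < s ==> \<exists>X. U = exp (ad (pr X)) * exp (ad (X - pr X))"
proof -
 let ?L = "%X. ad (pr X)" and ?R = "%X. ad (X - pr X)"
 have L: "bounded_linear ?L" using linear_compose[OF pr linear_ad] by (simp add: o_def linear_linear)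
 have "linear (%X. X - pr X)" by (intro linear_compose_sub linear_ident pr)
 from linear_compose[OF this linear_ad] have R: "bounded_linear ?R" by (simp add: o_def linear_linear)
 have eq: "(%X. ?L X + ?R X) = ad" by (intro ext) (simp add: ad_simps)
 have "strict_at_0 (%X. exp (?L X) * exp (?R X)) (%X. ?L X + ?R X)"
  by (intro strict_at_0_mult strict_at_0_exp L R) (simp_all add: linear_0[OF pr] ad_simps)
 hence st: "strict_at_0 (%X. exp (?L X) * exp (?R X)) ad" unfolding eq .
 obtain s where s: "s > 0" "!!U. aut U ==> norm (U - 1) < s ==> \<exists>X. norm X < 1 \<and> exp (?L X) * exp (?R X) = U"
 proof (rule ad_local_parametrization[OF _ st, of 1])
  show "\<exists>d>0. \<forall>X. norm X <= d --> aut (exp (?L X) * exp (?R X))"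
   by (intro exI[of _ 1]) (simp add: aut_mult aut_exp_ad)
 qed (auto simp: linear_0[OF pr] ad_simps)
 thus ?thesis using that[OF s(1)] by metis
qed

text \<open>Connectedness of \<open>G\<close> enters here: a polynomial condition on \<open>Ad g\<close> that holds near the
 identity holds everywhere, by analyticity along one-parameter subgroups.\<close>

lemma endo_det_continuation:
 assumes near: "s > 0" "!!U. aut U ==> norm (U - 1) < s ==> endo_det (P * U * P' + C) = 0"
  and g: "g \<in> carrier G"
 shows "endo_det (P * AdE g * P' + C) = 0"
proof -
 \<comment> \<open>The condition is asked for all automorphisms U near 1 and not only at
   \<open>AdE g\<close>. This provides the interval of parameters on which the identity theorem
   starts.\<close>
 define Z where "Z = {g \<in> carrier G. \<exists>e>0. \<forall>U. aut U --> norm (U - 1) < e --> endo_det (P * (AdE g * U) * P' + C) = 0}"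
 have "Z = carrier G"
 proof (rule lie_exp_generates)
  show "Z \<subseteq> carrier G" by (auto simp: Z_def)
  show "\<one> \<in> Z" using near by (auto simp: Z_def)
  fix h X assume "h \<in> Z"
  then obtain e where h: "h \<in> carrier G" and e: "e > 0"
   "!!U. aut U ==> norm (U - 1) < e ==> endo_det (P * (AdE h * U) * P' + C) = 0" by (auto simp: Z_def)
  have "endo_det (P * (AdE (h \<otimes> lie_exp G X) * U) * P' + C) = 0" if U: "aut U" "norm (U - 1) < min 1 (e / 4)" for U
  proof -
   obtain d where d: "d > 0" "!!S :: 'e endo. norm S <= d ==> norm (exp S - 1) < e / 4"
    using exp_near_one[of "e / 4"] e(1) by auto
   define \<tau> where "\<tau> = d / (norm (ad X) + 1)"
   have tau: "\<tau> > 0" using d by (simp add: \<tau>_def add_nonneg_pos)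
   let ?f = "%t. endo_det ((P * AdE h) * exp (t *\<^sub>R ad X) * (U * P') + C)"
   have small: "?f t = 0" if t: "\<bar>t\<bar> < \<tau>" for t
   proof -
    have "\<bar>t\<bar> * norm (ad X) <= \<tau> * (norm (ad X) + 1)" using t tau by (intro mult_mono) auto
    also have "\<dots> = d" by (simp add: \<tau>_def add_nonneg_eq_0_iff)
    finally have E: "norm (exp (t *\<^sub>R ad X) - 1) < e / 4" by (intro d(2)) simp
    have nU: "norm U <= 2" using norm_triangle_ineq[of "U - 1" 1] U(2) by simp
    have "exp (t *\<^sub>R ad X) * U - 1 = (exp (t *\<^sub>R ad X) - 1) * U + (U - 1)" by (simp add: algebra_simps)
    hence "norm (exp (t *\<^sub>R ad X) * U - 1) <= norm (exp (t *\<^sub>R ad X) - 1) * norm U + norm (U - 1)"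
     by (metis add_right_mono norm_mult_ineq norm_triangle_le)
    also have "\<dots> <= e / 4 * 2 + norm (U - 1)" using E nU e(1) by (intro add_right_mono mult_mono) auto
    also have "\<dots> < e" using U(2) e(1) by simp
    finally have "endo_det (P * (AdE h * (exp (t *\<^sub>R ad X) * U)) * P' + C) = 0"
     using e(2) aut_mult[OF aut_exp_ad[of "t *\<^sub>R X"] U(1)] by (simp add: ad_simps)
    thus ?thesis by (simp add: mult.assoc)
   qed
   have "entire ?f"
   proof (rule entire_endo_det)
    fix x y
    show "entire (%t. ((P * AdE h) * exp (t *\<^sub>R ad X) * (U * P') + C) \<cdot> x \<bullet> y)"
     unfolding app.add_left inner_add_left by (intro entire_add entire_sandwich entire_const)
   qed
   from entire_zero[OF this tau small, of 1] show ?thesis using h by (simp add: AdE_mult mult.assoc)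
  qed
  thus "h \<otimes> lie_exp G X \<in> Z" unfolding Z_def using h e(1) by (auto intro!: exI[of _ "min 1 (e / 4)"])
 qed
 then obtain e where "e > 0" "!!U. aut U ==> norm (U - 1) < e ==> endo_det (P * (AdE g * U) * P' + C) = 0"
  using g by (auto simp: Z_def)
 from this(2)[of 1] this(1) show ?thesis using aut_AdE[OF one_closed] by simp
qed

lemma dominant_wt:
 assumes "dominant H" "\<alpha> \<in> wts" "wneg \<alpha> \<notin> \<Phi>"
 shows "\<alpha> H \<ge> 0"
proof (cases "\<alpha> = zero_wt")
 case False
 hence "\<alpha> \<in> R" using assms(2) by (simp add: wts_def)
 thus ?thesis using assms(1,3) neg_Phi_iff by (auto simp: dominant_def)
qed (use assms in \<open>simp add: dominant_def\<close>)

lemma chamber_fix_dominant: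
 assumes t: "t \<in> T" and pos: "!!\<alpha>. \<alpha> \<in> \<Phi> ==> tw t \<alpha> \<in> \<Phi>" and H: "dominant H"
 shows "Ad G t H = H"
proof (rule ccontr)
 assume ne: "Ad G t H ~= H"
 let ?H' = "Ad G t H"
 note tc = T_carrier[OF t]
 have Ha: "H \<in> a" and H'a: "?H' \<in> a" using H T_a[OF t] by (auto simp: dominant_def)
 have posinv: "tw (inv t) \<alpha> \<in> \<Phi>" if \<alpha>: "\<alpha> \<in> \<Phi>" for \<alpha>
 proof (rule ccontr)
  assume "tw (inv t) \<alpha> \<notin> \<Phi>"
  hence "wneg (tw (inv t) \<alpha>) \<in> \<Phi>" using neg_Phi_iff[OF tw_R[OF T_inv[OF t] Phi_R[OF \<alpha>]]] by simp
  hence "tw t (wneg (tw (inv t) \<alpha>)) \<in> \<Phi>" by (rule pos)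
  hence "wneg \<alpha> \<in> \<Phi>" using t root_ext[OF Phi_R[OF \<alpha>]] by (simp add: tw_wneg)
  thus False using neg_Phi_iff[OF Phi_R[OF \<alpha>]] \<alpha> by simp
 qed
 have H'd: "dominant ?H'"
  using posinv H H'a t by (auto simp: dominant_def simp flip: tw_inv_app)
 define L where "L X c = W (%\<alpha>. \<alpha> X \<ge> c)" for X c
 have AdL: "Ad G t ` L H c = L ?H' c" for c
 proof
  show "Ad G t ` L H c \<subseteq> L ?H' c"
  proof
   fix y assume "y \<in> Ad G t ` L H c"
   then obtain x where x: "x \<in> L H c" "y = Ad G t x" by blast
   show "y \<in> L ?H' c" unfolding x(2) L_def
    by (rule Ad_W[OF t x(1)[unfolded L_def]]) (simp add: tw_Ad[OF t Ha])
  qed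
  show "L ?H' c \<subseteq> Ad G t ` L H c"
  proof
   fix y assume y: "y \<in> L ?H' c"
   have "Ad G (inv t) y \<in> L H c" unfolding L_def
    by (rule Ad_W[OF T_inv[OF t] y[unfolded L_def]]) (simp add: tw_inv_app[OF t Ha])
   thus "y \<in> Ad G t ` L H c" using tc by (force simp: image_iff)
  qed
 qed
 have "\<exists>\<alpha>\<in>R. \<alpha> H ~= \<alpha> ?H'"
 proof (rule ccontr)
  assume "\<not> (\<exists>\<alpha>\<in>R. \<alpha> H ~= \<alpha> ?H')"
  hence eq: "\<alpha> H = \<alpha> ?H'" if "\<alpha> \<in> R" for \<alpha> using that by blast
  have "H - ?H' = 0"
  proof (rule roots_separate[OF subspace_diff[OF subspace_a Ha H'a]])
   show "\<alpha> (H - ?H') = 0" if "\<alpha> \<in> R" for \<alpha>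
    unfolding root_linear(2)[OF that Ha H'a] using eq[OF that] by linarith
  qed
  thus False using ne by simp
 qed
 then obtain \<alpha> where \<alpha>: "\<alpha> \<in> R" "\<alpha> H ~= \<alpha> ?H'" by blast
 \<comment> \<open>At this level exactly one of L1 and L2 contains the root space of
   \<alpha>.\<close>
 define c where "c = max (\<alpha> H) (\<alpha> ?H')"
 define L1 where "L1 = L H c"
 define L2 where "L2 = L ?H' c"
 have subL: "subspace L1" "subspace L2" by (simp_all add: L1_def L2_def L_def)
 have neL: "L1 ~= L2"
 proof
  assume eq: "L1 = L2"
  obtain E where E: "E \<in> rs \<alpha>" "E ~= 0" using root_vector[OF \<alpha>(1)] by blast
  have "\<alpha> \<in> wts" using \<alpha>(1) by (simp add: wts_def)
  note i = rs_W_iff[OF this E]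
  have "c <= \<alpha> H \<longleftrightarrow> E \<in> L1" unfolding L1_def L_def i ..
  also have "\<dots> \<longleftrightarrow> c <= \<alpha> ?H'" unfolding eq L2_def L_def i ..
  finally have "c <= \<alpha> H \<longleftrightarrow> c <= \<alpha> ?H'" .
  thus False using \<alpha>(2) by (auto simp: c_def)
 qed
 have dimL: "dim L1 = dim L2"
 proof -
  have "inj_on (Ad G t) (span L1)" by (rule inj_on_inverseI[of _ "Ad G (inv t)"]) (simp add: tc)
  from dim_image_eq[OF linear_Ad[OF tc] this] show ?thesis using AdL[of c] by (simp add: L1_def L2_def)
 qed
 obtain pm where pm: "linear pm" "!!x. pm x \<in> W (%\<alpha>. wneg \<alpha> \<in> \<Phi>)" "!!x. x - pm x \<in> W (%\<alpha>. wneg \<alpha> \<notin> \<Phi>)"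
  "!!x. x \<in> W (%\<alpha>. wneg \<alpha> \<in> \<Phi>) ==> pm x = x" "!!x. x \<in> W (%\<alpha>. wneg \<alpha> \<notin> \<Phi>) ==> pm x = 0"
  by (rule W_projection[where P = "%\<alpha>. wneg \<alpha> \<in> \<Phi>"]) (rule that; assumption?)
 have L2: "L2 = W (%\<alpha>. \<alpha> ?H' \<ge> c)" by (simp add: L2_def L_def)
 obtain p2 where p2: "linear p2" "!!x. p2 x \<in> L2" "!!x. x - p2 x \<in> W (%\<alpha>. \<not> \<alpha> ?H' \<ge> c)"
  "!!x. x \<in> L2 ==> p2 x = x" "!!x. x \<in> W (%\<alpha>. \<not> \<alpha> ?H' \<ge> c) ==> p2 x = 0"
  by (rule W_projection[where P = "%\<alpha>. \<alpha> ?H' \<ge> c", folded L2]) (rule that; assumption?)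
 have p2L1: "p2 x \<in> L1" if "x \<in> L1" for x
 proof -
  have "x \<in> {x. p2 x \<in> L1}"
  proof (rule W_induct[OF that[unfolded L1_def L_def]])
   show "subspace {x. p2 x \<in> L1}" using subL(1)
    by (auto simp: subspace_def linear_add[OF p2(1)] linear_cmul[OF p2(1)] linear_0[OF p2(1)])
   fix \<beta> Y assume b: "\<beta> \<in> wts" "\<beta> H \<ge> c" "Y \<in> rs \<beta>"
   have Y1: "Y \<in> L1" unfolding L1_def L_def by (rule rs_W[OF b(1) _ b(3)]) (rule b(2))
   show "Y \<in> {x. p2 x \<in> L1}"
   proof (cases "\<beta> ?H' \<ge> c")
    case True
    hence "Y \<in> L2" unfolding L2_def L_def using rs_W[OF b(1) _ b(3), of "%\<alpha>. \<alpha> ?H' \<ge> c"] by simp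
    thus ?thesis using p2(4) Y1 by simp
   next
    case False
    hence "Y \<in> W (%\<alpha>. \<not> \<alpha> ?H' \<ge> c)" using rs_W[OF b(1) _ b(3), of "%\<alpha>. \<not> \<alpha> ?H' \<ge> c"] by simp
    thus ?thesis using p2(5) subL(1) by (simp add: subspace_0)
   qed
  qed
  thus ?thesis by simp
 qed
 have dim_lt: "dim (p2 ` L1) < dim L2"
 proof -
  have "p2 ` L1 \<subseteq> L1 \<inter> L2" using p2L1 p2(2) by blast
  moreover have "L1 \<inter> L2 \<subset> L2"
  proof -
   have "L2 \<subseteq> L1 ==> L2 = L1" using subspace_dim_equal[OF subL(2,1)] dimL by simp
   thus ?thesis using neL by blast
  qed
  ultimately have "p2 ` L1 \<subset> L2" by blast
  moreover have "subspace (p2 ` L1)" by (rule linear_subspace_image[OF p2(1) subL(1)])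
  ultimately show ?thesis using subL(2) by (intro dim_psubset) (simp only: span_eq_iff[THEN iffD2])
 qed
 \<comment> \<open>\<open>?C\<close> completes the compression to L2 by the identity on the
   complement, so that a determinant on the whole space detects singularity on L2.\<close>
 let ?P = "endo p2" and ?C = "1 - endo p2" and ?P' = "AdE (inv t) * endo p2"
 have p2app: "?P \<cdot> x = p2 x" for x using p2(1) by simp
 obtain s where s: "s > 0" "!!U. aut U ==> norm (U - 1) < s ==> \<exists>X. U = exp (ad (pm X)) * exp (ad (X - pm X))"
  using big_cell[OF pm(1)] by blast
 have singular: "endo_det (?P * U * ?P' + ?C) = 0" if U: "aut U" "norm (U - 1) < s" for U
 proof (rule ccontr)
  assume "endo_det (?P * U * ?P' + ?C) ~= 0"
  hence "inj ((\<cdot>) (?P * U * ?P' + ?C))"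
   using endo_det_eq_0 by (intro linear_injective_0[OF linear_app, THEN iffD2]) blast
  hence surj: "surj ((\<cdot>) (?P * U * ?P' + ?C))" using linear_injective_imp_surjective[OF linear_app] by simp
  obtain X where X: "U = exp (ad (pm X)) * exp (ad (X - pm X))" using s(2)[OF U] by blast
  let ?Em = "exp (ad (pm X))" and ?Ep = "exp (ad (X - pm X))"
  have Ep: "?Ep \<cdot> v \<in> L1" if "v \<in> L1" for v
  proof (rule exp_invariant[OF subL(1) _ that])
   fix v assume "v \<in> L1"
   thus "ad (X - pm X) \<cdot> v \<in> L1"
    unfolding L1_def L_def ad_app
   proof (rule W_br[OF pm(3)])
    fix \<beta> g assume b: "\<beta> \<in> wts" "g \<in> wts" "wneg \<beta> \<notin> \<Phi>" "c <= g H"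
    show "c <= wadd \<beta> g H" using dominant_wt[OF H b(1,3)] b(4) Ha by simp
   qed
  qed
  have Em: "?Em \<cdot> v \<in> W (%\<alpha>. \<not> \<alpha> ?H' \<ge> c)" if "v \<in> W (%\<alpha>. \<not> \<alpha> ?H' \<ge> c)" for v
  proof (rule exp_invariant[OF subspace_W _ that])
   fix v assume "v \<in> W (%\<alpha>. \<not> \<alpha> ?H' \<ge> c)"
   thus "ad (pm X) \<cdot> v \<in> W (%\<alpha>. \<not> \<alpha> ?H' \<ge> c)"
    unfolding ad_app
   proof (rule W_br[OF pm(2)])
    fix \<beta> g assume b: "\<beta> \<in> wts" "g \<in> wts" "wneg \<beta> \<in> \<Phi>" "\<not> c <= g ?H'"
    have "wneg \<beta> ?H' \<ge> 0" using H'd b(3) by (auto simp: dominant_def)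
    thus "\<not> c <= wadd \<beta> g ?H'" using b(4) H'a by simp
   qed
  qed
  have "L2 \<subseteq> (%v. p2 (?Em \<cdot> v)) ` (p2 ` L1)"
  proof
   fix y assume y: "y \<in> L2"
   obtain x where x: "y = (?P * U * ?P' + ?C) \<cdot> x" using surj by (rule surjE)
   have yx: "y = p2 (U \<cdot> Ad G (inv t) (p2 x)) + (x - p2 x)"
    using x tc p2app by (simp add: app_simps)
   hence "p2 y = p2 (U \<cdot> Ad G (inv t) (p2 x))"
    using p2(4)[OF p2(2)] by (simp add: linear_add[OF p2(1)] linear_diff[OF p2(1)])
   hence "y = p2 (U \<cdot> Ad G (inv t) (p2 x))" using p2(4)[OF y] by simp
   moreover have "Ad G (inv t) (p2 x) \<in> L1"
   proof -
    have "p2 x \<in> Ad G t ` L1" using AdL[of c] p2(2) by (simp add: L1_def L2_def)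
    thus ?thesis using tc by auto
   qed
   hence w: "?Ep \<cdot> Ad G (inv t) (p2 x) \<in> L1" (is "?w \<in> L1") by (rule Ep)
   moreover have "p2 (?Em \<cdot> ?w) = p2 (?Em \<cdot> p2 ?w)"
   proof -
    have "p2 (?Em \<cdot> (?w - p2 ?w)) = 0" by (rule p2(5)[OF Em[OF p2(3)]])
    thus ?thesis by (simp add: app_simps linear_diff[OF p2(1)])
   qed
   ultimately show "y \<in> (%v. p2 (?Em \<cdot> v)) ` (p2 ` L1)" by (auto simp: X)
  qed
  hence "dim L2 <= dim ((%v. p2 (?Em \<cdot> v)) ` (p2 ` L1))" by (rule dim_subset)
  also have "\<dots> <= dim (p2 ` L1)"
   using linear_compose[OF linear_app p2(1)] by (intro dim_image_le) (simp add: o_def)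
  finally show False using dim_lt by simp
 qed
 have "endo_det (?P * AdE t * ?P' + ?C) = 0"
  by (rule endo_det_continuation[OF s(1) singular tc])
 moreover have "?P * AdE t * ?P' + ?C = 1"
  using tc p2(4)[OF p2(2)] p2app by (intro endo_eqI) (simp add: app_simps)
 ultimately show False by (simp add: endo_det_one)
qed

text \<open>Adding a large multiple of \<open>H0\<close> makes H dominant, and \<open>H0\<close> is
  dominant itself, so both are fixed and H is their difference.\<close>

lemma chamber_fix:
 assumes t: "t \<in> T" and pos: "!!\<alpha>. \<alpha> \<in> \<Phi> ==> tw t \<alpha> \<in> \<Phi>" and H: "H \<in> a"
 shows "Ad G t H = H"
proof -
 have fin: "finite \<Phi>" by (rule finite_subset[OF _ finite_R]) (auto simp: Phi_R)
 define r where "r = (\<Sum>\<alpha>\<in>\<Phi>. \<bar>\<alpha> H\<bar> / \<alpha> H0)"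
 have rH: "r *\<^sub>R H0 \<in> a" using H0(1) subspace_scale[OF subspace_a] by blast
 have d0: "dominant H0" using H0(1) by (auto simp: dominant_def Phi_iff)
 have "dominant (H + r *\<^sub>R H0)"
  unfolding dominant_def
 proof (intro conjI ballI)
  show "H + r *\<^sub>R H0 \<in> a" by (rule subspace_add[OF subspace_a H rH])
  fix \<alpha> assume \<alpha>: "\<alpha> \<in> \<Phi>"
  hence p: "\<alpha> H0 > 0" and aR: "\<alpha> \<in> R" by (auto simp: Phi_iff)
  have "\<bar>\<alpha> H\<bar> / \<alpha> H0 <= r" unfolding r_def
   by (rule member_le_sum[OF \<alpha> _ fin]) (auto simp: Phi_iff)
  hence "\<bar>\<alpha> H\<bar> <= r * \<alpha> H0" using p by (simp add: pos_divide_le_eq)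
  thus "\<alpha> (H + r *\<^sub>R H0) \<ge> 0"
   using root_linear(1)[OF aR H rH] root_linear(3)[OF aR H0(1) H] by simp
 qed
 note f = chamber_fix_dominant[OF t pos this] chamber_fix_dominant[OF t pos d0]
 have "Ad G t (H + r *\<^sub>R H0) = Ad G t H + r *\<^sub>R Ad G t H0"
  using linear_add[OF linear_Ad[OF T_carrier[OF t]]] linear_cmul[OF linear_Ad[OF T_carrier[OF t]]] by simp
 thus ?thesis using f by simp
qed

section \<open>Simple reflections, inversions and the length of words\<close>

lemma reflection_rep:
 assumes \<alpha>: "\<alpha> \<in> R"
 obtains s where "s \<in> T" "!!H. H \<in> a ==> Ad G s H = refl \<alpha> H"
proof -
 obtain Z where Z: "Z \<in> k" "!!H. H \<in> a ==> exp (ad Z) \<cdot> H = refl \<alpha> H" using reflection_exists[OF \<alpha>] by blast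
 let ?s = "lie_exp G Z"
 have r: "Ad G ?s H = refl \<alpha> H" if "H \<in> a" for H using Z(2)[OF that] by (simp add: Ad_lie_exp)
 have n: "\<alpha> (hv \<alpha>) > 0" by (rule root_hv_pos[OF \<alpha>])
 have rr: "refl \<alpha> (refl \<alpha> H) = H" if H: "H \<in> a" for H
 proof -
  let ?c = "2 * \<alpha> H / \<alpha> (hv \<alpha>)"
  have "\<alpha> (refl \<alpha> H) = - \<alpha> H"
   unfolding refl_def using root_linear(2)[OF \<alpha> H subspace_scale[OF subspace_a hv(1)[OF \<alpha>]], of ?c]
    root_linear(3)[OF \<alpha> hv(1)[OF \<alpha>] H, of ?c] n by simp
  thus ?thesis by (simp add: refl_def[of _ "refl \<alpha> H"]) (simp add: refl_def)
 qed
 have "Ad G ?s ` a = a"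
 proof
  show "Ad G ?s ` a \<subseteq> a" using r refl_a[OF \<alpha>] by auto
  show "a \<subseteq> Ad G ?s ` a"
  proof
   fix H assume H: "H \<in> a"
   hence "H = Ad G ?s (refl \<alpha> H)" using r[OF refl_a[OF \<alpha> H]] rr[OF H] by simp
   thus "H \<in> Ad G ?s ` a" using refl_a[OF \<alpha> H] by blast
  qed
 qed
 hence "?s \<in> T" using lie_exp_K[OF Z(1)] by (simp add: T_iff)
 thus ?thesis using that r by blast
qed

lemma simple_reflection_reps_iff:
 "s \<in> simple_reflection_reps G K A a \<Phi> \<longleftrightarrow> s \<in> T \<and> (\<exists>\<alpha>\<in>simple_roots a \<Phi>. \<forall>H\<in>a. Ad G s H = refl \<alpha> H)"
proof -
 have "(\<forall>H\<in>a. \<alpha> H = 0 --> Ad G s H = H) \<and> (\<forall>H\<in>a. (\<forall>H'\<in>a. \<alpha> H' = 0 --> kil H H' = 0) --> Ad G s H = - H)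
  \<longleftrightarrow> (\<forall>H\<in>a. Ad G s H = refl \<alpha> H)" (is "?L1 \<and> ?L2 \<longleftrightarrow> ?R") if s: "s \<in> T" and \<alpha>: "\<alpha> \<in> R" for \<alpha>
 proof -
  note l = linear_Ad[OF T_carrier[OF s]]
  have n: "\<alpha> (hv \<alpha>) > 0" by (rule root_hv_pos[OF \<alpha>])
  have dec: "H - (\<alpha> H / \<alpha> (hv \<alpha>)) *\<^sub>R hv \<alpha> \<in> a \<and> \<alpha> (H - (\<alpha> H / \<alpha> (hv \<alpha>)) *\<^sub>R hv \<alpha>) = 0" if H: "H \<in> a" for H
  proof -
   have ch: "(\<alpha> H / \<alpha> (hv \<alpha>)) *\<^sub>R hv \<alpha> \<in> a" using hv(1)[OF \<alpha>] subspace_scale[OF subspace_a] by blast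
   thus ?thesis
    using root_linear(2)[OF \<alpha> H ch] root_linear(3)[OF \<alpha> hv(1)[OF \<alpha>] H] n subspace_diff[OF subspace_a H ch] by simp
  qed
  show ?thesis
  proof
   assume L: "?L1 \<and> ?L2"
   have hvn: "Ad G s (hv \<alpha>) = - hv \<alpha>"
    by (rule L[THEN conjunct2, rule_format, OF hv(1)[OF \<alpha>]]) (simp add: hv(2)[OF \<alpha>])
   show ?R
   proof
    fix H assume H: "H \<in> a"
    let ?c = "\<alpha> H / \<alpha> (hv \<alpha>)"
    have "Ad G s (H - ?c *\<^sub>R hv \<alpha>) = H - ?c *\<^sub>R hv \<alpha>"
     using L[THEN conjunct1] dec[OF H] by blast
    hence "Ad G s H = H - ?c *\<^sub>R hv \<alpha> - ?c *\<^sub>R hv \<alpha>"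
     by (simp add: linear_diff[OF l] linear_cmul[OF l] hvn algebra_simps)
    thus "Ad G s H = refl \<alpha> H" by (simp add: refl_def algebra_simps flip: scaleR_2)
   qed
  next
   assume r: ?R
   have "Ad G s H = - H" if H: "H \<in> a" "\<forall>H'\<in>a. \<alpha> H' = 0 --> kil H H' = 0" for H
   proof -
    let ?c = "\<alpha> H / \<alpha> (hv \<alpha>)" and ?w = "H - (\<alpha> H / \<alpha> (hv \<alpha>)) *\<^sub>R hv \<alpha>"
    have w: "?w \<in> a" "\<alpha> ?w = 0" using dec[OF H(1)] by auto
    have "kil ?w ?w = kil H ?w - ?c * kil (hv \<alpha>) ?w" by (simp only: kil_simps(3,5))
    also have "\<dots> = 0" using H(2) w hv(2)[OF \<alpha> w(1)] by simp
    finally have "?w = 0" using w(1) a_p by (metis Q_p(1) Q_zero_iff)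
    hence eH: "H = ?c *\<^sub>R hv \<alpha>" by simp
    have "refl \<alpha> H = H - 2 *\<^sub>R (?c *\<^sub>R hv \<alpha>)" by (simp add: refl_def)
    hence "refl \<alpha> H = H - 2 *\<^sub>R H" using eH by simp
    thus ?thesis using r H(1) by (simp add: scaleR_2)
   qed
   thus "?L1 \<and> ?L2" using r by (simp add: refl_def)
  qed
 qed
 thus ?thesis
  unfolding simple_reflection_reps_def killing_eq using simple_Phi Phi_R by blast
qed

text \<open>A restricted root system need not be reduced, so lengths are counted by the shortest
 roots on each positive ray.\<close>

definition \<Phi>0 :: "('e => real) set" where
 "\<Phi>0 = {\<beta> \<in> \<Phi>. \<forall>c. 0 < c --> c < 1 --> wscale c \<beta> \<notin> \<Phi>}"

definition inversions :: "'g => ('e => real) set" where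
 "inversions t = {\<beta> \<in> \<Phi>0. tw (inv t) \<beta> \<notin> \<Phi>}"

lemma Phi0_Phi: "\<beta> \<in> \<Phi>0 ==> \<beta> \<in> \<Phi>"
 by (simp add: \<Phi>0_def)

lemma finite_Phi0: "finite \<Phi>0"
 by (rule finite_subset[OF _ finite_R]) (auto dest: Phi0_Phi Phi_R)

lemma finite_inversions: "finite (inversions t)"
 by (rule finite_subset[OF _ finite_Phi0]) (auto simp: inversions_def)

lemma simple_Phi0: "\<alpha> \<in> simple_roots a \<Phi> ==> \<alpha> \<in> \<Phi>0"
 using simple_Phi simple_root_shortest by (auto simp: \<Phi>0_def)

lemma wscale_Phi: "\<beta> \<in> \<Phi> ==> c > 0 ==> wscale c \<beta> \<in> R ==> wscale c \<beta> \<in> \<Phi>"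
 using H0(1) by (simp add: Phi_iff)

lemma Phi0_unique_on_ray:
 assumes "\<alpha> \<in> \<Phi>0" "wscale c \<alpha> \<in> \<Phi>0"
 shows "wscale c \<alpha> = \<alpha>"
proof -
 have p: "\<alpha> \<in> \<Phi>" "wscale c \<alpha> \<in> \<Phi>" using assms Phi0_Phi by auto
 hence c: "c > 0" using H0(1) by (auto simp: Phi_iff zero_less_mult_iff)
 have inv: "wscale (1 / c) (wscale c \<alpha>) = \<alpha>"
  using c root_ext[OF Phi_R[OF p(1)]] by (intro wt_ext_eq) auto
 have "\<not> c < 1" using assms(1) p(2) c by (auto simp: \<Phi>0_def)
 moreover have "\<not> 1 / c < 1"
 proof
  assume "1 / c < 1"
  moreover have "0 < 1 / c" using c by simp
  ultimately have "wscale (1 / c) (wscale c \<alpha>) \<notin> \<Phi>" using assms(2) unfolding \<Phi>0_def by blast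
  thus False using inv p(1) by simp
 qed
 ultimately have "c = 1" using c by (simp add: field_simps)
 thus ?thesis using root_ext[OF Phi_R[OF p(1)]] by (intro wt_ext_eq) auto
qed

lemma Phi0_ray:
 assumes \<beta>: "\<beta> \<in> \<Phi>"
 obtains c \<gamma> where "c > 0" "\<gamma> \<in> \<Phi>0" "\<beta> = wscale c \<gamma>"
proof -
 define S where "S = {\<gamma> \<in> \<Phi>. \<exists>c>0. \<gamma> = wscale c \<beta>}"
 have fin: "finite S" by (rule finite_subset[OF _ finite_R]) (auto simp: S_def Phi_R)
 have "\<beta> = wscale 1 \<beta>" using root_ext[OF Phi_R[OF \<beta>]] by (intro wt_ext_eq) auto
 hence "\<beta> \<in> S" using \<beta> zero_less_one unfolding S_def by blast
 hence "Min ((%\<gamma>. \<gamma> H0) ` S) \<in> (%\<gamma>. \<gamma> H0) ` S" using fin by (intro Min_in) auto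
 then obtain \<gamma> where \<gamma>S: "\<gamma> \<in> S" "\<gamma> H0 = Min ((%\<gamma>. \<gamma> H0) ` S)" by auto
 have \<gamma>: "\<gamma> \<in> S" "\<gamma> H0 <= e H0" if "e \<in> S" for e
  using \<gamma>S fin that by simp_all
 obtain c where c: "c > 0" "\<gamma> = wscale c \<beta>" "\<gamma> \<in> \<Phi>" using \<gamma>S(1) by (auto simp: S_def)
 have "wscale d \<gamma> \<notin> \<Phi>" if d: "0 < d" "d < 1" for d
 proof
  assume "wscale d \<gamma> \<in> \<Phi>"
  moreover have "wscale d \<gamma> = wscale (d * c) \<beta>" unfolding c(2) by (rule wt_ext_eq) auto
  ultimately have "wscale d \<gamma> \<in> S" using d c(1) by (auto simp: S_def intro!: exI[of _ "d * c"])
  from \<gamma>(2)[OF this] have "\<gamma> H0 <= d * \<gamma> H0" using H0(1) by simp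
  thus False using c(3) d by (simp add: Phi_iff)
 qed
 hence "\<gamma> \<in> \<Phi>0" using c(3) by (simp add: \<Phi>0_def)
 moreover have "\<beta> = wscale (1 / c) \<gamma>" unfolding c(2) using c(1) root_ext[OF Phi_R[OF \<beta>]] by (intro wt_ext_eq) auto
 ultimately show ?thesis using that[of "1 / c" \<gamma>] c(1) by simp
qed

context
 fixes s \<alpha>
 assumes s: "s \<in> T" and \<alpha>: "\<alpha> \<in> simple_roots a \<Phi>" and s_refl: "!!H. H \<in> a ==> Ad G s H = refl \<alpha> H"
begin

lemma simple_R: "\<alpha> \<in> R"
 using \<alpha> simple_Phi Phi_R by blast

lemma root_refl_self: "H \<in> a ==> \<alpha> (refl \<alpha> H) = - \<alpha> H"
proof -
 assume H: "H \<in> a"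
 let ?c = "2 * \<alpha> H / \<alpha> (hv \<alpha>)"
 show ?thesis
  unfolding refl_def using root_linear(2)[OF simple_R H subspace_scale[OF subspace_a hv(1)[OF simple_R]], of ?c]
   root_linear(3)[OF simple_R hv(1)[OF simple_R] H, of ?c] root_hv_pos[OF simple_R] by simp
qed

lemma s_involution: "H \<in> a ==> Ad G (inv s) H = refl \<alpha> H"
proof -
 assume H: "H \<in> a"
 have "refl \<alpha> (refl \<alpha> H) = H"
  using root_refl_self[OF H] by (simp add: refl_def[of _ "refl \<alpha> H"]) (simp add: refl_def)
 hence "Ad G s (refl \<alpha> H) = H" using s_refl refl_a[OF simple_R H] by simp
 thus ?thesis using T_carrier[OF s] by (metis Ad_inv_cancel(1))
qed

lemma tw_s: "H \<in> a ==> tw s \<beta> H = \<beta> (refl \<alpha> H)" "H \<in> a ==> tw (inv s) \<beta> H = \<beta> (refl \<alpha> H)"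
 using s_involution s_refl s by (simp_all add: tw_app T_carrier)

lemma tw_s_inv: "tw (inv s) \<beta> = tw s \<beta>"
 by (rule wt_ext_eq) (simp_all add: tw_s)

lemma tw_s_alpha: "tw s \<alpha> = wneg \<alpha>"
 by (rule wt_ext_eq) (simp_all add: tw_s root_refl_self)

lemma tw_s_Phi: "\<beta> \<in> \<Phi> ==> (!!c. \<beta> ~= wscale c \<alpha>) ==> tw s \<beta> \<in> \<Phi>"
 by (rule simple_reflection_positive[OF \<alpha>]) (auto simp: tw_s tw_R[OF s Phi_R])

lemma tw_s_Phi0:
 assumes \<beta>: "\<beta> \<in> \<Phi>0" "\<beta> ~= \<alpha>"
 shows "tw s \<beta> \<in> \<Phi>0" "tw s \<beta> ~= \<alpha>"
proof -
 have bP: "\<beta> \<in> \<Phi>" using \<beta> Phi0_Phi by blast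
 have ext: "\<beta> \<in> extensional a" "\<alpha> \<in> extensional a" using root_ext Phi_R bP simple_R by auto
 have np: "\<beta> ~= wscale c \<alpha>" for c
  using Phi0_unique_on_ray[OF simple_Phi0[OF \<alpha>], of c] \<beta> by auto
 have ss: "tw s (tw s g) = g" if "g \<in> extensional a" for g
  using tw_inv(1)[OF s that] by (simp add: tw_s_inv)
 show "tw s \<beta> ~= \<alpha>"
 proof
  assume "tw s \<beta> = \<alpha>"
  hence "\<beta> = wneg \<alpha>" using ss[OF ext(1)] tw_s_alpha by simp
  thus False using bP neg_Phi_iff[OF simple_R] simple_Phi[OF \<alpha>] by simp
 qed
 have P: "tw s \<beta> \<in> \<Phi>" by (rule tw_s_Phi[OF bP np])
 have "wscale c (tw s \<beta>) \<notin> \<Phi>" if c: "0 < c" "c < 1" for c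
 proof
  assume "wscale c (tw s \<beta>) \<in> \<Phi>"
  hence 1: "tw s (wscale c \<beta>) \<in> \<Phi>" using tw_wscale[OF s] by simp
  have "tw s (wscale c \<beta>) ~= wscale d \<alpha>" for d
  proof
   assume "tw s (wscale c \<beta>) = wscale d \<alpha>"
   hence "wscale c \<beta> = tw s (wscale d \<alpha>)" using ss[of "wscale c \<beta>"] by simp
   hence 2: "wscale c \<beta> = wscale d (wneg \<alpha>)" using tw_wscale[OF s] tw_s_alpha by simp
   have "\<beta> = wscale (- d / c) \<alpha>"
   proof (rule wt_ext_eq[OF ext(1) w_ext(3)])
    fix H assume H: "H \<in> a"
    have "c * \<beta> H = d * (- \<alpha> H)" using fun_cong[OF 2, of H] H by simp
    thus "\<beta> H = wscale (- d / c) \<alpha> H" using c H by (simp add: field_simps)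
   qed
   thus False using np by blast
  qed
  hence "tw s (tw s (wscale c \<beta>)) \<in> \<Phi>" by (rule tw_s_Phi[OF 1])
  hence "wscale c \<beta> \<in> \<Phi>" using ss by simp
  thus False using \<beta>(1) c by (auto simp: \<Phi>0_def)
 qed
 thus "tw s \<beta> \<in> \<Phi>0" using P by (simp add: \<Phi>0_def)
qed

text \<open>A simple reflection permutes the shortest positive roots other than \<alpha> and negates
  \<alpha>. Hence it matches the inversions of \<open>s \<otimes> t\<close> and of t except for
  \<alpha>, which is an inversion of exactly one of them.\<close>

lemma inversions_mult:
 assumes t: "t \<in> T"
 shows "tw (inv t) \<alpha> \<in> \<Phi> ==> card (inversions (s \<otimes> t)) = Suc (card (inversions t))"
  and "tw (inv t) \<alpha> \<notin> \<Phi> ==> Suc (card (inversions (s \<otimes> t))) = card (inversions t)"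
proof -
 have ext: "\<alpha> \<in> extensional a" using root_ext simple_R by auto
 have st: "tw (inv (s \<otimes> t)) \<beta> = tw (inv t) (tw s \<beta>)" for \<beta>
  using s t by (simp add: inv_mult_group T_carrier tw_mult[OF T_inv T_inv] tw_s_inv)
 have bij: "bij_betw (tw s) (inversions (s \<otimes> t) - {\<alpha>}) (inversions t - {\<alpha>})"
 proof (rule bij_betw_byWitness[where f'="tw s"])
  have ss: "tw s (tw s \<beta>) = \<beta>" if "\<beta> \<in> \<Phi>0" for \<beta>
   using tw_inv(1)[OF s root_ext[OF Phi_R[OF Phi0_Phi[OF that]]]] by (simp add: tw_s_inv)
  show "\<forall>\<beta>\<in>inversions (s \<otimes> t) - {\<alpha>}. tw s (tw s \<beta>) = \<beta>" "\<forall>\<beta>\<in>inversions t - {\<alpha>}. tw s (tw s \<beta>) = \<beta>"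
   using ss by (auto simp: inversions_def)
  show "tw s ` (inversions (s \<otimes> t) - {\<alpha>}) \<subseteq> inversions t - {\<alpha>}"
   using tw_s_Phi0 by (auto simp: inversions_def st)
  show "tw s ` (inversions t - {\<alpha>}) \<subseteq> inversions (s \<otimes> t) - {\<alpha>}"
   using tw_s_Phi0 ss by (auto simp: inversions_def st)
 qed
 have ta: "tw (inv t) \<alpha> \<in> R" by (rule tw_R[OF T_inv[OF t] simple_R])
 have a1: "\<alpha> \<in> inversions t \<longleftrightarrow> tw (inv t) \<alpha> \<notin> \<Phi>" using simple_Phi0[OF \<alpha>] by (simp add: inversions_def)
 have a2: "\<alpha> \<in> inversions (s \<otimes> t) \<longleftrightarrow> tw (inv t) \<alpha> \<in> \<Phi>"
  using simple_Phi0[OF \<alpha>] neg_Phi_iff[OF ta] by (simp add: inversions_def st tw_s_alpha tw_wneg[OF T_inv[OF t]])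
 note c = bij_betw_same_card[OF bij]
 show "card (inversions (s \<otimes> t)) = Suc (card (inversions t))" if "tw (inv t) \<alpha> \<in> \<Phi>"
 proof -
  have "\<alpha> \<in> inversions (s \<otimes> t)" "inversions t - {\<alpha>} = inversions t" using a1 a2 that by blast+
  thus ?thesis using c card.remove[OF finite_inversions \<open>\<alpha> \<in> inversions (s \<otimes> t)\<close>] by argo
 qed
 show "Suc (card (inversions (s \<otimes> t))) = card (inversions t)" if "tw (inv t) \<alpha> \<notin> \<Phi>"
 proof -
  have "\<alpha> \<in> inversions t" "inversions (s \<otimes> t) - {\<alpha>} = inversions (s \<otimes> t)" using a1 a2 that by blast+
  thus ?thesis using c card.remove[OF finite_inversions \<open>\<alpha> \<in> inversions t\<close>] by argo
 qed
qed

end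

lemma weyl_words_T: "t \<in> weyl_words G K A a \<Phi> n ==> t \<in> T \<and> card (inversions t) <= n"
proof (induction n arbitrary: t)
 case 0
 hence m: "t \<in> M" by simp
 have "tw (inv t) \<beta> = \<beta>" if "\<beta> \<in> \<Phi>0" for \<beta>
  using m root_ext[OF Phi_R[OF Phi0_Phi[OF that]]] M_iff by (intro wt_ext_eq) (auto simp: tw_inv_app[OF M_T[OF m]])
 hence "inversions t = {}" using Phi0_Phi by (auto simp: inversions_def)
 thus ?case using M_T[OF m] by simp
next
 case (Suc n)
 then obtain s t' where st: "s \<in> simple_reflection_reps G K A a \<Phi>" "t' \<in> weyl_words G K A a \<Phi> n" "t = s \<otimes> t'"
  by (auto simp: set_mult_def)
 then obtain \<alpha> where \<alpha>: "s \<in> T" "\<alpha> \<in> simple_roots a \<Phi>" "!!H. H \<in> a ==> Ad G s H = refl \<alpha> H"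
  by (auto simp: simple_reflection_reps_iff)
 have t': "t' \<in> T" "card (inversions t') <= n" using Suc.IH[OF st(2)] by auto
 have "card (inversions t) <= Suc (card (inversions t'))"
  using inversions_mult[OF \<alpha> t'(1)] unfolding st(3) by (cases "tw (inv t') \<alpha> \<in> \<Phi>") auto
 thus ?case using t' T_mult[OF \<alpha>(1) t'(1)] st(3) by simp
qed

text \<open>Without inversions the inverse of t preserves \<Phi>, so \<open>chamber_fix\<close> puts
  t in M. Otherwise some simple root is inverted, since positivity on the simple roots would extend
  to all, and its reflection lowers the count by one.\<close>

lemma T_weyl_words: "t \<in> T ==> t \<in> weyl_words G K A a \<Phi> (card (inversions t))"
proof (induction "card (inversions t)" arbitrary: t)
 case 0
 hence empty: "inversions t = {}" using finite_inversions by auto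
 have it: "inv t \<in> T" by (rule T_inv[OF 0(2)])
 have pos: "tw (inv t) \<beta> \<in> \<Phi>" if \<beta>: "\<beta> \<in> \<Phi>" for \<beta>
 proof -
  obtain c g where c: "c > 0" "g \<in> \<Phi>0" "\<beta> = wscale c g" using Phi0_ray[OF \<beta>] by blast
  hence "tw (inv t) g \<in> \<Phi>" using empty by (auto simp: inversions_def)
  moreover have "tw (inv t) \<beta> = wscale c (tw (inv t) g)" using c(3) tw_wscale[OF it] by simp
  ultimately show ?thesis using wscale_Phi c(1) tw_R[OF it Phi_R[OF \<beta>]] by metis
 qed
 have "Ad G t H = H" if H: "H \<in> a" for H
  using chamber_fix[OF it pos H] T_carrier[OF 0(2)] by (metis Ad_inv_cancel(2))
 thus ?case using 0(1) T_K[OF 0(2)] M_iff by (simp flip: 0(1))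
next
 case (Suc n)
 note t = Suc.prems
 have it: "inv t \<in> T" by (rule T_inv[OF t])
 have "\<exists>\<alpha>\<in>simple_roots a \<Phi>. tw (inv t) \<alpha> \<notin> \<Phi>"
 proof (rule ccontr)
  assume no: "\<not> (\<exists>\<alpha>\<in>simple_roots a \<Phi>. tw (inv t) \<alpha> \<notin> \<Phi>)"
  have "tw (inv t) \<beta> H0 > 0" if "\<beta> \<in> \<Phi>" for \<beta>
   using that
  proof (induction rule: positive_root_induct)
   case (base \<alpha>)
   thus ?case using no by (auto simp: Phi_iff)
  qed (use H0(1) tw_wadd[OF it] in simp)
  hence "inversions t = {}" using tw_R[OF it] Phi0_Phi Phi_R by (auto simp: inversions_def Phi_iff)
  thus False using Suc(2) by simp
 qed
 then obtain \<alpha> where \<alpha>: "\<alpha> \<in> simple_roots a \<Phi>" "tw (inv t) \<alpha> \<notin> \<Phi>" by blast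
 obtain s where s: "s \<in> T" "!!H. H \<in> a ==> Ad G s H = refl \<alpha> H"
  using reflection_rep[OF Phi_R[OF simple_Phi[OF \<alpha>(1)]]] by blast
 have "Suc (card (inversions (s \<otimes> t))) = card (inversions t)"
  by (rule inversions_mult(2)[OF s(1) \<alpha>(1) s(2) t \<alpha>(2)])
 hence n: "card (inversions (s \<otimes> t)) = n" using Suc(2) by simp
 hence w: "s \<otimes> t \<in> weyl_words G K A a \<Phi> n" using Suc(1)[of "s \<otimes> t"] T_mult[OF s(1) t] by simp
 have isr: "inv s \<in> simple_reflection_reps G K A a \<Phi>"
  using s_involution[OF s(1) \<alpha>(1) s(2)] T_inv[OF s(1)] \<alpha>(1) by (auto simp: simple_reflection_reps_iff)
 have "t = inv s \<otimes> (s \<otimes> t)" using T_carrier[OF s(1)] T_carrier[OF t] by (simp flip: m_assoc)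
 hence "t \<in> weyl_words G K A a \<Phi> (Suc n)" using isr w by (auto simp: set_mult_def)
 thus ?case using Suc(2) by simp
qed

lemma weyl_length_eq: "t \<in> T ==> weyl_length G K A a \<Phi> t = card (inversions t)"
 unfolding weyl_length_def using T_weyl_words weyl_words_T by (intro Least_equality) auto

text \<open>If a simple root remained positive, a further simple reflection would increase the
  number of inversions, which is the length. Negativity extends from simple to positive roots by
  additivity.\<close>

lemma longest_rep_negates:
 assumes w: "longest_rep G K A a \<Phi> w0"
 shows "w0 \<in> T" "\<beta> \<in> \<Phi> ==> wneg (tw (inv w0) \<beta>) \<in> \<Phi>"
proof -
 show w0: "w0 \<in> T" using w by (simp add: longest_rep_def)
 have max: "card (inversions t) <= card (inversions w0)" if "t \<in> T" for t
  using w that w0 by (simp add: longest_rep_def flip: weyl_length_eq)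
 have iw: "inv w0 \<in> T" by (rule T_inv[OF w0])
 have simple: "tw (inv w0) \<alpha> \<notin> \<Phi>" if \<alpha>: "\<alpha> \<in> simple_roots a \<Phi>" for \<alpha>
 proof
  assume p: "tw (inv w0) \<alpha> \<in> \<Phi>"
  obtain s where s: "s \<in> T" "!!H. H \<in> a ==> Ad G s H = refl \<alpha> H"
   using reflection_rep[OF Phi_R[OF simple_Phi[OF \<alpha>]]] by blast
  have "card (inversions (s \<otimes> w0)) = Suc (card (inversions w0))"
   by (rule inversions_mult(1)[OF s(1) \<alpha> s(2) w0 p])
  thus False using max[OF T_mult[OF s(1) w0]] by simp
 qed
 assume \<beta>: "\<beta> \<in> \<Phi>"
 have "tw (inv w0) \<beta> H0 < 0"
  using \<beta>
 proof (induction rule: positive_root_induct)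
  case (base \<alpha>)
  thus ?case using simple[OF base] tw_R[OF iw Phi_R[OF simple_Phi[OF base]]] H0(2) by (force simp: Phi_iff)
 qed (use H0(1) tw_wadd[OF iw] in simp)
 thus "wneg (tw (inv w0) \<beta>) \<in> \<Phi>"
  using tw_R[OF iw Phi_R[OF \<beta>]] neg_Phi_iff by (auto simp: Phi_iff)
qed

end

section \<open>Spectral subspaces of ad X for X in p\<close>

context cartan_algebra
begin

text \<open>For S the nonnegative numbers this is the parabolic subalgebra attached to X, for the
  positive numbers its nilradical.\<close>

definition eig :: "'e => real set => 'e set" where
 "eig X S = span {e. \<exists>\<mu>\<in>S. br X e = \<mu> *\<^sub>R e}"

lemma subspace_eig [simp]: "subspace (eig X S)"
 by (simp add: eig_def)

lemma eigI: "br X e = \<mu> *\<^sub>R e ==> \<mu> \<in> S ==> e \<in> eig X S"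
 by (auto simp: eig_def intro!: span_base)

lemma eig_induct:
 assumes "y \<in> eig X S" "subspace V" "!!e \<mu>. br X e = \<mu> *\<^sub>R e ==> \<mu> \<in> S ==> e \<in> V"
 shows "y \<in> V"
 using assms(1) span_minimal[OF _ assms(2), of "{e. \<exists>\<mu>\<in>S. br X e = \<mu> *\<^sub>R e}"] assms(3)
 unfolding eig_def by blast

lemma eigenvectors_orthogonal:
 assumes X: "X \<in> p" and e: "br X e = \<mu> *\<^sub>R e" and f: "br X f = \<nu> *\<^sub>R f" and ne: "\<mu> ~= \<nu>"
 shows "Q e f = 0"
proof -
 have "\<mu> * Q e f = \<nu> * Q e f" using Q_br_p[OF X, of e f] unfolding e f Q_simps .
 thus ?thesis using ne by simp
qed

lemma eig_orth:
 assumes X: "X \<in> p" and y: "y \<in> eig X S" and f: "br X f = \<nu> *\<^sub>R f" "\<nu> \<notin> S"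
 shows "Q y f = 0"
proof -
 have "y \<in> {y. Q y f = 0}"
 proof (rule eig_induct[OF y])
  show "subspace {y. Q y f = 0}" by (auto simp: subspace_def Q_simps)
  fix e \<mu> assume "br X e = \<mu> *\<^sub>R e" "\<mu> \<in> S"
  thus "e \<in> {y. Q y f = 0}" using eigenvectors_orthogonal[OF X _ f(1)] f(2) by blast
 qed
 thus ?thesis by simp
qed

lemma eig_UNIV:
 assumes "X \<in> p"
 shows "eig X UNIV = UNIV"
proof -
 have "span (\<Union>l. {v. br X v = l *\<^sub>R v}) = UNIV"
  by (rule symmetric_spectral) (use Q_br_p[OF assms] bilinear_def br_bilinear in \<open>auto\<close>)
 thus ?thesis by (simp add: eig_def Collect_ex_eq[symmetric] UNION_eq)
qed

text \<open>Eigenvectors for distinct eigenvalues are orthogonal and all of them span, so membership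
  can be tested against the eigenvectors whose eigenvalue is left out.\<close>

lemma eig_iff:
 assumes X: "X \<in> p"
 shows "y \<in> eig X S \<longleftrightarrow> (\<forall>e \<mu>. \<mu> \<notin> S --> br X e = \<mu> *\<^sub>R e --> Q y e = 0)"
proof
 assume r: "\<forall>e \<mu>. \<mu> \<notin> S --> br X e = \<mu> *\<^sub>R e --> Q y e = 0"
 obtain v r where v: "v \<in> eig X S" "y = v + r" and r': "!!z. z \<in> eig X S ==> Q r z = 0"
  using orthogonal_decomposition[OF subspace_eig, of X S y] by metis
 have "r \<in> {z. Q r z = 0}"
 proof (rule eig_induct)
  show "r \<in> eig X UNIV" by (simp add: eig_UNIV[OF X])
  show "subspace {z. Q r z = 0}" by (auto simp: subspace_def Q_simps)
  fix e \<mu> assume e: "br X e = \<mu> *\<^sub>R e"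
  show "e \<in> {z. Q r z = 0}"
  proof (cases "\<mu> \<in> S")
   case True
   thus ?thesis using r'[OF eigI[OF e]] by simp
  next
   case False
   hence "Q y e = 0" using r e by blast
   thus ?thesis using eig_orth[OF X v(1) e False] v(2) by (simp add: Q_simps)
  qed
 qed
 hence "r = 0" by simp
 thus "y \<in> eig X S" using v by simp
qed (use eig_orth[OF X] in blast)

lemma eig_br:
 assumes y: "y \<in> eig X S" and z: "z \<in> eig X S'" and add: "!!\<mu> \<nu>. \<mu> \<in> S ==> \<nu> \<in> S' ==> \<mu> + \<nu> \<in> S''"
 shows "br y z \<in> eig X S''"
proof -
 have lin: "linear (br y)" "linear (%y. br y z)" for y z using br_bilinear by (auto simp: bilinear_def)
 have "y \<in> {y. br y z \<in> eig X S''}"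
 proof (rule eig_induct[OF y])
  show "subspace {y. br y z \<in> eig X S''}"
   by (rule linear_subspace_vimage[OF lin(2) subspace_eig, unfolded vimage_def])
  fix e \<mu> assume e: "br X e = \<mu> *\<^sub>R e" "\<mu> \<in> S"
  have "z \<in> {z. br e z \<in> eig X S''}"
  proof (rule eig_induct[OF z])
   show "subspace {z. br e z \<in> eig X S''}"
    by (rule linear_subspace_vimage[OF lin(1) subspace_eig, unfolded vimage_def])
   fix f \<nu> assume f: "br X f = \<nu> *\<^sub>R f" "\<nu> \<in> S'"
   have "br X (br e f) = (\<mu> + \<nu>) *\<^sub>R br e f"
    unfolding leibniz[of X e f] e(1) f(1) linear_cmul[OF lin(1)] linear_cmul[OF lin(2)] by (simp add: algebra_simps)
   thus "f \<in> {z. br e z \<in> eig X S''}" using eigI add[OF e(2) f(2)] by blast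
  qed
  thus "e \<in> {y. br y z \<in> eig X S''}" by simp
 qed
 thus ?thesis by simp
qed

lemma eig_mono: "y \<in> eig X S ==> S \<subseteq> S' ==> y \<in> eig X S'"
 by (rule eig_induct[OF _ subspace_eig]) (auto intro: eigI)

lemma eig_kil:
 assumes y: "y \<in> eig X {0<..}" and z: "z \<in> eig X {0..}"
 shows "kil y z = 0"
proof -
 have "y \<in> {y. kil y z = 0}"
 proof (rule eig_induct[OF y])
  show "subspace {y. kil y z = 0}" by (auto simp: subspace_def kil_simps)
  fix e \<mu> assume e: "br X e = \<mu> *\<^sub>R e" "\<mu> \<in> {0<..}"
  have "z \<in> {z. kil e z = 0}"
  proof (rule eig_induct[OF z])
   show "subspace {z. kil e z = 0}" by (auto simp: subspace_def kil_simps)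
   fix f \<nu> assume f: "br X f = \<nu> *\<^sub>R f" "\<nu> \<in> {0..}"
   have "\<mu> * kil e f = - (\<nu> * kil e f)" using kil_invariant'[of X e f] unfolding e(1) f(1) kil_simps .
   hence "(\<mu> + \<nu>) * kil e f = 0" by (simp add: algebra_simps)
   thus "f \<in> {z. kil e z = 0}" using e(2) f(2) by simp
  qed
  thus "e \<in> {y. kil y z = 0}" by simp
 qed
 thus ?thesis by simp
qed

lemma eig_contracted:
 assumes "y \<in> eig X {0<..}"
 shows "((%t. exp (- t *\<^sub>R ad X) \<cdot> y) \<longlongrightarrow> 0) at_top"
proof -
 let ?f = "%y t. exp (- t *\<^sub>R ad X) \<cdot> y"
 note lin = linear_app[where 'a = 'e]
 have "y \<in> {y. (?f y \<longlongrightarrow> 0) at_top}"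
 proof (rule eig_induct[OF assms])
  show "subspace {y. (?f y \<longlongrightarrow> 0) at_top}"
   unfolding subspace_def
  proof (intro conjI ballI allI)
   fix x y c assume x: "x \<in> {y. (?f y \<longlongrightarrow> 0) at_top}"
   hence "((%t. c *\<^sub>R ?f x t) \<longlongrightarrow> c *\<^sub>R 0) at_top" by (intro tendsto_scaleR tendsto_const) simp
   thus "c *\<^sub>R x \<in> {y. (?f y \<longlongrightarrow> 0) at_top}" by (simp add: linear_cmul[OF lin])
   assume "y \<in> {y. (?f y \<longlongrightarrow> 0) at_top}"
   hence "((%t. ?f x t + ?f y t) \<longlongrightarrow> 0 + 0) at_top" using x by (intro tendsto_add) simp_all
   thus "x + y \<in> {y. (?f y \<longlongrightarrow> 0) at_top}" by (simp add: linear_add[OF lin])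
  qed (simp add: linear_0[OF lin])
  fix e \<mu> assume e: "br X e = \<mu> *\<^sub>R e" "\<mu> \<in> {0<..}"
  have "?f e t = exp (- (t * \<mu>)) *\<^sub>R e" for t
   by (rule exp_eigenvector) (simp add: app_simps e(1))
  moreover have "((%t. exp (- (t * \<mu>)) *\<^sub>R e) \<longlongrightarrow> 0 *\<^sub>R e) at_top"
   using e(2) by (intro tendsto_intros) (auto intro!: filterlim_compose[OF exp_at_bot] simp: filterlim_uminus_at_bot filterlim_tendsto_pos_mult_at_top[OF tendsto_const] filterlim_at_top_mult_tendsto_pos[OF tendsto_const] filterlim_ident)
  ultimately show "e \<in> {y. (?f y \<longlongrightarrow> 0) at_top}" by simp
 qed
 thus ?thesis by simp
qed

lemma finite_eigenvalues:
 assumes X: "X \<in> p"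
 shows "finite {\<mu>. \<exists>e. e ~= 0 \<and> br X e = \<mu> *\<^sub>R e}" (is "finite ?M")
proof -
 define f where "f \<mu> = (SOME e. e ~= 0 \<and> br X e = \<mu> *\<^sub>R e)" for \<mu>
 have f: "f \<mu> ~= 0 \<and> br X (f \<mu>) = \<mu> *\<^sub>R f \<mu>" if "\<mu> \<in> ?M" for \<mu>
  using that someI_ex[of "%e. e ~= 0 \<and> br X e = \<mu> *\<^sub>R e"] by (simp add: f_def)
 have orth: "Q (f \<mu>) (f \<nu>) = 0" if "\<mu> \<in> ?M" "\<nu> \<in> ?M" "\<mu> ~= \<nu>" for \<mu> \<nu>
  using eigenvectors_orthogonal[OF X, of "f \<mu>" \<mu> "f \<nu>" \<nu>] f[OF that(1)] f[OF that(2)] that(3) by blast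
 have "inj_on f ?M"
 proof (rule inj_onI, rule ccontr)
  fix \<mu> \<nu> assume "\<mu> \<in> ?M" "\<nu> \<in> ?M" "f \<mu> = f \<nu>" "\<mu> ~= \<nu>"
  thus False using orth[of \<mu> \<nu>] f[of \<nu>] by simp
 qed
 moreover have "finite (f ` ?M)"
  by (rule orthogonal_family_finite) (use f orth in \<open>force+\<close>)
 ultimately show ?thesis by (simp add: finite_image_iff)
qed

lemma exp_growth_False:
 fixes c d q C :: real
 assumes "d < c" "q > 0" and le: "!!s. s \<ge> 0 ==> exp (s * c) * q <= C * exp (s * d)"
 shows False
proof -
 let ?s = "C / ((c - d) * q)"
 have s: "?s \<ge> 0" "?s * (c - d) * q = C" using assms(1,2) le[of 0] by auto
 have "?s * c = ?s * d + ?s * (c - d)" unfolding distrib_left[symmetric] by simp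
 hence "exp (?s * c) = exp (?s * d) * exp (?s * (c - d))" by (simp only: exp_add)
 hence "exp (?s * d) * (exp (?s * (c - d)) * q) <= exp (?s * d) * C" using le[OF s(1)] by (simp only: mult_ac)
 hence "exp (?s * (c - d)) * q <= C" by simp
 moreover have "(1 + ?s * (c - d)) * q <= exp (?s * (c - d)) * q" using assms(2) by (intro mult_right_mono exp_ge_add_one_self) simp
 ultimately show False using s(2) assms(2) by (simp only: distrib_right mult_1)
qed

text \<open>Otherwise let l be the lowest eigenvalue seen by y; it is negative. The perturbation v
  raises eigenvalues strictly, so it does not feed the lowest component, which evolves by the exact
  factor \<open>exp (- t * l)\<close> and is unbounded.\<close>

lemma eig_bounded_perturbed:
 assumes X: "X \<in> p" and v: "v \<in> eig X {0<..}"
  and b: "!!t. t \<ge> 0 ==> norm (exp (- t *\<^sub>R ad (X + v)) \<cdot> y) <= C"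
 shows "y \<in> eig X {0..}"
proof (rule ccontr)
 assume "y \<notin> eig X {0..}"
 define M where "M = {\<mu>. \<mu> < 0 \<and> (\<exists>e. br X e = \<mu> *\<^sub>R e \<and> Q y e ~= 0)}"
 have "M \<subseteq> {\<mu>. \<exists>e. e ~= 0 \<and> br X e = \<mu> *\<^sub>R e}" by (auto simp: M_def) (metis Q_simps(10))
 hence finM: "finite M" using finite_eigenvalues[OF X] finite_subset by blast
 obtain e \<mu> where "\<mu> \<notin> {0..}" "br X e = \<mu> *\<^sub>R e" "Q y e ~= 0"
  using \<open>y \<notin> _\<close> unfolding eig_iff[OF X] by blast
 hence "\<mu> \<in> M" by (auto simp: M_def)
 hence "M ~= {}" by blast
 define l where "l = Min M"
 have "l \<in> M" using Min_in[OF finM \<open>M ~= {}\<close>] by (simp add: l_def)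
 then obtain e where l0: "l < 0" and e: "br X e = l *\<^sub>R e" "Q y e ~= 0" by (auto simp: M_def)
 have y: "y \<in> eig X {l..}" unfolding eig_iff[OF X]
 proof (intro allI impI)
  fix f \<nu> assume f: "\<nu> \<notin> {l..}" "br X f = \<nu> *\<^sub>R f"
  hence "\<nu> \<notin> M" using Min_le[OF finM, of \<nu>] by (auto simp: l_def)
  thus "Q y f = 0" using f l0 by (auto simp: M_def)
 qed
 let ?L = "%w. Q w e *\<^sub>R e"
 have linL: "linear ?L" by (rule linearI) (simp_all add: Q_simps scaleR_add_left)
 have brl: "br (X + v) w = br X w + br v w" for w using bilinear_ladd[OF br_bilinear] .
 have vw: "br v w \<in> eig X {l<..}" if "w \<in> eig X {l..}" for w by (rule eig_br[OF v that]) auto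
 have Xw: "br X w \<in> eig X {l..}" if "w \<in> eig X {l..}" for w
 proof -
  have "X \<in> eig X {0}" by (rule eigI[of _ _ 0]) simp_all
  from eig_br[OF this that, of "{l..}"] show ?thesis by simp
 qed
 have "?L (exp (- t *\<^sub>R ad (X + v)) \<cdot> y) = exp ((- t * l) *\<^sub>R 1) \<cdot> ?L y" for t
 proof (rule exp_intertwine[OF linL subspace_eig _ _ y])
  fix w assume w: "w \<in> eig X {l..}"
  have app: "(- t *\<^sub>R ad (X + v)) \<cdot> w = - t *\<^sub>R br (X + v) w"
   by (simp add: app_simps)
  show "(- t *\<^sub>R ad (X + v)) \<cdot> w \<in> eig X {l..}"
   unfolding app brl
   by (intro subspace_scale[OF subspace_eig] subspace_add[OF subspace_eig] Xw[OF w] eig_mono[OF vw[OF w]]) auto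
  have "Q (br v w) e = 0" by (rule eig_orth[OF X vw[OF w] e(1)]) simp
  moreover have "Q (br X w) e = l * Q w e" using Q_br_p[OF X, of w e] unfolding e(1) Q_simps .
  ultimately show "?L ((- t *\<^sub>R ad (X + v)) \<cdot> w) = ((- t * l) *\<^sub>R 1) \<cdot> ?L w"
   unfolding app brl by (simp add: Q_simps app_simps)
 qed
 moreover have "exp ((- t * l) *\<^sub>R 1) \<cdot> z = exp (- t * l) *\<^sub>R z" for t and z :: 'e
  by (rule exp_eigenvector) (simp add: app_simps)
 moreover have "e ~= 0" using e(2) by (auto simp: Q_simps)
 ultimately have eq: "Q (exp (- t *\<^sub>R ad (X + v)) \<cdot> y) e = exp (- t * l) * Q y e" for t by simp
 obtain B where B: "!!x y. norm (Q x y) <= norm x * norm y * B" "B > 0"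
  using bounded_bilinear.pos_bounded[OF bounded_bilinear_Q] by metis
 have le: "exp (- t * l) * \<bar>Q y e\<bar> <= C * norm e * B" if "t \<ge> 0" for t
 proof -
  have "\<bar>exp (- t * l) * Q y e\<bar> <= norm (exp (- t *\<^sub>R ad (X + v)) \<cdot> y) * norm e * B"
   using B(1)[of "exp (- t *\<^sub>R ad (X + v)) \<cdot> y" e] unfolding eq by simp
  also have "\<dots> <= C * norm e * B" using b[OF that] B(2) by (intro mult_right_mono) auto
  finally show ?thesis by (simp add: abs_mult)
 qed
 show False
  by (rule exp_growth_False[of 0 "- l" "\<bar>Q y e\<bar>" "C * norm e * B"]) (use l0 e(2) le in auto)
qed

end

section \<open>The minimal parabolic subgroup and directions of asymptotic rays\<close>

context lie_symmetric
begin

definition nilpart :: "'e set" (\<open>\<nn>\<close>) where "\<nn> = W (%\<alpha>. \<alpha> \<in> \<Phi>)"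

definition compact_centralizer :: "'e set" (\<open>\<mm>\<close>) where "\<mm> = k \<inter> rs zero_wt"

lemma Phi_wts: "\<alpha> \<in> \<Phi> ==> \<alpha> \<in> wts"
 by (simp add: Phi_R wts_def)

lemma subspace_nn [simp]: "subspace \<nn>"
 by (simp add: nilpart_def)

lemma nn_eq: "\<nn> = span (\<Union>\<alpha>\<in>\<Phi>. rs \<alpha>)"
proof -
 have "{\<alpha> \<in> wts. \<alpha> \<in> \<Phi>} = \<Phi>" using Phi_wts by blast
 thus ?thesis by (simp add: nilpart_def W_def)
qed

lemma subspace_mm [simp]: "subspace \<mm>"
 by (simp add: compact_centralizer_def subspace_inter subspace_k subspace_rs)

lemma mmD: "Z \<in> \<mm> ==> Z \<in> k" "Z \<in> \<mm> ==> Z \<in> rs zero_wt" "Z \<in> \<mm> ==> H \<in> a ==> br H Z = 0" "Z \<in> \<mm> ==> H \<in> a ==> br Z H = 0"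
 using br_antisym[of Z H] by (auto simp: compact_centralizer_def rs_zero_wt)

lemma a_rs_zero: "H \<in> a ==> H \<in> rs zero_wt"
 by (simp add: rs_zero_wt br_aa)

lemma zero_wt_wts: "zero_wt \<in> wts"
 by (simp add: wts_def)

lemma wadd_zero: "\<beta> \<in> extensional a ==> wadd zero_wt \<beta> = \<beta>"
 by (rule wt_ext_eq) simp_all

lemma wadd_Phi:
 assumes "\<alpha> \<in> \<Phi>" "\<beta> \<in> \<Phi>" "wadd \<alpha> \<beta> \<in> wts"
 shows "wadd \<alpha> \<beta> \<in> \<Phi>"
proof -
 have pos: "wadd \<alpha> \<beta> H0 > 0" using assms(1,2) H0(1) by (simp add: Phi_iff)
 hence "wadd \<alpha> \<beta> ~= zero_wt" using w_app(4)[OF H0(1)] by (metis less_irrefl)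
 thus ?thesis using assms(3) pos by (simp add: wts_def Phi_iff)
qed

text \<open>The Lie algebra m + a + n of \<open>par\<close>, written by weights: the zero weight
  space is m + a.\<close>

abbreviation nonneg_part :: "'e set" (\<open>\<bb>\<close>) where "\<bb> \<equiv> W (%\<alpha>. \<alpha> = zero_wt \<or> \<alpha> \<in> \<Phi>)"

lemma br_bb_nn: "Y \<in> \<bb> ==> Z \<in> \<nn> ==> br Y Z \<in> \<nn>"
 unfolding nilpart_def
proof (erule W_br, assumption)
 fix \<alpha> \<beta> assume "\<beta> \<in> wts" "\<alpha> = zero_wt \<or> \<alpha> \<in> \<Phi>" "\<beta> \<in> \<Phi>" "wadd \<alpha> \<beta> \<in> wts"
 thus "wadd \<alpha> \<beta> \<in> \<Phi>" using wadd_zero[OF wts_ext] wadd_Phi by metis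
qed

lemma nn_bb: "Z \<in> \<nn> ==> Z \<in> \<bb>"
 unfolding nilpart_def by (erule W_mono) simp

lemma a_bb: "H \<in> a ==> H \<in> \<bb>" and mm_bb: "Z \<in> \<mm> ==> Z \<in> \<bb>"
 by (rule rs_W[OF zero_wt_wts]; simp add: a_rs_zero mmD(2))+

lemma exp_nn_nn:
 assumes "Y \<in> \<bb>" "Z \<in> \<nn>"
 shows "exp (ad Y) \<cdot> Z \<in> \<nn>"
 by (rule exp_invariant[OF subspace_nn _ assms(2)]) (simp add: br_bb_nn[OF assms(1)])

text \<open>The bracket with n maps this subalgebra into the nilradical, so modulo the nilradical
  \<open>ad n\<close> is zero and its exponential the identity. The projection \<open>?L\<close>
  plays the part of the quotient map.\<close>

lemma exp_nn_bb:
 assumes n: "n \<in> \<nn>" and Y: "Y \<in> \<bb>"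
 shows "exp (ad n) \<cdot> Y - Y \<in> \<nn>"
proof -
 obtain pr where pr: "linear pr" "!!x. pr x \<in> \<nn>" "!!x. x - pr x \<in> W (%\<alpha>. \<alpha> \<notin> \<Phi>)"
  "!!x. x \<in> \<nn> ==> pr x = x" "!!x. x \<in> W (%\<alpha>. \<alpha> \<notin> \<Phi>) ==> pr x = 0"
  by (rule W_projection[where P = "%\<alpha>. \<alpha> \<in> \<Phi>", folded nilpart_def]) (rule that; assumption?)
 let ?L = "%x. x - pr x"
 have L: "linear ?L" by (intro linear_compose_sub linear_ident pr(1))
 have br: "br n v \<in> \<nn>" if "v \<in> \<bb>" for v
 proof -
  have "- br v n \<in> \<nn>" by (rule subspace_neg[OF subspace_nn br_bb_nn[OF that n]])
  thus ?thesis using br_antisym[of n v] by simp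
 qed
 have "?L (exp (ad n) \<cdot> Y) = exp 0 \<cdot> ?L Y"
 proof (rule exp_intertwine[OF L subspace_W _ _ Y])
  fix v assume v: "v \<in> \<bb>"
  show "ad n \<cdot> v \<in> \<bb>" using nn_bb[OF br[OF v]] by simp
  show "?L (ad n \<cdot> v) = 0 \<cdot> ?L v"
   using pr(4)[OF br[OF v]] by (simp add: app_simps)
 qed
 hence "exp (ad n) \<cdot> Y - Y = pr (exp (ad n) \<cdot> Y) - pr Y" by (simp add: algebra_simps)
 thus ?thesis using subspace_diff[OF subspace_nn pr(2) pr(2)] by simp
qed

definition par :: "'g set" where "par = M <#> A <#> grp_N G a \<Phi>"

lemma parE:
 assumes "q \<in> par"
 obtains m H n where "m \<in> M" "H \<in> a" "n \<in> \<nn>" "q = m \<otimes> lie_exp G H \<otimes> lie_exp G n"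
 using assms by (auto simp: par_def set_mult_def A_def grp_N_def nn_eq)

lemma M_carrier: "m \<in> M ==> m \<in> carrier G"
 using M_iff K_carrier by blast

lemma par_carrier: "q \<in> par ==> q \<in> carrier G"
 by (erule parE) (auto intro!: m_closed simp: M_carrier)

lemma tw_M: "m \<in> M ==> \<alpha> \<in> extensional a ==> tw m \<alpha> = \<alpha>"
proof (rule wt_ext_eq)
 fix H assume m: "m \<in> M" and H: "H \<in> a"
 have "Ad G (inv m) (Ad G m H) = H" using M_carrier[OF m] by simp
 thus "tw m \<alpha> H = \<alpha> H" using m H by (simp add: tw_app M_iff)
qed simp_all

lemma Ad_M_W: "m \<in> M ==> X \<in> W P ==> Ad G m X \<in> W P"
 by (rule Ad_W[OF M_T]) (simp_all add: tw_M wts_ext)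

lemma Ad_M_nn: "m \<in> M ==> Y \<in> \<nn> ==> Ad G m Y \<in> \<nn>"
 unfolding nilpart_def by (rule Ad_M_W)

lemma Ad_T_mm: "t \<in> T ==> Z \<in> \<mm> ==> Ad G t Z \<in> \<mm>"
proof -
 assume t: "t \<in> T" and Z: "Z \<in> \<mm>"
 have "tw t zero_wt = zero_wt" by (rule wt_ext_eq) (auto simp: tw_app T_a T_inv t)
 thus ?thesis
  using Ad_rs[OF t mmD(2)[OF Z]] Ad_K_k[OF T_K[OF t] mmD(1)[OF Z]] by (simp add: compact_centralizer_def)
qed

lemma par_Ad_nn:
 assumes q: "q \<in> par" and Y: "Y \<in> \<nn>"
 shows "Ad G q Y \<in> \<nn>"
proof -
 obtain m H n where q: "m \<in> M" "H \<in> a" "n \<in> \<nn>" "q = m \<otimes> lie_exp G H \<otimes> lie_exp G n" by (rule parE[OF q])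
 have "Ad G m (exp (ad H) \<cdot> (exp (ad n) \<cdot> Y)) \<in> \<nn>"
  by (intro Ad_M_nn q exp_nn_nn a_bb nn_bb Y)
 thus ?thesis using q M_carrier[OF q(1)] by (simp add: Ad_mult Ad_lie_exp)
qed

lemma exp_fix:
 assumes "br Y Z = 0"
 shows "exp (ad Y) \<cdot> Z = Z"
 using exp_eigenvector[of "ad Y" Z 0] assms by simp

text \<open>The unipotent factor changes H + Z only by the nilradical, the factor from A fixes H +
  Z, and the factor from M fixes H and maps Z within m. The component in \<open>a\<close>, which
  \<open>asym\<close> records, is thus untouched by \<open>par\<close>.\<close>

lemma par_Ad:
 assumes q: "q \<in> par" and H: "H \<in> a" and Z: "Z \<in> \<mm>" and n: "n \<in> \<nn>"
 obtains Z' n' where "Z' \<in> \<mm>" "n' \<in> \<nn>" "Ad G q (H + Z + n) = H + Z' + n'" "Z = 0 ==> Z' = 0"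
proof -
 obtain m H1 n1 where q': "m \<in> M" "H1 \<in> a" "n1 \<in> \<nn>" "q = m \<otimes> lie_exp G H1 \<otimes> lie_exp G n1" by (rule parE[OF q])
 have mc: "m \<in> carrier G" by (rule M_carrier[OF q'(1)])
 define r where "r = exp (ad n1) \<cdot> (H + Z) - (H + Z)"
 have r: "r \<in> \<nn>" unfolding r_def
  by (rule exp_nn_bb[OF q'(3)]) (intro subspace_add[OF subspace_W] a_bb mm_bb H Z)
 have "exp (ad H1) \<cdot> (H + Z) = H + Z"
  by (rule exp_fix) (simp add: br_simps br_aa q'(2) H mmD(3)[OF Z])
 hence "Ad G q (H + Z) = Ad G m (H + Z + exp (ad H1) \<cdot> r)"
  using q'(4) mc by (simp add: Ad_mult Ad_lie_exp r_def app_simps)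
 also have "\<dots> = H + Ad G m Z + Ad G m (exp (ad H1) \<cdot> r)"
  using q'(1) H by (simp add: linear_add[OF linear_Ad[OF mc]] M_iff)
 finally have eq: "Ad G q (H + Z + n) = H + Ad G m Z + (Ad G m (exp (ad H1) \<cdot> r) + Ad G q n)"
  by (simp add: linear_add[OF linear_Ad[OF par_carrier[OF q]]])
 show thesis
 proof (rule that[OF _ _ eq])
  show "Ad G m Z \<in> \<mm>" by (rule Ad_T_mm[OF M_T[OF q'(1)] Z])
  show "Ad G m (exp (ad H1) \<cdot> r) + Ad G q n \<in> \<nn>"
   by (intro subspace_add[OF subspace_nn] Ad_M_nn q' exp_nn_nn a_bb r par_Ad_nn[OF q n])
  show "Ad G m Z = 0" if "Z = 0" using that linear_0[OF linear_Ad[OF mc]] by simp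
 qed
qed

text \<open>\<open>asym X h H\<close> says that the geodesic ray of \<open>X\<close> is asymptotic to a ray in a flat through \<open>hP\<close>,
 whose direction in that flat is \<open>H\<close>.\<close>

definition asym :: "'e => 'g => 'e => bool" where
 "asym X h H \<longleftrightarrow> H \<in> a \<and> (\<exists>u\<in>eig X {0<..}. \<exists>Z\<in>\<mm>. \<exists>n\<in>\<nn>. X + u = Ad G h (H + Z + n))"

lemma asym_par:
 assumes h: "h \<in> carrier G" and q: "q \<in> par" and p: "asym X (h \<otimes> q) H"
 shows "asym X h H"
proof -
 obtain u Z n where u: "H \<in> a" "u \<in> eig X {0<..}" "Z \<in> \<mm>" "n \<in> \<nn>" "X + u = Ad G (h \<otimes> q) (H + Z + n)"
  using p unfolding asym_def by blast
 obtain Z' n' where "Z' \<in> \<mm>" "n' \<in> \<nn>" "Ad G q (H + Z + n) = H + Z' + n'"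
  by (rule par_Ad[OF q u(1,3,4)])
 thus ?thesis using u h par_carrier[OF q] unfolding asym_def by (auto simp: Ad_mult)
qed

text \<open>The difference Y of the two representations is conjugate to an element N of the positive
  eigenspaces of X. Conjugation by the flow of X contracts N, so Y is conjugate to an element with
  arbitrarily small \<open>ad\<close> and \<open>exp (s ad Y)\<close> grows at most like
  \<open>exp (s * (\<alpha> D / 2))\<close>. On a root vector of \<alpha>, however, its component
  along the root space grows like \<open>exp (s * \<alpha> D)\<close>.\<close>

lemma asym_unique:
 assumes X: "X \<in> p" and h: "h \<in> carrier G" and p1: "asym X h H" and p2: "asym X h H'"
 shows "H = H'"
proof (rule ccontr)
 assume ne: "H ~= H'"
 obtain u Z n where u: "H \<in> a" "u \<in> eig X {0<..}" "Z \<in> \<mm>" "n \<in> \<nn>" "X + u = Ad G h (H + Z + n)"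
  using p1 unfolding asym_def by blast
 obtain u' Z' n' where u': "H' \<in> a" "u' \<in> eig X {0<..}" "Z' \<in> \<mm>" "n' \<in> \<nn>" "X + u' = Ad G h (H' + Z' + n')"
  using p2 unfolding asym_def by blast
 have Da: "H - H' \<in> a" by (rule subspace_diff[OF subspace_a u(1) u'(1)])
 obtain \<beta> where \<beta>: "\<beta> \<in> R" "\<beta> (H - H') ~= 0" using roots_separate[OF Da] ne by auto
 obtain \<alpha> where \<alpha>: "\<alpha> \<in> R" "\<alpha> (H - H') > 0"
 proof (cases "\<beta> (H - H') > 0")
  case False
  hence "wneg \<beta> (H - H') > 0" using Da \<beta>(2) by simp
  thus ?thesis using that wneg_root[OF \<beta>(1)] by blast
 qed (use that \<beta> in blast)
 define D where "D = H - H'"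
 define Zd where "Zd = Z - Z'"
 define nd where "nd = n - n'"
 define Y where "Y = D + Zd + nd"
 define N where "N = Ad G h Y"
 have Z: "Zd \<in> \<mm>" unfolding Zd_def by (rule subspace_diff[OF subspace_mm u(3) u'(3)])
 have nd: "nd \<in> \<nn>" unfolding nd_def by (rule subspace_diff[OF subspace_nn u(4) u'(4)])
 have Da: "D \<in> a" using Da by (simp add: D_def)
 have aD: "\<alpha> D > 0" using \<alpha>(2) by (simp add: D_def)
 have "Y = (H + Z + n) - (H' + Z' + n')" by (simp add: Y_def D_def Zd_def nd_def)
 hence "N = u - u'" unfolding N_def using linear_diff[OF linear_Ad[OF h]] u(5) u'(5) by (metis add_diff_cancel_left)
 hence N: "N \<in> eig X {0<..}" using subspace_diff[OF subspace_eig u(2) u'(2)] by simp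
 obtain C where C: "C > 0" "!!X. norm (ad X) <= C * norm X" by (rule ad_bound) (rule that; assumption?)
 have "\<forall>\<^sub>F t in at_top. norm (exp (- t *\<^sub>R ad X) \<cdot> N) < \<alpha> D / (2 * C)"
  using tendstoD[OF eig_contracted[OF N], of "\<alpha> D / (2 * C)"] C(1) aD by (simp add: dist_norm)
 then obtain \<tau> where \<tau>: "norm (exp (- \<tau> *\<^sub>R ad X) \<cdot> N) < \<alpha> D / (2 * C)"
  using eventually_happens'[OF trivial_limit_at_top_linorder] by blast
 define F where "F = lie_exp G (- \<tau> *\<^sub>R X) \<otimes> h"
 have Fc: "F \<in> carrier G" using h by (simp add: F_def)
 define Y' where "Y' = Ad G F Y"
 have "Y' = exp (- \<tau> *\<^sub>R ad X) \<cdot> N"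
  using h by (simp add: Y'_def F_def N_def Ad_mult Ad_lie_exp ad_simps)
 hence "norm (ad Y') <= C * (\<alpha> D / (2 * C))" using C(2)[of Y'] \<tau> C(1) by (smt (verit) mult_left_mono)
 hence nY': "norm (ad Y') <= \<alpha> D / 2" using C(1) by simp
 have adY: "AdE (inv F) * ad Y' * AdE F = ad Y"
  using aut_ad[OF aut_AdE[OF Fc], of Y] Fc AdE_inv(1)[OF Fc] unfolding Y'_def
  by (metis (no_types, lifting) AdE_app mult.assoc mult.left_neutral mult.right_neutral)
 define C1 where "C1 = norm (AdE (inv F)) * norm (AdE F)"
 have up: "norm (exp (s *\<^sub>R ad Y)) <= C1 * exp (s * (\<alpha> D / 2))" if "s \<ge> 0" for s
 proof -
  have "exp (s *\<^sub>R ad Y) = AdE (inv F) * exp (s *\<^sub>R ad Y') * AdE F"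
   unfolding exp_conj_endo[OF AdE_inv(2)[OF Fc] AdE_inv(1)[OF Fc]] by (simp flip: adY)
  hence "norm (exp (s *\<^sub>R ad Y)) <= norm (AdE (inv F)) * norm (exp (s *\<^sub>R ad Y')) * norm (AdE F)"
   using norm_mult_ineq[of "AdE (inv F) * exp (s *\<^sub>R ad Y')" "AdE F"] norm_mult_ineq[of "AdE (inv F)" "exp (s *\<^sub>R ad Y')"]
   by (smt (verit) mult_right_mono norm_ge_zero)
  also have "\<dots> = C1 * norm (exp (s *\<^sub>R ad Y'))" by (simp add: C1_def mult_ac)
  also have "\<dots> <= C1 * exp (s * (\<alpha> D / 2))"
  proof (rule mult_left_mono)
   have "norm (exp (s *\<^sub>R ad Y')) <= exp (norm (s *\<^sub>R ad Y'))" by (rule norm_exp)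
   also have "\<dots> <= exp (s * (\<alpha> D / 2))" using mult_left_mono[OF nY' that] that by simp
   finally show "norm (exp (s *\<^sub>R ad Y')) <= exp (s * (\<alpha> D / 2))" .
  qed (simp add: C1_def)
  finally show ?thesis .
 qed
 obtain v where v: "v \<in> rs \<alpha>" "v ~= 0" by (rule root_vector[OF \<alpha>(1)])
 have aw: "\<alpha> \<in> wts" using \<alpha>(1) by (simp add: wts_def)
 obtain pr where pr: "linear pr" "!!x. pr x \<in> W (%\<beta>. \<beta> = \<alpha>)" "!!x. x - pr x \<in> W (%\<beta>. \<beta> ~= \<alpha>)"
  "!!x. x \<in> W (%\<beta>. \<beta> = \<alpha>) ==> pr x = x" "!!x. x \<in> W (%\<beta>. \<beta> ~= \<alpha>) ==> pr x = 0"
  by (rule W_projection[where P = "%\<beta>. \<beta> = \<alpha>"]) (rule that; assumption?)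
 have Wrs: "x \<in> rs \<alpha>" if "x \<in> W (%\<beta>. \<beta> = \<alpha>)" for x
  by (rule W_induct[OF that subspace_rs]) simp
 \<comment> \<open>On this space the nilpotent part \<open>nd\<close> raises weights strictly, so
   the projection to the root space of \<alpha> sees only \<open>D + Zd\<close>; there
   \<open>Zd\<close> commutes with D and acts by isometries.\<close>
 let ?V = "W (%\<beta>. \<beta> = \<alpha> \<or> \<beta> H0 > \<alpha> H0)"
 have vV: "v \<in> ?V" by (rule rs_W[OF aw _ v(1)]) simp
 have DZ: "br (D + Zd) w \<in> W P" if "w \<in> W P" for w P
 proof -
  have "D + Zd \<in> W (%\<beta>. \<beta> = zero_wt)"
   by (rule rs_W[OF zero_wt_wts]) (simp_all add: subspace_add[OF subspace_rs] a_rs_zero Da mmD(2)[OF Z])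
  thus ?thesis by (rule W_br[OF _ that]) (simp add: wadd_zero wts_ext)
 qed
 have nV: "br nd w \<in> W (%\<beta>. \<beta> H0 > \<alpha> H0)" if "w \<in> ?V" for w
  by (rule W_br[OF nd[unfolded nilpart_def] that]) (use H0(1) in \<open>auto simp: Phi_iff\<close>)
 have Yw: "br Y w = br (D + Zd) w + br nd w" for w unfolding Y_def by (rule bilinear_ladd[OF br_bilinear])
 have prY: "pr (exp (s *\<^sub>R ad Y) \<cdot> v) = exp (s *\<^sub>R ad (D + Zd)) \<cdot> pr v" for s
 proof (rule exp_intertwine[OF pr(1) subspace_W _ _ vV])
  fix w assume w: "w \<in> ?V"
  have app: "(s *\<^sub>R ad E) \<cdot> w = s *\<^sub>R br E w" for E w by (simp add: app_simps)
  show "(s *\<^sub>R ad Y) \<cdot> w \<in> ?V" unfolding app Yw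
   by (intro subspace_scale[OF subspace_W] subspace_add[OF subspace_W] DZ w W_mono[OF nV[OF w]]) simp
  have n0: "pr (br nd w) = 0" by (rule pr(5)) (rule W_mono[OF nV[OF w]], auto)
  have "br (D + Zd) w = br (D + Zd) (pr w) + br (D + Zd) (w - pr w)"
   using bilinear_radd[OF br_bilinear, of "D + Zd" "pr w" "w - pr w"] by simp
  hence "pr (br (D + Zd) w) = br (D + Zd) (pr w)"
   using pr(4)[OF DZ[OF pr(2)]] pr(5)[OF DZ[OF pr(3)]] by (simp add: linear_add[OF pr(1)])
  thus "pr ((s *\<^sub>R ad Y) \<cdot> w) = (s *\<^sub>R ad (D + Zd)) \<cdot> pr w"
   unfolding app Yw linear_cmul[OF pr(1)] linear_add[OF pr(1)] n0 by simp
 qed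
 have prv: "pr v = v" by (rule pr(4)) (rule rs_W[OF aw _ v(1)], simp)
 have comm: "ad D * ad Zd = ad Zd * ad D" using ad_br[of D Zd] mmD(3)[OF Z Da] linear_0[OF linear_ad] by simp
 have Qe: "Q (pr (exp (s *\<^sub>R ad Y) \<cdot> v)) (pr (exp (s *\<^sub>R ad Y) \<cdot> v)) = (exp (s * \<alpha> D))\<^sup>2 * Q v v" for s
 proof -
  have "exp (s *\<^sub>R ad (D + Zd)) = exp (ad (s *\<^sub>R Zd)) * exp (s *\<^sub>R ad D)"
   using exp_add_commuting[of "s *\<^sub>R ad Zd" "s *\<^sub>R ad D"] comm
   by (simp add: ad_simps scaleR_add_right add.commute)
  moreover have "exp (s *\<^sub>R ad D) \<cdot> v = exp (s * \<alpha> D) *\<^sub>R v"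
   by (rule exp_eigenvector) (simp add: app_simps rsD[OF v(1) Da])
  moreover have "s *\<^sub>R Zd \<in> k" by (rule subspace_scale[OF subspace_k mmD(1)[OF Z]])
  ultimately show ?thesis unfolding prY prv using Q_exp_k[of "s *\<^sub>R Zd" "exp (s * \<alpha> D) *\<^sub>R v" "exp (s * \<alpha> D) *\<^sub>R v"]
   by (simp add: Q_simps power2_eq_square)
 qed
 obtain cq Cq where cq: "Cq > 0" "!!x. Q x x <= Cq * (norm x)\<^sup>2" by (rule Q_bounds) (rule that; assumption?)
 obtain B where B: "B > 0" "!!x. norm (pr x) <= B * norm x" by (rule linear_bounded_pos[OF pr(1)]) (rule that; assumption?)
 define E where "E = B * (C1 * norm v)"
 show False
 proof (rule exp_growth_False[of "\<alpha> D" "2 * \<alpha> D" "Q v v" "Cq * E\<^sup>2"])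
  fix s :: real assume s: "s \<ge> 0"
  have "norm (exp (s *\<^sub>R ad Y) \<cdot> v) <= C1 * exp (s * (\<alpha> D / 2)) * norm v"
   using norm_app[of "exp (s *\<^sub>R ad Y)" v] mult_right_mono[OF up[OF s], of "norm v"] by simp
  hence "norm (pr (exp (s *\<^sub>R ad Y) \<cdot> v)) <= B * (C1 * exp (s * (\<alpha> D / 2)) * norm v)"
   using B(2)[of "exp (s *\<^sub>R ad Y) \<cdot> v"] B(1) by (smt (verit) mult_left_mono)
  hence "norm (pr (exp (s *\<^sub>R ad Y) \<cdot> v)) <= E * exp (s * (\<alpha> D / 2))" by (simp add: E_def mult_ac)
  hence "(norm (pr (exp (s *\<^sub>R ad Y) \<cdot> v)))\<^sup>2 <= (E * exp (s * (\<alpha> D / 2)))\<^sup>2" by (rule power_mono) simp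
  also have "\<dots> = E\<^sup>2 * exp (s * \<alpha> D)" by (simp add: power_mult_distrib flip: exp_double)
  finally have "(exp (s * \<alpha> D))\<^sup>2 * Q v v <= Cq * (E\<^sup>2 * exp (s * \<alpha> D))"
   using cq(2)[of "pr (exp (s *\<^sub>R ad Y) \<cdot> v)"] cq(1) unfolding Qe by (smt (verit) mult_left_mono)
  thus "exp (s * (2 * \<alpha> D)) * Q v v <= Cq * E\<^sup>2 * exp (s * \<alpha> D)"
   by (simp add: power2_eq_square mult_ac flip: exp_add)
 qed (use aD Q_pos[OF v(2)] in auto)
qed

text \<open>The brackets of H with the parts in k and in p lie in p and in k and add up to zero, so
  both vanish. Maximality of \<open>a\<close> places the p part in \<open>a\<close>.\<close>

lemma rs_zero_decomp:
 assumes r: "r \<in> rs zero_wt"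
 obtains H Z where "H \<in> a" "Z \<in> \<mm>" "r = H + Z"
proof -
 obtain Z Y where Z: "Z \<in> k" "Y \<in> p" "r = Z + Y" by (rule kp_decomp)
 have YZ: "br H Y = 0" "br H Z = 0" if H: "H \<in> a" for H
 proof -
  have 0: "br H Z + br H Y = 0"
   using r H unfolding rs_zero_wt Z(3) bilinear_radd[OF br_bilinear] by blast
  hence "br H Z = - br H Y" by (simp add: eq_neg_iff_add_eq_0)
  moreover have "br H Z \<in> p" by (rule br_pk[OF a_p[OF H] Z(1)])
  moreover have "- br H Y \<in> k" by (rule subspace_neg[OF subspace_k br_pp[OF a_p[OF H] Z(2)]])
  ultimately have "br H Z \<in> k \<inter> p" by simp
  thus "br H Z = 0" unfolding kp_int by simp
  thus "br H Y = 0" using 0 by simp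
 qed
 show thesis
 proof (rule that)
  show "Y \<in> a" by (rule a_maximal[OF Z(2) YZ(1)])
  show "Z \<in> \<mm>" using Z(1) YZ(2) by (simp add: compact_centralizer_def rs_zero_wt)
 qed (simp add: Z(3))
qed

lemma centralizer_H0:
 assumes "br H0 r = 0"
 shows "r \<in> rs zero_wt"
proof -
 obtain v w where v: "v \<in> W (%\<alpha>. \<alpha> = zero_wt)" and w: "w \<in> W (%\<alpha>. \<alpha> ~= zero_wt)" and r: "r = v + w"
  using W_decomp[of "%\<alpha>. \<alpha> = zero_wt" r] by blast
 have v: "v \<in> rs zero_wt" by (rule W_induct[OF v subspace_rs]) simp
 have "br H0 w = 0" using assms v H0(1) unfolding r bilinear_radd[OF br_bilinear] by (simp add: rs_zero_wt)
 have "w \<in> {y. Q w y = 0}"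
 proof (rule W_induct[OF w])
  show "subspace {y. Q w y = 0}" by (auto simp: subspace_def Q_simps)
  fix \<alpha> E assume \<alpha>: "\<alpha> \<in> wts" "\<alpha> ~= zero_wt" and E: "E \<in> rs \<alpha>"
  have "\<alpha> H0 * Q w E = 0"
   using Q_br_p[OF a_p[OF H0(1)], of w E] \<open>br H0 w = 0\<close> rsD[OF E H0(1)] by (simp add: Q_simps)
  thus "E \<in> {y. Q w y = 0}" using H0(2) \<alpha> by (simp add: wts_def)
 qed
 thus ?thesis using v r by simp
qed

lemma X_eig: "X \<in> eig X {0..}"
 by (rule eigI[of _ _ 0]) simp_all

lemma eig_br_X:
 assumes "y \<in> eig X {0..}"
 shows "br y X \<in> eig X {0<..}"
proof -
 have "y \<in> {y. br y X \<in> eig X {0<..}}"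
 proof (rule eig_induct[OF assms])
  have "linear (%y. br y X)" using br_bilinear by (simp add: bilinear_def)
  thus "subspace {y. br y X \<in> eig X {0<..}}" by (rule linear_subspace_vimage[OF _ subspace_eig, unfolded vimage_def])
  fix e \<mu> assume e: "br X e = \<mu> *\<^sub>R e" "\<mu> \<in> {0..}"
  have eq: "br e X = - \<mu> *\<^sub>R e" using br_antisym[of e X] e(1) by simp
  show "e \<in> {y. br y X \<in> eig X {0<..}}"
  proof (cases "\<mu> = 0")
   case False
   thus ?thesis unfolding mem_Collect_eq eq using e by (intro subspace_scale[OF subspace_eig] eigI[OF e(1)]) simp
  qed (simp add: eq subspace_0)
 qed
 thus ?thesis by simp
qed

text \<open>Seen from the flat, the nilradical of X becomes V, stable under \<open>br H0\<close>,
  and the hypothesis B puts the bracket of \<open>H0\<close> with the transported X into V. Hence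
  the component r orthogonal to V commutes with \<open>H0\<close> and lies in a + m. If its
  \<open>a\<close> part vanishes, the Killing square of X equals that of Z, so it is both
  nonnegative and nonpositive.\<close>

lemma asym_flat:
 assumes X: "X \<in> p" and g: "g \<in> carrier G" and B: "Ad G g H0 \<in> eig X {0..}"
 obtains H Z u where "H \<in> a" "Z \<in> \<mm>" "u \<in> eig X {0<..}" "X + u = Ad G g (H + Z)" "H = 0 ==> X = 0"
proof -
 let ?h = "inv g"
 have h: "?h \<in> carrier G" using g by simp
 define V where "V = Ad G ?h ` eig X {0<..}"
 have V: "subspace V" unfolding V_def by (rule linear_subspace_image[OF linear_Ad[OF h] subspace_eig])
 have H0V: "br H0 y \<in> V" if y: "y \<in> V" for y
 proof -
  obtain u where u: "u \<in> eig X {0<..}" "y = Ad G ?h u" using y by (auto simp: V_def)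
  have "br H0 y = Ad G ?h (br (Ad G g H0) u)" using g by (simp add: Ad_bracket u(2))
  moreover have "br (Ad G g H0) u \<in> eig X {0<..}" by (rule eig_br[OF B u(1)]) simp
  ultimately show ?thesis by (simp add: V_def)
 qed
 obtain v r where v: "v \<in> V" "Ad G ?h X = v + r" and orth: "!!y. y \<in> V ==> Q r y = 0"
  using orthogonal_decomposition[OF V, of "Ad G ?h X"] by metis
 have "br H0 (Ad G ?h X) \<in> V"
 proof -
  have "br H0 (Ad G ?h X) = Ad G ?h (br (Ad G g H0) X)" using g by (simp add: Ad_bracket)
  thus ?thesis using eig_br_X[OF B] by (simp add: V_def)
 qed
 moreover have "br H0 r = br H0 (Ad G ?h X) - br H0 v" by (simp add: v(2) br_simps)
 ultimately have "br H0 r \<in> V" using subspace_diff[OF V] H0V[OF v(1)] by simp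
 \<comment> \<open>\<open>br H0 r\<close> lies in V and so does its bracket with \<open>H0\<close>;
   since \<open>ad H0\<close> is symmetric, this is the square length of
   \<open>br H0 r\<close>.\<close>
 hence "Q r (br H0 (br H0 r)) = 0" using orth H0V by blast
 hence "br H0 r = 0" using Q_br_p[OF a_p[OF H0(1)], of r "br H0 r"] by simp
 then obtain H Z where HZ: "H \<in> a" "Z \<in> \<mm>" "r = H + Z" using rs_zero_decomp[OF centralizer_H0] by metis
 define u where "u = - Ad G g v"
 obtain u0 where u0: "u0 \<in> eig X {0<..}" "v = Ad G ?h u0" using v(1) by (auto simp: V_def)
 hence uu: "u = - u0" using g by (simp add: u_def)
 hence u: "u \<in> eig X {0<..}" using u0(1) subspace_neg[OF subspace_eig] by blast
 have "X = Ad G g (Ad G ?h X)" using g by simp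
 also have "\<dots> = Ad G g v + Ad G g r" unfolding v(2) by (rule linear_add[OF linear_Ad[OF g]])
 finally have Xu: "X + u = Ad G g (H + Z)" by (simp add: u_def HZ(3))
 show thesis
 proof (rule that[OF HZ(1,2) u Xu])
  assume "H = 0"
  hence "kil (X + u) (X + u) = kil Z Z" unfolding Xu using kil_Ad[OF g] by simp
  moreover have "kil (X + u) (X + u) = kil X X"
   using eig_kil[OF u X_eig] eig_kil[OF u eig_mono[OF u, of "{0..}"]] kil_sym[of X u] by (simp add: kil_simps subset_eq)
  moreover have "kil Z Z <= 0" using kil_neg[OF mmD(1)[OF HZ(2)], folded kil_eq] by (cases "Z = 0") (auto simp: kil_simps)
  ultimately have "\<not> kil X X > 0" by simp
  thus "X = 0" using kil_pos[OF X, folded kil_eq] by blast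
 qed
qed

text \<open>The same flat viewed from the chamber of t: the ray stays, and its direction is
  expressed in the coordinates of that chamber.\<close>

lemma asym_flatT:
 assumes g: "g \<in> carrier G" and t: "t \<in> T" and H: "H \<in> a" and Z: "Z \<in> \<mm>" and u: "u \<in> eig X {0<..}" "X + u = Ad G g (H + Z)"
 shows "X + u = Ad G (g \<otimes> t) (Ad G (inv t) H + Ad G (inv t) Z)" "asym X (g \<otimes> t) (Ad G (inv t) H)"
proof -
 have tc: "t \<in> carrier G" by (rule T_carrier[OF t])
 have ti: "inv t \<in> carrier G" using tc by simp
 show eq: "X + u = Ad G (g \<otimes> t) (Ad G (inv t) H + Ad G (inv t) Z)"
  unfolding u(2) linear_add[OF linear_Ad[OF ti], symmetric] using g tc by (simp add: Ad_mult)
 show "asym X (g \<otimes> t) (Ad G (inv t) H)" unfolding asym_def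
 proof (intro conjI bexI)
  show "X + u = Ad G (g \<otimes> t) (Ad G (inv t) H + Ad G (inv t) Z + 0)" using eq by simp
 qed (use u(1) T_a[OF T_inv[OF t] H] Ad_T_mm[OF T_inv[OF t] Z] subspace_0[OF subspace_nn] in auto)
qed

text \<open>For dominant H the operators \<open>exp (- t ad H)\<close> with t nonnegative are
  bounded on B, and Z contributes isometries commuting with them. Transported by f, the flow of X +
  u is bounded on \<open>Ad G f B\<close>, so \<open>eig_bounded_perturbed\<close> applies.\<close>

lemma eig_dominant:
 assumes X: "X \<in> p" and f: "f \<in> carrier G" and u: "u \<in> eig X {0<..}" "X + u = Ad G f (H + Z)"
  and H: "dominant H" and Z: "Z \<in> \<mm>" and B: "B \<in> \<bb>"
 shows "Ad G f B \<in> eig X {0..}"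
proof -
 have Ha: "H \<in> a" using H by (simp add: dominant_def)
 let ?e = "%t. exp (- t *\<^sub>R ad H)"
 note sc = app.scaleR_left app.minus_left
 have "B \<in> {B. \<exists>C. \<forall>t\<ge>0. norm (?e t \<cdot> B) <= C}"
 proof (rule W_induct[OF B])
  show "subspace {B. \<exists>C. \<forall>t\<ge>0. norm (?e t \<cdot> B) <= C}" unfolding subspace_def
  proof (intro conjI ballI allI)
   show "0 \<in> {B. \<exists>C. \<forall>t\<ge>0. norm (?e t \<cdot> B) <= C}" using linear_0[OF linear_app] by (auto intro!: exI[of _ 0])
   fix x y c assume "x \<in> {B. \<exists>C. \<forall>t\<ge>0. norm (?e t \<cdot> B) <= C}"
   then obtain C where C: "!!t. t \<ge> 0 ==> norm (?e t \<cdot> x) <= C" by blast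
   have "norm (?e t \<cdot> (c *\<^sub>R x)) <= \<bar>c\<bar> * C" if "t \<ge> 0" for t
    using mult_left_mono[OF C[OF that], of "\<bar>c\<bar>"] by (simp add: app_simps)
   thus "c *\<^sub>R x \<in> {B. \<exists>C. \<forall>t\<ge>0. norm (?e t \<cdot> B) <= C}" by blast
   assume "y \<in> {B. \<exists>C. \<forall>t\<ge>0. norm (?e t \<cdot> B) <= C}"
   then obtain C' where C': "!!t. t \<ge> 0 ==> norm (?e t \<cdot> y) <= C'" by blast
   have "norm (?e t \<cdot> (x + y)) <= C + C'" if "t \<ge> 0" for t
    unfolding linear_add[OF linear_app] using C[OF that] C'[OF that] by (rule norm_add_rule_thm)
   thus "x + y \<in> {B. \<exists>C. \<forall>t\<ge>0. norm (?e t \<cdot> B) <= C}" by blast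
  qed
  fix \<alpha> E assume \<alpha>: "\<alpha> \<in> wts" "\<alpha> = zero_wt \<or> \<alpha> \<in> \<Phi>" and E: "E \<in> rs \<alpha>"
  have a0: "\<alpha> H \<ge> 0" using \<alpha>(2) H Ha by (auto simp: dominant_def)
  have "?e t \<cdot> E = exp (- (t * \<alpha> H)) *\<^sub>R E" for t by (rule exp_eigenvector) (simp add: sc rsD[OF E Ha])
  hence "norm (?e t \<cdot> E) <= norm E" if "t \<ge> 0" for t using a0 that by (simp add: mult_left_le_one_le)
  thus "E \<in> {B. \<exists>C. \<forall>t\<ge>0. norm (?e t \<cdot> B) <= C}" by blast
 qed
 then obtain C where C: "!!t. t \<ge> 0 ==> norm (?e t \<cdot> B) <= C" by blast
 obtain c1 C1 where Qb: "c1 > 0" "C1 > 0" "!!x. c1 * (norm x)\<^sup>2 <= Q x x" "!!x. Q x x <= C1 * (norm x)\<^sup>2"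
  by (rule Q_bounds) (rule that; assumption?)
 have comm: "ad H * ad Z = ad Z * ad H" using ad_br[of H Z] mmD(3)[OF Z Ha] linear_0[OF linear_ad] by simp
 define C2 where "C2 = norm (AdE f) * sqrt (C1 * C\<^sup>2 / c1)"
 show ?thesis
 proof (rule eig_bounded_perturbed[OF X u(1)])
  fix t :: real assume t: "t \<ge> 0"
  have eq: "Ad G f (exp (- t *\<^sub>R ad (H + Z)) \<cdot> B) = exp (- t *\<^sub>R ad (X + u)) \<cdot> Ad G f B"
   by (rule exp_intertwine[OF linear_Ad[OF f] subspace_UNIV])
    (simp_all add: sc u(2) Ad_bracket[OF f] linear_cmul[OF linear_Ad[OF f]] linear_neg[OF linear_Ad[OF f]])
  have eZ: "exp (- t *\<^sub>R ad (H + Z)) = exp (ad (- t *\<^sub>R Z)) * ?e t"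
   using exp_add_commuting[of "- t *\<^sub>R ad Z" "- t *\<^sub>R ad H"] comm
   by (simp add: ad_simps scaleR_add_right add.commute)
  let ?y = "exp (- t *\<^sub>R ad (H + Z)) \<cdot> B"
  have "- t *\<^sub>R Z \<in> k" by (rule subspace_scale[OF subspace_k mmD(1)[OF Z]])
  hence "Q ?y ?y = Q (?e t \<cdot> B) (?e t \<cdot> B)" unfolding eZ app_mult by (rule Q_exp_k)
  also have "\<dots> <= C1 * C\<^sup>2" using Qb(4)[of "?e t \<cdot> B"] mult_left_mono[OF power_mono[OF C[OF t] norm_ge_zero, of 2], of C1] Qb(2) by linarith
  finally have "c1 * (norm ?y)\<^sup>2 <= C1 * C\<^sup>2" using Qb(3)[of ?y] by linarith
  hence "(norm ?y)\<^sup>2 <= C1 * C\<^sup>2 / c1" using Qb(1) by (simp add: field_simps)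
  hence "norm ?y <= sqrt (C1 * C\<^sup>2 / c1)" by (rule real_le_rsqrt)
  hence "norm (AdE f) * norm ?y <= C2" unfolding C2_def by (rule mult_left_mono) simp
  thus "norm (exp (- t *\<^sub>R ad (X + u)) \<cdot> Ad G f B) <= C2"
   using norm_app[of "AdE f" ?y] f unfolding eq[symmetric] by simp
 qed
qed

lemma one_par: "\<one> \<in> par"
proof -
 have "\<one> \<in> M" using subgroup.one_closed[OF subgroup_K] by (simp add: M_iff Ad_one)
 moreover have "\<one> \<in> A" unfolding A_def by (rule image_eqI[of _ _ 0]) (simp_all add: subspace_0[OF subspace_a])
 moreover have "\<one> \<in> grp_N G a \<Phi>"
  unfolding grp_N_def nn_eq[symmetric] by (rule image_eqI[of _ _ 0]) (simp_all add: subspace_0)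
 moreover have "\<one> = \<one> \<otimes> \<one> \<otimes> \<one>" by simp
 ultimately show ?thesis unfolding par_def set_mult_def by blast
qed

text \<open>The cosets are equal as sets, and \<open>\<one> \<in> par\<close> makes
  \<open>h'\<close> an element of both.\<close>

lemma par_cosetD:
 assumes "h \<in> carrier G" "h' \<in> carrier G" "h <# par = h' <# par"
 obtains q where "q \<in> par" "h' = h \<otimes> q"
proof -
 have "h' \<otimes> \<one> \<in> h' <# par" unfolding l_coset_def using one_par by blast
 thus thesis using that assms unfolding assms(3)[symmetric] l_coset_def by auto
qed

lemma par_coset_mult: "g \<in> carrier G ==> h \<in> carrier G ==> g <# (h <# par) = (g \<otimes> h) <# par"
 by (rule lcos_m_assoc) (auto simp: par_carrier)

definition dir :: "'e => 'g set => 'e => bool" where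
 "dir X x H \<longleftrightarrow> (\<exists>h\<in>carrier G. x = h <# par \<and> asym X h H)"

lemma dirI: "h \<in> carrier G ==> asym X h H ==> dir X (h <# par) H"
 unfolding dir_def by blast

lemma dir_unique:
 assumes X: "X \<in> p" and "dir X x H" "dir X x H'"
 shows "H = H'"
proof -
 obtain h where h: "h \<in> carrier G" "x = h <# par" "asym X h H" using assms(2) unfolding dir_def by blast
 obtain h' where h': "h' \<in> carrier G" "x = h' <# par" "asym X h' H'" using assms(3) unfolding dir_def by blast
 obtain q where q: "q \<in> par" "h' = h \<otimes> q" using par_cosetD[OF h(1) h'(1)] h(2) h'(2) by metis
 show ?thesis by (rule asym_unique[OF X h(1,3) asym_par[OF h(1) q(1) h'(3)[unfolded q(2)]]])
qed

lemma finite_orbit: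
 assumes H: "H \<in> a"
 shows "finite ((%t. Ad G t H) ` T)" (is "finite ?S")
proof -
 define f where "f H' = (\<lambda>\<alpha>\<in>R. \<alpha> H')" for H' :: 'e
 have Sa: "?S \<subseteq> a" using T_a H by blast
 have "inj_on f ?S"
 proof (rule inj_onI)
  fix x y assume x: "x \<in> ?S" and y: "y \<in> ?S" and eq: "f x = f y"
  have xy: "x \<in> a" "y \<in> a" using x y Sa by blast+
  have "x - y = 0"
  proof (rule roots_separate[OF subspace_diff[OF subspace_a xy]])
   fix \<alpha> assume \<alpha>: "\<alpha> \<in> R"
   hence "\<alpha> x = \<alpha> y" using fun_cong[OF eq, of \<alpha>] by (simp add: f_def)
   thus "\<alpha> (x - y) = 0" using root_linear(2)[OF \<alpha> xy] by simp
  qed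
  thus "x = y" by simp
 qed
 moreover have "f ` ?S \<subseteq> R \<rightarrow>\<^sub>E (%\<beta>. \<beta> H) ` R"
 proof (intro image_subsetI)
  fix x assume "x \<in> ?S"
  then obtain t where t: "t \<in> T" "x = Ad G t H" by blast
  have "\<alpha> x \<in> (%\<beta>. \<beta> H) ` R" if \<alpha>: "\<alpha> \<in> R" for \<alpha>
   using tw_R[OF T_inv[OF t(1)] \<alpha>] tw_inv_app[OF t(1) H, of \<alpha>] t(2) by (metis image_eqI)
  thus "f x \<in> R \<rightarrow>\<^sub>E (%\<beta>. \<beta> H) ` R" by (simp add: f_def)
 qed
 hence "finite (f ` ?S)" by (rule finite_subset) (simp add: finite_PiE finite_R)
 ultimately show ?thesis by (simp add: finite_image_iff)
qed

text \<open>On the finite orbit of H the Killing product with \<open>H0\<close> has a maximum. Where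
  a positive root is negative, reflecting in it would increase this product.\<close>

lemma dominant_rep:
 assumes H: "H \<in> a"
 obtains t where "t \<in> T" "dominant (Ad G (inv t) H)"
proof -
 let ?S = "(%t. Ad G t H) ` T"
 have ne: "?S ~= {}" using M_T[of \<one>] subgroup.one_closed[OF subgroup_K] by (auto simp: M_iff Ad_one)
 obtain x where x: "x \<in> ?S" "Max ((%y. kil y H0) ` ?S) = kil x H0"
  using Max_in[OF finite_imageI[OF finite_orbit[OF H]]] ne by blast
 have xmax: "kil y H0 <= kil x H0" if "y \<in> ?S" for y
  unfolding x(2)[symmetric] by (rule Max_ge[OF finite_imageI[OF finite_orbit[OF H]] imageI[OF that]])
 obtain t where t: "t \<in> T" "x = Ad G t H" using x(1) by blast
 have xa: "x \<in> a" using T_a[OF t(1) H] t(2) by simp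
 have "\<alpha> x \<ge> 0" if \<alpha>: "\<alpha> \<in> \<Phi>" for \<alpha>
 proof (rule ccontr)
  assume neg: "\<not> 0 <= \<alpha> x"
  obtain s where s: "s \<in> T" "!!H. H \<in> a ==> Ad G s H = refl \<alpha> H" using reflection_rep[OF Phi_R[OF \<alpha>]] by metis
  have "refl \<alpha> x \<in> ?S"
   using s(2)[OF xa] T_mult[OF s(1) t(1)] T_carrier[OF s(1)] T_carrier[OF t(1)] t(2) by (metis Ad_mult image_eqI)
  from xmax[OF this] have "(2 * \<alpha> x / \<alpha> (hv \<alpha>)) * \<alpha> H0 \<ge> 0"
   using hv(2)[OF Phi_R[OF \<alpha>] H0(1)] by (simp add: refl_def kil_simps)
  moreover have "(2 * \<alpha> x / \<alpha> (hv \<alpha>)) < 0"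
   by (rule divide_neg_pos) (use neg root_hv_pos[OF Phi_R[OF \<alpha>]] in auto)
  hence "(2 * \<alpha> x / \<alpha> (hv \<alpha>)) * \<alpha> H0 < 0" by (rule mult_neg_pos) (use \<alpha> in \<open>simp add: Phi_iff\<close>)
  ultimately show False by simp
 qed
 hence "dominant x" using xa by (simp add: dominant_def)
 thus thesis using that[OF T_inv[OF t(1)]] T_carrier[OF t(1)] t(2) by simp
qed

lemma a_zeroI:
 assumes H: "H \<in> a" and z: "!!\<alpha>. \<alpha> \<in> \<Phi> ==> \<alpha> H = 0"
 shows "H = 0"
proof (rule roots_separate[OF H])
 fix \<alpha> assume \<alpha>: "\<alpha> \<in> R"
 show "\<alpha> H = 0"
 proof (cases "\<alpha> \<in> \<Phi>")
  case False
  hence "wneg \<alpha> H = 0" using z neg_Phi_iff[OF \<alpha>] by blast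
  thus ?thesis using H by simp
 qed (rule z)
qed

end

section \<open>Opposition and the vanishing of destabilizing directions\<close>

locale lie_longest = lie_symmetric G K p a \<Phi>
 for G :: "('g, 'e::euclidean_space) lie_data" (structure) and K :: "'g set" and p a :: "'e set" and \<Phi> +
 fixes w0 :: 'g
 assumes longest: "longest_rep G K A a \<Phi> w0"
begin

lemma w0: "w0 \<in> T" "\<beta> \<in> \<Phi> ==> wneg (tw (inv w0) \<beta>) \<in> \<Phi>"
 using longest_rep_negates[OF longest] by blast+

lemma w0_carrier [simp]: "w0 \<in> carrier G"
 by (rule T_carrier[OF w0(1)])

lemma dir_opposite:
 assumes X: "X \<in> p" and g: "g \<in> carrier G" and B: "Ad G g H0 \<in> eig X {0..}"
 obtains H where "H \<in> a" "dir X (g <# par) H" "dir X (g <# (w0 <# par)) (Ad G (inv w0) H)" "H = 0 ==> X = 0"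
proof -
 obtain H Z u where H: "H \<in> a" "Z \<in> \<mm>" "u \<in> eig X {0<..}" "X + u = Ad G g (H + Z)" "H = 0 ==> X = 0"
  by (rule asym_flat[OF X g B]) (rule that; assumption?)
 have "\<one> \<in> T" using subgroup.one_closed[OF subgroup_K] by (intro M_T) (simp add: M_iff Ad_one)
 from dirI[OF _ asym_flatT(2)[OF g this H(1-4)]] dirI[OF _ asym_flatT(2)[OF g w0(1) H(1-4)]]
 have "dir X (g <# par) H" "dir X (g <# (w0 <# par)) (Ad G (inv w0) H)"
  using g by (simp_all add: par_coset_mult Ad_one)
 thus thesis using that H by blast
qed

definition oppair :: "'e => 'g set => 'g set => bool" where
 "oppair X x y \<longleftrightarrow> (\<exists>g\<in>carrier G. x = g <# par \<and> y = g <# (w0 <# par) \<and> Ad G g H0 \<in> eig X {0..})"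

lemma oppair_dir:
 assumes X: "X \<in> p" and o: "oppair X x y"
 obtains H where "H \<in> a" "dir X x H" "dir X y (Ad G (inv w0) H)" "H = 0 ==> X = 0"
proof -
 obtain g where g: "g \<in> carrier G" "x = g <# par" "y = g <# (w0 <# par)" "Ad G g H0 \<in> eig X {0..}"
  using o unfolding oppair_def by blast
 show thesis
  by (rule dir_opposite[OF X g(1,4), folded g(2,3)]) (rule that; assumption?)
qed

lemma stable_minus_one:
 assumes X: "X \<in> p" and neg: "!!H. H \<in> a ==> Ad G w0 H = - H"
  and o: "oppair X x y" "oppair X y z" "oppair X z x"
 shows "X = 0"
proof -
 have inv: "Ad G (inv w0) H = - H" if H: "H \<in> a" for H
 proof -
  have "Ad G (inv w0) (Ad G w0 (- H)) = - H" by simp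
  thus ?thesis using neg[OF subspace_neg[OF subspace_a H]] by simp
 qed
 obtain H where H: "H \<in> a" "dir X x H" "dir X y (Ad G (inv w0) H)" "H = 0 ==> X = 0"
  by (rule oppair_dir[OF X o(1)]) (rule that; assumption?)
 obtain H1 where H1: "H1 \<in> a" "dir X y H1" "dir X z (Ad G (inv w0) H1)"
  by (rule oppair_dir[OF X o(2)]) (rule that; assumption?)
 obtain H2 where H2: "H2 \<in> a" "dir X z H2" "dir X x (Ad G (inv w0) H2)"
  by (rule oppair_dir[OF X o(3)]) (rule that; assumption?)
 have "H1 = - H" "H2 = - H1" "H = - H2"
  using dir_unique[OF X H1(2) H(3)] dir_unique[OF X H2(2) H1(3)] dir_unique[OF X H(2) H2(3)] inv H(1) H1(1) H2(1) by auto
 hence "H = - H" by simp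
 hence "H + H = 0" by (rule eq_neg_iff_add_eq_0[THEN iffD1])
 hence "2 *\<^sub>R H = 0" by (simp only: scaleR_2)
 hence "H = 0" by simp
 thus ?thesis by (rule H(4))
qed

definition oppflat :: "'e => 'g set => 'g set => 'g set => bool" where
 "oppflat X x y z \<longleftrightarrow> (\<exists>g\<in>carrier G. x = g <# par \<and> y = g <# (w0 <# par) \<and> Ad G g H0 \<in> eig X {0..} \<and>
   (\<forall>t\<in>T. opposite G par w0 z ((g \<otimes> t) <# par)))"

lemma Ad_w0_neg: "Y \<in> a ==> \<beta> \<in> \<Phi> ==> dominant Y ==> \<beta> (Ad G w0 Y) <= 0"
proof -
 assume Y: "Y \<in> a" "dominant Y" and \<beta>: "\<beta> \<in> \<Phi>"
 have "wneg (tw (inv w0) \<beta>) Y \<ge> 0" using w0(2)[OF \<beta>] Y(2) unfolding dominant_def by blast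
 thus ?thesis using Y(1) tw_inv_app[OF w0(1) Y(1)] by simp
qed

text \<open>The chamber t of the flat is chosen so that the ray of X has dominant direction there.
  As z is opposite to that boundary point, their pair is represented by some h, and dominance puts
  \<open>Ad G h H0\<close> into the nonnegative part although this pair is not one of the tuple. The
  direction at the boundary point is thus obtained once from the flat and once from z, and
  uniqueness equates the two.\<close>

lemma oppflat_dir:
 assumes X: "X \<in> p" and o: "oppflat X x y z" and z: "dir X z H'"
 shows "dominant (Ad G (inv w0) H')"
proof -
 obtain g where g: "g \<in> carrier G" "Ad G g H0 \<in> eig X {0..}" and opp: "!!t. t \<in> T ==> opposite G par w0 z ((g \<otimes> t) <# par)"
  using o unfolding oppflat_def by blast
 obtain H Z u where H: "H \<in> a" "Z \<in> \<mm>" "u \<in> eig X {0<..}" "X + u = Ad G g (H + Z)"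
  by (rule asym_flat[OF X g]) (rule that; assumption?)
 obtain t where t: "t \<in> T" "dominant (Ad G (inv t) H)" by (rule dominant_rep[OF H(1)])
 have tc: "t \<in> carrier G" by (rule T_carrier[OF t(1)])
 note f = asym_flatT[OF g(1) t(1) H]
 have gt: "g \<otimes> t \<in> carrier G" using g(1) tc by simp
 obtain h where h: "h \<in> carrier G" "z = h <# par" "(g \<otimes> t) <# par = h <# (w0 <# par)"
  using opp[OF t(1)] unfolding opposite_def by blast
 have hw: "h \<otimes> w0 \<in> carrier G" using h(1) by simp
 have eqc: "(g \<otimes> t) <# par = (h \<otimes> w0) <# par" using h(3) par_coset_mult[OF h(1) w0_carrier] by simp
 obtain q where q: "q \<in> par" "h \<otimes> w0 = g \<otimes> t \<otimes> q" by (rule par_cosetD[OF gt hw eqc])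
 have Ha: "Ad G (inv w0) H0 \<in> a" by (rule T_a[OF T_inv[OF w0(1)] H0(1)])
 obtain Z' n' where Zn: "Z' \<in> \<mm>" "n' \<in> \<nn>" "Ad G q (Ad G (inv w0) H0 + 0 + 0) = Ad G (inv w0) H0 + Z' + n'"
  by (rule par_Ad[OF q(1) Ha subspace_0[OF subspace_mm] subspace_0[OF subspace_nn]])
 have "Ad G h H0 = Ad G (h \<otimes> w0) (Ad G (inv w0) H0)" using h(1) by (simp add: Ad_mult)
 also have "\<dots> = Ad G (g \<otimes> t) (Ad G (inv w0) H0 + Z' + n')" using Zn(3) unfolding q(2) by (simp add: Ad_mult gt par_carrier[OF q(1)])
 also have "\<dots> \<in> eig X {0..}"
  by (rule eig_dominant[OF X gt H(3) f(1) t(2) Ad_T_mm[OF T_inv[OF t(1)] H(2)]])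
   (intro subspace_add[OF subspace_W] a_bb Ha mm_bb Zn(1) nn_bb Zn(2))
 finally obtain H1 where H1: "H1 \<in> a" "dir X z H1" "dir X (h <# (w0 <# par)) (Ad G (inv w0) H1)"
  by (rule dir_opposite[OF X h(1), folded h(2)]) (rule that; assumption?)
 have "Ad G (inv w0) H1 = Ad G (inv t) H"
  by (rule dir_unique[OF X H1(3)[folded h(3)] dirI[OF gt f(2)]])
 thus ?thesis using t(2) dir_unique[OF X z H1(2)] by simp
qed

lemma stable_generic:
 assumes X: "X \<in> p" and o: "oppair X x y" "oppflat X y z x" "oppflat X z x y"
 shows "X = 0"
proof -
 obtain H where H: "H \<in> a" "dir X x H" "dir X y (Ad G (inv w0) H)" "H = 0 ==> X = 0"
  by (rule oppair_dir[OF X o(1)]) (rule that; assumption?)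
 let ?H = "Ad G (inv w0) H"
 have Ha: "?H \<in> a" by (rule T_a[OF T_inv[OF w0(1)] H(1)])
 have d: "dominant ?H" by (rule oppflat_dir[OF X o(2) H(2)])
 have d': "dominant (Ad G (inv w0) ?H)" by (rule oppflat_dir[OF X o(3) H(3)])
 \<comment> \<open>\<open>?H\<close> is dominant and at the same time the image of a dominant vector
   under w0, so each positive root is nonnegative and nonpositive on it.\<close>
 have "?H = 0"
 proof (rule a_zeroI[OF Ha])
  fix \<beta> assume \<beta>: "\<beta> \<in> \<Phi>"
  have "\<beta> (Ad G w0 (Ad G (inv w0) ?H)) <= 0" by (rule Ad_w0_neg[OF T_a[OF T_inv[OF w0(1)] Ha] \<beta> d'])
  thus "\<beta> ?H = 0" using d \<beta> by (force simp: dominant_def)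
 qed
 hence "Ad G w0 ?H = 0" using linear_0[OF linear_Ad[OF w0_carrier]] by simp
 hence "H = 0" by simp
 thus ?thesis by (rule H(4))
qed

end

section \<open>Perturbation of a transverse intersection, and uniqueness of polar parts\<close>

text \<open>The vector of an opposite pair is the common point of two affine spaces, each depending
  on one entry. Transversality at S and S' bounds the difference map \<open>?L\<close> from below,
  and this bounds the displacement of any common point of the perturbed spaces.\<close>

lemma affine_intersection_continuous:
 fixes S S' :: "'a::euclidean_space endo"
 assumes V: "subspace V" and inj: "!!v v'. v \<in> V ==> v' \<in> V ==> S \<cdot> v = S' \<cdot> v' ==> v = 0 \<and> v' = 0"
  and v0: "v0 \<in> V" "v0' \<in> V" "S \<cdot> (b + v0) = S' \<cdot> (b' + v0')" and e: "\<epsilon> > 0"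
 obtains r where "r > 0" "!!T T' v v'. norm (T - S) < r ==> norm (T' - S') < r ==> v \<in> V ==> v' \<in> V ==>
  T \<cdot> (b + v) = T' \<cdot> (b' + v') ==> norm (T \<cdot> (b + v) - S \<cdot> (b + v0)) < \<epsilon>"
proof -
 let ?L = "%x. S \<cdot> fst x - S' \<cdot> snd x"
 have L: "bounded_linear ?L"
  by (intro bounded_linear_sub app.bounded_linear_right[THEN bounded_linear_compose] bounded_linear_fst bounded_linear_snd)
 have "\<exists>c>0. \<forall>x\<in>V \<times> V. norm (?L x) \<ge> c * norm x"
  by (rule injective_imp_isometric[OF _ _ L]) (use V inj in \<open>auto intro: closed_Times closed_subspace subspace_Times simp: prod_eq_iff\<close>)
 then obtain c where c: "c > 0" "!!x. x \<in> V \<times> V ==> norm (?L x) \<ge> c * norm x" by blast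
 \<comment> \<open>K bounds the data at the base point and N is the resulting Lipschitz constant;
   the bound \<open>c / 4\<close> on r lets half of \<open>c * norm ?x\<close> absorb the
   perturbation of the linear map.\<close>
 define K where "K = norm (b + v0) + norm (b' + v0')"
 define N where "N = 2 * K + norm S * (4 * K / c)"
 define r where "r = min (c / 4) (\<epsilon> / (N + 1))"
 have N: "N \<ge> 0" "K \<ge> 0" using c(1) by (simp_all add: N_def K_def)
 have "r > 0" using c(1) e N by (simp add: r_def)
 moreover have "r <= c / 4" unfolding r_def by (rule min.cobounded1)
 ultimately have d: "r > 0" "r <= c / 4" .
 have "r <= \<epsilon> / (N + 1)" unfolding r_def by (rule min.cobounded2)
 hence "r * (N + 1) <= \<epsilon>" using N by (simp add: pos_le_divide_eq)
 hence dN: "r * N < \<epsilon>" using d(1) by (simp add: distrib_left)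
 show thesis
 proof (rule that[OF d(1)])
  fix T T' v v'
  assume TS: "norm (T - S) < r" "norm (T' - S') < r" and v: "v \<in> V" "v' \<in> V" and eq: "T \<cdot> (b + v) = T' \<cdot> (b' + v')"
  let ?x = "(v - v0, v' - v0')"
  have bd: "norm (U \<cdot> (x + y)) <= r * (K + norm ?x)"
   if "norm U < r" "norm (x + y0) <= K" "norm (y - y0) <= norm ?x" for U and x y y0 :: 'a
  proof (rule order_trans[OF norm_app mult_mono])
   show "norm (x + y) <= K + norm ?x" using norm_triangle_ineq[of "x + y0" "y - y0"] that by simp
  qed (use that d(1) in auto)
  note bds = bd[OF TS(1), of b v0 v] bd[OF TS(2), of b' v0' v']
  have le: "norm (v - v0) <= norm ?x" "norm (v' - v0') <= norm ?x"
   using norm_fst_le[of "v - v0" "v' - v0'"] norm_snd_le[of "v' - v0'" "v - v0"] by auto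
  have "?L ?x = (T' - S') \<cdot> (b' + v') - (T - S) \<cdot> (b + v)" using eq v0(3) by (simp add: app_simps algebra_simps)
  hence "c * norm ?x <= norm ((T' - S') \<cdot> (b' + v')) + norm ((T - S) \<cdot> (b + v))"
   using c(2)[of ?x] norm_triangle_ineq4 subspace_diff[OF V] v v0 by (metis mem_Sigma_iff order_trans)
  also have "\<dots> <= r * (K + norm ?x) + r * (K + norm ?x)" using bds le by (intro add_mono) (auto simp: K_def)
  finally have "c * norm ?x <= 2 * (r * K) + 2 * (r * norm ?x)" by (simp add: algebra_simps)
  moreover have "r * norm ?x <= c / 4 * norm ?x" by (rule mult_right_mono[OF d(2)]) simp
  ultimately have "c * norm ?x <= 4 * (r * K)" by simp
  hence x: "norm ?x <= r * (4 * K / c)" using c(1) by (simp add: field_simps)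
  also have "\<dots> <= c / 4 * (4 * K / c)" using N(2) c(1) by (intro mult_right_mono d(2)) simp
  finally have xK: "norm ?x <= K" using c(1) by simp
  have "T \<cdot> (b + v) - S \<cdot> (b + v0) = (T - S) \<cdot> (b + v) + S \<cdot> (v - v0)" by (simp add: app_simps)
  hence "norm (T \<cdot> (b + v) - S \<cdot> (b + v0)) <= norm ((T - S) \<cdot> (b + v)) + norm (S \<cdot> (v - v0))"
   by (simp only: norm_triangle_ineq)
  also have "\<dots> <= r * (K + K) + norm S * (r * (4 * K / c))"
  proof (rule add_mono)
   have "r * (K + norm ?x) <= r * (K + K)" using xK d(1) by simp
   thus "norm ((T - S) \<cdot> (b + v)) <= r * (K + K)" using bds(1) le(1) by (simp add: K_def)
   show "norm (S \<cdot> (v - v0)) <= norm S * (r * (4 * K / c))"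
    using le(1) x by (intro order_trans[OF norm_app] mult_left_mono) auto
  qed
  also have "\<dots> = r * N" by (simp add: N_def algebra_simps)
  finally show "norm (T \<cdot> (b + v) - S \<cdot> (b + v0)) < \<epsilon>" using dN by simp
 qed
qed

lemma (in lie_cartan) lie_exp_commuting_add:
 assumes "bracket G X Y = 0"
 shows "lie_exp G (X + Y) = lie_exp G X \<otimes> lie_exp G Y"
proof -
 have comm: "gam X s \<otimes> gam Y t = gam Y t \<otimes> gam X s" for s t
 proof -
  have "ad (s *\<^sub>R X) \<cdot> (t *\<^sub>R Y) = 0 *\<^sub>R (t *\<^sub>R Y)" using assms by (simp add: br_simps)
  from exp_eigenvector[OF this] have "Ad G (lie_exp G (s *\<^sub>R X)) (t *\<^sub>R Y) = t *\<^sub>R Y" by (simp add: Ad_lie_exp)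
  hence "lie_exp G (s *\<^sub>R X) \<otimes> lie_exp G (t *\<^sub>R Y) \<otimes> inv (lie_exp G (s *\<^sub>R X)) = lie_exp G (t *\<^sub>R Y)"
   by (simp add: lie_exp_conj)
  from conj_fixed_commute[OF _ _ this] show ?thesis using gam(2) by (simp add: lie_exp_scale)
 qed
 have adc: "ad X * ad Y = ad Y * ad X" using ad_br[of X Y] assms by (simp add: ad_simps)
 obtain r where r: "r > 0" "!!g h. g \<in> nball r ==> h \<in> nball r ==> g \<otimes> h \<in> nball rad"
  by (rule nball_square[OF delta0(1)]) (rule that; assumption?)
 obtain \<tau> \<tau>' where \<tau>: "\<tau> > 0" "\<tau>' > 0" "!!t. \<bar>t\<bar> <= \<tau> ==> gam X t \<in> nball r" "!!t. \<bar>t\<bar> <= \<tau>' ==> gam Y t \<in> nball r"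
  using gam(4)[OF r(1)] by metis
 have "gam X t \<otimes> gam Y t = gam (X + Y) t" for t
 proof (rule gam_unique[where \<tau> = "min \<tau> \<tau>'"])
  fix s t
  have "gam X (s + t) \<otimes> gam Y (s + t) = gam X s \<otimes> (gam X t \<otimes> gam Y s) \<otimes> gam Y t" by (simp add: gam(1,2) m_assoc)
  thus "gam X (s + t) \<otimes> gam Y (s + t) = gam X s \<otimes> gam Y s \<otimes> (gam X t \<otimes> gam Y t)"
   unfolding comm[of t s] by (simp add: gam(2) m_assoc)
  have "exp (t *\<^sub>R ad X + t *\<^sub>R ad Y) = exp (t *\<^sub>R ad X) * exp (t *\<^sub>R ad Y)"
   by (rule exp_add_commuting) (simp add: adc)
  thus "AdE (gam X t \<otimes> gam Y t) = exp (t *\<^sub>R ad (X + Y))"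
   by (simp add: AdE_mult gam(2,3) ad_simps scaleR_add_right)
 qed (use \<tau> r gam(2) in auto)
 thus ?thesis by (simp add: lie_exp_eq)
qed

text \<open>An eigenvector of \<open>ad X\<close> is an eigenvector of the common exponential. It is
  therefore orthogonal to the eigenvectors of \<open>ad Y\<close> for every other eigenvalue, the
  real exponential being injective.\<close>

lemma (in cartan_algebra) exp_ad_p_inj:
 assumes X: "X \<in> p" and Y: "Y \<in> p" and eq: "exp (ad X) = exp (ad Y)"
 shows "X = Y"
proof -
 have "br X v = br Y v" for v
 proof -
  have "v \<in> {v. br X v = br Y v}"
  proof (rule eig_induct)
   show "v \<in> eig X UNIV" by (simp add: eig_UNIV[OF X])
   show "subspace {v. br X v = br Y v}" by (auto simp: subspace_def br_simps)
   fix e \<mu> assume e: "br X e = \<mu> *\<^sub>R e"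
   have "e \<in> eig Y {\<mu>}" unfolding eig_iff[OF Y]
   proof (intro allI impI)
    fix f \<nu> assume f: "\<nu> \<notin> {\<mu>}" "br Y f = \<nu> *\<^sub>R f"
    have "exp (ad Y) \<cdot> e = exp \<mu> *\<^sub>R e" unfolding eq[symmetric] by (rule exp_eigenvector) (simp add: e)
    moreover have "exp (ad Y) \<cdot> f = exp \<nu> *\<^sub>R f" by (rule exp_eigenvector) (simp add: f)
    ultimately have "exp \<mu> * Q e f = exp \<nu> * Q e f" using Q_exp_p[OF Y, of e f] by (simp add: Q_simps)
    thus "Q e f = 0" using f(1) by simp
   qed
   hence "e \<in> {e. br Y e = \<mu> *\<^sub>R e}"
    by (rule eig_induct) (auto simp: subspace_def br_simps scaleR_add_right)
   thus "e \<in> {v. br X v = br Y v}" using e by simp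
  qed
  thus ?thesis by simp
 qed
 hence "br (X - Y) v = 0" for v by (simp add: br_simps)
 hence "ad (X - Y) = 0" by (intro endo_eqI) (simp add: app_simps)
 thus ?thesis using ad_inj[of "X - Y"] by simp
qed

section \<open>Stabilizers of flats and of boundary pairs\<close>

context lie_symmetric
begin

text \<open>Taking adjoints for \<open>Q\<close> moves c to the other side; multiplying both forms
  cancels it and gives the same square \<open>exp (ad (2 X)) = exp (ad (2 Y))\<close>.\<close>

lemma polar_unique:
 assumes X: "X \<in> p" and Y: "Y \<in> p" and c: "c \<in> K" and eq: "lie_exp G X = lie_exp G Y \<otimes> c"
 shows "X = Y"
proof -
 have "exp (ad X) = exp (ad Y) * AdE c" using arg_cong[OF eq, of AdE] K_carrier[OF c] by (simp add: AdE_mult)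
 hence X1: "exp (ad X) \<cdot> v = exp (ad Y) \<cdot> Ad G c v" for v using K_carrier[OF c] by simp
 have dbl: "exp (ad (2 *\<^sub>R Z)) = exp (ad Z) * exp (ad Z)" for Z
  using exp_scaleR_add[of 1 1 "ad Z"] by (simp add: ad_simps)
 have X2: "exp (ad X) \<cdot> v = Ad G (inv c) (exp (ad Y) \<cdot> v)" (is "?l = ?r") for v
 proof -
  have "Q ?l w = Q ?r w" for w
  proof -
   have "Q ?l w = Q v (exp (ad Y) \<cdot> Ad G c w)" unfolding X1[symmetric] by (rule Q_exp_p[OF X])
   also have "\<dots> = Q (exp (ad Y) \<cdot> v) (Ad G c w)" by (rule Q_exp_p[OF Y, symmetric])
   also have "\<dots> = Q ?r w" using Q_Ad_K[OF c, of ?r w] K_carrier[OF c] by simp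
   finally show ?thesis .
  qed
  hence "Q (?l - ?r) (?l - ?r) = 0" by (simp add: Q_simps)
  thus ?thesis by simp
 qed
 have "exp (ad (2 *\<^sub>R X)) = exp (ad (2 *\<^sub>R Y))"
 proof (rule endo_eqI)
  fix v
  have "exp (ad X) \<cdot> exp (ad X) \<cdot> v = exp (ad Y) \<cdot> Ad G c (exp (ad X) \<cdot> v)" by (rule X1)
  thus "exp (ad (2 *\<^sub>R X)) \<cdot> v = exp (ad (2 *\<^sub>R Y)) \<cdot> v"
   unfolding dbl app_mult X2[of v] using K_carrier[OF c] by simp
 qed
 hence "2 *\<^sub>R X = 2 *\<^sub>R Y" by (rule exp_ad_p_inj[rotated 2]) (simp_all add: X Y subspace_scale subspace_p)
 thus ?thesis by simp
qed

lemma A_mult: "x \<in> A ==> y \<in> A ==> x \<otimes> y \<in> A"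
 unfolding A_def by (elim imageE) (simp add: lie_exp_commuting_add[OF br_aa, symmetric] subspace_add[OF subspace_a])

lemma A_inv: "x \<in> A ==> inv x \<in> A"
 unfolding A_def using inv_lie_exp subspace_neg[OF subspace_a] by auto

lemma A_carrier: "x \<in> A ==> x \<in> carrier G"
 by (auto simp: A_def)

lemma one_A: "\<one> \<in> A"
 unfolding A_def by (rule image_eqI[of _ _ 0]) (simp_all add: subspace_0[OF subspace_a])

lemma A_par:
 assumes x: "x \<in> A"
 shows "x <# par = par"
proof -
 have sub: "y \<otimes> q \<in> par" if y: "y \<in> A" and q: "q \<in> par" for y q
 proof -
  obtain m z n where q': "m \<in> M" "z \<in> A" "n \<in> grp_N G a \<Phi>" "q = m \<otimes> z \<otimes> n" using q by (auto simp: par_def set_mult_def)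
  have nc: "n \<in> carrier G" using q'(3) by (auto simp: grp_N_def)
  have "m \<otimes> y = y \<otimes> m" using q'(1) y by (simp add: grp_M_def)
  hence "y \<otimes> q = m \<otimes> (y \<otimes> z) \<otimes> n"
   using q' nc M_carrier[OF q'(1)] A_carrier[OF y] A_carrier[OF q'(2)] by (simp add: m_assoc[symmetric])
  thus ?thesis using q' A_mult[OF y q'(2)] unfolding par_def set_mult_def by blast
 qed
 show ?thesis
 proof
  show "x <# par \<subseteq> par" using sub[OF x] by (auto simp: l_coset_def)
  show "par \<subseteq> x <# par"
  proof
   fix q assume q: "q \<in> par"
   have "q = x \<otimes> (inv x \<otimes> q)" using A_carrier[OF x] par_carrier[OF q] by (simp add: m_assoc[symmetric])
   thus "q \<in> x <# par" using sub[OF A_inv[OF x] q] unfolding l_coset_def by blast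
  qed
 qed
qed

lemma (in group) subgroup_translate: "subgroup H G ==> x \<in> H ==> (%h. x \<otimes> h) ` H = H"
 using coset_join3[OF subgroup.mem_carrier] by (force simp: l_coset_def)

lemma subgroup_A: "subgroup A G"
 by (rule subgroupI) (use A_carrier one_A A_inv A_mult in auto)

lemma one_T: "\<one> \<in> T"
 using subgroup.one_closed[OF subgroup_K] by (intro M_T) (simp add: M_iff Ad_one)

lemma subgroup_T: "subgroup T G"
 by (rule subgroupI) (use T_carrier one_T T_inv T_mult in auto)

lemma K_coset:
 assumes "c \<in> K" "g \<in> carrier G"
 shows "(g \<otimes> c) <# K = g <# K"
 using lcos_m_assoc[OF subgroup.subset[OF subgroup_K] assms(2) K_carrier] coset_join3[OF K_carrier subgroup_K] assms(1) by metis

lemma K_coset_mult: "g \<in> carrier G ==> h \<in> carrier G ==> g <# (h <# K) = (g \<otimes> h) <# K"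
 by (rule lcos_m_assoc) (auto simp: K_carrier)

lemma K_cosetD:
 assumes "h \<in> carrier G" "h' \<in> carrier G" "h <# K = h' <# K"
 obtains c where "c \<in> K" "h' = h \<otimes> c"
proof -
 have "h' \<otimes> \<one> \<in> h' <# K" unfolding l_coset_def using subgroup.one_closed[OF subgroup_K] by blast
 thus thesis using that assms unfolding assms(3)[symmetric] l_coset_def by auto
qed

text \<open>An element fixing \<open>H0\<close> commutes with the flow of \<open>H0\<close>, yet
  conjugation by this flow in the negative direction moves the exponential of n arbitrarily close to
  the identity. Being constant under it, the element is the identity, as the topology is
  Hausdorff.\<close>

lemma grp_N_fix_H0:
 assumes n: "n \<in> \<nn>" and fx: "exp (ad n) \<cdot> H0 = H0"
 shows "lie_exp G n = \<one>"
proof (rule ccontr)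
 assume ne: "lie_exp G n ~= \<one>"
 have "Hausdorff_space (topo G)" using is_lie_group by (simp add: is_lie_group_def)
 then obtain U V where U: "openin (topo G) U" "openin (topo G) V" "\<one> \<in> U" "lie_exp G n \<in> V" "disjnt U V"
  unfolding Hausdorff_space_def using ne by (metis lie_exp_carrier one_closed topspace_eq)
 obtain r where r: "r > 0" "!!X. norm X < r ==> lie_exp G X \<in> U" by (rule lie_exp_near[OF U(1,3)]) (rule that; assumption?)
 let ?f = "%y t. exp (- t *\<^sub>R ad H0) \<cdot> y"
 have "n \<in> eig H0 {0<..}"
  by (rule W_induct[OF n[unfolded nilpart_def] subspace_eig]) (rule eigI[OF rsD[OF _ H0(1)]], auto simp: Phi_iff)
 from tendstoD[OF eig_contracted[OF this] r(1)] obtain t where t: "norm (?f n t) < r"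
  using eventually_happens'[OF trivial_limit_at_top_linorder] by (metis (mono_tags, lifting) dist_0_norm dist_commute)
 let ?h = "lie_exp G (- t *\<^sub>R H0)"
 have "Ad G (lie_exp G n) (- t *\<^sub>R H0) = - t *\<^sub>R H0"
  unfolding Ad_lie_exp linear_cmul[OF linear_app] fx ..
 hence "lie_exp G n \<otimes> ?h \<otimes> inv (lie_exp G n) = ?h" by (simp only: lie_exp_conj lie_exp_carrier)
 hence "lie_exp G n \<otimes> ?h = ?h \<otimes> lie_exp G n" by (rule conj_fixed_commute[rotated 2]) simp_all
 hence "?h \<otimes> lie_exp G n \<otimes> inv ?h = lie_exp G n" by (metis inv_solve_right' lie_exp_carrier m_closed)
 moreover have "?h \<otimes> lie_exp G n \<otimes> inv ?h = lie_exp G (?f n t)"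
  by (simp add: lie_exp_conj Ad_lie_exp ad_simps)
 ultimately have "lie_exp G n \<in> U" using r(2)[OF t] by simp
 thus False using U(4,5) by (auto simp: disjnt_def)
qed

text \<open>The factors from M and A fix \<open>H0\<close>, so the unipotent factor fixes it too and
  is trivial. Two elements giving the same opposite pair therefore differ by an element of MA, which
  preserves the base flat.\<close>

lemma par_fix_H0:
 assumes q: "q \<in> par" and fx: "Ad G q H0 = H0"
 obtains m x where "m \<in> M" "x \<in> A" "q = m \<otimes> x"
proof -
 obtain m H n where q': "m \<in> M" "H \<in> a" "n \<in> \<nn>" "q = m \<otimes> lie_exp G H \<otimes> lie_exp G n" by (rule parE[OF q])
 let ?b = "m \<otimes> lie_exp G H"
 have bc: "?b \<in> carrier G" using M_carrier[OF q'(1)] by simp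
 have "Ad G ?b H0 = H0" using q'(1) exp_fix[OF br_aa[OF q'(2) H0(1)]] H0(1) by (simp add: Ad_mult M_carrier Ad_lie_exp M_iff)
 hence "exp (ad n) \<cdot> H0 = Ad G (inv ?b) (Ad G q H0)" unfolding q'(4) using bc by (simp add: Ad_mult Ad_lie_exp del: m_assoc)
 also have "\<dots> = H0" using Ad_inv_cancel(1)[OF bc, of H0] \<open>Ad G ?b H0 = H0\<close> fx by simp
 finally have "lie_exp G n = \<one>" by (rule grp_N_fix_H0[OF q'(3)])
 hence "q = ?b" using q'(4) bc by simp
 thus thesis using that[OF q'(1), of "lie_exp G H"] q'(2) by (simp add: A_def)
qed

lemma act_base_flat:
 assumes "g \<in> carrier G"
 shows "act_set G g (base_flat G K A) = (%x. (g \<otimes> x) <# K) ` A"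
 unfolding act_set_def base_flat_def Setcompr_eq_image image_image
 by (rule image_cong) (simp_all add: K_coset_mult assms A_carrier)

lemma act_base_flat_boundary:
 assumes "g \<in> carrier G"
 shows "act_set G g (base_flat_boundary G K par A) = (%t. (g \<otimes> t) <# par) ` T"
 unfolding act_set_def base_flat_boundary_def Setcompr_eq_image image_image
 by (rule image_cong) (simp_all add: par_coset_mult assms T_carrier)

lemma act_base_flat_fix:
 assumes g: "g \<in> carrier G" and m: "m \<in> M" and x: "x \<in> A"
 shows "act_set G (g \<otimes> (m \<otimes> x)) (base_flat G K A) = act_set G g (base_flat G K A)"
proof -
 have mc: "m \<in> carrier G" and xc: "x \<in> carrier G" and mK: "m \<in> K" using m x M_carrier A_carrier by (auto simp: M_iff)
 have eq: "(g \<otimes> (m \<otimes> x) \<otimes> y) <# K = (g \<otimes> (x \<otimes> y)) <# K" if y: "y \<in> A" for y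
 proof -
  have "m \<otimes> (x \<otimes> y) = (x \<otimes> y) \<otimes> m" using m A_mult[OF x y] by (simp add: grp_M_def)
  hence "g \<otimes> (m \<otimes> x) \<otimes> y = (g \<otimes> (x \<otimes> y)) \<otimes> m" using g mc xc A_carrier[OF y] by (simp add: m_assoc)
  thus ?thesis using K_coset[OF mK, of "g \<otimes> (x \<otimes> y)"] g xc A_carrier[OF y] by simp
 qed
 have "(%y. (g \<otimes> y) <# K) ` A = (%y. (g \<otimes> (x \<otimes> y)) <# K) ` A"
  using image_image[of "%y. (g \<otimes> y) <# K" "%y. x \<otimes> y" A] unfolding subgroup_translate[OF subgroup_A x] .
 thus ?thesis using g mc xc eq by (simp add: act_base_flat)
qed

text \<open>The image of the base point splits off x from A. The rest c lies in K and preserves the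
  flat, so for H in \<open>a\<close> the exponential of \<open>Ad G c H\<close> is one from
  \<open>a\<close> times an element of K; uniqueness of the polar part gives \<open>Ad G c H\<close>
  in \<open>a\<close>.\<close>

lemma flat_stabilizer:
 assumes h: "h \<in> carrier G" and eq: "act_set G h (base_flat G K A) = base_flat G K A"
 obtains x c where "x \<in> A" "c \<in> T" "h = x \<otimes> c"
proof -
 have mem: "\<exists>z\<in>A. (h \<otimes> y) <# K = z <# K" if "y \<in> A" for y
 proof -
  have "(h \<otimes> y) <# K \<in> act_set G h (base_flat G K A)" unfolding act_base_flat[OF h] using that by (rule imageI)
  thus ?thesis unfolding eq unfolding base_flat_def by blast
 qed
 obtain x where x: "x \<in> A" "(h \<otimes> \<one>) <# K = x <# K" using mem[OF one_A] by blast
 obtain c where c: "c \<in> K" "h = x \<otimes> c" using K_cosetD[OF A_carrier[OF x(1)] h] x(2) h by (metis r_one)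
 have xc: "x \<in> carrier G" and kc: "c \<in> carrier G" using A_carrier[OF x(1)] K_carrier[OF c(1)] by auto
 have sub: "Ad G c H \<in> a" if H: "H \<in> a" for H
 proof -
  let ?y = "lie_exp G H"
  have y: "?y \<in> A" using H by (simp add: A_def)
  obtain z where z: "z \<in> A" "(h \<otimes> ?y) <# K = z <# K" using mem[OF y] by blast
  obtain c' where k': "c' \<in> K" "h \<otimes> ?y = z \<otimes> c'"
   using K_cosetD[OF A_carrier[OF z(1)] _ z(2)[symmetric]] h A_carrier[OF y] by (metis m_closed)
  have zc: "z \<in> carrier G" and kc': "c' \<in> carrier G" using A_carrier[OF z(1)] K_carrier[OF k'(1)] by auto
  obtain H' where H': "H' \<in> a" "inv x \<otimes> z = lie_exp G H'"
   using A_mult[OF A_inv[OF x(1)] z(1)] unfolding A_def by blast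
  have "c \<otimes> ?y = inv x \<otimes> (h \<otimes> ?y)" unfolding c(2) using xc kc by (simp add: m_assoc[symmetric])
  also have "\<dots> = lie_exp G H' \<otimes> c'" unfolding k'(2) H'(2)[symmetric] using xc zc kc' by (simp add: m_assoc)
  finally have "c \<otimes> ?y \<otimes> inv c = lie_exp G H' \<otimes> (c' \<otimes> inv c)" using kc kc' by (simp add: m_assoc)
  hence "lie_exp G (Ad G c H) = lie_exp G H' \<otimes> (c' \<otimes> inv c)" by (simp add: lie_exp_conj[OF kc])
  hence "Ad G c H = H'"
   by (rule polar_unique[rotated 3])
    (simp_all add: Ad_K_p c(1) a_p H H'(1) subgroup.m_closed[OF subgroup_K] subgroup.m_inv_closed[OF subgroup_K] k'(1))
  thus ?thesis using H'(1) by simp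
 qed
 have "Ad G c ` a = a"
 proof (rule subspace_dim_equal)
  show "subspace (Ad G c ` a)" by (rule linear_subspace_image[OF linear_Ad[OF kc] subspace_a])
  have "inj_on (Ad G c) (span a)" by (rule inj_on_inverseI[of _ "Ad G (inv c)"]) (simp add: kc)
  thus "dim a <= dim (Ad G c ` a)" using dim_image_eq[OF linear_Ad[OF kc]] by (metis order_refl)
 qed (use sub subspace_a in auto)
 hence "c \<in> T" using c(1) by (simp add: T_iff)
 thus thesis using that x(1) c(2) by blast
qed

text \<open>The description by \<open>THE\<close> is unambiguous: two elements giving the same flat
  differ by x from A and c from T. Right translation by c permutes T, and x, moved past an element
  of T, is again in A and fixes the base point.\<close>

lemma flat_boundary_act:
 assumes g: "g \<in> carrier G"
 shows "flat_boundary G K par A (act_set G g (base_flat G K A)) = (%t. (g \<otimes> t) <# par) ` T"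
 unfolding flat_boundary_def
proof (rule the_equality)
 show "\<exists>g'\<in>carrier G. act_set G g (base_flat G K A) = act_set G g' (base_flat G K A) \<and>
   (%t. (g \<otimes> t) <# par) ` T = act_set G g' (base_flat_boundary G K par A)"
  using g act_base_flat_boundary by auto
next
 fix B assume "\<exists>g'\<in>carrier G. act_set G g (base_flat G K A) = act_set G g' (base_flat G K A) \<and>
   B = act_set G g' (base_flat_boundary G K par A)"
 then obtain g' where g': "g' \<in> carrier G" "act_set G g (base_flat G K A) = act_set G g' (base_flat G K A)"
  "B = (%t. (g' \<otimes> t) <# par) ` T"
  using act_base_flat_boundary by auto
 let ?h = "inv g \<otimes> g'"
 have h: "?h \<in> carrier G" and gh: "g' = g \<otimes> ?h" using g g'(1) by (simp_all add: m_assoc[symmetric])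
 have act: "act_set G u (act_set G v (base_flat G K A)) = act_set G (u \<otimes> v) (base_flat G K A)"
  if "u \<in> carrier G" "v \<in> carrier G" for u v
  unfolding act_base_flat[OF that(2)] act_base_flat[OF m_closed[OF that]] unfolding act_set_def image_image
  by (rule image_cong) (simp_all add: that K_coset_mult A_carrier m_assoc)
 have "act_set G ?h (base_flat G K A) = act_set G (inv g) (act_set G g (base_flat G K A))"
  using act[of "inv g" g'] g g' by simp
 also have "\<dots> = act_set G \<one> (base_flat G K A)" using act[of "inv g" g] g by simp
 also have "\<dots> = base_flat G K A" unfolding act_base_flat[OF one_closed] unfolding base_flat_def by (force simp: A_carrier)
 finally obtain x c where x: "x \<in> A" "c \<in> T" "?h = x \<otimes> c" by (rule flat_stabilizer[OF h])
 have xc: "x \<in> carrier G" and kc: "c \<in> carrier G" using A_carrier[OF x(1)] T_carrier[OF x(2)] by auto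
 have eq: "(g' \<otimes> t) <# par = (g \<otimes> (c \<otimes> t)) <# par" if t: "t \<in> T" for t
 proof -
  let ?s = "c \<otimes> t"
  have s: "?s \<in> T" by (rule T_mult[OF x(2) t])
  have sc: "?s \<in> carrier G" and tc: "t \<in> carrier G" using T_carrier[OF s] T_carrier[OF t] by auto
  obtain H where H: "H \<in> a" "x = lie_exp G H" using x(1) by (auto simp: A_def)
  let ?y = "inv ?s \<otimes> x \<otimes> ?s"
  have "?y = lie_exp G (Ad G (inv ?s) H)" using lie_exp_conj[of "inv ?s" H] sc unfolding H(2) by simp
  hence y: "?y \<in> A" using T_a[OF T_inv[OF s] H(1)] by (simp add: A_def)
  have "g' \<otimes> t = g \<otimes> ?h \<otimes> t" using gh by simp
  also have "\<dots> = g \<otimes> (x \<otimes> ?s)" unfolding x(3) using g xc kc tc by (simp add: m_assoc)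
  also have "x \<otimes> ?s = ?s \<otimes> ?y" using xc sc by (simp add: m_assoc[symmetric])
  also have "g \<otimes> (?s \<otimes> ?y) = (g \<otimes> ?s) \<otimes> ?y" using g sc xc by (simp only: m_assoc m_closed inv_closed)
  finally have "(g' \<otimes> t) <# par = (g \<otimes> ?s) <# (?y <# par)"
   using par_coset_mult[of "g \<otimes> ?s" ?y] g sc A_carrier[OF y] by simp
  thus ?thesis unfolding A_par[OF y] .
 qed
 have "(%t. (g \<otimes> t) <# par) ` T = (%t. (g \<otimes> (c \<otimes> t)) <# par) ` T"
  using image_image[of "%t. (g \<otimes> t) <# par" "%t. c \<otimes> t" T] unfolding subgroup_translate[OF subgroup_T x(2)] .
 thus "B = (%t. (g \<otimes> t) <# par) ` T" unfolding g'(3) using eq by simp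
qed

end

section \<open>The vector attached to an opposite pair\<close>

context lie_longest
begin

lemma w0_nn:
 assumes n: "n \<in> \<nn>" "n' \<in> \<nn>" "n = Ad G w0 n'"
 shows "n = 0"
proof -
 have "Ad G w0 n' \<in> W (%\<alpha>. \<alpha> \<notin> \<Phi>)"
 proof (rule Ad_W[OF w0(1) n(2)[unfolded nilpart_def]])
  fix \<alpha> assume \<alpha>: "\<alpha> \<in> wts" "\<alpha> \<in> \<Phi>"
  show "tw w0 \<alpha> \<notin> \<Phi>"
  proof
   assume "tw w0 \<alpha> \<in> \<Phi>"
   from w0(2)[OF this] have "wneg \<alpha> \<in> \<Phi>" using tw_inv(1)[OF w0(1) wts_ext[OF \<alpha>(1)]] by simp
   thus False using neg_Phi_iff[OF Phi_R] \<alpha>(2) by blast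
  qed
 qed
 from W_orth[OF n(1)[unfolded nilpart_def] this[folded n(3)]] show ?thesis by simp
qed

lemma opposite_transverse:
 assumes g: "g \<in> carrier G" "h \<in> carrier G" "h' \<in> carrier G" "g <# par = h <# par" "(g \<otimes> w0) <# par = h' <# par"
  and n: "n \<in> \<nn>" "n' \<in> \<nn>" "Ad G h n = Ad G h' n'"
 shows "n = 0 \<and> n' = 0"
proof -
 have gw: "g \<otimes> w0 \<in> carrier G" using g(1) by simp
 obtain q where q: "q \<in> par" "h = g \<otimes> q" by (rule par_cosetD[OF g(1,2,4)])
 obtain q' where q': "q' \<in> par" "h' = g \<otimes> w0 \<otimes> q'" by (rule par_cosetD[OF gw g(3,5)])
 note qc = par_carrier[OF q(1)] par_carrier[OF q'(1)]
 have "Ad G g (Ad G q n) = Ad G g (Ad G w0 (Ad G q' n'))"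
  using n(3) unfolding q(2) q'(2) using g(1) qc by (simp add: Ad_mult)
 hence "Ad G q n = Ad G w0 (Ad G q' n')" using Ad_inv_cancel(1)[OF g(1)] by metis
 hence "Ad G q n = 0" by (rule w0_nn[OF par_Ad_nn[OF q(1) n(1)] par_Ad_nn[OF q'(1) n(2)]])
 hence "n = 0" using Ad_inv_cancel(1)[OF qc(1), of n] linear_0[OF linear_Ad[OF inv_closed[OF qc(1)]]] by simp
 moreover have "n' = 0" if "n = 0"
  using Ad_inv_cancel(1)[OF g(3), of n'] n(3) that linear_0[OF linear_Ad[OF g(2)]] linear_0[OF linear_Ad[OF inv_closed[OF g(3)]]] by simp
 ultimately show ?thesis by simp
qed

text \<open>\<open>Ad\<close> of \<open>par\<close> moves an element of \<open>a\<close> only by the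
  nilradical. So for any representatives h and h' the vector lies in two affine spaces, one
  determined by h and one by h'; this decoupling makes continuity accessible.\<close>

lemma opposite_affine:
 assumes g: "g \<in> carrier G" "h \<in> carrier G" "h' \<in> carrier G" "g <# par = h <# par" "(g \<otimes> w0) <# par = h' <# par"
 obtains n n' where "n \<in> \<nn>" "n' \<in> \<nn>" "Ad G g H0 = Ad G h (H0 + n)" "Ad G g H0 = Ad G h' (Ad G (inv w0) H0 + n')"
proof -
 have gw: "g \<otimes> w0 \<in> carrier G" using g(1) by simp
 obtain q where q: "q \<in> par" "g = h \<otimes> q" by (rule par_cosetD[OF g(2,1) g(4)[symmetric]])
 obtain q' where q': "q' \<in> par" "g \<otimes> w0 = h' \<otimes> q'" by (rule par_cosetD[OF g(3) gw g(5)[symmetric]])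
 note qc = par_carrier[OF q(1)] par_carrier[OF q'(1)]
 note z = subspace_0[OF subspace_mm] subspace_0[OF subspace_nn]
 obtain Z n where n: "n \<in> \<nn>" "Ad G q (H0 + 0 + 0) = H0 + Z + n" "(0::'e) = 0 ==> Z = 0"
  by (rule par_Ad[OF q(1) H0(1) z]) (rule that; assumption?)
 obtain Z' n' where n': "n' \<in> \<nn>" "Ad G q' (Ad G (inv w0) H0 + 0 + 0) = Ad G (inv w0) H0 + Z' + n'" "(0::'e) = 0 ==> Z' = 0"
  by (rule par_Ad[OF q'(1) T_a[OF T_inv[OF w0(1)] H0(1)] z]) (rule that; assumption?)
 have "Ad G g H0 = Ad G (g \<otimes> w0) (Ad G (inv w0) H0)" using g(1) by (simp add: Ad_mult)
 hence "Ad G g H0 = Ad G h' (Ad G (inv w0) H0 + n')" unfolding q'(2) using n'(2,3) g(3) qc by (simp add: Ad_mult)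
 moreover have "Ad G g H0 = Ad G h (H0 + n)" unfolding q(2) using n(2,3) g(2) qc by (simp add: Ad_mult)
 ultimately show thesis using that n(1) n'(1) by blast
qed

lemma opposite_vector_unique:
 assumes g: "g \<in> carrier G" "g' \<in> carrier G" "g <# par = g' <# par" "(g \<otimes> w0) <# par = (g' \<otimes> w0) <# par"
 shows "Ad G g H0 = Ad G g' H0"
proof -
 have gw: "g' \<otimes> w0 \<in> carrier G" using g(2) by simp
 obtain n n' where n: "n \<in> \<nn>" "n' \<in> \<nn>" "Ad G g H0 = Ad G g' (H0 + n)" "Ad G g H0 = Ad G (g' \<otimes> w0) (Ad G (inv w0) H0 + n')"
  by (rule opposite_affine[OF g(1,2) gw g(3,4)])
 have "Ad G (g' \<otimes> w0) (Ad G (inv w0) H0 + n') = Ad G g' (H0 + Ad G w0 n')"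
  using g(2) by (simp add: Ad_mult linear_add[OF linear_Ad[OF w0_carrier]])
 hence "H0 + n = H0 + Ad G w0 n'" using n(3,4) Ad_inv_cancel(1)[OF g(2)] by metis
 hence "n = Ad G w0 n'" by simp
 hence "n = 0" by (rule w0_nn[OF n(1,2)])
 thus ?thesis using n(3) by simp
qed

definition opp_vec :: "'g set => 'g set => 'e" where
 "opp_vec x y = Ad G (SOME g. g \<in> carrier G \<and> x = g <# par \<and> y = g <# (w0 <# par)) H0"

lemma opp_vec:
 assumes g: "g \<in> carrier G"
 shows "opp_vec (g <# par) (g <# (w0 <# par)) = Ad G g H0"
proof -
 let ?P = "%g'. g' \<in> carrier G \<and> g <# par = g' <# par \<and> g <# (w0 <# par) = g' <# (w0 <# par)"
 have "?P (SOME g'. ?P g')" by (rule someI[of ?P g]) (simp add: g)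
 hence P: "(SOME g'. ?P g') \<in> carrier G" "(SOME g'. ?P g') <# par = g <# par" "(SOME g'. ?P g') <# (w0 <# par) = g <# (w0 <# par)"
  by auto
 show ?thesis unfolding opp_vec_def
  by (rule opposite_vector_unique[OF P(1) g P(2)]) (use P(1,3) g in \<open>simp add: par_coset_mult\<close>)
qed

lemma opposite_obtains:
 assumes "opposite G par w0 x y"
 obtains g where "g \<in> carrier G" "x = g <# par" "y = g <# (w0 <# par)" "opp_vec x y = Ad G g H0"
 using assms opp_vec unfolding opposite_def by blast

lemma opposite_act:
 assumes h: "h \<in> carrier G" and o: "opposite G par w0 x y"
 shows "opposite G par w0 (h <# x) (h <# y)" "opp_vec (h <# x) (h <# y) = Ad G h (opp_vec x y)"
proof -
 obtain g where g: "g \<in> carrier G" "x = g <# par" "y = g <# (w0 <# par)" "opp_vec x y = Ad G g H0"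
  by (rule opposite_obtains[OF o])
 have eq: "h <# x = (h \<otimes> g) <# par" "h <# y = (h \<otimes> g) <# (w0 <# par)"
  unfolding g(2,3) using h g(1) by (simp_all add: par_coset_mult m_assoc)
 have hg: "h \<otimes> g \<in> carrier G" using h g(1) by simp
 show "opposite G par w0 (h <# x) (h <# y)" unfolding eq opposite_def using hg by blast
 show "opp_vec (h <# x) (h <# y) = Ad G h (opp_vec x y)" unfolding eq opp_vec[OF hg] g(4) using h g(1) by (simp add: Ad_mult)
qed

lemma opp_vec_continuous:
 assumes h: "h \<in> carrier G" "h' \<in> carrier G" "opposite G par w0 (h <# par) (h' <# par)" and e: "\<epsilon> > 0"
 obtains d where "d > 0" "!!v v'. v \<in> carrier G ==> v' \<in> carrier G ==> norm (AdE v - AdE h) < d ==> norm (AdE v' - AdE h') < d ==>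
  opposite G par w0 (v <# par) (v' <# par) ==> norm (opp_vec (v <# par) (v' <# par) - opp_vec (h <# par) (h' <# par)) < \<epsilon>"
proof -
 obtain g where g: "g \<in> carrier G" "h <# par = g <# par" "h' <# par = g <# (w0 <# par)" "opp_vec (h <# par) (h' <# par) = Ad G g H0"
  by (rule opposite_obtains[OF h(3)])
 note g3 = g(3)[unfolded par_coset_mult[OF g(1) w0_carrier]]
 obtain n n' where n: "n \<in> \<nn>" "n' \<in> \<nn>" "Ad G g H0 = Ad G h (H0 + n)" "Ad G g H0 = Ad G h' (Ad G (inv w0) H0 + n')"
  by (rule opposite_affine[OF g(1) h(1,2) g(2)[symmetric] g3[symmetric]])
 have tr: "AdE h \<cdot> n = AdE h' \<cdot> n' ==> n = 0 \<and> n' = 0" if "n \<in> \<nn>" "n' \<in> \<nn>" for n n'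
  using opposite_transverse[OF g(1) h(1,2) g(2)[symmetric] g3[symmetric] that] h by simp
 have eqh: "AdE h \<cdot> (H0 + n) = AdE h' \<cdot> (Ad G (inv w0) H0 + n')" using n(3,4) h by simp
 obtain d where d: "d > 0" "!!T T' v v'. norm (T - AdE h) < d ==> norm (T' - AdE h') < d ==> v \<in> \<nn> ==> v' \<in> \<nn> ==>
   T \<cdot> (H0 + v) = T' \<cdot> (Ad G (inv w0) H0 + v') ==> norm (T \<cdot> (H0 + v) - AdE h \<cdot> (H0 + n)) < \<epsilon>"
  by (rule affine_intersection_continuous[OF subspace_nn tr n(1,2) eqh e]) (assumption | rule that)+
 show thesis
 proof (rule that[OF d(1)])
  fix v v' assume v: "v \<in> carrier G" "v' \<in> carrier G" "norm (AdE v - AdE h) < d" "norm (AdE v' - AdE h') < d"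
   and o: "opposite G par w0 (v <# par) (v' <# par)"
  obtain f where f: "f \<in> carrier G" "v <# par = f <# par" "v' <# par = f <# (w0 <# par)" "opp_vec (v <# par) (v' <# par) = Ad G f H0"
   by (rule opposite_obtains[OF o])
  note f3 = f(3)[unfolded par_coset_mult[OF f(1) w0_carrier]]
  obtain m m' where m: "m \<in> \<nn>" "m' \<in> \<nn>" "Ad G f H0 = Ad G v (H0 + m)" "Ad G f H0 = Ad G v' (Ad G (inv w0) H0 + m')"
   by (rule opposite_affine[OF f(1) v(1,2) f(2)[symmetric] f3[symmetric]])
  have "AdE v \<cdot> (H0 + m) = AdE v' \<cdot> (Ad G (inv w0) H0 + m')" using m(3,4) v by simp
  from d(2)[OF v(3,4) m(1,2) this]
  show "norm (opp_vec (v <# par) (v' <# par) - opp_vec (h <# par) (h' <# par)) < \<epsilon>"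
   unfolding f(4) g(4) using m(3) n(3) v(1) h(1) by simp
 qed
qed

text \<open>Both definite descriptions are resolved here. Elements representing the same pair have
  the same vector, so they differ by an element of \<open>par\<close> fixing \<open>H0\<close>, and
  such an element leaves the flat unchanged.\<close>

lemma flat_boundary_through:
 assumes g: "g \<in> carrier G"
 shows "flat_boundary G K par A (flat_through G K par A w0 (g <# par) (g <# (w0 <# par))) = (%t. (g \<otimes> t) <# par) ` T"
proof -
 have "flat_through G K par A w0 (g <# par) (g <# (w0 <# par)) = act_set G g (base_flat G K A)"
  unfolding flat_through_def
 proof (rule the_equality)
  fix F assume "\<exists>g'\<in>carrier G. g <# par = g' <# par \<and> g <# (w0 <# par) = g' <# (w0 <# par) \<and> F = act_set G g' (base_flat G K A)"
  then obtain g' where g': "g' \<in> carrier G" "g <# par = g' <# par" "g <# (w0 <# par) = g' <# (w0 <# par)" "F = act_set G g' (base_flat G K A)"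
   by blast
  obtain q where q: "q \<in> par" "g' = g \<otimes> q" by (rule par_cosetD[OF g g'(1,2)])
  have "Ad G g H0 = Ad G g' H0"
   by (rule opposite_vector_unique[OF g g'(1,2)]) (use g g'(1,3) in \<open>simp add: par_coset_mult\<close>)
  also have "\<dots> = Ad G g (Ad G q H0)" unfolding q(2) using g par_carrier[OF q(1)] by (simp add: Ad_mult)
  finally have "Ad G q H0 = H0" using Ad_inv_cancel(1)[OF g] by metis
  then obtain m x where "m \<in> M" "x \<in> A" "q = m \<otimes> x" by (rule par_fix_H0[OF q(1)])
  thus "F = act_set G g (base_flat G K A)" unfolding g'(4) q(2) using act_base_flat_fix[OF g] by blast
 qed (use g in blast)
 thus ?thesis using flat_boundary_act[OF g] by simp
qed

text \<open>The obstruction to a proper energy: along the geodesic of X none of the vectors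
  grows.\<close>

definition spread :: "'e => nat => (nat => 'g set) => bool" where
 "spread X q x \<longleftrightarrow> (\<forall>i<q. \<forall>j<q. i ~= j --> opposite G par w0 (x i) (x j) \<and> opp_vec (x i) (x j) \<in> eig X {0..})"

lemma spread_oppair: "spread X q x ==> i < q ==> j < q ==> i ~= j ==> oppair X (x i) (x j)"
 unfolding spread_def oppair_def by (metis opposite_obtains)

lemma spread_oppflat:
 assumes s: "spread X q x" and ij: "i < q" "j < q" "i ~= j" and gen: "(x i, x j, z) \<in> generic_triples G K par A w0"
 shows "oppflat X (x i) (x j) z"
proof -
 have o: "opposite G par w0 (x i) (x j)" and v: "opp_vec (x i) (x j) \<in> eig X {0..}" using s ij unfolding spread_def by blast+
 obtain g where g: "g \<in> carrier G" "x i = g <# par" "x j = g <# (w0 <# par)" "opp_vec (x i) (x j) = Ad G g H0"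
  by (rule opposite_obtains[OF o])
 have "\<forall>u\<in>flat_boundary G K par A (flat_through G K par A w0 (x i) (x j)). opposite G par w0 z u"
  using gen unfolding generic_triples_def by blast
 hence "\<forall>t\<in>T. opposite G par w0 z ((g \<otimes> t) <# par)" unfolding g(2,3) flat_boundary_through[OF g(1)] by blast
 thus ?thesis unfolding oppflat_def using g v by auto
qed

lemma spread_minus_one:
 assumes X: "X \<in> p" and neg: "!!H. H \<in> a ==> Ad G w0 H = - H" and q: "q \<ge> 3" and s: "spread X q x"
 shows "X = 0"
 by (rule stable_minus_one[OF X neg spread_oppair[OF s, of 0 1] spread_oppair[OF s, of 1 2] spread_oppair[OF s, of 2 0]])
  (use q in auto)

lemma spread_generic:
 assumes X: "X \<in> p" and q: "q \<ge> 3" and s: "spread X q x" and x: "x \<in> generic_tuples G K par A w0 q"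
 shows "X = 0"
proof -
 have gen: "(x 1, x 2, x 0) \<in> generic_triples G K par A w0" "(x 2, x 0, x 1) \<in> generic_triples G K par A w0"
  using x q unfolding generic_tuples_def by auto
 show ?thesis
  by (rule stable_generic[OF X spread_oppair[OF s, of 0 1] spread_oppflat[OF s _ _ _ gen(1)] spread_oppflat[OF s _ _ _ gen(2)]])
   (use q in auto)
qed

end

section \<open>The energy along geodesics\<close>

context cartan_algebra
begin

text \<open>The argument is an endomorphism, so that \<open>AdE\<close> of a group element and an
  exponential can both be inserted and K-invariance is a statement about left
  multiplication.\<close>

definition energy :: "'i set => ('i => 'e) => 'e endo => real" where
 "energy I v S = (\<Sum>c\<in>I. Q (S \<cdot> v c) (S \<cdot> v c))"

abbreviation penergy :: "'i set => ('i => 'e) => 'e => real" where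
 "penergy I v X \<equiv> energy I v (exp (ad (- X)))"

definition stable :: "'i set => ('i => 'e) => bool" where
 "stable I v \<longleftrightarrow> (\<forall>X\<in>p. (\<forall>c\<in>I. v c \<in> eig X {0..}) --> X = 0)"

text \<open>Because \<open>ad X\<close> is symmetric for \<open>Q\<close>, the second derivative is
  four times a sum of square lengths.\<close>

lemma convex_energy_ray:
 assumes X: "X \<in> p"
 shows "convex_on UNIV (%t. penergy I v (t *\<^sub>R X))"
proof -
 define S where "S = ad (- X)"
 have sym: "Q (S \<cdot> x) y = Q x (S \<cdot> y)" for x y
  unfolding S_def ad_app by (rule Q_br_p[OF subspace_neg[OF subspace_p X]])
 let ?y = "%c t. exp (t *\<^sub>R S) \<cdot> v c"
 have d: "(?y c has_vector_derivative S \<cdot> ?y c t) (at t)" for c t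
  using bounded_linear.has_vector_derivative[OF bounded_bilinear.bounded_linear_left[OF bounded_bilinear_app] exp_scaleR_has_vector_derivative_left]
  by simp
 have dS: "((%t. S \<cdot> ?y c t) has_vector_derivative S \<cdot> S \<cdot> ?y c t) (at t)" for c t
  by (rule bounded_linear.has_vector_derivative[OF bounded_bilinear.bounded_linear_right[OF bounded_bilinear_app] d])
 have eq: "penergy I v (t *\<^sub>R X) = (\<Sum>c\<in>I. Q (?y c t) (?y c t))" for t
  by (simp add: energy_def S_def ad_simps)
 have d1: "((%t. Q (?y c t) (?y c t)) has_vector_derivative 2 * Q (S \<cdot> ?y c t) (?y c t)) (at t)" for c t
  using bounded_bilinear.has_vector_derivative[OF bounded_bilinear_Q d d] by (simp add: sym)
 have d2: "((%t. 2 * Q (S \<cdot> ?y c t) (?y c t)) has_vector_derivative 4 * Q (S \<cdot> ?y c t) (S \<cdot> ?y c t)) (at t)" for c t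
  using has_vector_derivative_mult_right[OF bounded_bilinear.has_vector_derivative[OF bounded_bilinear_Q dS d], of 2] by (simp add: sym)
 show ?thesis unfolding eq
 proof (rule f''_ge0_imp_convex)
  show "((%t. \<Sum>c\<in>I. Q (?y c t) (?y c t)) has_real_derivative (\<Sum>c\<in>I. 2 * Q (S \<cdot> ?y c t) (?y c t))) (at t)" for t
   unfolding has_real_derivative_iff_has_vector_derivative
   by (intro has_vector_derivative_sum d1)
  show "((%t. \<Sum>c\<in>I. 2 * Q (S \<cdot> ?y c t) (?y c t)) has_real_derivative (\<Sum>c\<in>I. 4 * Q (S \<cdot> ?y c t) (S \<cdot> ?y c t))) (at t)" for t
   unfolding has_real_derivative_iff_has_vector_derivative
   by (intro has_vector_derivative_sum d2)
  show "(\<Sum>c\<in>I. 4 * Q (S \<cdot> ?y c t) (S \<cdot> ?y c t)) \<ge> 0" for t by (simp add: sum_nonneg Q_nonneg)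
 qed simp
qed

lemma energy_beyond:
 assumes X: "X \<in> p" and gt: "penergy I v (r *\<^sub>R X) > penergy I v 0" and r: "0 < r" "r <= s"
 shows "penergy I v (s *\<^sub>R X) > penergy I v 0"
proof (rule ccontr)
 assume n: "\<not> ?thesis"
 let ?f = "%t. penergy I v (t *\<^sub>R X)"
 have s: "s > 0" using r by simp
 have "?f ((1 - r / s) *\<^sub>R 0 + (r / s) *\<^sub>R s) <= (1 - r / s) * ?f 0 + (r / s) * ?f s"
  using convex_onD[OF convex_energy_ray[OF X, of I v], of "r / s" 0 s] r s by simp
 also have "\<dots> <= (1 - r / s) * ?f 0 + (r / s) * ?f 0"
  using n r s by (intro add_left_mono mult_left_mono) auto
 also have "\<dots> = penergy I v 0" by (simp add: algebra_simps)
 finally show False using gt s by simp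
qed

text \<open>With \<open>?S\<close> the symmetric square root of \<open>?E\<close>, the square length
  of \<open>?E \<cdot> x - x\<close> is the energy at the end plus that at the start minus twice
  that at the midpoint. The two inequalities make it vanish, so \<open>?E\<close> fixes every
  vector, and none of them can have a component of negative eigenvalue.\<close>

lemma energy_strict:
 assumes X: "X \<in> p" and fin: "finite I" and st: "stable I v"
  and mid: "penergy I v 0 <= penergy I v (X /\<^sub>R 2)" and le: "penergy I v X <= penergy I v 0"
 shows "X = 0"
proof -
 let ?S = "exp (ad (- (X /\<^sub>R 2)))" and ?E = "exp (ad (- X))"
 have E: "?E \<cdot> x = ?S \<cdot> ?S \<cdot> x" for x
  using exp_scaleR_add[of "1/2" "1/2" "ad (- X)"] by (simp add: ad_simps)
 have nXp: "- (X /\<^sub>R 2) \<in> p" using X by (simp add: subspace_neg subspace_scale subspace_p)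
 have trm: "Q (?E \<cdot> x - x) (?E \<cdot> x - x) = Q (?E \<cdot> x) (?E \<cdot> x) + Q x x - 2 * Q (?S \<cdot> x) (?S \<cdot> x)" for x
 proof -
  have "Q (?E \<cdot> x) x = Q (?S \<cdot> x) (?S \<cdot> x)" unfolding E by (rule Q_exp_p[OF nXp])
  thus ?thesis using Q_sym[of x "?E \<cdot> x"] by (simp add: Q_simps)
 qed
 have "(\<Sum>c\<in>I. Q (?E \<cdot> v c - v c) (?E \<cdot> v c - v c)) = penergy I v X + penergy I v 0 - 2 * penergy I v (X /\<^sub>R 2)"
  unfolding trm by (simp add: energy_def sum.distrib sum_subtractf sum_distrib_left ad_simps)
 hence "(\<Sum>c\<in>I. Q (?E \<cdot> v c - v c) (?E \<cdot> v c - v c)) <= 0" using mid le by linarith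
 hence "(\<Sum>c\<in>I. Q (?E \<cdot> v c - v c) (?E \<cdot> v c - v c)) = 0" by (intro antisym sum_nonneg Q_nonneg)
 hence fx: "?E \<cdot> v c = v c" if "c \<in> I" for c
  using sum_nonneg_eq_0_iff[OF fin, of "%c. Q (?E \<cdot> v c - v c) (?E \<cdot> v c - v c)"] that Q_nonneg by simp
 have "v c \<in> eig X {0..}" if c: "c \<in> I" for c unfolding eig_iff[OF X]
 proof (intro allI impI)
  fix e \<mu> assume mu: "\<mu> \<notin> {0::real..}" and e: "br X e = \<mu> *\<^sub>R e"
  have "?E \<cdot> e = exp (- \<mu>) *\<^sub>R e" by (rule exp_eigenvector) (simp add: br_simps e)
  moreover have "Q (?E \<cdot> v c) e = Q (v c) (?E \<cdot> e)" by (rule Q_exp_p[OF subspace_neg[OF subspace_p X]])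
  ultimately have "Q (v c) e = exp (- \<mu>) * Q (v c) e" unfolding fx[OF c] by (simp add: Q_simps)
  thus "Q (v c) e = 0" using mu by simp
 qed
 thus ?thesis using st X unfolding stable_def by blast
qed

definition above :: "'i set => ('i => 'e) => real => bool" where
 "above I v R \<longleftrightarrow> (\<forall>X\<in>p. norm X = R --> penergy I v X > penergy I v 0)"

lemma continuous_exp_ad: "continuous_on UNIV (%X. exp (ad (- X)))"
proof -
 have "isCont exp S" for S :: "'e endo"
  unfolding continuous_at_eps_delta
 proof (intro allI impI)
  fix \<epsilon> :: real assume e: "\<epsilon> > 0"
  let ?r = "norm S + 1" and ?d = "min 1 (\<epsilon> / exp (norm S + 1))"
  have "dist (exp T) (exp S) < \<epsilon>" if T: "dist T S < ?d" for T
  proof -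
   have "norm T <= ?r" using T norm_triangle_sub[of T S] by (simp add: dist_norm)
   hence "norm (exp T - exp S - (T - S)) <= (exp ?r - 1) * norm (T - S)" by (intro exp_strict_derivative_bound) auto
   moreover have "norm (exp T - exp S) <= norm (exp T - exp S - (T - S)) + norm (T - S)"
    using norm_triangle_ineq[of "exp T - exp S - (T - S)" "T - S"] by simp
   ultimately have "norm (exp T - exp S) <= exp ?r * norm (T - S)" by (simp add: algebra_simps)
   also have "\<dots> < \<epsilon>" using T by (simp add: dist_norm field_simps)
   finally show ?thesis by (simp add: dist_norm)
  qed
  thus "\<exists>d>0. \<forall>T. dist T S < d --> dist (exp T) (exp S) < \<epsilon>" using e by (intro exI[of _ ?d]) simp
 qed
 hence "continuous_on UNIV (exp :: 'e endo => _)" by (simp add: continuous_at_imp_continuous_on)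
 moreover have "continuous_on UNIV (%X. ad (- X))" by (intro bounded_linear.continuous_on[OF bounded_linear_ad] continuous_intros)
 ultimately show ?thesis by (rule continuous_on_compose2) simp
qed

lemma continuous_energy: "continuous_on UNIV (%X. penergy I v X)"
 unfolding energy_def
 by (intro continuous_intros bounded_bilinear.continuous_on[OF bounded_bilinear_Q] bounded_bilinear.continuous_on[OF bounded_bilinear_app] continuous_exp_ad)

text \<open>If the energy never exceeded its initial value on the ray, each vector would stay
  bounded under the flow and so lie in the nonnegative part, by \<open>eig_bounded_perturbed\<close>
  with perturbation zero.\<close>

lemma energy_escapes:
 assumes X: "X \<in> p" "X ~= 0" and fin: "finite I" and st: "stable I v"
 obtains t where "t > 0" "penergy I v (t *\<^sub>R X) > penergy I v 0"
proof (rule ccontr)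
 assume "\<not> thesis"
 hence le: "penergy I v (t *\<^sub>R X) <= penergy I v 0" if "t > 0" for t using that \<open>!!t. _ ==> _ ==> thesis\<close> by (meson not_le)
 obtain c1 C1 where Qb: "c1 > 0" "C1 > 0" "!!x. c1 * (norm x)\<^sup>2 <= Q x x" "!!x. Q x x <= C1 * (norm x)\<^sup>2"
  by (rule Q_bounds) (rule that; assumption?)
 have "v c \<in> eig X {0..}" if c: "c \<in> I" for c
 proof (rule eig_bounded_perturbed[OF X(1) subspace_0[OF subspace_eig]])
  fix t :: real assume t: "t \<ge> 0"
  let ?y = "exp (- t *\<^sub>R ad (X + 0)) \<cdot> v c"
  have y: "?y = exp (ad (- (t *\<^sub>R X))) \<cdot> v c" by (simp add: ad_simps)
  have "Q ?y ?y <= penergy I v (t *\<^sub>R X)"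
   unfolding energy_def y using c fin by (intro member_le_sum[of c I "%c. Q (exp (ad (- (t *\<^sub>R X))) \<cdot> v c) (exp (ad (- (t *\<^sub>R X))) \<cdot> v c)"]) (auto simp: Q_nonneg)
  also have "\<dots> <= penergy I v 0" using le[of t] t by (cases "t = 0") auto
  finally have "c1 * (norm ?y)\<^sup>2 <= penergy I v 0" using Qb(3)[of ?y] by linarith
  hence "(norm ?y)\<^sup>2 <= penergy I v 0 / c1" using Qb(1) by (simp add: field_simps)
  thus "norm ?y <= sqrt (penergy I v 0 / c1)" by (rule real_le_rsqrt)
 qed
 thus False using st X unfolding stable_def by blast
qed

text \<open>By convexity the open sets of directions whose energy exceeds the initial value at
  radius \<open>Suc n\<close> increase with n. They cover the compact unit sphere, so one radius
  serves all directions.\<close>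

lemma energy_coercive:
 assumes fin: "finite I" and st: "stable I v"
 obtains R where "R > 0" "above I v R"
proof -
 let ?S = "p \<inter> sphere 0 1"
 have cS: "compact ?S" by (rule closed_Int_compact[OF closed_subspace[OF subspace_p] compact_sphere])
 let ?U = "%n. {X. penergy I v (real (Suc n) *\<^sub>R X) > penergy I v 0}"
 have "continuous_on UNIV (%X. penergy I v (r *\<^sub>R X))" for r
  using continuous_on_compose2[OF continuous_energy[of I v], of UNIV "%X. r *\<^sub>R X"] by (simp add: continuous_intros)
 hence op: "open (?U n)" for n by (intro open_Collect_less continuous_on_const) blast
 have mono: "X \<in> ?U m" if "X \<in> ?U n" "n <= m" "X \<in> ?S" for X n m
  using energy_beyond[of X I v "real (Suc n)" "real (Suc m)"] that by auto
 have cov: "?S \<subseteq> (\<Union>n. ?U n)"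
 proof
  fix X assume X: "X \<in> ?S"
  hence "X \<in> p" "X ~= 0" by auto
  then obtain t where t: "t > 0" "penergy I v (t *\<^sub>R X) > penergy I v 0" by (rule energy_escapes[OF _ _ fin st])
  obtain n where n: "t <= real n" using real_arch_simple by blast
  have "penergy I v (real (Suc n) *\<^sub>R X) > penergy I v 0"
   by (rule energy_beyond[OF \<open>X \<in> p\<close> t(2,1)]) (use n in simp)
  thus "X \<in> (\<Union>n. ?U n)" by blast
 qed
 obtain D where D: "finite D" "?S \<subseteq> (\<Union>n\<in>D. ?U n)"
  using compactE_image[OF cS, of UNIV ?U] op cov by (metis (no_types, lifting) UNIV_I)
 define m where "m = Max (insert 0 D)"
 show thesis
 proof (rule that[of "real (Suc m)"]; (intro above_def[THEN iffD2] allI impI ballI)?)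
  fix X assume X: "X \<in> p" "norm X = real (Suc m)"
  define Y where "Y = X /\<^sub>R real (Suc m)"
  have Y: "Y \<in> ?S" "X = real (Suc m) *\<^sub>R Y" unfolding Y_def using X by (simp_all add: subspace_scale subspace_p)
  then obtain n where n: "n \<in> D" "Y \<in> ?U n" using D(2) by blast
  have "Y \<in> ?U m" by (rule mono[OF n(2) _ Y(1)]) (simp add: m_def D(1) n(1))
  thus "penergy I v X > penergy I v 0" using Y(2) by simp
 qed simp
qed

lemma energy_minimum:
 assumes R: "R > 0" "above I v R"
 obtains X where "X \<in> p" "norm X <= R" "\<forall>Y\<in>p. penergy I v X <= penergy I v Y"
proof -
 let ?B = "p \<inter> cball 0 R"
 have "compact ?B" by (rule closed_Int_compact[OF closed_subspace[OF subspace_p] compact_cball])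
 moreover have "0 \<in> ?B" using R(1) by (simp add: subspace_0 subspace_p)
 ultimately obtain X where X: "X \<in> ?B" "!!Y. Y \<in> ?B ==> penergy I v X <= penergy I v Y"
  using continuous_attains_inf[of ?B "%X. penergy I v X"] continuous_on_subset[OF continuous_energy] by (metis empty_iff subset_UNIV)
 have "penergy I v X <= penergy I v Y" if Y: "Y \<in> p" for Y
 proof (cases "norm Y <= R")
  case False
  define Z where "Z = Y /\<^sub>R norm Y"
  have Yn: "Y = norm Y *\<^sub>R Z" using False R(1) by (cases "Y = 0") (auto simp: Z_def)
  have Z: "Z \<in> p" "norm (R *\<^sub>R Z) = R" unfolding Z_def using Y False R(1) by (cases "Y = 0"; simp add: subspace_scale subspace_p)+
  have "penergy I v (norm Y *\<^sub>R Z) > penergy I v 0"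
   by (rule energy_beyond[OF Z(1) _ R(1)]) (use R(2) Z False subspace_scale[OF subspace_p Z(1)] in \<open>auto simp: above_def\<close>)
  thus ?thesis using X(2)[OF \<open>0 \<in> ?B\<close>] unfolding Yn[symmetric] by simp
 qed (use X(2) Y in simp)
 thus thesis using that X(1) by auto
qed

text \<open>On the compact sphere the strict inequality survives small changes of the vectors: a
  sequence of violations would have a limit violating it for v. By \<open>energy_minimum\<close> the
  inequality is enough to produce a minimizer inside, also for the perturbed vectors.\<close>

lemma energy_sphere_open:
 assumes R: "above I v R"
 obtains d where "d > 0" "\<forall>v'. (\<forall>c\<in>I. norm (v' c - v c) < d) --> above I v' R"
proof (rule ccontr)
 assume no: "\<not> thesis"
 have "\<exists>v' X. (\<forall>c\<in>I. norm (v' c - v c) < inverse (real (Suc n))) \<and> X \<in> p \<inter> sphere 0 R \<and> penergy I v' X <= penergy I v' 0" for n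
 proof (rule ccontr)
  assume "\<not> ?thesis"
  hence "\<forall>v'. (\<forall>c\<in>I. norm (v' c - v c) < inverse (real (Suc n))) --> above I v' R" unfolding above_def by force
  thus False using no that[of "inverse (real (Suc n))"] by simp
 qed
 then obtain u x where u: "!!n c. c \<in> I ==> norm (u n c - v c) < inverse (real (Suc n))"
  and x: "!!n. x n \<in> p \<inter> sphere 0 R" "!!n. penergy I (u n) (x n) <= penergy I (u n) 0" by metis
 have "compact (p \<inter> sphere 0 R)" by (rule closed_Int_compact[OF closed_subspace[OF subspace_p] compact_sphere])
 then obtain X r where X: "X \<in> p \<inter> sphere 0 R" "strict_mono r" "(x \<circ> r) \<longlonglongrightarrow> X" using x(1) unfolding compact_def by blast
 have lim: "(%n. u (r n) c) \<longlonglongrightarrow> v c" if "c \<in> I" for c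
 proof -
  have "(%n. u n c - v c) \<longlonglongrightarrow> 0"
   by (rule Lim_null_comparison[OF _ LIMSEQ_inverse_real_of_nat]) (intro always_eventually allI less_imp_le u that)
  from LIMSEQ_subseq_LIMSEQ[OF LIM_zero_cancel[OF this] X(2)] show ?thesis by (simp add: o_def)
 qed
 have en: "(%n. penergy I (u (r n)) (y n)) \<longlonglongrightarrow> penergy I v Y" if "y \<longlonglongrightarrow> Y" for y Y
  unfolding energy_def
  by (intro tendsto_sum bounded_bilinear.tendsto[OF bounded_bilinear_Q] app.tendsto lim continuous_on_tendsto_compose[OF continuous_exp_ad that]) auto
 have "penergy I v X <= penergy I v 0" by (rule LIMSEQ_le[OF en[OF X(3)] en[OF tendsto_const]]) (use x(2) in auto)
 thus False using R X(1) unfolding above_def by auto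
qed

end

section \<open>Minimizers of the energy on the symmetric space\<close>

context lie_symmetric
begin

text \<open>Points of G/K are represented by group elements; since K acts by isometries of
  \<open>Q\<close>, the energy of the inverse depends only on the coset of g.\<close>

definition energy_min :: "'i set => ('i => 'e) => 'g => bool" where
 "energy_min I v g \<longleftrightarrow> g \<in> carrier G \<and> (\<forall>h\<in>carrier G. energy I v (AdE (inv g)) <= energy I v (AdE (inv h)))"

lemma energy_K: "c \<in> K ==> energy I v (AdE c * S) = energy I v S"
 by (simp add: energy_def K_carrier Q_Ad_K)

lemma energy_Ad: "h \<in> carrier G ==> energy I (%c. Ad G h (v c)) S = energy I v (S * AdE h)"
 by (simp add: energy_def)

lemma energy_polar: "X \<in> p ==> c \<in> K ==> energy I v (AdE (inv (lie_exp G X \<otimes> c))) = penergy I v X"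
 using energy_K[OF subgroup.m_inv_closed[OF subgroup_K], of c I v "exp (ad (- X))"] K_carrier
 by (simp add: inv_mult_group inv_lie_exp AdE_mult)

lemma energy_minI:
 assumes X: "X \<in> p" "\<forall>Y\<in>p. penergy I v X <= penergy I v Y"
 shows "energy_min I v (lie_exp G X)"
 unfolding energy_min_def
proof (intro conjI ballI)
 fix h assume "h \<in> carrier G"
 then obtain Y c where Y: "Y \<in> p" "c \<in> K" "h = lie_exp G Y \<otimes> c" by (rule polar_decomposition)
 show "energy I v (AdE (inv (lie_exp G X))) <= energy I v (AdE (inv h))"
  unfolding Y(3) energy_polar[OF Y(1,2)] using bspec[OF X(2) Y(1)] by (simp add: inv_lie_exp)
qed simp

lemma energy_min_exists:
 assumes "finite I" "stable I v"
 obtains g where "energy_min I v g"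
proof -
 obtain R where R: "R > 0" "above I v R" by (rule energy_coercive[OF assms])
 obtain X where "X \<in> p" "norm X <= R" "\<forall>Y\<in>p. penergy I v X <= penergy I v Y" by (rule energy_minimum[OF R])
 thus thesis using that energy_minI by blast
qed

lemma energy_min_act:
 assumes h: "h \<in> carrier G" and m: "energy_min I v g"
 shows "energy_min I (%c. Ad G h (v c)) (h \<otimes> g)"
 unfolding energy_min_def
proof (intro conjI ballI)
 have g: "g \<in> carrier G" using m by (simp add: energy_min_def)
 have shift: "energy I (%c. Ad G h (v c)) (AdE (inv (h \<otimes> f))) = energy I v (AdE (inv f))" if "f \<in> carrier G" for f
  unfolding energy_Ad[OF h] using h that by (simp add: inv_mult_group AdE_mult mult.assoc)
 show "h \<otimes> g \<in> carrier G" using h g by simp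
 fix f assume f: "f \<in> carrier G"
 have "f = h \<otimes> (inv h \<otimes> f)" using h f by (simp add: m_assoc[symmetric])
 hence "energy I (%c. Ad G h (v c)) (AdE (inv f)) = energy I v (AdE (inv (inv h \<otimes> f)))"
  using shift[of "inv h \<otimes> f"] h f by simp
 thus "energy I (%c. Ad G h (v c)) (AdE (inv (h \<otimes> g))) <= energy I (%c. Ad G h (v c)) (AdE (inv f))"
  using shift[OF g] m h f by (simp add: energy_min_def)
qed

lemma energy_min_one:
 assumes g: "energy_min I v g"
 shows "energy_min I (%c. Ad G (inv g) (v c)) \<one>"
 using energy_min_act[OF _ g, of "inv g"] g by (simp add: energy_min_def)

lemma energy_min_oneD:
 assumes "energy_min I v \<one>"
 shows "penergy I v 0 <= penergy I v X"
proof -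
 have "energy I v (AdE (inv \<one>)) <= energy I v (AdE (inv (lie_exp G X)))"
  using assms lie_exp_carrier unfolding energy_min_def by blast
 thus ?thesis by (simp add: inv_lie_exp ad_simps)
qed

text \<open>After translating g to the identity, the other minimizer is the endpoint of a geodesic
  from the base point. Start, end and midpoint then satisfy the inequalities of
  \<open>energy_strict\<close>.\<close>

lemma energy_min_unique:
 assumes fin: "finite I" and st: "!!g. g \<in> carrier G ==> stable I (%c. Ad G (inv g) (v c))"
  and m: "energy_min I v g" "energy_min I v h"
 shows "g <# K = h <# K"
proof -
 have gc: "g \<in> carrier G" "h \<in> carrier G" using m by (auto simp: energy_min_def)
 let ?w = "%c. Ad G (inv g) (v c)"
 note m1 = energy_min_one[OF m(1)]
 have m2: "energy_min I ?w (inv g \<otimes> h)" by (rule energy_min_act[OF inv_closed[OF gc(1)] m(2)])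
 have "inv g \<otimes> h \<in> carrier G" using gc by simp
 then obtain X z where X: "X \<in> p" "z \<in> K" "inv g \<otimes> h = lie_exp G X \<otimes> z" by (rule polar_decomposition)
 have "X = 0"
 proof (rule energy_strict[OF X(1) fin st[OF gc(1)]])
  show "penergy I ?w 0 <= penergy I ?w (X /\<^sub>R 2)" by (rule energy_min_oneD[OF m1])
  have "penergy I ?w X = energy I ?w (AdE (inv (inv g \<otimes> h)))" unfolding X(3) by (rule energy_polar[OF X(1,2), symmetric])
  also have "\<dots> <= energy I ?w (AdE (inv \<one>))" using m2 unfolding energy_min_def by blast
  finally show "penergy I ?w X <= penergy I ?w 0" by (simp add: ad_simps)
 qed
 hence "inv g \<otimes> h = z" using X(3) K_carrier[OF X(2)] by simp
 hence "h = g \<otimes> z" using gc by (simp add: m_assoc[symmetric] flip: \<open>inv g \<otimes> h = z\<close>)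
 thus ?thesis using K_coset[OF X(2) gc(1)] by simp
qed

text \<open>By strictness every sphere around the minimizer has larger energy, however small its
  radius. This persists for nearby vectors and confines a minimizer of theirs to the same
  ball.\<close>

lemma energy_min_near:
 assumes fin: "finite I" and st: "!!g. g \<in> carrier G ==> stable I (%c. Ad G (inv g) (v c))"
  and m: "energy_min I v g" and r: "r > 0"
 obtains d where "d > 0" "\<forall>v'. (\<forall>c\<in>I. norm (v' c - v c) < d) --> (\<exists>X. norm X <= r \<and> energy_min I v' (g \<otimes> lie_exp G X))"
proof -
 have g: "g \<in> carrier G" and ig: "inv g \<in> carrier G" using m by (auto simp: energy_min_def)
 let ?w = "%c. Ad G (inv g) (v c)"
 note m1 = energy_min_oneD[OF energy_min_one[OF m]]
 have "above I ?w r" unfolding above_def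
 proof (intro ballI impI, rule ccontr)
  fix X assume X: "X \<in> p" "norm X = r"
  assume "\<not> penergy I ?w X > penergy I ?w 0"
  hence "X = 0" using energy_strict[OF X(1) fin st[OF g] m1] by simp
  thus False using X(2) r by simp
 qed
 then obtain d where d: "d > 0" "\<forall>v'. (\<forall>c\<in>I. norm (v' c - ?w c) < d) --> above I v' r"
  by (rule energy_sphere_open)
 define L where "L = norm (AdE (inv g)) + 1"
 have L: "L > 0" by (simp add: L_def add_nonneg_pos)
 show thesis
 proof (rule that[of "d / L"]; (intro allI impI)?)
  fix v' assume v': "\<forall>c\<in>I. norm (v' c - v c) < d / L"
  let ?w' = "%c. Ad G (inv g) (v' c)"
  have near: "norm (?w' c - ?w c) < d" if "c \<in> I" for c
  proof -
   have "?w' c - ?w c = AdE (inv g) \<cdot> (v' c - v c)" using ig by (simp add: linear_diff[OF linear_Ad[OF ig]])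
   hence "norm (?w' c - ?w c) <= norm (AdE (inv g)) * norm (v' c - v c)" by (simp add: norm_app)
   also have "\<dots> <= L * norm (v' c - v c)" by (rule mult_right_mono) (simp_all add: L_def)
   also have "\<dots> < d" using bspec[OF v' that] L by (simp add: field_simps)
   finally show ?thesis .
  qed
  have "above I ?w' r" using spec[OF d(2), of ?w'] near by blast
  then obtain X where X: "X \<in> p" "norm X <= r" "\<forall>Y\<in>p. penergy I ?w' X <= penergy I ?w' Y"
   by (rule energy_minimum[OF r])
  have "energy_min I (%c. Ad G g (?w' c)) (g \<otimes> lie_exp G X)" by (rule energy_min_act[OF g energy_minI[OF X(1,3)]])
  thus "\<exists>X. norm X <= r \<and> energy_min I v' (g \<otimes> lie_exp G X)" using X(2) g by auto
 qed (use d(1) L in simp)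
qed

text \<open>The projection onto G/P is open: if g and v in V define the same coset, then
  \<open>v = g \<otimes> q\<close> with q fixing the base point, and right multiplication by q pulls
  V back to a neighbourhood of g.\<close>

lemma openin_par_cosets:
 assumes V: "openin (topo G) V"
 shows "openin (coset_topology G par) ((%v. v <# par) ` V)"
proof -
 have Vc: "V \<subseteq> carrier G" using openin_subset[OF V] by simp
 have "openin (topo G) {g \<in> topspace (topo G). g <# par \<in> (%v. v <# par) ` V}"
 proof (subst openin_subopen, intro ballI)
  fix g assume "g \<in> {g \<in> topspace (topo G). g <# par \<in> (%v. v <# par) ` V}"
  then obtain v where g: "g \<in> carrier G" and v: "v \<in> V" "g <# par = v <# par" by auto
  have vc: "v \<in> carrier G" using v(1) Vc by blast
  obtain q where q: "q \<in> par" "v = g \<otimes> q" by (rule par_cosetD[OF g vc v(2)])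
  have qc: "q \<in> carrier G" by (rule par_carrier[OF q(1)])
  have "g <# par = g <# (q <# par)" using v(2) par_coset_mult[OF g qc] q(2) by simp
  hence "inv g <# (g <# par) = inv g <# (g <# (q <# par))" by simp
  hence "\<one> <# par = \<one> <# (q <# par)"
   using par_coset_mult[of "inv g" g] par_coset_mult[OF g qc] par_coset_mult[of "inv g" "g \<otimes> q"] par_coset_mult[OF one_closed qc] g qc
   by (simp add: m_assoc[symmetric])
  hence qP: "par = q <# par" using par_coset_mult[OF one_closed qc] qc lcos_mult_one[of par] par_carrier by (simp add: subsetI)
  let ?N = "{h \<in> topspace (topo G). h \<otimes> q \<in> V}"
  have "openin (topo G) ?N"
   using qc by (intro openin_continuous_map_preimage[OF continuous_map_mult V]) auto
  moreover have "g \<in> ?N" using g v(1) q(2) by simp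
  moreover have "?N \<subseteq> {g \<in> topspace (topo G). g <# par \<in> (%v. v <# par) ` V}"
  proof
   fix h assume h: "h \<in> ?N"
   hence "h <# par = (h \<otimes> q) <# par" using par_coset_mult[of h q] qc qP by simp
   thus "h \<in> {g \<in> topspace (topo G). g <# par \<in> (%v. v <# par) ` V}" using h by auto
  qed
  ultimately show "\<exists>N. openin (topo G) N \<and> g \<in> N \<and> N \<subseteq> {g \<in> topspace (topo G). g <# par \<in> (%v. v <# par) ` V}" by blast
 qed
 thus ?thesis using Vc by (auto simp: openin_coset_topology LCOSETS_def)
qed

end

section \<open>The barycenter of a tuple and invariance of the domains\<close>

context lie_longest
begin

text \<open>The vector of a pair depends on its order; taking all ordered pairs makes the total
  energy invariant under permutations of the entries.\<close>

definition pairs :: "nat => (nat \<times> nat) set" where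
 "pairs q = {c. fst c < q \<and> snd c < q \<and> fst c ~= snd c}"

definition pvec :: "(nat => 'g set) => nat \<times> nat => 'e" where
 "pvec x c = opp_vec (x (fst c)) (x (snd c))"

definition bary :: "nat => (nat => 'g set) => 'g set" where
 "bary q x = (THE C. \<exists>g. energy_min (pairs q) (pvec x) g \<and> C = g <# K)"

lemma finite_pairs [simp]: "finite (pairs q)"
proof -
 have "pairs q \<subseteq> {..<q} \<times> {..<q}" by (auto simp: pairs_def)
 thus ?thesis by (rule finite_subset) simp
qed

abbreviation translate :: "nat => 'g => (nat => 'g set) => nat => 'g set" where
 "translate q g x \<equiv> \<lambda>i\<in>{..<q}. g <# x i"

lemma par_lcosets_act: "g \<in> carrier G ==> x \<in> lcosets par ==> g <# x \<in> lcosets par"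
 by (auto simp: LCOSETS_def par_coset_mult)

lemma generic_triples_act:
 assumes g: "g \<in> carrier G" and gen: "(x, y, z) \<in> generic_triples G K par A w0"
 shows "(g <# x, g <# y, g <# z) \<in> generic_triples G K par A w0"
proof -
 have o: "opposite G par w0 x y" and fl: "\<forall>u\<in>flat_boundary G K par A (flat_through G K par A w0 x y). opposite G par w0 z u"
  and l: "x \<in> lcosets par" "y \<in> lcosets par" "z \<in> lcosets par"
  using gen by (auto simp: generic_triples_def)
 obtain h where h: "h \<in> carrier G" "x = h <# par" "y = h <# (w0 <# par)" using o unfolding opposite_def by blast
 have gh: "g \<otimes> h \<in> carrier G" using g h(1) by simp
 have eq: "g <# x = (g \<otimes> h) <# par" "g <# y = (g \<otimes> h) <# (w0 <# par)"
  unfolding h(2,3) using g h(1) by (simp_all add: par_coset_mult m_assoc)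
 have "opposite G par w0 (g <# z) u" if u: "u \<in> flat_boundary G K par A (flat_through G K par A w0 (g <# x) (g <# y))" for u
 proof -
  obtain t where t: "t \<in> T" "u = (g \<otimes> h \<otimes> t) <# par" using u unfolding eq flat_boundary_through[OF gh] by blast
  have "opposite G par w0 z ((h \<otimes> t) <# par)" using fl t(1) unfolding h(2,3) flat_boundary_through[OF h(1)] by blast
  from opposite_act(1)[OF g this] show ?thesis using g h(1) T_carrier[OF t(1)] unfolding t(2) by (simp add: par_coset_mult m_assoc)
 qed
 thus ?thesis using opposite_act(1)[OF g o] l par_lcosets_act[OF g] by (auto simp: generic_triples_def)
qed

lemma generic_tuples_act:
 assumes "g \<in> carrier G" "x \<in> generic_tuples G K par A w0 q"
 shows "translate q g x \<in> generic_tuples G K par A w0 q"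
 using assms(2) generic_triples_act[OF assms(1)] par_lcosets_act[OF assms(1)] by (simp add: generic_tuples_def PiE_iff)

lemma pairwise_opposite_tuples_act:
 assumes "g \<in> carrier G" "x \<in> pairwise_opposite_tuples G par w0 q"
 shows "translate q g x \<in> pairwise_opposite_tuples G par w0 q"
 using assms(2) opposite_act(1)[OF assms(1)] par_lcosets_act[OF assms(1)] by (simp add: pairwise_opposite_tuples_def PiE_iff)

lemma permuted_PiE:
 assumes "s permutes {..<q}" "x \<in> {..<q} \<rightarrow>\<^sub>E S"
 shows "x \<circ> s \<in> {..<q} \<rightarrow>\<^sub>E S"
 using assms permutes_in_image[OF assms(1)] permutes_not_in[OF assms(1)] by (auto simp: PiE_iff extensional_def)

lemma permutes_less:
 assumes "s permutes {..<q}"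
 shows "s i < q \<longleftrightarrow> i < q" "s i = s j \<longleftrightarrow> i = j"
 using permutes_in_image[OF assms, of i] permutes_inj[OF assms] by (auto simp: inj_eq)

lemma generic_tuples_permute:
 assumes "s permutes {..<q}" "x \<in> generic_tuples G K par A w0 q"
 shows "x \<circ> s \<in> generic_tuples G K par A w0 q"
 using assms(2) permuted_PiE[OF assms(1), of x] by (auto simp: generic_tuples_def permutes_less[OF assms(1)])

lemma pairwise_opposite_tuples_permute:
 assumes "s permutes {..<q}" "x \<in> pairwise_opposite_tuples G par w0 q"
 shows "x \<circ> s \<in> pairwise_opposite_tuples G par w0 q"
 using assms(2) permuted_PiE[OF assms(1), of x] by (auto simp: pairwise_opposite_tuples_def permutes_less[OF assms(1)])

text \<open>Genericity speaks of triples only, so opposition of two entries is read off from a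
  triple with a third index, available because q is at least 3.\<close>

lemma generic_tuples_opposite:
 assumes q: "q \<ge> 3"
 shows "generic_tuples G K par A w0 q \<subseteq> pairwise_opposite_tuples G par w0 q"
proof
 fix x assume x: "x \<in> generic_tuples G K par A w0 q"
 have "opposite G par w0 (x i) (x j)" if ij: "i < q" "j < q" "i ~= j" for i j
 proof -
  have "\<exists>l::nat. l < 3 \<and> l ~= i \<and> l ~= j" by presburger
  then obtain l where "l < 3" "l ~= i" "l ~= j" by blast
  hence "(x i, x j, x l) \<in> generic_triples G K par A w0" using x ij q by (auto simp: generic_tuples_def)
  thus ?thesis by (simp add: generic_triples_def)
 qed
 thus "x \<in> pairwise_opposite_tuples G par w0 q" using x by (auto simp: generic_tuples_def pairwise_opposite_tuples_def)
qed

end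

section \<open>Equivariance, symmetry and continuity for stable families of tuples\<close>

text \<open>The common ground of both domains. Triviality of X is demanded for every translate of a
  tuple, because minimizers are compared after moving them to the identity.\<close>

locale stable_tuples = lie_longest G K p a \<Phi> w0
 for G :: "('g, 'e::euclidean_space) lie_data" (structure) and K :: "'g set" and p a :: "'e set" and \<Phi> and w0 :: 'g +
 fixes q :: nat and D :: "(nat => 'g set) set"
 assumes D: "D \<subseteq> pairwise_opposite_tuples G par w0 q"
  and D_stable: "x \<in> D ==> X \<in> p ==> g \<in> carrier G ==> spread X q (translate q g x) ==> X = 0"
begin

lemma D_coset: "x \<in> D ==> i < q ==> \<exists>h\<in>carrier G. x i = h <# par"
 using D unfolding pairwise_opposite_tuples_def LCOSETS_def by (fastforce simp: PiE_iff)

lemma D_opposite: "x \<in> D ==> c \<in> pairs q ==> opposite G par w0 (x (fst c)) (x (snd c))"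
 using D by (auto simp: pairwise_opposite_tuples_def pairs_def)

lemma pvec_translate:
 assumes x: "x \<in> D" and g: "g \<in> carrier G" and c: "c \<in> pairs q"
 shows "pvec (translate q g x) c = Ad G g (pvec x c)"
 using opposite_act(2)[OF g D_opposite[OF x c]] c by (simp add: pvec_def pairs_def)

lemma stable_pvec:
 assumes x: "x \<in> D" and g: "g \<in> carrier G"
 shows "stable (pairs q) (%c. Ad G (inv g) (pvec x c))"
 unfolding stable_def
proof (intro ballI impI)
 fix X assume X: "X \<in> p" and v: "\<forall>c\<in>pairs q. Ad G (inv g) (pvec x c) \<in> eig X {0..}"
 have ig: "inv g \<in> carrier G" using g by simp
 show "X = 0"
 proof (rule D_stable[OF x X ig])
  show "spread X q (translate q (inv g) x)" unfolding spread_def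
  proof (intro allI impI conjI)
   fix i j assume ij: "i < q" "j < q" "i ~= j"
   hence c: "(i, j) \<in> pairs q" by (simp add: pairs_def)
   show "opposite G par w0 (translate q (inv g) x i) (translate q (inv g) x j)"
    using opposite_act(1)[OF ig D_opposite[OF x c]] ij by simp
   have "pvec (translate q (inv g) x) (i, j) \<in> eig X {0..}" using bspec[OF v c] unfolding pvec_translate[OF x ig c] .
   thus "opp_vec (translate q (inv g) x i) (translate q (inv g) x j) \<in> eig X {0..}"
    by (simp add: pvec_def)
  qed
 qed
qed

lemma bary_eqI:
 assumes x: "x \<in> D" and g: "energy_min (pairs q) (pvec x) g"
 shows "bary q x = g <# K"
 unfolding bary_def
 by (rule the_equality) (use g energy_min_unique[OF finite_pairs stable_pvec[OF x]] in blast)+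

lemma bary_obtains:
 assumes x: "x \<in> D"
 obtains g where "energy_min (pairs q) (pvec x) g" "bary q x = g <# K" "g \<in> carrier G"
proof -
 have "stable (pairs q) (pvec x)" using stable_pvec[OF x one_closed] by (simp add: Ad_one)
 then obtain g where "energy_min (pairs q) (pvec x) g" by (rule energy_min_exists[OF finite_pairs])
 thus thesis using that bary_eqI[OF x] unfolding energy_min_def by blast
qed

lemma energy_min_cong: "(!!c. c \<in> I ==> v c = v' c) ==> energy_min I v g = energy_min I v' g"
 by (simp add: energy_min_def energy_def)

lemma bary_equivariant:
 assumes tr: "!!g x. g \<in> carrier G ==> x \<in> D ==> translate q g x \<in> D"
 shows "equivariant_on G q D (bary q)"
 unfolding equivariant_on_def
proof (intro ballI)
 fix g x assume g: "g \<in> carrier G" and x: "x \<in> D"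
 obtain h where h: "energy_min (pairs q) (pvec x) h" "bary q x = h <# K" "h \<in> carrier G" by (rule bary_obtains[OF x])
 have "energy_min (pairs q) (%c. Ad G g (pvec x c)) (g \<otimes> h)" by (rule energy_min_act[OF g h(1)])
 hence "energy_min (pairs q) (pvec (translate q g x)) (g \<otimes> h)"
  using energy_min_cong[of "pairs q" "%c. Ad G g (pvec x c)" "pvec (translate q g x)"] pvec_translate[OF x g] by simp
 thus "bary q (translate q g x) = g <# bary q x"
  unfolding h(2) K_coset_mult[OF g h(3)] by (rule bary_eqI[OF tr[OF g x]])
qed

lemma bary_symmetric:
 assumes "!!\<sigma> x. \<sigma> permutes {..<q} ==> x \<in> D ==> x \<circ> \<sigma> \<in> D"
 shows "symmetric_on q D (bary q)"
 unfolding symmetric_on_def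
proof (intro allI impI ballI)
 fix \<sigma> x assume \<sigma>: "\<sigma> permutes {..<q}" and x: "x \<in> D"
 obtain h where h: "energy_min (pairs q) (pvec x) h" "bary q x = h <# K" by (rule bary_obtains[OF x])
 have bij: "bij_betw (map_prod \<sigma> \<sigma>) (pairs q) (pairs q)"
 proof -
  note s = permutes_less[OF \<sigma>]
  have "pairs q \<subseteq> map_prod \<sigma> \<sigma> ` pairs q"
  proof
   fix c assume c: "c \<in> pairs q"
   obtain i j where ij: "\<sigma> i = fst c" "\<sigma> j = snd c" using permutes_surj[OF \<sigma>] by (metis surj_def)
   hence "(i, j) \<in> pairs q" "map_prod \<sigma> \<sigma> (i, j) = c"
    using c s(1)[of i] s(1)[of j] unfolding pairs_def by (auto simp: prod_eq_iff)
   thus "c \<in> map_prod \<sigma> \<sigma> ` pairs q" by force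
  qed
  moreover have "inj_on (map_prod \<sigma> \<sigma>) (pairs q)" by (rule inj_onI) (auto simp: s prod_eq_iff)
  ultimately show ?thesis by (auto simp: bij_betw_def pairs_def s)
 qed
 have "energy (pairs q) (pvec (x \<circ> \<sigma>)) S = energy (pairs q) (pvec x) S" for S
  using sum.reindex_bij_betw[OF bij, of "%c. Q (S \<cdot> pvec x c) (S \<cdot> pvec x c)"] by (simp add: energy_def pvec_def)
 hence "energy_min (pairs q) (pvec (x \<circ> \<sigma>)) h" using h(1) by (simp add: energy_min_def)
 thus "bary q (x \<circ> \<sigma>) = bary q x" unfolding h(2) by (rule bary_eqI[OF assms[OF \<sigma> x]])
qed

lemma pvec_near:
 assumes x: "x \<in> D" and h: "!!i. i < q ==> h i \<in> carrier G \<and> x i = h i <# par" and e: "\<epsilon> > 0"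
 obtains r where "r > 0" "\<forall>y\<in>D. \<forall>v. (\<forall>i<q. v i \<in> carrier G \<and> y i = v i <# par \<and> norm (AdE (v i) - AdE (h i)) < r) -->
  (\<forall>c\<in>pairs q. norm (pvec y c - pvec x c) < \<epsilon>)"
proof -
 have "\<exists>r>0. \<forall>v v'. v \<in> carrier G --> v' \<in> carrier G --> norm (AdE v - AdE (h (fst c))) < r --> norm (AdE v' - AdE (h (snd c))) < r -->
   opposite G par w0 (v <# par) (v' <# par) --> norm (opp_vec (v <# par) (v' <# par) - pvec x c) < \<epsilon>" if c: "c \<in> pairs q" for c
 proof -
  have hc: "h (fst c) \<in> carrier G" "h (snd c) \<in> carrier G" "x (fst c) = h (fst c) <# par" "x (snd c) = h (snd c) <# par"
   using h c by (auto simp: pairs_def)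
  obtain r where "r > 0" "!!v v'. v \<in> carrier G ==> v' \<in> carrier G ==> norm (AdE v - AdE (h (fst c))) < r ==> norm (AdE v' - AdE (h (snd c))) < r ==>
   opposite G par w0 (v <# par) (v' <# par) ==> norm (opp_vec (v <# par) (v' <# par) - opp_vec (h (fst c) <# par) (h (snd c) <# par)) < \<epsilon>"
   by (rule opp_vec_continuous[OF hc(1,2) D_opposite[OF x c, unfolded hc(3,4)] e]) (rule that; assumption?)
  thus ?thesis unfolding pvec_def hc(3,4) by blast
 qed
 then obtain d where d: "!!c. c \<in> pairs q ==> d c > 0" "!!c v v'. c \<in> pairs q ==> v \<in> carrier G ==> v' \<in> carrier G ==>
   norm (AdE v - AdE (h (fst c))) < d c ==> norm (AdE v' - AdE (h (snd c))) < d c ==>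
   opposite G par w0 (v <# par) (v' <# par) ==> norm (opp_vec (v <# par) (v' <# par) - pvec x c) < \<epsilon>"
  by metis
 \<comment> \<open>The entry 1 keeps the minimum defined when there are no pairs.\<close>
 define r where "r = Min (insert 1 (d ` pairs q))"
 show thesis
 proof (rule that[of r]; (intro ballI allI impI)?)
  show "r > 0" unfolding r_def using d(1) by (subst Min_gr_iff) auto
  fix y v c assume y: "y \<in> D" and "\<forall>i<q. v i \<in> carrier G \<and> y i = v i <# par \<and> norm (AdE (v i) - AdE (h i)) < r" and c: "c \<in> pairs q"
  hence v: "v i \<in> carrier G \<and> y i = v i <# par \<and> norm (AdE (v i) - AdE (h i)) < r" if "i < q" for i using that by blast
  have dc: "r <= d c" unfolding r_def by (rule Min_le) (use c in auto)
  have ij: "fst c < q" "snd c < q" using c by (auto simp: pairs_def)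
  note v1 = v[OF ij(1)] and v2 = v[OF ij(2)]
  have "opposite G par w0 (v (fst c) <# par) (v (snd c) <# par)" using D_opposite[OF y c] v1 v2 by simp
  thus "norm (pvec y c - pvec x c) < \<epsilon>"
   using d(2)[OF c, of "v (fst c)" "v (snd c)"] v1 v2 dc unfolding pvec_def[of y] by simp
 qed
qed

text \<open>Since G/P carries the quotient topology, a neighbourhood of x is a product of images of
  open sets V i. Tuples in it have representatives with \<open>AdE\<close> close to those of x,
  hence vectors close to those of x, and \<open>energy_min_near\<close> keeps the minimizer
  close.\<close>

lemma bary_continuous: "continuous_map (tuple_topology G par q D) (coset_topology G K) (bary q)"
proof -
 let ?X = "product_topology (%_. coset_topology G par) {..<q}"
 have qt: "quotient_map (topo G) (coset_topology G H) (%g. g <# H)" for H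
  by (rule quotient_map_coset_topology) simp
 have DX: "D \<subseteq> topspace ?X"
 proof -
  have "topspace (coset_topology G par) = (%g. g <# par) ` carrier G" using quotient_imp_surjective_map[OF qt] by simp
  hence "topspace (coset_topology G par) = lcosets par" by (auto simp: LCOSETS_def)
  thus ?thesis using D by (auto simp: pairwise_opposite_tuples_def)
 qed
 hence ts: "topspace (tuple_topology G par q D) = D" unfolding tuple_topology_def by (rule topspace_subtopology_subset)
 show ?thesis unfolding continuous_map_def
 proof (intro conjI allI impI)
  show "bary q \<in> topspace (tuple_topology G par q D) \<rightarrow> topspace (coset_topology G K)"
  proof
   fix x assume "x \<in> topspace (tuple_topology G par q D)"
   hence "x \<in> D" by (simp only: ts)
   then obtain g where "bary q x = g <# K" "g \<in> carrier G" by (rule bary_obtains)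
   thus "bary q x \<in> topspace (coset_topology G K)" using quotient_imp_surjective_map[OF qt] by auto
  qed
  fix U assume U: "openin (coset_topology G K) U"
  show "openin (tuple_topology G par q D) {x \<in> topspace (tuple_topology G par q D). bary q x \<in> U}"
   unfolding ts
  proof (subst openin_subopen, intro ballI)
   fix x assume "x \<in> {x \<in> D. bary q x \<in> U}"
   hence x: "x \<in> D" "bary q x \<in> U" by auto
   obtain g where g: "energy_min (pairs q) (pvec x) g" "bary q x = g <# K" "g \<in> carrier G" by (rule bary_obtains[OF x(1)])
   have "openin (topo G) {h \<in> topspace (topo G). h <# K \<in> U}" using U by (simp add: openin_coset_topology)
   hence "openin (topo G) {h \<in> topspace (topo G). g \<otimes> h \<in> {h \<in> topspace (topo G). h <# K \<in> U}}"
    using g(3) by (intro openin_continuous_map_preimage[OF continuous_map_mult]) auto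
   moreover have "\<one> \<in> {h \<in> topspace (topo G). g \<otimes> h \<in> {h \<in> topspace (topo G). h <# K \<in> U}}" using g x(2) by simp
   ultimately obtain r where r: "r > 0" "!!X. norm X < r ==> lie_exp G X \<in> {h \<in> topspace (topo G). g \<otimes> h \<in> {h \<in> topspace (topo G). h <# K \<in> U}}"
    by (rule lie_exp_near) (rule that; assumption?)
   \<comment> \<open>The minimizer is confined to a closed ball, while the neighbourhood of the
     identity was given by a strict inequality.\<close>
   have r2: "r / 2 > 0" using r(1) by simp
   obtain \<epsilon> where e: "\<epsilon> > 0" "\<forall>v'. (\<forall>c\<in>pairs q. norm (v' c - pvec x c) < \<epsilon>) --> (\<exists>X. norm X <= r / 2 \<and> energy_min (pairs q) v' (g \<otimes> lie_exp G X))"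
    by (rule energy_min_near[OF finite_pairs stable_pvec[OF x(1)] g(1) r2])
   obtain h where h: "!!i. i < q ==> h i \<in> carrier G \<and> x i = h i <# par" using D_coset[OF x(1)] by metis
   obtain d where d: "d > 0" "\<forall>y\<in>D. \<forall>v. (\<forall>i<q. v i \<in> carrier G \<and> y i = v i <# par \<and> norm (AdE (v i) - AdE (h i)) < d) -->
     (\<forall>c\<in>pairs q. norm (pvec y c - pvec x c) < \<epsilon>)"
    by (rule pvec_near[OF x(1) h e(1)])
   define V where "V i = {v \<in> topspace (topo G). AdE v \<in> ball (AdE (h i)) d}" for i
   have V: "openin (topo G) (V i)" for i
    unfolding V_def by (rule openin_continuous_map_preimage[OF continuous_AdE]) simp
   let ?N = "PiE {..<q} (%i. (%v. v <# par) ` V i)"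
   have "openin ?X ?N" by (simp add: openin_PiE openin_par_cosets V)
   hence oN: "openin (tuple_topology G par q D) (D \<inter> ?N)" unfolding tuple_topology_def openin_subtopology by blast
   have "x \<in> extensional {..<q}" using D x(1) by (auto simp: pairwise_opposite_tuples_def PiE_def)
   moreover have "x i \<in> (%v. v <# par) ` V i" if "i < q" for i using h[OF that] d(1) by (auto simp: V_def)
   ultimately have xN: "x \<in> D \<inter> ?N" using x(1) by (simp add: PiE_def)
   have "D \<inter> ?N \<subseteq> {x \<in> D. bary q x \<in> U}"
   proof
    fix y assume y: "y \<in> D \<inter> ?N"
    have "\<exists>v\<in>V i. y i = v <# par" if "i < q" for i using y that by (auto simp: PiE_iff)
    then obtain v where v: "!!i. i < q ==> v i \<in> V i \<and> y i = v i <# par" by metis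
    have "\<forall>i<q. v i \<in> carrier G \<and> y i = v i <# par \<and> norm (AdE (v i) - AdE (h i)) < d"
     using v by (auto simp: V_def dist_norm norm_minus_commute)
    hence "\<forall>c\<in>pairs q. norm (pvec y c - pvec x c) < \<epsilon>" using d(2) y by blast
    then obtain X where X: "norm X <= r / 2" "energy_min (pairs q) (pvec y) (g \<otimes> lie_exp G X)" using e(2) by blast
    have "bary q y = (g \<otimes> lie_exp G X) <# K" by (rule bary_eqI[OF _ X(2)]) (use y in simp)
    thus "y \<in> {x \<in> D. bary q x \<in> U}" using r(2)[of X] X(1) r(1) y by auto
   qed
   thus "\<exists>N. openin (tuple_topology G par q D) N \<and> x \<in> N \<and> N \<subseteq> {x \<in> D. bary q x \<in> U}" using oN xN by blast
  qed
 qed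
qed

end

section \<open>Barycenter maps on generic and on pairwise opposite tuples\<close>

theorem corollary4:
 fixes G :: "('g, 'e::euclidean_space) lie_data"
  and K P A :: "'g set" and w0 :: 'g
  and p a :: "'e set" and \<Phi> :: "('e => real) set"
 assumes "is_lie_group G"
  and "connected_space (topo G)"
  and "semisimple G"
  and "noncompact_type G"
  and "finite (group_center G)"
  and "maximal_compact G K"
  and "compatible_choices G K P A p a \<Phi>"
  and "longest_rep G K A a \<Phi> w0"
 shows "(\<forall>q\<ge>3. \<exists>bar.
      continuous_map (tuple_topology G P q (generic_tuples G K P A w0 q)) (coset_topology G K) bar \<and>
      equivariant_on G q (generic_tuples G K P A w0 q) bar \<and>
      symmetric_on q (generic_tuples G K P A w0 q) bar) \<and>
     ((\<forall>X\<in>a. Ad G w0 X = - X) -->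
     (\<forall>q\<ge>3. \<exists>bar.
      continuous_map (tuple_topology G P q (pairwise_opposite_tuples G P w0 q)) (coset_topology G K) bar \<and>
      equivariant_on G q (pairwise_opposite_tuples G P w0 q) bar \<and>
      symmetric_on q (pairwise_opposite_tuples G P w0 q) bar))"
proof -
 note cc = assms(7)[unfolded compatible_choices_def]
 interpret S: lie_symmetric G K p a \<Phi>
  by unfold_locales (use assms cc in auto)
 have A: "A = S.A" using cc by (simp add: S.A_def)
 have P: "P = S.par" using cc by (simp add: S.par_def A)
 interpret L: lie_longest G K p a \<Phi> w0
  by unfold_locales (use assms(8) A in simp)
 \<comment> \<open>Both claims are instances: \<open>spread_generic\<close> and
   \<open>spread_minus_one\<close> supply the stability, and each domain is invariant under
   translations and permutations.\<close>
 have map: "\<exists>bar. continuous_map (tuple_topology G P q D) (coset_topology G K) bar \<and> equivariant_on G q D bar \<and> symmetric_on q D bar"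
  if "D \<subseteq> pairwise_opposite_tuples G P w0 q"
   and "!!x X g. x \<in> D ==> X \<in> p ==> g \<in> carrier G ==> L.spread X q (\<lambda>i\<in>{..<q}. g <#\<^bsub>G\<^esub> x i) ==> X = 0"
   and "!!g x. g \<in> carrier G ==> x \<in> D ==> (\<lambda>i\<in>{..<q}. g <#\<^bsub>G\<^esub> x i) \<in> D"
   and "!!\<sigma> x. \<sigma> permutes {..<q} ==> x \<in> D ==> x \<circ> \<sigma> \<in> D" for q D
 proof -
  interpret B: stable_tuples G K p a \<Phi> w0 q D
   by unfold_locales (use that(1) P in simp, rule that(2))
  show ?thesis unfolding P
   using B.bary_continuous B.bary_equivariant[OF that(3)] B.bary_symmetric[OF that(4)] by blast
 qed
 show ?thesis
 proof (intro conjI allI impI)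
  fix q :: nat assume q: "q \<ge> 3"
  show "\<exists>bar. continuous_map (tuple_topology G P q (generic_tuples G K P A w0 q)) (coset_topology G K) bar \<and>
    equivariant_on G q (generic_tuples G K P A w0 q) bar \<and> symmetric_on q (generic_tuples G K P A w0 q) bar"
   unfolding A P
   by (rule map[unfolded P]) (use L.generic_tuples_opposite[OF q] L.spread_generic[OF _ q _ L.generic_tuples_act]
    L.generic_tuples_act L.generic_tuples_permute in blast)+
  assume "\<forall>X\<in>a. Ad G w0 X = - X"
  hence neg: "Ad G w0 X = - X" if "X \<in> a" for X using that by blast
  show "\<exists>bar. continuous_map (tuple_topology G P q (pairwise_opposite_tuples G P w0 q)) (coset_topology G K) bar \<and>
    equivariant_on G q (pairwise_opposite_tuples G P w0 q) bar \<and> symmetric_on q (pairwise_opposite_tuples G P w0 q) bar"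
   unfolding P
   by (rule map[unfolded P]) (use L.spread_minus_one[OF _ neg q] L.pairwise_opposite_tuples_act L.pairwise_opposite_tuples_permute in blast)+
 qed
qed

end
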